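(* Let $Y_i=(-I_i\times_{f_i}X_i,(Y_i^k)_{k\in\mathbb N})$, $i\in\mathbb N\cup\{\infty\}$, be properly covered generalized cones (with base points $o_i\in X_i$ and intervals $I_i^k\subset I_i$). Assume that 1. $(X_i,o_i)\to(X_\infty,o_\infty)$ in the pointed Gromov–Hausdorff sense, 2. $I_i^k\to I_\infty^k$ in the Gromov–Hausdorff sense for all $k\in\mathbb N$, 3. $f_i|_{I_i^k}$ converges uniformly to $f_\infty|_{I_\infty^k}$ as $i\to\infty$ for all $k\in\mathbb N$. Then the sequence of properly covered Lorentzian length spaces $Y_i$ converges in the $\ell$-sense to the properly covered Lorentzian length space $Y_\infty$. If every $Y_i$ is equipped with the measure $f_i^N\,dt\otimes d\mathrm m_{X_i}$, i.e. if we consider properly covered generalized $N$-cones $Y_i=-I_i\times^N_{f_i}X_i$, then $Y_i$ converges in the measured $\ell$-sense to $Y_\infty$.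
   Context: **Lorentzian pre-length spaces.** A Lorentzian pre-length space $(Y,d,\ll,\le,\tau)$ is a set $Y$ with a reflexive transitive relation $\le$, a transitive relation $\ll$ contained in $\le$, a separable metric $d$ and a lower semicontinuous $\tau:Y\times Y\to[0,\infty]$ such that $\tau(x,y)=0$ if $x\not\le y$; $\tau(x,y)>0$ iff $x\ll y$; $\tau(x,z)\ge\tau(x,y)+\tau(y,z)$ if $x\le y\le z$. Set $\ell(x,y)=\tau(x,y)$ if $x\le y$, and $\ell(x,y)=-\infty$ otherwise. Causal curves are locally $d$-Lipschitz curves with $\gamma(s)\le\gamma(t)$ for $s\le t$ (or time-reversed). **Generalized cones.** Let $I\subset\mathbb R$ be an open interval, $f:I\to(0,\infty)$ continuous, $(X,d_X)$ a geodesic metric space. A curve $\gamma=(\alpha,\beta):[a,b]\to I\times X$ with $\alpha,\beta$ Lipschitz is timelike (causal) if $-(\alpha')^2+(f\circ\alpha)^2|\beta'|^2<0$ ($\le0$) a.e., where $|\beta'|$ is the metric speed, and future directed if $\alpha$ is strictly increasing ($\alpha'>0$ a.e.). $(s,x)\ll(t,y)$ if there is a future directed timelike curve from $(s,x)$ to $(t,y)$; $(s,x)\le(t,y)$ if there is a future directed causal curve or the points are equal. $\tau$ is the supremum of $\int_a^b\sqrt{(\alpha')^2-(f\circ\alpha)^2|\beta'|^2}\,dt$ over future directed causal curves joining the points, and $0$ if there are none. The generalized cone $-I\times_fX$ is $I\times X$ with the $L^2$-product metric $d$ and $\ll,\le,\tau$. If $X$ is a metric measure space, i.e. carries a nonnegative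 locally finite Radon measure $\mathrm m_X$, and $N\in[0,\infty)$, the generalized $N$-cone $-I\times_f^NX$ is $-I\times_fX$ with the measure $f^N\,dt\otimes d\mathrm m_X$. **Properly covered generalized cone.** This is $-I\times_fX$ together with a point $o\in X$ and open, relatively compact intervals $I^k\subset I$, $k\in\mathbb N$, with $I^k\subset I^{k+1}$, $\bigcup_kI^k=I$, $\operatorname{diam}I^k\le\min\{k,\operatorname{diam}I\}$; the proper cover is $U^k=I^k\times B_{2^k}(o)$ (balls in $X$ being relatively compact), and $Y^k=I^k\times\overline{B}_{2^k}(o)$. **Uniform convergence of $f_i|_{I_i^k}$** is understood along identifications of the converging intervals: there are increasing bijections $\varphi_i:I_i^k\to I_\infty^k$ with $\sup_{s,t}|(\varphi_i(s)-\varphi_i(t))-(s-t)|\to0$ and $\sup_{I_i^k}|f_i-f_\infty\circ\varphi_i|\to0$. **Gromov–Hausdorff convergence.** A $\delta$-GH-isometry $\phi:A\to B$ of compact metric spaces satisfies $|d(\phi(x),\phi(y))-d(x,y)|<\delta$ for all $x,y\in A$ and $B_\delta(\phi(A))=B$; $A_i\to A$ in the Gromov–Hausdorff (GH) sense if for every $\delta>0$ there are $\delta$-GH-isometries $A_i\to A$ for all large $i$; $d_{GH}$ is the GH distance. $(X_i,o_i)\to(X,o)$ in the pointed GH sense (complete spaces) if for every $R>0$, $\epsilon>0$ and all large $i$ there is $\phi:B_R(o_i)\to X$ with $\phi(o_i)=o$, $|d(\phi(x),\phi(y))-d(x,y)|<\epsilon$ on $B_R(o_i)$ and $B_{R-\epsilon}(o)\subset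 B_\epsilon(\phi(B_R(o_i)))$. **$\ell$-convergence.** A proper cover of $Y$ is a family $\{U^k\}_{k\in\mathbb N}$ with $U^k$ relatively compact, $U^k\subset U^{k+1}$, $\bigcup_kU^k=Y$, $\sup_{U^k\times U^k}\tau<\infty$. Spaces $Y_i$ with proper covers $\{U_i^k\}$ converge in the $\ell$-sense to $Y$ with proper cover $\{U^k\}$ if: (a) $\overline{U_i^k}\to\overline{U^k}$ in the GH sense for each $k$; (b) for each $k$ there is $C(k)>0$ such that for all $i$ every causal curve in $U_i^k$ has $d_i$-length $\le C(k)$; (c) for all $k,l\in\mathbb N$ and $\epsilon\in(0,\frac1{2l})$ there are $\delta(k,l,\epsilon)>0$ and $i(k,l,\epsilon)\in\mathbb N$ such that for $\delta\in(0,\delta(k,l,\epsilon))$ and $i\ge i(k,l,\epsilon)$ we have $d_{GH}(\overline{U_i^k},\overline{U^k})\le\delta$ and, for a given $\delta$-GH-isometry $\phi:\overline{U_i^k}\to\overline{U^k}$: (1) if $x_i,y_i\in\overline{U_i^k}$ with $\ell_i(x_i,y_i)\ge0$, then $\ell_i(x_i,y_i)\le\ell(x,y)+\epsilon$ for all $x,y\in\overline{U^k}$ with $d(\phi(x_i),x)+d(\phi(y_i),y)\le\delta$; (2) if $x,y\in\overline{U^k}$ with $\ell(x,y)\ge\frac1l$, then $\ell_i(x_i,y_i)\ge\ell(x,y)-\epsilon$ for all $x_i,y_i\in\overline{U_i^k}$ with $d(\phi(x_i),x)+d(\phi(y_i),y)\le\delta$. Convergence is in the measured $\ell$-sense if moreover,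 for each $k$, $\mathrm m_i(\overline{U_i^k})^{-1}\mathrm m_i|_{\overline{U_i^k}}$ converges weakly to $\mathrm m(\overline{U^k})^{-1}\mathrm m|_{\overline{U^k}}$ after isometric embedding of $\overline{U_i^k},\overline{U^k}$ into a metric space $Z^k$ in which $\overline{U_i^k}$ converges to $\overline{U^k}$ in the Hausdorff sense.
   Formalization: Repaired: in (c)(1) ℓ(x,y) becomes τ(x,y), plus some causally related pair within δ; φ is one fixed family φ_i for each k, not every isometry; i(k,l,ε) may depend on δ; the measured part also assumes normalised measured GH convergence of the closed balls of radius 2^k about o_i. *)

theory Defs
  imports "HOL-Analysis.Analysis"
begin

text \<open>
  Index families \<open>k \<in> \<nat>\<close> of covers start at \<open>k = 1\<close> throughout: the bound
  \<open>diam I\<^sup>k \<le> k\<close> rules out \<open>k = 0\<close> for a nonempty open interval.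
\<close>

section \<open>Gromov--Hausdorff convergence\<close>

definition nbhd :: "'a metric \<Rightarrow> real \<Rightarrow> 'a set \<Rightarrow> 'a set" where
  "nbhd m r S = (\<Union>x\<in>S. mball_of m x r)"

definition GH_isometry :: "real \<Rightarrow> 'a metric \<Rightarrow> 'b metric \<Rightarrow> ('a \<Rightarrow> 'b) \<Rightarrow> bool" where
  "GH_isometry \<delta> A B \<phi> \<longleftrightarrow>
     \<phi> \<in> mspace A \<rightarrow> mspace B \<and>
     (\<forall>x\<in>mspace A. \<forall>y\<in>mspace A. \<bar>mdist B (\<phi> x) (\<phi> y) - mdist A x y\<bar> < \<delta>) \<and>
     nbhd B \<delta> (\<phi> ` mspace A) = mspace B"

definition GH_converges :: "(nat \<Rightarrow> 'a metric) \<Rightarrow> 'b metric \<Rightarrow> bool" where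
  "GH_converges A B \<longleftrightarrow> (\<forall>\<delta>>0. \<forall>\<^sub>F i in sequentially. \<exists>\<phi>. GH_isometry \<delta> (A i) B \<phi>)"

definition pointed_GH_converges ::
  "(nat \<Rightarrow> 'a metric) \<Rightarrow> (nat \<Rightarrow> 'a) \<Rightarrow> 'b metric \<Rightarrow> 'b \<Rightarrow> bool" where
  "pointed_GH_converges X p X' p' \<longleftrightarrow>
     (\<forall>R>0. \<forall>\<epsilon>>0. \<forall>\<^sub>F i in sequentially. \<exists>\<phi>.
        \<phi> \<in> mball_of (X i) (p i) R \<rightarrow> mspace X' \<and> \<phi> (p i) = p' \<and>
        (\<forall>x\<in>mball_of (X i) (p i) R. \<forall>y\<in>mball_of (X i) (p i) R.
           \<bar>mdist X' (\<phi> x) (\<phi> y) - mdist (X i) x y\<bar> < \<epsilon>) \<and>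
        mball_of X' p' (R - \<epsilon>) \<subseteq> nbhd X' \<epsilon> (\<phi> ` mball_of (X i) (p i) R))"

definition isometric_embedding :: "'a metric \<Rightarrow> 'b metric \<Rightarrow> ('a \<Rightarrow> 'b) \<Rightarrow> bool" where
  "isometric_embedding A Z \<iota> \<longleftrightarrow>
     \<iota> \<in> mspace A \<rightarrow> mspace Z \<and>
     (\<forall>x\<in>mspace A. \<forall>y\<in>mspace A. mdist Z (\<iota> x) (\<iota> y) = mdist A x y)"

definition Hausdorff_dist :: "'a metric \<Rightarrow> 'a set \<Rightarrow> 'a set \<Rightarrow> real" where
  "Hausdorff_dist Z S T = Inf {r. 0 < r \<and> S \<subseteq> nbhd Z r T \<and> T \<subseteq> nbhd Z r S}"

text \<open>
  The ambient space \<open>Z\<close> in the next definition and in \<open>measured_GH_converges\<close> is an arbitrary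
  metric space whose points are encoded in \<open>nat \<Rightarrow> real\<close> (with an arbitrary metric, not
  a norm).  This is no restriction for compact spaces: \<open>Z\<close> may be cut down to the union of
  countably many compact images, which is separable and so has at most continuum many points.
\<close>

definition GH_dist :: "'a metric \<Rightarrow> 'b metric \<Rightarrow> real" where
  "GH_dist A B = Inf {Hausdorff_dist Z (\<iota> ` mspace A) (\<kappa> ` mspace B) |
     (Z :: (nat \<Rightarrow> real) metric) \<iota> \<kappa>. isometric_embedding A Z \<iota> \<and> isometric_embedding B Z \<kappa>}"

text \<open>
  Weak convergence of the normalised measures \<open>\<mu>\<^sub>i(A\<^sub>i)\<^sup>-\<^sup>1 \<mu>\<^sub>i|A\<^sub>i\<close>, where \<open>A\<^sub>i\<close> is the carrier of
  \<open>A i\<close>, after isometric embedding into a common space in which the images Hausdorff converge.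
  Integrals against the push-forwards to \<open>Z\<close> are written as integrals over \<open>A\<^sub>i\<close>.
\<close>

definition measured_GH_converges ::
  "(nat \<Rightarrow> 'a metric) \<Rightarrow> (nat \<Rightarrow> 'a measure) \<Rightarrow> 'b metric \<Rightarrow> 'b measure \<Rightarrow> bool" where
  "measured_GH_converges A \<mu> B \<nu> \<longleftrightarrow>
     (\<exists>(Z :: (nat \<Rightarrow> real) metric) \<iota> \<kappa>.
        (\<forall>i. isometric_embedding (A i) Z (\<iota> i)) \<and> isometric_embedding B Z \<kappa> \<and>
        (\<lambda>i. Hausdorff_dist Z (\<iota> i ` mspace (A i)) (\<kappa> ` mspace B)) \<longlonglongrightarrow> 0 \<and>
        (\<forall>g. continuous_map (mtopology_of Z) euclideanreal g \<and> bounded (g ` mspace Z) \<longrightarrow>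
           (\<lambda>i. (LINT x:mspace (A i)|\<mu> i. g (\<iota> i x)) / measure (\<mu> i) (mspace (A i)))
             \<longlonglongrightarrow> (LINT x:mspace B|\<nu>. g (\<kappa> x)) / measure \<nu> (mspace B)))"

section \<open>Lorentzian pre-length spaces\<close>

record 'a lorentz =
  met :: "'a metric"
  chron :: "'a \<Rightarrow> 'a \<Rightarrow> bool"
  caus :: "'a \<Rightarrow> 'a \<Rightarrow> bool"
  tsep :: "'a \<Rightarrow> 'a \<Rightarrow> ennreal"

definition separable_metric :: "'a metric \<Rightarrow> bool" where
  "separable_metric m \<longleftrightarrow>
     (\<exists>C. countable C \<and> C \<subseteq> mspace m \<and> mtopology_of m closure_of C = mspace m)"

definition Lorentzian_pre_length_space :: "'a lorentz \<Rightarrow> bool" where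
  "Lorentzian_pre_length_space Y \<longleftrightarrow>
     (let M = mspace (met Y); T = mtopology_of (met Y) in
      reflp_on M (caus Y) \<and> transp_on M (caus Y) \<and> transp_on M (chron Y) \<and>
      (\<forall>x\<in>M. \<forall>y\<in>M. chron Y x y \<longrightarrow> caus Y x y) \<and>
      separable_metric (met Y) \<and>
      (\<forall>c. openin (prod_topology T T) {z \<in> M \<times> M. c < tsep Y (fst z) (snd z)}) \<and>
      (\<forall>x\<in>M. \<forall>y\<in>M. \<not> caus Y x y \<longrightarrow> tsep Y x y = 0) \<and>
      (\<forall>x\<in>M. \<forall>y\<in>M. 0 < tsep Y x y \<longleftrightarrow> chron Y x y) \<and>
      (\<forall>x\<in>M. \<forall>y\<in>M. \<forall>z\<in>M. caus Y x y \<and> caus Y y z \<longrightarrow>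
         tsep Y x y + tsep Y y z \<le> tsep Y x z))"

definition ell :: "'a lorentz \<Rightarrow> 'a \<Rightarrow> 'a \<Rightarrow> ereal" where
  "ell Y x y = (if caus Y x y then enn2ereal (tsep Y x y) else -\<infinity>)"

definition causal_curve :: "'a lorentz \<Rightarrow> real set \<Rightarrow> (real \<Rightarrow> 'a) \<Rightarrow> bool" where
  "causal_curve Y J \<gamma> \<longleftrightarrow>
     is_interval J \<and> \<gamma> \<in> J \<rightarrow> mspace (met Y) \<and>
     (\<forall>t\<in>J. \<exists>e>0. Lipschitz_continuous_map (submetric euclidean_metric (J \<inter> ball t e)) (met Y) \<gamma>) \<and>
     ((\<forall>s\<in>J. \<forall>t\<in>J. s \<le> t \<longrightarrow> caus Y (\<gamma> s) (\<gamma> t)) \<or>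
      (\<forall>s\<in>J. \<forall>t\<in>J. s \<le> t \<longrightarrow> caus Y (\<gamma> t) (\<gamma> s)))"

definition curve_length :: "'a metric \<Rightarrow> real set \<Rightarrow> (real \<Rightarrow> 'a) \<Rightarrow> ennreal" where
  "curve_length m J \<gamma> =
     (SUP ts \<in> {ts. sorted ts \<and> set ts \<subseteq> J}.
        \<Sum>j<length ts - 1. ennreal (mdist m (\<gamma> (ts ! j)) (\<gamma> (ts ! Suc j))))"

definition proper_cover :: "'a lorentz \<Rightarrow> (nat \<Rightarrow> 'a set) \<Rightarrow> bool" where
  "proper_cover Y U \<longleftrightarrow>
     (\<forall>k\<ge>1. U k \<subseteq> mspace (met Y) \<and>
        compactin (mtopology_of (met Y)) (mtopology_of (met Y) closure_of U k) \<and>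
        U k \<subseteq> U (Suc k) \<and>
        (SUP z \<in> U k \<times> U k. tsep Y (fst z) (snd z)) < \<infinity>) \<and>
     (\<Union>k\<in>{1..}. U k) = mspace (met Y)"

definition cl_metric :: "'a lorentz \<Rightarrow> 'a set \<Rightarrow> 'a metric" where
  "cl_metric Y S = submetric (met Y) (mtopology_of (met Y) closure_of S)"

section \<open>Convergence in the \<open>\<ell>\<close>-sense\<close>

text \<open>
  The two comparison properties of \<open>\<ell>\<close> along a map \<open>\<phi> : A \<rightarrow> B\<close> between closed members
  of the covers of \<open>Y\<close> and \<open>Y'\<close>.

  In the upper bound the time separation \<open>\<tau> = max \<ell> 0\<close> of the limit appears instead of
  \<open>\<ell>\<close>, together with the existence of \<^emph>\<open>some\<close> nearby pair \<open>(x', y')\<close> that is causally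
  related (so that \<open>\<ell> = \<tau>\<close> there and \<open>\<ell>\<^sub>i \<le> \<ell>(x', y') + \<epsilon>\<close>).  Requiring
  \<open>\<ell>\<^sub>i \<le> \<ell>(x, y) + \<epsilon>\<close> for \<^emph>\<open>all\<close> nearby pairs would be unsatisfiable: for \<open>xi = yi\<close> the left
  side is \<open>0\<close>, whereas \<open>\<ell>(x, y) = -\<infinity>\<close> for \<open>x\<close>, \<open>y\<close> arbitrarily close to \<open>\<phi> xi\<close> with \<open>y\<close> slightly
  in the past of \<open>x\<close>.
\<close>

definition ell_upper ::
  "'a lorentz \<Rightarrow> 'a metric \<Rightarrow> 'b lorentz \<Rightarrow> 'b metric \<Rightarrow> ('a \<Rightarrow> 'b) \<Rightarrow> real \<Rightarrow> real \<Rightarrow> bool" where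
  "ell_upper Y A Y' B \<phi> \<epsilon> \<delta> \<longleftrightarrow>
     (\<forall>xi\<in>mspace A. \<forall>yi\<in>mspace A. 0 \<le> ell Y xi yi \<longrightarrow>
        (\<forall>x\<in>mspace B. \<forall>y\<in>mspace B. mdist B (\<phi> xi) x + mdist B (\<phi> yi) y \<le> \<delta> \<longrightarrow>
           ell Y xi yi \<le> enn2ereal (tsep Y' x y) + ereal \<epsilon>) \<and>
        (\<exists>x'\<in>mspace B. \<exists>y'\<in>mspace B. mdist B (\<phi> xi) x' + mdist B (\<phi> yi) y' \<le> \<delta> \<and>
           0 \<le> ell Y' x' y'))"

definition ell_lower ::
  "'a lorentz \<Rightarrow> 'a metric \<Rightarrow> 'b lorentz \<Rightarrow> 'b metric \<Rightarrow> ('a \<Rightarrow> 'b) \<Rightarrow> nat \<Rightarrow> real \<Rightarrow> real \<Rightarrow> bool"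
  where
  "ell_lower Y A Y' B \<phi> l \<epsilon> \<delta> \<longleftrightarrow>
     (\<forall>x\<in>mspace B. \<forall>y\<in>mspace B. ereal (1 / real l) \<le> ell Y' x y \<longrightarrow>
        (\<forall>xi\<in>mspace A. \<forall>yi\<in>mspace A. mdist B (\<phi> xi) x + mdist B (\<phi> yi) y \<le> \<delta> \<longrightarrow>
           ell Y' x y - ereal \<epsilon> \<le> ell Y xi yi))"

text \<open>
  The \<open>\<delta>\<close>-isometries in the comparison condition belong to one given family \<open>\<phi> i\<close> for each
  \<open>k\<close>, independent of \<open>l\<close>, \<open>\<epsilon>\<close> and \<open>\<delta>\<close>.  They cannot be arbitrary, since isometries of the
  metrics may reverse time.  The threshold \<open>i\<^sub>0\<close> depends on \<open>\<delta>\<close>, as \<open>GH_dist \<le> \<delta>\<close> for all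
  small \<open>\<delta>\<close> and a common \<open>i\<close> would force \<open>GH_dist = 0\<close>.
\<close>

definition l_converges ::
  "(nat \<Rightarrow> 'a lorentz) \<Rightarrow> (nat \<Rightarrow> nat \<Rightarrow> 'a set) \<Rightarrow> 'b lorentz \<Rightarrow> (nat \<Rightarrow> 'b set) \<Rightarrow> bool" where
  "l_converges Y U Y' U' \<longleftrightarrow>
     (\<forall>i. Lorentzian_pre_length_space (Y i) \<and> proper_cover (Y i) (U i)) \<and>
     Lorentzian_pre_length_space Y' \<and> proper_cover Y' U' \<and>
     (\<forall>k\<ge>1. GH_converges (\<lambda>i. cl_metric (Y i) (U i k)) (cl_metric Y' (U' k))) \<and>
     (\<forall>k\<ge>1. \<exists>C>0. \<forall>i J \<gamma>. causal_curve (Y i) J \<gamma> \<and> \<gamma> ` J \<subseteq> U i k \<longrightarrow>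
        curve_length (met (Y i)) J \<gamma> \<le> ennreal C) \<and>
     (\<forall>k\<ge>1. \<exists>\<phi>. \<forall>l\<ge>1. \<forall>\<epsilon>. 0 < \<epsilon> \<and> \<epsilon> < 1 / (2 * real l) \<longrightarrow>
        (\<exists>\<delta>\<^sub>0>0. \<forall>\<delta>. 0 < \<delta> \<and> \<delta> < \<delta>\<^sub>0 \<longrightarrow>
          (\<exists>i\<^sub>0. \<forall>i\<ge>i\<^sub>0.
             GH_dist (cl_metric (Y i) (U i k)) (cl_metric Y' (U' k)) \<le> \<delta> \<and>
             GH_isometry \<delta> (cl_metric (Y i) (U i k)) (cl_metric Y' (U' k)) (\<phi> i) \<and>
             ell_upper (Y i) (cl_metric (Y i) (U i k)) Y' (cl_metric Y' (U' k)) (\<phi> i) \<epsilon> \<delta> \<and>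
             ell_lower (Y i) (cl_metric (Y i) (U i k)) Y' (cl_metric Y' (U' k)) (\<phi> i) l \<epsilon> \<delta>)))"

definition measured_l_converges ::
  "(nat \<Rightarrow> 'a lorentz) \<Rightarrow> (nat \<Rightarrow> nat \<Rightarrow> 'a set) \<Rightarrow> (nat \<Rightarrow> 'a measure) \<Rightarrow>
   'b lorentz \<Rightarrow> (nat \<Rightarrow> 'b set) \<Rightarrow> 'b measure \<Rightarrow> bool" where
  "measured_l_converges Y U \<mu> Y' U' \<nu> \<longleftrightarrow>
     l_converges Y U Y' U' \<and>
     (\<forall>k\<ge>1. measured_GH_converges (\<lambda>i. cl_metric (Y i) (U i k)) \<mu> (cl_metric Y' (U' k)) \<nu>)"

section \<open>Generalized cones\<close>

definition geodesic_space :: "'a metric \<Rightarrow> bool" where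
  "geodesic_space X \<longleftrightarrow>
     (\<forall>x\<in>mspace X. \<forall>y\<in>mspace X. \<exists>\<gamma>. \<gamma> \<in> {0..1::real} \<rightarrow> mspace X \<and> \<gamma> 0 = x \<and> \<gamma> 1 = y \<and>
        (\<forall>s\<in>{0..1}. \<forall>t\<in>{0..1}. mdist X (\<gamma> s) (\<gamma> t) = \<bar>s - t\<bar> * mdist X x y))"

definition metric_speed :: "'a metric \<Rightarrow> (real \<Rightarrow> 'a) \<Rightarrow> real \<Rightarrow> real" where
  "metric_speed X \<beta> t = Lim (at t) (\<lambda>s. mdist X (\<beta> s) (\<beta> t) / \<bar>s - t\<bar>)"

text \<open>The quadratic form \<open>-(\<alpha>')\<^sup>2 + (f \<circ> \<alpha>)\<^sup>2 |\<beta>'|\<^sup>2\<close>.\<close>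

definition cone_form ::
  "(real \<Rightarrow> real) \<Rightarrow> 'x metric \<Rightarrow> (real \<Rightarrow> real) \<Rightarrow> (real \<Rightarrow> 'x) \<Rightarrow> real \<Rightarrow> real" where
  "cone_form f X \<alpha> \<beta> t = - (deriv \<alpha> t)\<^sup>2 + (f (\<alpha> t))\<^sup>2 * (metric_speed X \<beta> t)\<^sup>2"

definition future_causal ::
  "real set \<Rightarrow> (real \<Rightarrow> real) \<Rightarrow> 'x metric \<Rightarrow> real \<Rightarrow> real \<Rightarrow> (real \<Rightarrow> real) \<Rightarrow> (real \<Rightarrow> 'x) \<Rightarrow> bool" where
  "future_causal I f X a b \<alpha> \<beta> \<longleftrightarrow>
     a < b \<and> \<alpha> \<in> {a..b} \<rightarrow> I \<and> (\<exists>L. L-lipschitz_on {a..b} \<alpha>) \<and>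
     Lipschitz_continuous_map (submetric euclidean_metric {a..b}) X \<beta> \<and>
     strict_mono_on {a..b} \<alpha> \<and> (AE t in lebesgue_on {a..b}. 0 < deriv \<alpha> t) \<and>
     (AE t in lebesgue_on {a..b}. cone_form f X \<alpha> \<beta> t \<le> 0)"

definition future_timelike ::
  "real set \<Rightarrow> (real \<Rightarrow> real) \<Rightarrow> 'x metric \<Rightarrow> real \<Rightarrow> real \<Rightarrow> (real \<Rightarrow> real) \<Rightarrow> (real \<Rightarrow> 'x) \<Rightarrow> bool" where
  "future_timelike I f X a b \<alpha> \<beta> \<longleftrightarrow>
     future_causal I f X a b \<alpha> \<beta> \<and> (AE t in lebesgue_on {a..b}. cone_form f X \<alpha> \<beta> t < 0)"

definition joins :: "real \<Rightarrow> real \<Rightarrow> (real \<Rightarrow> real) \<Rightarrow> (real \<Rightarrow> 'x) \<Rightarrow> real \<times> 'x \<Rightarrow> real \<times> 'x \<Rightarrow> bool" where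
  "joins a b \<alpha> \<beta> z w \<longleftrightarrow> (\<alpha> a, \<beta> a) = z \<and> (\<alpha> b, \<beta> b) = w"

definition gen_cone :: "real set \<Rightarrow> (real \<Rightarrow> real) \<Rightarrow> 'x metric \<Rightarrow> (real \<times> 'x) lorentz" where
  "gen_cone I f X =
     \<lparr> met = prod_metric (submetric euclidean_metric I) X,
       chron = (\<lambda>z w. \<exists>a b \<alpha> \<beta>. future_timelike I f X a b \<alpha> \<beta> \<and> joins a b \<alpha> \<beta> z w),
       caus = (\<lambda>z w. z = w \<or> (\<exists>a b \<alpha> \<beta>. future_causal I f X a b \<alpha> \<beta> \<and> joins a b \<alpha> \<beta> z w)),
       tsep = (\<lambda>z w. Sup {(\<integral>\<^sup>+ t. ennreal (sqrt (- cone_form f X \<alpha> \<beta> t)) \<partial>lebesgue_on {a..b}) |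
                 a b \<alpha> \<beta>. future_causal I f X a b \<alpha> \<beta> \<and> joins a b \<alpha> \<beta> z w}) \<rparr>"

text \<open>
  \<open>diameter\<close> is a junk value on unbounded sets, hence the guard \<open>bounded I\<close>.
\<close>

definition properly_covered_cone ::
  "real set \<Rightarrow> (real \<Rightarrow> real) \<Rightarrow> 'x metric \<Rightarrow> 'x \<Rightarrow> (nat \<Rightarrow> real set) \<Rightarrow> bool" where
  "properly_covered_cone I f X p J \<longleftrightarrow>
     is_interval I \<and> open I \<and> I \<noteq> {} \<and> continuous_on I f \<and> (\<forall>t\<in>I. 0 < f t) \<and>
     geodesic_space X \<and> p \<in> mspace X \<and>
     (\<forall>x\<in>mspace X. \<forall>r. compactin (mtopology_of X) (mtopology_of X closure_of mball_of X x r)) \<and>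
     (\<forall>k\<ge>1. is_interval (J k) \<and> open (J k) \<and> J k \<noteq> {} \<and>
        compact (closure (J k)) \<and> closure (J k) \<subseteq> I \<and> J k \<subseteq> J (Suc k) \<and>
        diameter (J k) \<le> real k \<and> (bounded I \<longrightarrow> diameter (J k) \<le> diameter I)) \<and>
     (\<Union>k\<in>{1..}. J k) = I"

definition cone_cover :: "'x metric \<Rightarrow> 'x \<Rightarrow> (nat \<Rightarrow> real set) \<Rightarrow> nat \<Rightarrow> (real \<times> 'x) set" where
  "cone_cover X p J k = J k \<times> mball_of X p (2 ^ k)"

definition warping_converges ::
  "(nat \<Rightarrow> real set) \<Rightarrow> (nat \<Rightarrow> real \<Rightarrow> real) \<Rightarrow> real set \<Rightarrow> (real \<Rightarrow> real) \<Rightarrow> bool" where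
  "warping_converges J f J' f' \<longleftrightarrow>
     (\<exists>\<phi>. (\<forall>i. strict_mono_on (J i) (\<phi> i) \<and> bij_betw (\<phi> i) (J i) J') \<and>
        (\<forall>e>0. \<forall>\<^sub>F i in sequentially. \<forall>s\<in>J i. \<forall>t\<in>J i. \<bar>(\<phi> i s - \<phi> i t) - (s - t)\<bar> \<le> e) \<and>
        (\<forall>e>0. \<forall>\<^sub>F i in sequentially. \<forall>s\<in>J i. \<bar>f i s - f' (\<phi> i s)\<bar> \<le> e))"

text \<open>Locally finite Radon measures on the Borel sets of \<open>X\<close>.\<close>

definition radon_measure_on :: "'x metric \<Rightarrow> 'x measure \<Rightarrow> bool" where
  "radon_measure_on X m \<longleftrightarrow>
     space m = mspace X \<and>
     sets m = sigma_sets (mspace X) {U. openin (mtopology_of X) U} \<and>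
     (\<forall>x\<in>mspace X. \<exists>U. openin (mtopology_of X) U \<and> x \<in> U \<and> emeasure m U < \<infinity>) \<and>
     (\<forall>A\<in>sets m. emeasure m A = (SUP K\<in>{K. compactin (mtopology_of X) K \<and> K \<subseteq> A}. emeasure m K))"

text \<open>
  Pointed GH convergence of the fibres does not see the fibre measures, so measured convergence
  of the cones also needs \<open>measured_GH_converges\<close> for the closed balls \<open>mcball_of X p (2 ^ k)\<close>
  of the fibres, with their normalised measures.
\<close>

definition cone_measure ::
  "real set \<Rightarrow> (real \<Rightarrow> real) \<Rightarrow> real \<Rightarrow> 'x measure \<Rightarrow> (real \<times> 'x) measure" where
  "cone_measure I f N m =
     density (restrict_space lborel I) (\<lambda>t. ennreal (f t powr N)) \<Otimes>\<^sub>M m"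

end

theory Submission
  imports Defs
begin

text \<open>
  The time separation of a cone over \<open>X\<close> depends on the fibre points only through their distance \<open>r\<close>.
  Pairing the Cauchy--Schwarz bound \<open>sqrt (\<alpha>'\<^sup>2 - f\<^sup>2 v\<^sup>2) + \<mu> v \<le> \<alpha>' sqrt (1 + \<mu>\<^sup>2 / f\<^sup>2)\<close> with a
  geodesic of the fibre run at the speed of equality gives the dual formula
  \<open>\<tau>((s, x), (t, y)) = inf {\<integral>\<^sub>s\<^sup>t sqrt (1 + \<mu>\<^sup>2 / f\<^sup>2) - \<mu> r | \<mu> \<ge> 0}\<close>, clipped at \<open>0\<close>, while
  \<open>(s, x) \<le> (t, y)\<close> means \<open>s \<le> t\<close> and \<open>r \<le> \<integral>\<^sub>s\<^sup>t 1 / f\<close>. These formulas make sense for merely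
  Lipschitz curves because a Lipschitz curve in a metric space has a metric speed almost everywhere.
  Up to a small error the infimum runs over bounded \<open>\<mu>\<close>, so \<open>\<tau>\<close> depends uniformly continuously on
  \<open>f\<close>, \<open>s\<close>, \<open>t\<close>, \<open>r\<close>, and it converges along the product of the affine maps of the intervals with
  almost isometries of the fibre balls. For the measures, Fubini's theorem and dominated
  convergence in time reduce the weak convergence to that of the fibres.
\<close>

text \<open>Curves cannot be carried from one cone to another: the fibres are linked only by maps
  that need not be continuous, and a maximizing curve may leave the ball of the cover. The dual
  formula removes curves from the comparison, because it involves only \<open>f\<close> between the
  two times and the distance of the two fibre points, and both are visible inside the closed cover.
  Two conclusions are not covered by it. The causal relation at vanishing time separation is a
  closed condition without margin, so causal pairs in the limit come from compactness. And weak
  convergence asks for genuine isometric embeddings, so there the intervals are translated rather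
  than rescaled. Elsewhere affine maps replace the given bijections of the intervals: those need not
  be Lipschitz, so integrals could not be transported along them, and they are not given on the
  closed intervals.\<close>

section \<open>Lipschitz curves\<close>

text \<open>Henstock's lemma makes the summed discrepancies over disjoint bad intervals small. Each
  discrepancy exceeds \<open>e\<close> times the length of its interval, so the total length is
  small too. A Vitali subfamily covers the bad set once its intervals are enlarged five
  times.\<close>

lemma negligible_bad_points:
  fixes f :: "real \<Rightarrow> real"
  assumes f: "f integrable_on {a..b}" and e: "e > 0"
  shows "negligible {x \<in> {a..b}. \<forall>r>0. \<exists>c d. x \<in> {c..d} \<and> c < d \<and> {c..d} \<subseteq> {a..b} \<and> d - c < r \<and>
     \<bar>(d - c) * f x - integral {c..d} f\<bar> > e * (d - c)}" (is "negligible ?E")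
proof -
  define E where "E = ?E"
  have Edef: "x \<in> E \<Longrightarrow> r > 0 \<Longrightarrow> \<exists>c d. x \<in> {c..d} \<and> c < d \<and> {c..d} \<subseteq> {a..b} \<and> d - c < r \<and>
     \<bar>(d - c) * f x - integral {c..d} f\<bar> > e * (d - c)" for x r
    unfolding E_def by blast
  have "negligible E"
  unfolding negligible_outer_le
proof (intro allI impI)
  fix \<mu> :: real assume \<mu>: "\<mu> > 0"
  \<comment> \<open>With this tolerance the disjoint bad intervals have total length at most
    \<open>\<mu> / 5\<close>, and their fivefold enlargements at most \<open>\<mu>\<close>.\<close>
  have e': "\<mu> * e / 5 > 0" using e \<mu> by simp
  obtain \<gamma> where g: "gauge \<gamma>"
    and \<gamma>: "\<And>p. \<lbrakk>p tagged_partial_division_of (cbox a b); \<gamma> fine p\<rbrakk> \<Longrightarrow>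
             sum (\<lambda>(x,k). norm(measure lborel k *\<^sub>R f x - integral k f)) p < \<mu> * e / 5"
    using f e' by (auto intro: Henstock_lemma[of f a b "\<mu> * e / 5"] simp: cbox_interval)
  have "\<forall>x. x \<in> E \<longrightarrow> (\<exists>c d. x \<in> {c..d} \<and> c < d \<and> {c..d} \<subseteq> {a..b} \<and> {c..d} \<subseteq> \<gamma> x \<and>
     \<bar>(d - c) * f x - integral {c..d} f\<bar> > e * (d - c))"
  proof (intro allI impI)
    fix x assume x: "x \<in> E"
    obtain r where r: "r > 0" "ball x r \<subseteq> \<gamma> x"
      using g by (meson gauge_def open_contains_ball)
    obtain c d where cd: "x \<in> {c..d}" "c < d" "{c..d} \<subseteq> {a..b}" "d - c < r"
     "\<bar>(d - c) * f x - integral {c..d} f\<bar> > e * (d - c)" using Edef[OF x r(1)] by blast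
    have "{c..d} \<subseteq> ball x r" using cd by (auto simp: dist_real_def)
    then show "\<exists>c d. x \<in> {c..d} \<and> c < d \<and> {c..d} \<subseteq> {a..b} \<and> {c..d} \<subseteq> \<gamma> x \<and>
     \<bar>(d - c) * f x - integral {c..d} f\<bar> > e * (d - c)" using cd r by blast
  qed
  then obtain c d where cd: "\<And>x. x \<in> E \<Longrightarrow> x \<in> {c x..d x} \<and> c x < d x \<and> {c x..d x} \<subseteq> {a..b} \<and>
     {c x..d x} \<subseteq> \<gamma> x \<and> \<bar>(d x - c x) * f x - integral {c x..d x} f\<bar> > e * (d x - c x)"
    by metis
  define m where "m = (\<lambda>x. (c x + d x)/2)"
  define r where "r = (\<lambda>x. (d x - c x)/2)"
  have cb: "cball (m x) (r x) = {c x..d x}" if "x \<in> E" for x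
    using cd[OF that] by (simp add: cball_eq_atLeastAtMost m_def r_def field_simps)
  have cov: "E \<subseteq> (\<Union>x\<in>E. cball (m x) (r x))"
  proof
    fix x assume "x \<in> E" then show "x \<in> (\<Union>x\<in>E. cball (m x) (r x))" using cd[of x] cb[of x] by (intro UN_I[of x]) auto
  qed
  have rb: "0 < r x \<and> r x \<le> b - a" if "x \<in> E" for x
    using cd[OF that] by (auto simp: r_def field_simps)
  obtain C where C: "countable C" "C \<subseteq> E"
     "pairwise (\<lambda>i j. disjnt (cball (m i) (r i)) (cball (m j) (r j))) C"
     "E \<subseteq> (\<Union>i\<in>C. cball (m i) (5 * r i))"
    by (rule Vitali_covering_lemma_cballs[OF cov rb])
  have fin: "(\<Sum>x\<in>P. d x - c x) \<le> \<mu> / 5" if P: "P \<subseteq> C" "finite P" for P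
  proof -
    define p where "p = (\<lambda>x. (x, {c x..d x})) ` P"
    have inj: "inj_on (\<lambda>x. (x, {c x..d x})) P" by (simp add: inj_on_def)
    note cd1 = cd[THEN conjunct1] and cd2 = cd[THEN conjunct2, THEN conjunct1]
      and cd3 = cd[THEN conjunct2, THEN conjunct2, THEN conjunct1]
      and cd4 = cd[THEN conjunct2, THEN conjunct2, THEN conjunct2, THEN conjunct1]
    have PE: "\<And>x. x \<in> P \<Longrightarrow> x \<in> E" using P C by blast
    have "p tagged_partial_division_of (cbox a b)"
      unfolding tagged_partial_division_of_def
    proof (intro conjI allI impI)
      show "finite p" using P by (simp add: p_def)
      show "x \<in> K" if "(x, K) \<in> p" for x K using cd1[OF PE] that unfolding p_def by blast
      show "K \<subseteq> cbox a b" if "(x, K) \<in> p" for x K using cd3[OF PE] that unfolding p_def cbox_interval by blast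
      show "\<exists>a b. K = cbox a b" if "(x, K) \<in> p" for x K using that by (force simp: p_def cbox_interval)
      fix x1 K1 x2 K2 assume h: "(x1, K1) \<in> p \<and> (x2, K2) \<in> p \<and> (x1, K1) \<noteq> (x2, K2)"
      then have "x1 \<noteq> x2" "x1 \<in> C" "x2 \<in> C" using P by (auto simp: p_def)
      then have "disjnt (cball (m x1) (r x1)) (cball (m x2) (r x2))"
        using C(3) by (auto simp: pairwise_def)
      then have "disjnt K1 K2" using cb PE h by (auto simp: p_def)
      then show "interior K1 \<inter> interior K2 = {}"
        using interior_subset by (fastforce simp: disjnt_def)
    qed
    moreover have "\<gamma> fine p"
      using cd4[OF PE] unfolding fine_def p_def by blast
    ultimately have "sum (\<lambda>(x,k). norm(measure lborel k *\<^sub>R f x - integral k f)) p < \<mu> * e / 5"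
      by (rule \<gamma>)
    moreover have "sum (\<lambda>(x,k). norm(measure lborel k *\<^sub>R f x - integral k f)) p
       = (\<Sum>x\<in>P. \<bar>(d x - c x) * f x - integral {c x..d x} f\<bar>)"
    proof -
      have "sum (\<lambda>(x,k). norm(measure lborel k *\<^sub>R f x - integral k f)) p =
        (\<Sum>x\<in>P. norm(measure lborel {c x..d x} *\<^sub>R f x - integral {c x..d x} f))"
        unfolding p_def by (subst sum.reindex[OF inj]) (simp add: o_def)
      also have "\<dots> = (\<Sum>x\<in>P. \<bar>(d x - c x) * f x - integral {c x..d x} f\<bar>)"
      proof (rule sum.cong[OF refl])
        fix x assume "x \<in> P" then have "c x < d x" using cd PE by blast
        then show "norm(measure lborel {c x..d x} *\<^sub>R f x - integral {c x..d x} f) = \<bar>(d x - c x) * f x - integral {c x..d x} f\<bar>"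
          by simp
      qed
      finally show ?thesis .
    qed
    moreover have "(\<Sum>x\<in>P. e * (d x - c x)) \<le> (\<Sum>x\<in>P. \<bar>(d x - c x) * f x - integral {c x..d x} f\<bar>)"
      using cd[OF PE] by (intro sum_mono less_imp_le) blast
    ultimately have "(\<Sum>x\<in>P. e * (d x - c x)) \<le> \<mu> * e / 5" by linarith
    then have "e * (\<Sum>x\<in>P. d x - c x) \<le> e * (\<mu> / 5)"
      unfolding sum_distrib_left by (simp add: mult.commute)
    then show ?thesis using e by simp
  qed
  have lm: "cball (m x) (5 * r x) \<in> lmeasurable" for x
    by simp
  have bd: "measure lebesgue (\<Union>i\<in>P. cball (m i) (5 * r i)) \<le> \<mu>" if P: "P \<subseteq> C" "finite P" for P
  proof -
    have "measure lebesgue (\<Union>i\<in>P. cball (m i) (5 * r i)) \<le> (\<Sum>i\<in>P. measure lebesgue (cball (m i) (5 * r i)))"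
      using P by (intro measure_UNION_le) auto
    also have "\<dots> = (\<Sum>i\<in>P. 5 * (d i - c i))"
    proof (rule sum.cong[OF refl])
      fix i assume "i \<in> P" then have "0 < d i - c i" using rb[of i] P C by (auto simp: r_def)
      then have "0 \<le> 5 * r i" by (simp add: r_def)
      then have "measure lebesgue (cball (m i) (5 * r i)) = 2 * (5 * r i)"
        by (simp add: cball_eq_atLeastAtMost)
      then show "measure lebesgue (cball (m i) (5 * r i)) = 5 * (d i - c i)"
        by (simp add: r_def)
    qed
    also have "\<dots> = 5 * (\<Sum>i\<in>P. d i - c i)" by (rule sum_distrib_left[symmetric])
    also have "\<dots> \<le> \<mu>" using fin[OF P] by linarith
    finally show ?thesis .
  qed
  show "\<exists>T. E \<subseteq> T \<and> T \<in> lmeasurable \<and> measure lebesgue T \<le> \<mu>"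
    using C(4) fmeasurable_UN_bound[OF C(1) lm bd] measure_UN_bound[OF C(1) lm bd]
    by (intro exI[of _ "\<Union>i\<in>C. cball (m i) (5 * r i)"] conjI)
qed
  then show ?thesis by (simp add: E_def)
qed

text \<open>The exceptional set is the union of the bad sets for the tolerances
  \<open>1 / (n + 1)\<close>. Intervals in \<open>E\<close> contain \<open>x\<close> in the closed
  sense, so \<open>{x..y}\<close> and \<open>{y..x}\<close> both qualify and control the two
  one-sided difference quotients.\<close>

lemma lebesgue_differentiation_real:
  fixes f :: "real \<Rightarrow> real"
  assumes f: "f integrable_on {a..b}"
  shows "\<exists>N. negligible N \<and> (\<forall>x\<in>{a<..<b} - N. ((\<lambda>u. integral {a..u} f) has_real_derivative f x) (at x))"
proof -
  define E where "E = (\<lambda>e. {x \<in> {a..b}. \<forall>r>0. \<exists>c d. x \<in> {c..d} \<and> c < d \<and> {c..d} \<subseteq> {a..b} \<and> d - c < r \<and>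
     \<bar>(d - c) * f x - integral {c..d} f\<bar> > e * (d - c)})"
  define N where "N = (\<Union>n. E (1 / real (Suc n)))"
  have "negligible (E e)" if "e > 0" for e
    unfolding E_def by (rule negligible_bad_points[OF f that])
  then have "negligible N" unfolding N_def
    by (intro negligible_countable_Union) auto
  moreover have "((\<lambda>u. integral {a..u} f) has_real_derivative f x) (at x)" if x: "x \<in> {a<..<b} - N" for x
    unfolding has_field_derivative_iff LIM_def
  proof (intro allI impI)
    fix e :: real assume "e > 0"
    then obtain n where n: "1 / real (Suc n) < e" using nat_approx_posE by blast
    have "x \<notin> E (1 / real (Suc n))" using x by (auto simp: N_def)
    moreover have xab: "a < x" "x < b" using x by auto
    ultimately have "\<exists>r>0. \<forall>c d. x \<in> {c..d} \<longrightarrow> c < d \<longrightarrow> {c..d} \<subseteq> {a..b} \<longrightarrow> d - c < r \<longrightarrow>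
      \<not> (\<bar>(d - c) * f x - integral {c..d} f\<bar> > 1 / real (Suc n) * (d - c))"
      using x unfolding E_def mem_Collect_eq by (metis DiffD1 atLeastAtMost_iff greaterThanLessThan_iff less_imp_le)
    then obtain r where r0: "r > 0" and "\<forall>c d. x \<in> {c..d} \<longrightarrow> c < d \<longrightarrow> {c..d} \<subseteq> {a..b} \<longrightarrow> d - c < r \<longrightarrow>
      \<not> (\<bar>(d - c) * f x - integral {c..d} f\<bar> > 1 / real (Suc n) * (d - c))" by blast
    then have r: "\<bar>(d - c) * f x - integral {c..d} f\<bar> \<le> 1 / real (Suc n) * (d - c)"
      if "x \<in> {c..d}" "c < d" "{c..d} \<subseteq> {a..b}" "d - c < r" for c d
      using that not_less by blast
    show "\<exists>s>0. \<forall>y. y \<noteq> x \<and> dist y x < s \<longrightarrow>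
       dist ((integral {a..y} f - integral {a..x} f) / (y - x)) (f x) < e"
    proof (intro exI[of _ "min r (min (x - a) (b - x))"] conjI allI impI)
      show "0 < min r (min (x - a) (b - x))" using r0 xab by auto
      fix y assume y: "y \<noteq> x \<and> dist y x < min r (min (x - a) (b - x))"
      then have yr: "a < y" "y < b" "\<bar>y - x\<bar> < r" "y \<noteq> x" by (auto simp: dist_real_def)
      have int: "f integrable_on {u..v}" if "a \<le> u" "v \<le> b" for u v
        using integrable_on_subinterval[OF f] that by auto
      have "\<bar>(y - x) * f x - (integral {a..y} f - integral {a..x} f)\<bar> \<le> 1 / real (Suc n) * \<bar>y - x\<bar>"
      proof (cases "x < y")
        case True
        have "integral {a..y} f = integral {a..x} f + integral {x..y} f"
          using Henstock_Kurzweil_Integration.integral_combine[of a x y f] int True xab yr by auto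
        then show ?thesis using r[of x y] True yr xab by auto
      next
        case False
        then have "integral {a..x} f = integral {a..y} f + integral {y..x} f"
          using Henstock_Kurzweil_Integration.integral_combine[of a y x f] int xab yr by auto
        then show ?thesis using r[of y x] False yr xab by (auto simp: algebra_simps abs_minus_commute)
      qed
      then have "\<bar>(integral {a..y} f - integral {a..x} f) - f x * (y - x)\<bar> < e * \<bar>y - x\<bar>"
        using n yr(4) by (smt (verit, best) mult.commute mult_less_cancel_right)
      moreover have "(integral {a..y} f - integral {a..x} f) / (y - x) - f x =
        ((integral {a..y} f - integral {a..x} f) - f x * (y - x)) / (y - x)"
        using yr(4) by (simp add: field_simps)
      ultimately show "dist ((integral {a..y} f - integral {a..x} f) / (y - x)) (f x) < e"
        using yr(4) by (simp add: dist_real_def field_simps)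
    qed
  qed
  ultimately show ?thesis by blast
qed

section \<open>Derivatives of Lipschitz functions and metric speed\<close>

lemma AE_lebesgue_on_iff_negligible:
  assumes "S \<in> sets lebesgue"
  shows "(AE t in lebesgue_on S. P t) \<longleftrightarrow> negligible {t \<in> S. \<not> P t}"
proof -
  have "(AE t in lebesgue_on S. P t) \<longleftrightarrow> (AE t in lebesgue. t \<in> S \<longrightarrow> P t)"
    using assms by (simp add: AE_restrict_space_iff)
  also have "\<dots> \<longleftrightarrow> (\<exists>N. negligible N \<and> {t \<in> S. \<not> P t} \<subseteq> N)"
    unfolding eventually_ae_filter negligible_iff_null_sets by auto
  also have "\<dots> \<longleftrightarrow> negligible {t \<in> S. \<not> P t}"
    using negligible_subset by blast
  finally show ?thesis .
qed

text \<open>The density is the Radon--Nikodym derivative of the pull-back of Lebesgue measure along the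
  bi-Lipschitz map \<open>t \<mapsto> g t + 2 (L + 1) t\<close>.\<close>

lemma lipschitz_density:
  fixes g :: "real \<Rightarrow> real"
  assumes g: "L-lipschitz_on UNIV g"
  obtains m where "\<And>s t. s \<le> t \<Longrightarrow> (m has_integral (g t - g s)) {s..t}"
proof -
  define C where "C = L + 1"
  have L0: "L \<ge> 0" and C: "C > 0" using lipschitz_on_nonneg[OF g] by (auto simp: C_def)
  \<comment> \<open>The difference quotients of \<open>g\<close> lie between \<open>-C\<close> and
    \<open>C\<close>, so those of \<open>G\<close> lie between \<open>C\<close> and
    \<open>3 * C\<close>. Taking \<open>C = L + 1\<close> keeps the lower bound positive even for
    \<open>L = 0\<close>.\<close>
  define G where "G = (\<lambda>t. g t + 2 * C * t)"
  have gL: "\<bar>g t - g s\<bar> \<le> L * \<bar>t - s\<bar>" for s t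
    using lipschitz_onD[OF g, of t s] by (simp add: dist_real_def)
  have G1: "C * (t - s) \<le> G t - G s" if "s \<le> t" for s t
    using gL[of t s] that by (simp add: G_def C_def algebra_simps abs_if split: if_splits)
  have G2: "\<bar>G t - G s\<bar> \<le> 3 * C * \<bar>t - s\<bar>" for s t
  proof -
    have "\<bar>G t - G s\<bar> \<le> \<bar>g t - g s\<bar> + \<bar>2 * C * (t - s)\<bar>"
      unfolding G_def by (simp add: algebra_simps abs_if)
    also have "\<bar>2 * C * (t - s)\<bar> = 2 * C * \<bar>t - s\<bar>" using C by (simp add: abs_mult)
    also have "\<bar>g t - g s\<bar> \<le> C * \<bar>t - s\<bar>" using gL[of t s] by (simp add: C_def algebra_simps)
    finally show ?thesis by simp
  qed
  have Gmono: "G s \<le> G t \<longleftrightarrow> s \<le> t" for s t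
  proof (cases "s \<le> t")
    case True
    then have "0 \<le> C * (t - s)" using C by simp
    then show ?thesis using G1[OF True] True by simp
  next
    case False
    then have "0 < C * (s - t)" using C by simp
    then show ?thesis using G1[of t s] False by simp
  qed
  have Gcont: "continuous_on UNIV G"
    unfolding G_def by (intro continuous_intros lipschitz_on_continuous_on[OF g])
  have "surj G"
  proof -
    have "\<exists>x. G x = y" for y
    proof -
      define R where "R = \<bar>y - G 0\<bar> / C"
      have R: "R \<ge> 0" "C * R = \<bar>y - G 0\<bar>" using C by (auto simp: R_def)
      have "G (-R) \<le> y" using G1[of "-R" 0] R by auto
      moreover have "y \<le> G R" using G1[of 0 R] R by auto
      ultimately show ?thesis
        using IVT'[of G "-R" y R] R Gcont continuous_on_subset by fastforce
    qed
    then show ?thesis by (metis surj_def)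
  qed
  moreover have "inj G"
    by (metis Gmono antisym injI order_refl)
  ultimately have bij: "bij G" by (simp add: bij_def)
  define H where "H = inv G"
  have GH: "G (H y) = y" and HG: "H (G x) = x" for x y
    using bij by (simp_all add: H_def bij_is_surj surj_f_inv_f bij_is_inj inv_f_f)
  have "(1 / C)-lipschitz_on UNIV H"
  proof (rule lipschitz_onI)
    fix x y
    have "C * \<bar>H x - H y\<bar> \<le> \<bar>G (H x) - G (H y)\<bar>"
      using G1[of "H x" "H y"] G1[of "H y" "H x"] by (cases "H x \<le> H y") auto
    then show "dist (H x) (H y) \<le> 1 / C * dist x y"
      using C by (simp add: GH dist_real_def field_simps)
  qed (use C in simp)
  then have Hm[measurable]: "H \<in> borel_measurable borel"
    by (intro borel_measurable_continuous_onI lipschitz_on_continuous_on)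
  \<comment> \<open>\<open>\<nu>\<close> assigns to a set the length of its image under
    \<open>G\<close>. It is absolutely continuous since Lipschitz maps preserve negligible sets, and
    on \<open>{s..t}\<close> it equals \<open>G t - G s\<close>.\<close>
  define \<nu> where "\<nu> = distr lborel borel H"
  have vim: "H -` A = G ` A" for A
    using GH HG by (auto simp: image_iff) (metis GH)
  have "absolutely_continuous lborel \<nu>"
    unfolding absolutely_continuous_def
  proof
    fix A :: "real set" assume A: "A \<in> null_sets lborel"
    then have Am: "A \<in> sets borel" by auto
    have "negligible A" using A by (simp add: negligible_iff_null_sets null_sets_completionI)
    have "negligible (G ` A)"
    proof (rule negligible_locally_Lipschitz_image)
      fix x
      have "\<forall>y\<in>A \<inter> UNIV. norm (G y - G x) \<le> (3 * C) * norm (y - x)" using G2 by simp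
      then show "\<exists>T B. open T \<and> x \<in> T \<and> (\<forall>y\<in>A \<inter> T. norm (G y - G x) \<le> B * norm (y - x))"
        by (intro exI[of _ UNIV] exI[of _ "3 * C"]) auto
    qed (use \<open>negligible A\<close> in auto)
    moreover have "H -` A \<in> sets borel" using measurable_sets[OF Hm Am] by simp
    ultimately have "emeasure lborel (H -` A) = 0"
      unfolding vim negligible_iff_null_sets using emeasure_completion[of "G ` A" lborel] by auto
    then show "A \<in> null_sets \<nu>"
      using Am by (auto simp: null_sets_def \<nu>_def emeasure_distr)
  qed
  moreover have "sets \<nu> = sets lborel" by (simp add: \<nu>_def)
  ultimately obtain \<phi> where \<phi>[measurable]: "\<phi> \<in> borel_measurable lborel" and d\<phi>: "density lborel \<phi> = \<nu>"
    using sigma_finite_measure.Radon_Nikodym[OF sigma_finite_lborel] by blast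
  have nn: "(\<integral>\<^sup>+x. \<phi> x * indicator {s..t} x \<partial>lborel) = ennreal (G t - G s)" if "s \<le> t" for s t
  proof -
    have "(\<integral>\<^sup>+x. \<phi> x * indicator {s..t} x \<partial>lborel) = emeasure \<nu> {s..t}"
      unfolding d\<phi>[symmetric] by (subst emeasure_density) auto
    also have "\<dots> = emeasure lborel (H -` {s..t})" by (simp add: \<nu>_def emeasure_distr)
    also have "H -` {s..t} = {G s..G t}"
      using Gmono GH by (auto) (metis Gmono GH)+
    finally show ?thesis using that Gmono by simp
  qed
  define m where "m = (\<lambda>x. enn2real (\<phi> x) - 2 * C)"
  show thesis
  proof (rule that[of m])
    fix s t :: real assume st: "s \<le> t"
    have "AE x in lborel. \<phi> x * indicator {s..t} x \<noteq> \<infinity>"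
      using nn[OF st] by (intro nn_integral_PInf_AE) auto
    then have "(\<integral>\<^sup>+x. ennreal (enn2real (\<phi> x) * indicator {s..t} x) \<partial>lborel)
      = (\<integral>\<^sup>+x. \<phi> x * indicator {s..t} x \<partial>lborel)"
      by (intro nn_integral_cong_AE) (auto split: split_indicator simp: less_top)
    then have "((\<lambda>x. enn2real (\<phi> x) * indicator {s..t} x) has_integral (G t - G s)) UNIV"
      using nn[OF st] st Gmono by (intro nn_integral_has_integral) auto
    moreover have "(\<lambda>x. enn2real (\<phi> x) * indicator {s..t} x) = (\<lambda>x. if x \<in> {s..t} then enn2real (\<phi> x) else 0)"
      by (auto simp: indicator_def)
    ultimately have "((\<lambda>x. enn2real (\<phi> x)) has_integral (G t - G s)) {s..t}"
      by (simp only: has_integral_restrict_UNIV)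
    from has_integral_diff[OF this has_integral_const_real[of "2 * C" s t]]
    show "(m has_integral (g t - g s)) {s..t}"
      using st by (simp add: m_def G_def algebra_simps)
  qed
qed

text \<open>The increments of \<open>g\<close> are integrals of a density, and the differentiation
  theorem identifies this density with \<open>deriv g\<close> off a negligible set. Changing the
  integrand there leaves the integral unchanged, which is the fundamental theorem for Lipschitz
  functions.\<close>

lemma lipschitz_on_real_deriv:
  fixes g :: "real \<Rightarrow> real"
  assumes g: "L-lipschitz_on {a..b} g" and ab: "a < b"
  shows "\<exists>N. negligible N \<and> (\<forall>x\<in>{a<..<b} - N. (g has_real_derivative deriv g x) (at x))"
    and "(deriv g has_integral (g b - g a)) {a..b}"
proof -
  define k where "k = (\<lambda>x. g (max a (min b x)))"
  have "L-lipschitz_on UNIV k"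
  proof (rule lipschitz_onI)
    fix x y
    have "dist (k x) (k y) \<le> L * dist (max a (min b x)) (max a (min b y))"
      unfolding k_def using ab by (intro lipschitz_onD[OF g]) auto
    also have "\<dots> \<le> L * dist x y"
      using lipschitz_on_nonneg[OF g] by (intro mult_left_mono) (auto simp: dist_real_def)
    finally show "dist (k x) (k y) \<le> L * dist x y" .
  qed (use lipschitz_on_nonneg[OF g] in simp)
  then obtain m where m: "\<And>s t. s \<le> t \<Longrightarrow> (m has_integral (k t - k s)) {s..t}"
    using lipschitz_density by blast
  have mg: "(m has_integral (g t - g s)) {s..t}" if "a \<le> s" "s \<le> t" "t \<le> b" for s t
    using m[OF that(2)] that by (simp add: k_def)
  obtain N where N: "negligible N" "\<And>x. x\<in>{a<..<b} - N \<Longrightarrow> ((\<lambda>u. integral {a..u} m) has_real_derivative m x) (at x)"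
    using lebesgue_differentiation_real[OF has_integral_integrable[OF mg[OF order_refl less_imp_le[OF ab] order_refl]]]
    by metis
  have der: "(g has_real_derivative m x) (at x)" if x: "x \<in> {a<..<b} - N" for x
  proof -
    have "((\<lambda>u. g a + integral {a..u} m) has_real_derivative 0 + m x) (at x)"
      by (intro derivative_intros N(2)[OF x])
    then have "((\<lambda>u. g a + integral {a..u} m) has_real_derivative m x) (at x)" by simp
    moreover have "open {a<..<b}" "x \<in> {a<..<b}" using x by auto
    moreover have "g a + integral {a..u} m = g u" if "u \<in> {a<..<b}" for u
      using mg[of a u] that by (simp add: integral_unique)
    ultimately show ?thesis
      by (rule has_field_derivative_transform_within_open)
  qed
  have dm: "deriv g x = m x" if "x \<in> {a<..<b} - N" for x
    using DERIV_imp_deriv[OF der[OF that]] .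
  show "\<exists>N. negligible N \<and> (\<forall>x\<in>{a<..<b} - N. (g has_real_derivative deriv g x) (at x))"
    using N(1) der dm by auto
  show "(deriv g has_integral (g b - g a)) {a..b}"
  proof (rule has_integral_spike[OF _ _ mg[of a b]])
    show "negligible (insert a (insert b N))" using N(1) by simp
    show "deriv g x = m x" if "x \<in> {a..b} - insert a (insert b N)" for x
      using that by (intro dm) auto
  qed (use ab in auto)
qed

text \<open>The distances to the countably many points \<open>\<beta> q\<close>, \<open>q\<close>
  rational, are real Lipschitz functions. The supremum \<open>m\<close> of their absolute
  derivatives is the speed: it is a lower bound by the reverse triangle inequality, and an upper
  bound because the distance of \<open>\<beta> s\<close> and \<open>\<beta> t\<close> is at most the
  integral of \<open>m\<close>, which is then differentiated.\<close>

lemma metric_speed_exists: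
  assumes \<beta>: "\<beta> \<in> {a..b} \<rightarrow> mspace X" and ab: "a < b"
    and Lip: "\<And>s t. s \<in> {a..b} \<Longrightarrow> t \<in> {a..b} \<Longrightarrow> mdist X (\<beta> s) (\<beta> t) \<le> L * \<bar>s - t\<bar>"
  shows "\<exists>N. negligible N \<and> (\<forall>t\<in>{a<..<b} - N. \<exists>v. ((\<lambda>s. mdist X (\<beta> s) (\<beta> t) / \<bar>s - t\<bar>) \<longlongrightarrow> v) (at t))"
proof -
  interpret X: Metric_space "mspace X" "mdist X" by simp
  have bX: "\<beta> s \<in> mspace X" if "s \<in> {a..b}" for s using \<beta> that by blast
  have L0: "L \<ge> 0"
  proof -
    have "mdist X (\<beta> b) (\<beta> a) \<le> L * (b - a)" using Lip[of b a] ab by simp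
    then have "0 \<le> L * (b - a)" using X.nonneg[of "\<beta> b" "\<beta> a"] by linarith
    then show ?thesis using ab by (simp add: zero_le_mult_iff)
  qed
  define Q where "Q = \<rat> \<inter> {a..b}"
  have Q: "countable Q" "Q \<subseteq> {a..b}" unfolding Q_def using countable_rat by (auto intro: countable_subset)
  define h where "h = (\<lambda>q s. mdist X (\<beta> s) (\<beta> q))"
  have hL: "L-lipschitz_on {a..b} (h q)" if "q \<in> {a..b}" for q
  proof (rule lipschitz_onI)
    fix x y assume xy: "x \<in> {a..b}" "y \<in> {a..b}"
    have "\<bar>h q x - h q y\<bar> \<le> mdist X (\<beta> x) (\<beta> y)"
      unfolding h_def using X.mdist_reverse_triangle bX xy that
        X.triangle[OF bX[OF xy(1)] bX[OF xy(2)] bX[OF that]] X.triangle[OF bX[OF xy(2)] bX[OF xy(1)] bX[OF that]]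
        X.commute[of "\<beta> x" "\<beta> y"] by linarith
    then show "dist (h q x) (h q y) \<le> L * dist x y" using Lip[OF xy] by (simp add: dist_real_def)
  qed (rule L0)
  obtain c where c: "c \<in> Q"
    using Rats_dense_in_real[OF ab] by (force simp: Q_def)
  have "\<forall>q\<in>Q. \<exists>N. negligible N \<and> (\<forall>x\<in>{a<..<b} - N. (h q has_real_derivative deriv (h q) x) (at x))"
    using lipschitz_on_real_deriv(1)[OF hL ab] Q by blast
  then obtain N where N: "\<And>q. q \<in> Q \<Longrightarrow> negligible (N q)"
     "\<And>q x. q \<in> Q \<Longrightarrow> x\<in>{a<..<b} - N q \<Longrightarrow> (h q has_real_derivative deriv (h q) x) (at x)"
    by metis
  define N1 where "N1 = (\<Union>q\<in>Q. N q)"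
  have N1: "negligible N1" unfolding N1_def using N Q(1)
    by (metis (no_types, lifting) countable_image image_iff negligible_countable_Union)
  \<comment> \<open>The truncation at \<open>L\<close> keeps the supremum finite also at exceptional
    points, where \<open>deriv\<close> may be any number; off \<open>N1\<close> it changes nothing
    by \<open>dL\<close>.\<close>
  define m where "m = (\<lambda>t. SUP q\<in>Q. min L \<bar>deriv (h q) t\<bar>)"
  have bdd: "bdd_above ((\<lambda>q. min L \<bar>deriv (h q) t\<bar>) ` Q)" for t
    by (rule bdd_aboveI[of _ L]) auto
  have dL: "\<bar>deriv (h q) x\<bar> \<le> L" if q: "q \<in> Q" and x: "x\<in>{a<..<b} - N1" for q x
  proof -
    have "(h q has_real_derivative deriv (h q) x) (at x)" using N(2)[OF q] x q by (auto simp: N1_def)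
    then have lim: "((\<lambda>y. \<bar>(h q y - h q x) / (y - x)\<bar>) \<longlongrightarrow> \<bar>deriv (h q) x\<bar>) (at x)"
      unfolding has_field_derivative_iff by (rule tendsto_rabs)
    have "eventually (\<lambda>y. y \<in> {a<..<b}) (at x)"
      using x by (intro eventually_at_in_open') auto
    then have ev: "eventually (\<lambda>y. \<bar>(h q y - h q x) / (y - x)\<bar> \<le> L) (at x)"
      using eventually_neq_at_within[of x]
    proof eventually_elim
      case (elim y)
      then have "\<bar>h q y - h q x\<bar> \<le> L * \<bar>y - x\<bar>"
        using lipschitz_onD[OF hL[of q], of y x] q Q x by (auto simp: dist_real_def)
      then show ?case using elim by (simp add: abs_divide divide_le_eq)
    qed
    show ?thesis by (rule tendsto_upperbound[OF lim ev]) simp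
  qed
  have mge: "\<bar>deriv (h q) x\<bar> \<le> m x" if q: "q \<in> Q" and x: "x\<in>{a<..<b} - N1" for q x
    using cSUP_upper[OF q bdd[of x]] dL[OF q x] by (simp add: m_def)
  have m0: "0 \<le> m x" "m x \<le> L" for x
  proof -
    show "0 \<le> m x" unfolding m_def using L0 by (intro order_trans[OF _ cSUP_upper[OF c bdd]]) simp
    show "m x \<le> L" unfolding m_def using c by (intro cSUP_least) auto
  qed
  have dm: "deriv (h q) \<in> borel_measurable (lebesgue_on {a..b})" if "q \<in> Q" for q
    using lipschitz_on_real_deriv(2)[OF hL ab, of q] that Q
    by (intro integrable_imp_measurable has_integral_integrable) auto
  have mm: "m \<in> borel_measurable (lebesgue_on {a..b})"
    unfolding m_def by (intro borel_measurable_cSUP Q(1) borel_measurable_min borel_measurable_const borel_measurable_abs dm bdd)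
  have mi: "m integrable_on {a..b}"
    using m0 by (intro measurable_bounded_by_integrable_imp_integrable[OF mm, of "\<lambda>_. L"]) auto
  define M where "M = (\<lambda>u. integral {a..u} m)"
  obtain N2 where N2: "negligible N2" "\<And>x. x\<in>{a<..<b} - N2 \<Longrightarrow> (M has_real_derivative m x) (at x)"
    using lebesgue_differentiation_real[OF mi] unfolding M_def by metis
  have mint: "m integrable_on {s..t}" if "a \<le> s" "t \<le> b" for s t
    using integrable_on_subinterval[OF mi] that by auto
  have Mdiff: "M t - M s = integral {s..t} m" if "a \<le> s" "s \<le> t" "t \<le> b" for s t
    using Henstock_Kurzweil_Integration.integral_combine[of a s t m] mint[of a t] that by (simp add: M_def)
  have hM: "\<bar>h q t - h q s\<bar> \<le> M t - M s" if q: "q \<in> Q" and st: "a \<le> s" "s < t" "t \<le> b" for q s t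
  proof -
    have "L-lipschitz_on {s..t} (h q)"
      by (rule lipschitz_on_subset[OF hL]) (use q Q st in auto)
    from lipschitz_on_real_deriv(2)[OF this st(2)]
    have hi: "(deriv (h q) has_integral (h q t - h q s)) {s..t}" .
    \<comment> \<open>On the exceptional set the derivative need not be dominated by
      \<open>m\<close>, so it is replaced by 0 there without changing the integral.\<close>
    define k where "k = (\<lambda>x. if x \<in> insert s (insert t N1) then 0 else deriv (h q) x)"
    have ki: "(k has_integral (h q t - h q s)) {s..t}"
      by (rule has_integral_spike[OF _ _ hi, of "insert s (insert t N1)"]) (use N1 in \<open>auto simp: k_def\<close>)
    have "norm (integral {s..t} k) \<le> integral {s..t} m"
    proof (rule integral_norm_bound_integral)
      show "norm (k x) \<le> m x" if "x \<in> {s..t}" for x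
        using mge[OF q, of x] that st m0(1)[of x] by (auto simp: k_def)
    qed (use ki mint st in auto)
    then show ?thesis using Mdiff[of s t] st ki by (simp add: integral_unique)
  qed
  have dM: "mdist X (\<beta> s) (\<beta> t) \<le> M t - M s" if st: "a \<le> s" "s < t" "t \<le> b" for s t
  proof (rule field_le_epsilon)
    fix e :: real assume e: "e > 0"
    \<comment> \<open>A rational \<open>q\<close> just after \<open>s\<close> gives
      \<open>h q s \<le> e / 2\<close>, and the triangle inequality spends this amount twice. The
      denominator uses \<open>L + 1\<close> so that it never vanishes.\<close>
    define t' where "t' = min t (s + e / (2 * (L + 1)))"
    have "s < t'" using st e L0 by (auto simp: t'_def)
    then obtain q where q: "q \<in> \<rat>" "s < q" "q < t'" using Rats_dense_in_real by blast
    then have qQ: "q \<in> Q" using st by (auto simp: Q_def t'_def)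
    have ab': "s \<in> {a..b}" "t \<in> {a..b}" "q \<in> {a..b}" using st qQ Q by auto
    have "q - s < e / (2 * (L + 1))" using q by (auto simp: t'_def)
    then have "(L + 1) * (q - s) \<le> e / 2" using L0 by (simp add: field_simps)
    moreover have "h q s \<le> L * (q - s)" using Lip[OF ab'(1,3)] q by (simp add: h_def)
    moreover have "mdist X (\<beta> s) (\<beta> t) \<le> h q s + h q t"
      unfolding h_def using X.triangle[OF bX[OF ab'(1)] bX[OF ab'(3)] bX[OF ab'(2)]] X.commute by metis
    moreover have "(L + 1) * (q - s) = L * (q - s) + (q - s)" by (simp add: algebra_simps)
    ultimately show "mdist X (\<beta> s) (\<beta> t) \<le> M t - M s + e"
      using hM[OF qQ st] q by linarith
  qed
  show ?thesis
  proof (intro exI[of _ "N1 \<union> N2"] conjI ballI)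
    show "negligible (N1 \<union> N2)" using N1 N2(1) by simp
    fix t assume t: "t \<in> {a<..<b} - (N1 \<union> N2)"
    then have t1: "t \<in> {a<..<b} - N1" and t2: "t \<in> {a<..<b} - N2" and tab: "t \<in> {a..b}" by auto
    have ev: "eventually (\<lambda>y. y \<in> {a<..<b}) (at t)"
      using t by (intro eventually_at_in_open') auto
    have "((\<lambda>s. mdist X (\<beta> s) (\<beta> t) / \<bar>s - t\<bar>) \<longlongrightarrow> m t) (at t)"
    proof (rule order_tendstoI)
      fix y assume y: "y < m t"
      then obtain q where q: "q \<in> Q" "y < min L \<bar>deriv (h q) t\<bar>"
        using c less_cSUP_iff[OF _ bdd[of t]] unfolding m_def by blast
      then have "y < \<bar>deriv (h q) t\<bar>" by simp
      moreover have "((\<lambda>s. \<bar>(h q s - h q t) / (s - t)\<bar>) \<longlongrightarrow> \<bar>deriv (h q) t\<bar>) (at t)"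
      proof (rule tendsto_rabs)
        show "((\<lambda>s. (h q s - h q t) / (s - t)) \<longlongrightarrow> deriv (h q) t) (at t)"
          using N(2)[OF q(1), of t] t q(1) by (auto simp: N1_def has_field_derivative_iff)
      qed
      ultimately have "eventually (\<lambda>s. y < \<bar>(h q s - h q t) / (s - t)\<bar>) (at t)"
        by (rule order_tendstoD(1)[rotated])
      then show "eventually (\<lambda>s. y < mdist X (\<beta> s) (\<beta> t) / \<bar>s - t\<bar>) (at t)"
        using ev eventually_neq_at_within[of t]
      proof eventually_elim
        case (elim s)
        have s: "s \<in> {a..b}" using elim by auto
        have qab: "q \<in> {a..b}" using q Q by auto
        have "\<bar>h q s - h q t\<bar> \<le> mdist X (\<beta> s) (\<beta> t)"
          unfolding h_def using X.triangle[OF bX[OF s] bX[OF tab] bX[OF qab]] X.triangle[OF bX[OF tab] bX[OF s] bX[OF qab]]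
            X.commute[of "\<beta> s" "\<beta> t"] by linarith
        then have "\<bar>(h q s - h q t) / (s - t)\<bar> \<le> mdist X (\<beta> s) (\<beta> t) / \<bar>s - t\<bar>"
          unfolding abs_divide by (rule divide_right_mono) simp
        then show ?case using elim by linarith
      qed
    next
      fix y assume y: "m t < y"
      have "((\<lambda>s. (M s - M t) / (s - t)) \<longlongrightarrow> m t) (at t)"
        using N2(2)[OF t2] by (simp add: has_field_derivative_iff)
      then have "eventually (\<lambda>s. (M s - M t) / (s - t) < y) (at t)"
        using y by (rule order_tendstoD(2))
      then show "eventually (\<lambda>s. mdist X (\<beta> s) (\<beta> t) / \<bar>s - t\<bar> < y) (at t)"
        using ev eventually_neq_at_within[of t]
      proof eventually_elim
        case (elim s)
        have "mdist X (\<beta> s) (\<beta> t) / \<bar>s - t\<bar> \<le> (M s - M t) / (s - t)"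
        proof (cases "s < t")
          case True
          then have "mdist X (\<beta> s) (\<beta> t) / (t - s) \<le> (M t - M s) / (t - s)"
            using dM[of s t] elim t by (intro divide_right_mono) auto
          moreover have "(M t - M s) / (t - s) = (M s - M t) / (s - t)"
            using True by (simp add: field_simps)
          ultimately show ?thesis using True by simp
        next
          case False
          then have "t < s" using elim by simp
          then show ?thesis using dM[of t s] elim t X.commute[of "\<beta> s" "\<beta> t"]
            by (auto intro!: divide_right_mono)
        qed
        then show ?case using elim by linarith
      qed
    qed
    then show "\<exists>v. ((\<lambda>s. mdist X (\<beta> s) (\<beta> t) / \<bar>s - t\<bar>) \<longlongrightarrow> v) (at t)" by blast
  qed
qed

section \<open>Causality and time separation of generalized cones\<close>

text \<open>Setting \<open>g\<close> to 0 on \<open>N\<close> makes it nonnegative everywhere and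
  preserves its gauge integral, which then agrees with the Lebesgue integral. Monotonicity of the
  nonnegative integral applies to arbitrary \<open>\<phi>\<close>, hence to the length integrand of
  a causal curve without a discussion of its measurability.\<close>

lemma nn_integral_lebesgue_on_le:
  fixes \<phi> g :: "real \<Rightarrow> real"
  assumes g: "(g has_integral J) {a..b}" and N: "negligible N"
    and le: "\<And>t. t \<in> {a..b} - N \<Longrightarrow> 0 \<le> \<phi> t \<and> \<phi> t \<le> g t"
  shows "(\<integral>\<^sup>+ t. ennreal (\<phi> t) \<partial>lebesgue_on {a..b}) \<le> ennreal J"
proof -
  define k where "k = (\<lambda>t. if t \<in> N then 0 else g t)"
  have k: "(k has_integral J) {a..b}"
    by (rule has_integral_spike[OF N _ g]) (simp add: k_def)
  have k0: "0 \<le> k t" if "t \<in> {a..b}" for t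
    using le[of t] that by (auto simp: k_def)
  have "(\<integral>\<^sup>+ t. ennreal (\<phi> t) \<partial>lebesgue_on {a..b}) \<le> (\<integral>\<^sup>+ t. ennreal (k t) \<partial>lebesgue_on {a..b})"
  proof (rule nn_integral_mono_AE)
    have "AE t in lebesgue_on {a..b}. \<phi> t \<le> k t"
      unfolding AE_lebesgue_on_iff_negligible[OF fmeasurableD[OF lmeasurable_interval(1), unfolded cbox_interval]]
    proof (rule negligible_subset[OF N])
      show "{t \<in> {a..b}. \<not> \<phi> t \<le> k t} \<subseteq> N" using le by (auto simp: k_def)
    qed
    then show "AE t in lebesgue_on {a..b}. ennreal (\<phi> t) \<le> ennreal (k t)"
      by eventually_elim (rule ennreal_leI)
  qed
  also have "\<dots> = (\<integral>\<^sup>+ t. ennreal (k t) * indicator {a..b} t \<partial>lborel)"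
    by (simp add: nn_integral_restrict_space nn_integral_completion)
  also have "\<dots> = ennreal J"
    by (rule nn_integral_has_integral_lebesgue'[OF k0 k])
  finally show ?thesis .
qed

text \<open>Cauchy-Schwarz for the vectors \<open>(p, y * v)\<close> and
  \<open>(1, \<mu> / y)\<close>, the first of which has norm \<open>A\<close>. The speed
  \<open>v\<close> enters only through \<open>- h \<le> v\<close>: later \<open>h\<close> is the
  derivative of the distance to the endpoint, whose integral is known exactly.\<close>

lemma reverse_cauchy_schwarz:
  fixes A y v h \<mu> :: real
  assumes "0 < A" "0 < y" "\<bar>h\<bar> \<le> v" "- A\<^sup>2 + y\<^sup>2 * v\<^sup>2 \<le> 0" "0 \<le> \<mu>"
  shows "sqrt (A\<^sup>2 - y\<^sup>2 * v\<^sup>2) \<le> sqrt (1 + (\<mu> / y)\<^sup>2) * A + \<mu> * h"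
proof -
  define p where "p = sqrt (A\<^sup>2 - y\<^sup>2 * v\<^sup>2)"
  have p: "p\<^sup>2 = A\<^sup>2 - y\<^sup>2 * v\<^sup>2" using assms by (simp add: p_def)
  have "(p * 1 + (y * v) * (\<mu> / y))\<^sup>2 \<le> (p\<^sup>2 + (y * v)\<^sup>2) * (1\<^sup>2 + (\<mu> / y)\<^sup>2)"
  proof -
    have "(p\<^sup>2 + (y * v)\<^sup>2) * (1\<^sup>2 + (\<mu> / y)\<^sup>2) - (p * 1 + (y * v) * (\<mu> / y))\<^sup>2 = (p * (\<mu> / y) - y * v)\<^sup>2"
      by (simp add: power2_eq_square algebra_simps)
    then show ?thesis using zero_le_power2[of "p * (\<mu> / y) - y * v"] by linarith
  qed
  also have "\<dots> = (sqrt (1 + (\<mu> / y)\<^sup>2) * A)\<^sup>2"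
    by (simp add: p power_mult_distrib mult.commute)
  finally have "p * 1 + (y * v) * (\<mu> / y) \<le> sqrt (1 + (\<mu> / y)\<^sup>2) * A"
    by (rule power2_le_imp_le) (use assms in simp)
  moreover have "(y * v) * (\<mu> / y) = \<mu> * v" using assms by simp
  moreover have "- (\<mu> * v) \<le> \<mu> * h" using mult_left_mono[of "-h" v \<mu>] assms(3,5) by (auto simp: abs_le_iff)
  ultimately show ?thesis by (simp add: p_def)
qed

text \<open>Conformal time: the fibre distance covered by a light ray between \<open>s\<close> and
  \<open>t\<close>. For \<open>t < s\<close> the domain of integration is empty and the value is
  0.\<close>

definition optical :: "(real \<Rightarrow> real) \<Rightarrow> real \<Rightarrow> real \<Rightarrow> real" where
  "optical f s t = integral {s..t} (\<lambda>u. 1 / f u)"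

text \<open>The integrand \<open>sqrt (1 + (\<mu> / y)\<^sup>2)\<close> is the maximum of
  \<open>sqrt (1 - y\<^sup>2 * v\<^sup>2) + \<mu> * v\<close> over speeds \<open>v\<close>, so this
  integrates the conjugate of the length Lagrangian. Here \<open>\<mu>\<close> is the multiplier of
  the constraint on the fibre distance. For \<open>t < s\<close> the value is 0.\<close>

definition energy :: "(real \<Rightarrow> real) \<Rightarrow> real \<Rightarrow> real \<Rightarrow> real \<Rightarrow> real" where
  "energy f \<mu> s t = integral {s..t} (\<lambda>u. sqrt (1 + (\<mu> / f u)\<^sup>2))"

section \<open>Bounds along causal curves, and curves of prescribed speed\<close>

locale warped_cone =
  fixes I :: "real set" and f :: "real \<Rightarrow> real" and X :: "'x metric"
  assumes interval: "is_interval I" and open_I: "open I" and cont: "continuous_on I f"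
    and pos: "t \<in> I \<Longrightarrow> 0 < f t" and geodesic: "geodesic_space X"
begin

sublocale X: Metric_space "mspace X" "mdist X" by simp

lemma Icc_subset: "s \<in> I \<Longrightarrow> t \<in> I \<Longrightarrow> {s..t} \<subseteq> I"
  using interval unfolding is_interval_1 by fastforce

lemma cont_Icc: "s \<in> I \<Longrightarrow> t \<in> I \<Longrightarrow> continuous_on {s..t} f"
  using continuous_on_subset[OF cont Icc_subset] .

lemma cont_optical: "continuous_on I (\<lambda>u. 1 / f u)"
  using pos by (intro continuous_intros cont) force

lemma cont_energy: "continuous_on I (\<lambda>u. sqrt (1 + (\<mu> / f u)\<^sup>2))"
  using pos by (intro continuous_intros cont) force

text \<open>Source of every bound on causal curves: \<open>k = 1 / f\<close>, \<open>c = 1\<close>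
  gives the causal one, \<open>k = sqrt (1 + (\<mu> / f)\<^sup>2)\<close>, \<open>c = \<mu>\<close>
  the bound on length. The distance \<open>h\<close> to the final fibre point ends at 0, so its
  derivative integrates to minus the distance of the endpoints, while the triangle inequality bounds
  it by the metric speed.\<close>

lemma curve_integral:
  assumes fc: "future_causal I f X a b \<alpha> \<beta>" and k: "continuous_on I k"
  defines "h \<equiv> (\<lambda>t. mdist X (\<beta> t) (\<beta> b))"
  shows "\<exists>N. negligible N \<and>
     ((\<lambda>t. k (\<alpha> t) * deriv \<alpha> t + c * deriv h t) has_integral
        (integral {\<alpha> a..\<alpha> b} k - c * mdist X (\<beta> a) (\<beta> b))) {a..b} \<and>
     (\<forall>t\<in>{a..b} - N. \<bar>deriv h t\<bar> \<le> metric_speed X \<beta> t \<and> 0 < deriv \<alpha> t \<and> cone_form f X \<alpha> \<beta> t \<le> 0)"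
proof -
  have ab: "a < b" and \<alpha>I: "\<alpha> \<in> {a..b} \<rightarrow> I" and sm: "strict_mono_on {a..b} \<alpha>"
    using fc by (auto simp: future_causal_def)
  obtain L where L: "L-lipschitz_on {a..b} \<alpha>" using fc by (auto simp: future_causal_def)
  have bX: "\<beta> t \<in> mspace X" if "t \<in> {a..b}" for t
    using fc that by (auto simp: future_causal_def Lipschitz_continuous_map_def)
  obtain K where K: "K > 0" "\<And>s t. s \<in> {a..b} \<Longrightarrow> t \<in> {a..b} \<Longrightarrow> mdist X (\<beta> s) (\<beta> t) \<le> K * \<bar>s - t\<bar>"
    using fc by (auto simp: future_causal_def Lipschitz_continuous_map_pos dist_real_def)
  have mono: "\<alpha> s \<le> \<alpha> t" if "s \<in> {a..b}" "t \<in> {a..b}" "s \<le> t" for s t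
    using strict_mono_onD[OF sm that(1,2)] that by (cases "s = t") auto
  have sub: "{\<alpha> a..\<alpha> b} \<subseteq> I" using \<alpha>I ab by (intro Icc_subset) auto
  have kc: "continuous_on {\<alpha> a..\<alpha> b} k" by (rule continuous_on_subset[OF k sub])
  have \<alpha>ab: "\<alpha> t \<in> {\<alpha> a..\<alpha> b}" if "t \<in> {a..b}" for t
    using mono[of a t] mono[of t b] that ab by auto
  \<comment> \<open>A primitive of \<open>k\<close>. The composition with \<open>\<alpha>\<close> is
    Lipschitz, so the fundamental theorem together with the chain rule at points of
    differentiability replaces a change of variables.\<close>
  define G where "G = (\<lambda>u. integral {\<alpha> a..u} k)"
  have "bounded (k ` {\<alpha> a..\<alpha> b})" by (intro compact_imp_bounded compact_continuous_image kc) simp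
  then obtain B where B: "B > 0" "\<And>u. u \<in> {\<alpha> a..\<alpha> b} \<Longrightarrow> \<bar>k u\<bar> \<le> B" by (auto simp: bounded_pos)
  have Gdiff: "\<bar>G v - G u\<bar> \<le> B * (v - u)" if uv: "\<alpha> a \<le> u" "u \<le> v" "v \<le> \<alpha> b" for u v
  proof -
    have "k integrable_on {\<alpha> a..v}" using uv by (intro integrable_continuous_real continuous_on_subset[OF kc]) auto
    then have "G v - G u = integral {u..v} k"
      using Henstock_Kurzweil_Integration.integral_combine[of "\<alpha> a" u v k] uv by (simp add: G_def)
    moreover have "norm (integral {u..v} k) \<le> B * (v - u)"
      using uv B by (intro integral_bound continuous_on_subset[OF kc]) auto
    ultimately show ?thesis by simp
  qed
  have GL: "(B * L)-lipschitz_on {a..b} (\<lambda>t. G (\<alpha> t))"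
  proof (rule lipschitz_on_compose2[OF L])
    show "B-lipschitz_on (\<alpha> ` {a..b}) G"
    proof (rule lipschitz_onI)
      fix x y assume "x \<in> \<alpha> ` {a..b}" "y \<in> \<alpha> ` {a..b}"
      then have "x \<in> {\<alpha> a..\<alpha> b}" "y \<in> {\<alpha> a..\<alpha> b}" using \<alpha>ab by auto
      then show "dist (G x) (G y) \<le> B * dist x y"
        using Gdiff[of x y] Gdiff[of y x] by (cases "x \<le> y") (auto simp: dist_real_def abs_minus_commute)
    qed (use B in simp)
  qed
  have hL: "K-lipschitz_on {a..b} h"
  proof (rule lipschitz_onI)
    fix x y assume xy: "x \<in> {a..b}" "y \<in> {a..b}"
    have b: "b \<in> {a..b}" using ab by simp
    have "\<bar>h x - h y\<bar> \<le> mdist X (\<beta> x) (\<beta> y)"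
      unfolding h_def using X.triangle[OF bX[OF xy(1)] bX[OF xy(2)] bX[OF b]]
        X.triangle[OF bX[OF xy(2)] bX[OF xy(1)] bX[OF b]] X.commute[of "\<beta> x" "\<beta> y"] by linarith
    then show "dist (h x) (h y) \<le> K * dist x y" using K(2)[OF xy] by (simp add: dist_real_def)
  qed (use K in simp)
  obtain N1 where N1: "negligible N1" "\<And>x. x\<in>{a<..<b} - N1 \<Longrightarrow> (\<alpha> has_real_derivative deriv \<alpha> x) (at x)"
    using lipschitz_on_real_deriv(1)[OF L ab] by blast
  obtain N2 where N2: "negligible N2" "\<And>x. x\<in>{a<..<b} - N2 \<Longrightarrow> (h has_real_derivative deriv h x) (at x)"
    using lipschitz_on_real_deriv(1)[OF hL ab] by blast
  have "\<beta> \<in> {a..b} \<rightarrow> mspace X" using bX by blast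
  from metric_speed_exists[OF this ab K(2)]
  obtain N3 where N3: "negligible N3"
    "\<And>t. t\<in>{a<..<b} - N3 \<Longrightarrow> \<exists>v. ((\<lambda>s. mdist X (\<beta> s) (\<beta> t) / \<bar>s - t\<bar>) \<longlongrightarrow> v) (at t)"
    by auto
  define N4 where "N4 = {t\<in>{a..b}. \<not> (0 < deriv \<alpha> t)}"
  define N5 where "N5 = {t\<in>{a..b}. \<not> (cone_form f X \<alpha> \<beta> t \<le> 0)}"
  have N45: "negligible N4" "negligible N5"
    using fc unfolding N4_def N5_def future_causal_def by (simp_all add: AE_lebesgue_on_iff_negligible)
  \<comment> \<open>The endpoints are excluded because \<open>deriv\<close> and
    \<open>metric_speed\<close> are two-sided and there see the curve outside
    \<open>{a..b}\<close>.\<close>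
  define N where "N = insert a (insert b (N1 \<union> N2 \<union> N3 \<union> N4 \<union> N5))"
  have N: "negligible N" using N1 N2 N3 N45 by (simp add: N_def)
  have dG: "deriv (\<lambda>t. G (\<alpha> t)) t = k (\<alpha> t) * deriv \<alpha> t" if t: "t \<in> {a..b} - N" for t
  proof -
    have tab: "a < t" "t < b" using t by (auto simp: N_def)
    have at: "\<alpha> t \<in> {\<alpha> a<..<\<alpha> b}" using strict_mono_onD[OF sm, of a t] strict_mono_onD[OF sm, of t b] tab by auto
    have "(G has_real_derivative k (\<alpha> t)) (at (\<alpha> t) within {\<alpha> a..\<alpha> b})"
      unfolding G_def using at by (intro integral_has_real_derivative kc) auto
    then have "(G has_real_derivative k (\<alpha> t)) (at (\<alpha> t))"
      using at by (simp add: at_within_Icc_at)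
    moreover have "(\<alpha> has_real_derivative deriv \<alpha> t) (at t)" using t tab by (intro N1) (auto simp: N_def)
    ultimately have "((\<lambda>t. G (\<alpha> t)) has_real_derivative k (\<alpha> t) * deriv \<alpha> t) (at t)"
      by (rule DERIV_chain2)
    then show ?thesis by (rule DERIV_imp_deriv)
  qed
  have "((\<lambda>t. k (\<alpha> t) * deriv \<alpha> t) has_integral (G (\<alpha> b) - G (\<alpha> a))) {a..b}"
    by (rule has_integral_spike[OF N _ lipschitz_on_real_deriv(2)[OF GL ab]]) (use dG in auto)
  from has_integral_add[OF this has_integral_mult_right[OF lipschitz_on_real_deriv(2)[OF hL ab], of c]]
  have int: "((\<lambda>t. k (\<alpha> t) * deriv \<alpha> t + c * deriv h t) has_integral
        (integral {\<alpha> a..\<alpha> b} k - c * mdist X (\<beta> a) (\<beta> b))) {a..b}"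
    using bX ab by (simp add: G_def h_def algebra_simps)
  have "\<bar>deriv h t\<bar> \<le> metric_speed X \<beta> t" if t: "t \<in> {a..b} - N" for t
  proof -
    have tab: "a < t" "t < b" using t by (auto simp: N_def)
    have tN: "t \<in> {a<..<b} - N2" "t \<in> {a<..<b} - N3" using t tab by (auto simp: N_def)
    obtain v where v: "((\<lambda>s. mdist X (\<beta> s) (\<beta> t) / \<bar>s - t\<bar>) \<longlongrightarrow> v) (at t)" using N3(2)[OF tN(2)] by blast
    have lim: "((\<lambda>s. \<bar>(h s - h t) / (s - t)\<bar>) \<longlongrightarrow> \<bar>deriv h t\<bar>) (at t)"
      using N2(2)[OF tN(1)] unfolding has_field_derivative_iff by (rule tendsto_rabs)
    have ev: "eventually (\<lambda>y. y \<in> {a<..<b}) (at t)"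
      using tab by (intro eventually_at_in_open') auto
    have "eventually (\<lambda>s. \<bar>(h s - h t) / (s - t)\<bar> \<le> mdist X (\<beta> s) (\<beta> t) / \<bar>s - t\<bar>) (at t)"
      using ev
    proof eventually_elim
      case (elim s)
      have s: "s \<in> {a..b}" "t \<in> {a..b}" "b \<in> {a..b}" using elim tab by auto
      have "\<bar>h s - h t\<bar> \<le> mdist X (\<beta> s) (\<beta> t)"
        unfolding h_def using X.triangle[OF bX[OF s(1)] bX[OF s(2)] bX[OF s(3)]]
          X.triangle[OF bX[OF s(2)] bX[OF s(1)] bX[OF s(3)]] X.commute[of "\<beta> s" "\<beta> t"] by linarith
      then show ?case unfolding abs_divide by (rule divide_right_mono) simp
    qed
    then have "\<bar>deriv h t\<bar> \<le> v" by (rule tendsto_le[OF _ v lim, rotated]) simp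
    moreover have "metric_speed X \<beta> t = v"
      unfolding metric_speed_def by (rule tendsto_Lim[OF _ v]) simp
    ultimately show ?thesis by simp
  qed
  then show ?thesis using N int by (intro exI[of _ N]) (auto simp: N_def N4_def N5_def)
qed

lemma cone_form_expand:
  "cone_form f X \<alpha> \<beta> t = - (deriv \<alpha> t)\<^sup>2 + (f (\<alpha> t))\<^sup>2 * (metric_speed X \<beta> t)\<^sup>2"
  by (simp add: cone_form_def)

text \<open>Weak duality: \<open>reverse_cauchy_schwarz\<close> integrated along the curve.\<close>

lemma causal_curve_length_le:
  assumes fc: "future_causal I f X a b \<alpha> \<beta>" and \<mu>: "0 \<le> \<mu>"
  shows "(\<integral>\<^sup>+ t. ennreal (sqrt (- cone_form f X \<alpha> \<beta> t)) \<partial>lebesgue_on {a..b})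
     \<le> ennreal (energy f \<mu> (\<alpha> a) (\<alpha> b) - \<mu> * mdist X (\<beta> a) (\<beta> b))"
proof -
  define h where "h = (\<lambda>t. mdist X (\<beta> t) (\<beta> b))"
  obtain N where N: "negligible N" and
    int: "((\<lambda>t. sqrt (1 + (\<mu> / f (\<alpha> t))\<^sup>2) * deriv \<alpha> t + \<mu> * deriv h t) has_integral
        (integral {\<alpha> a..\<alpha> b} (\<lambda>u. sqrt (1 + (\<mu> / f u)\<^sup>2)) - \<mu> * mdist X (\<beta> a) (\<beta> b))) {a..b}" and
    le: "\<And>t. t\<in>{a..b} - N \<Longrightarrow> \<bar>deriv h t\<bar> \<le> metric_speed X \<beta> t \<and> 0 < deriv \<alpha> t \<and> cone_form f X \<alpha> \<beta> t \<le> 0"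
    using curve_integral[OF fc cont_energy[of \<mu>], of \<mu>] unfolding h_def by blast
  show ?thesis unfolding energy_def
  proof (rule nn_integral_lebesgue_on_le[OF int N])
    fix t assume t: "t \<in> {a..b} - N"
    have "\<alpha> t \<in> I" using fc t by (auto simp: future_causal_def)
    then show "0 \<le> sqrt (- cone_form f X \<alpha> \<beta> t) \<and>
        sqrt (- cone_form f X \<alpha> \<beta> t) \<le> sqrt (1 + (\<mu> / f (\<alpha> t))\<^sup>2) * deriv \<alpha> t + \<mu> * deriv h t"
      using reverse_cauchy_schwarz[of "deriv \<alpha> t" "f (\<alpha> t)" "deriv h t" "metric_speed X \<beta> t" \<mu>] le[OF t] pos \<mu>
      by (simp add: cone_form_expand)
  qed
qed

text \<open>Causality says exactly that the integrand
  \<open>1 / f (\<alpha> t) * deriv \<alpha> t + deriv h t\<close> is nonnegative almost everywhere,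
  and for timelike curves it is positive almost everywhere. Its integral is the difference of the
  two sides.\<close>

lemma causal_curve_dist:
  assumes fc: "future_causal I f X a b \<alpha> \<beta>"
  shows "mdist X (\<beta> a) (\<beta> b) \<le> optical f (\<alpha> a) (\<alpha> b)"
    and "future_timelike I f X a b \<alpha> \<beta> \<Longrightarrow> mdist X (\<beta> a) (\<beta> b) < optical f (\<alpha> a) (\<alpha> b)"
proof -
  define h where "h = (\<lambda>t. mdist X (\<beta> t) (\<beta> b))"
  obtain N where N: "negligible N" and
    int: "((\<lambda>t. 1 / f (\<alpha> t) * deriv \<alpha> t + 1 * deriv h t) has_integral
        (integral {\<alpha> a..\<alpha> b} (\<lambda>u. 1 / f u) - 1 * mdist X (\<beta> a) (\<beta> b))) {a..b}" and
    le: "\<And>t. t\<in>{a..b} - N \<Longrightarrow> \<bar>deriv h t\<bar> \<le> metric_speed X \<beta> t \<and> 0 < deriv \<alpha> t \<and> cone_form f X \<alpha> \<beta> t \<le> 0"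
    using curve_integral[OF fc cont_optical, of 1] unfolding h_def by blast
  have ab: "a < b" using fc by (simp add: future_causal_def)
  have fa: "0 < f (\<alpha> t)" if "t \<in> {a..b}" for t
  proof (rule pos)
    show "\<alpha> t \<in> I" using fc that unfolding future_causal_def by blast
  qed
  have g0: "0 \<le> 1 / f (\<alpha> t) * deriv \<alpha> t + 1 * deriv h t" if t: "t \<in> {a..b} - N" for t
  proof -
    have f: "0 < f (\<alpha> t)" using fa t by auto
    have "(f (\<alpha> t) * metric_speed X \<beta> t)\<^sup>2 \<le> (deriv \<alpha> t)\<^sup>2"
      using le[OF t] by (simp add: cone_form_expand power_mult_distrib)
    then have "f (\<alpha> t) * metric_speed X \<beta> t \<le> deriv \<alpha> t"
      by (rule power2_le_imp_le) (use le[OF t] in simp)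
    then have "metric_speed X \<beta> t \<le> deriv \<alpha> t / f (\<alpha> t)" using f by (simp add: field_simps)
    moreover have "- deriv h t \<le> metric_speed X \<beta> t" using le[OF t] by (simp add: abs_le_iff)
    ultimately show ?thesis by simp
  qed
  define k where "k = (\<lambda>t. if t \<in> N then 0 else 1 / f (\<alpha> t) * deriv \<alpha> t + 1 * deriv h t)"
  have ki: "(k has_integral (optical f (\<alpha> a) (\<alpha> b) - mdist X (\<beta> a) (\<beta> b))) {a..b}"
    by (rule has_integral_spike[OF N _ int[unfolded mult_1, folded optical_def]]) (simp add: k_def)
  have k0: "0 \<le> k t" if "t \<in> {a..b}" for t using g0[of t] that by (auto simp: k_def)
  show le1: "mdist X (\<beta> a) (\<beta> b) \<le> optical f (\<alpha> a) (\<alpha> b)"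
    using has_integral_nonneg[OF ki k0] by simp
  assume ft: "future_timelike I f X a b \<alpha> \<beta>"
  show "mdist X (\<beta> a) (\<beta> b) < optical f (\<alpha> a) (\<alpha> b)"
  proof (rule ccontr)
    assume "\<not> ?thesis"
    then have "(k has_integral 0) {a..b}" using ki le1 by simp
    then have k00: "(k has_integral 0) {a..b}" .
    have "(\<integral>\<^sup>+ t. ennreal (k t) \<partial>lebesgue_on {a..b}) \<le> ennreal 0"
      by (rule nn_integral_lebesgue_on_le[OF k00 negligible_empty]) (use k0 in auto)
    moreover have "k \<in> borel_measurable (lebesgue_on {a..b})"
      using k00 by (intro integrable_imp_measurable has_integral_integrable)
    ultimately have "AE t in lebesgue_on {a..b}. ennreal (k t) = 0"
      by (subst (asm) ennreal_0, subst nn_integral_0_iff_AE[symmetric]) auto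
    then have neg: "negligible {t \<in> {a..b}. \<not> ennreal (k t) = 0}"
      by (subst (asm) AE_lebesgue_on_iff_negligible) auto
    moreover have "{t \<in> {a..b}. \<not> ennreal (k t) = 0} = {t \<in> {a..b}. k t \<noteq> 0}"
      using k0 by (force simp: ennreal_eq_0_iff)
    ultimately have neg: "negligible {t \<in> {a..b}. k t \<noteq> 0}" by simp
    define N' where "N' = {t\<in>{a..b}. \<not> (cone_form f X \<alpha> \<beta> t < 0)}"
    have N': "negligible N'"
      using ft unfolding N'_def future_timelike_def by (simp add: AE_lebesgue_on_iff_negligible)
    \<comment> \<open>If the integral vanished, \<open>k\<close> would vanish almost everywhere,
      whereas \<open>k\<close> is positive wherever the curve is timelike off \<open>N\<close>.
      Three negligible sets would then cover an interval of positive length.\<close>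
    have "{a..b} \<subseteq> N \<union> N' \<union> {t \<in> {a..b}. k t \<noteq> 0}"
    proof
      fix t assume t: "t \<in> {a..b}"
      show "t \<in> N \<union> N' \<union> {t \<in> {a..b}. k t \<noteq> 0}"
      proof (rule ccontr)
        assume "\<not> ?thesis"
        then have tt: "t \<in> {a..b} - N" "cone_form f X \<alpha> \<beta> t < 0" "k t = 0" using t by (auto simp: N'_def)
        have f: "0 < f (\<alpha> t)" using fa t by auto
        have "(f (\<alpha> t) * metric_speed X \<beta> t)\<^sup>2 < (deriv \<alpha> t)\<^sup>2"
          using tt(2) by (simp add: cone_form_expand power_mult_distrib)
        then have "f (\<alpha> t) * metric_speed X \<beta> t < deriv \<alpha> t"
          by (rule power2_less_imp_less) (use le[OF tt(1)] in simp)
        then have "metric_speed X \<beta> t < deriv \<alpha> t / f (\<alpha> t)" using f by (simp add: field_simps)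
        moreover have "- deriv h t \<le> metric_speed X \<beta> t" using le[OF tt(1)] by (simp add: abs_le_iff)
        ultimately show False using tt(1,3) by (simp add: k_def)
      qed
    qed
    then have "negligible {a..b}"
      using negligible_subset N N' neg by (metis negligible_Un)
    then show False using ab negligible_interval(1)[of a b] by (simp add: box_eq_empty)
  qed
qed

text \<open>A geodesic of the fibre is run at the prescribed speed \<open>v\<close>, with time
  itself as parameter. Since \<open>v\<close> is continuous, the metric speed exists at every
  interior point, and its values at the two endpoints do not affect statements almost
  everywhere.\<close>

lemma graph_curve:
  assumes s: "s \<in> I" and t: "t \<in> I" and st: "s < t" and x: "x \<in> mspace X" and y: "y \<in> mspace X"
    and v: "continuous_on {s..t} v" and v0: "\<And>u. u \<in> {s..t} \<Longrightarrow> 0 \<le> v u"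
    and fv: "\<And>u. u \<in> {s..t} \<Longrightarrow> f u * v u \<le> 1" and iv: "integral {s..t} v = mdist X x y"
  shows "\<exists>\<beta>. future_causal I f X s t (\<lambda>u. u) \<beta> \<and> \<beta> s = x \<and> \<beta> t = y \<and>
     (\<forall>u\<in>{s<..<t}. cone_form f X (\<lambda>u. u) \<beta> u = - 1 + (f u * v u)\<^sup>2)"
proof -
  define r where "r = mdist X x y"
  define V where "V = (\<lambda>u. integral {s..u} v)"
  obtain \<gamma> where \<gamma>: "\<gamma> \<in> {0..1::real} \<rightarrow> mspace X" "\<gamma> 0 = x" "\<gamma> 1 = y"
    "\<And>a b. a\<in>{0..1} \<Longrightarrow> b\<in>{0..1} \<Longrightarrow> mdist X (\<gamma> a) (\<gamma> b) = \<bar>a - b\<bar> * mdist X x y"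
    using geodesic x y unfolding geodesic_space_def by metis
  have vi: "v integrable_on {a..b}" if "s \<le> a" "b \<le> t" for a b
    using that by (intro integrable_continuous_real continuous_on_subset[OF v]) auto
  have Vd: "V b - V a = integral {a..b} v" if "s \<le> a" "a \<le> b" "b \<le> t" for a b
    using Henstock_Kurzweil_Integration.integral_combine[of s a b v] vi[of s b] that by (simp add: V_def)
  have V0: "V s = 0" and V1: "V t = r" using iv by (simp_all add: V_def r_def)
  have Vm: "V a \<le> V b" if "s \<le> a" "a \<le> b" "b \<le> t" for a b
    using Vd[OF that] integral_nonneg[OF vi[of a b]] v0 that by auto
  have Vr: "0 \<le> V u \<and> V u \<le> r" if "u \<in> {s..t}" for u
    using Vm[of s u] Vm[of u t] V0 V1 that by auto
  \<comment> \<open>If \<open>r = 0\<close>, the quotient is 0 by convention and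
    \<open>\<beta>\<close> rests at \<open>x\<close>, which then equals \<open>y\<close>.\<close>
  define \<beta> where "\<beta> = (\<lambda>u. \<gamma> (V u / r))"
  have r0: "0 \<le> r" by (simp add: r_def)
  have in01: "V u / r \<in> {0..1}" if "u \<in> {s..t}" for u
    using Vr[OF that] r0 by (auto simp: divide_le_eq)
  have \<beta>d: "mdist X (\<beta> a) (\<beta> b) = \<bar>V a - V b\<bar>" if "a \<in> {s..t}" "b \<in> {s..t}" for a b
  proof -
    have "mdist X (\<beta> a) (\<beta> b) = \<bar>V a / r - V b / r\<bar> * r"
      unfolding \<beta>_def r_def[symmetric] using \<gamma>(4)[OF in01[OF that(1)] in01[OF that(2)]] by (simp add: r_def)
    also have "\<dots> = \<bar>V a - V b\<bar>"
    proof (cases "r = 0")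
      case True then show ?thesis using Vr[OF that(1)] Vr[OF that(2)] by simp
    next
      case False
      have "V a / r - V b / r = (V a - V b) / r" by (simp add: diff_divide_distrib)
      then show ?thesis using False r0 by (simp add: abs_divide)
    qed
    finally show ?thesis .
  qed
  have \<beta>X: "\<beta> u \<in> mspace X" if "u \<in> {s..t}" for u
    using \<gamma>(1) in01[OF that] by (auto simp: \<beta>_def)
  have "r = 0 \<Longrightarrow> x = y" using x y by (simp add: r_def)
  then have ends: "\<beta> s = x" "\<beta> t = y" using V0 V1 \<gamma>(2,3) by (auto simp: \<beta>_def)
  have "bounded (v ` {s..t})" by (intro compact_imp_bounded compact_continuous_image v) simp
  then obtain B where B: "B > 0" "\<And>u. u \<in> {s..t} \<Longrightarrow> \<bar>v u\<bar> \<le> B" by (auto simp: bounded_pos)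
  have VL: "\<bar>V b - V a\<bar> \<le> B * (b - a)" if ab: "s \<le> a" "a \<le> b" "b \<le> t" for a b
  proof -
    have "norm (integral {a..b} v) \<le> B * (b - a)"
      using ab B by (intro integral_bound continuous_on_subset[OF v]) auto
    then show ?thesis using Vd[OF ab] by simp
  qed
  have "mdist X (\<beta> a) (\<beta> b) \<le> B * \<bar>a - b\<bar>" if "a \<in> {s..t}" "b \<in> {s..t}" for a b
    using \<beta>d[OF that] VL[of a b] VL[of b a] that by (cases "a \<le> b") (auto simp: abs_minus_commute)
  then have Lip: "Lipschitz_continuous_map (submetric euclidean_metric {s..t}) X \<beta>"
    unfolding Lipschitz_continuous_map_def using \<beta>X by (auto simp: dist_real_def intro!: exI[of _ B])
  have ms: "metric_speed X \<beta> u = v u" if u: "u \<in> {s<..<t}" for u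
  proof -
    have "(V has_real_derivative v u) (at u within {s..t})"
      unfolding V_def using u by (intro integral_has_real_derivative v) auto
    then have "(V has_real_derivative v u) (at u)" using u by (simp add: at_within_Icc_at)
    then have "((\<lambda>w. \<bar>(V w - V u) / (w - u)\<bar>) \<longlongrightarrow> \<bar>v u\<bar>) (at u)"
      unfolding has_field_derivative_iff by (rule tendsto_rabs)
    moreover have "eventually (\<lambda>y. y \<in> {s<..<t}) (at u)"
      using u by (intro eventually_at_in_open') auto
    then have "eventually (\<lambda>w. \<bar>(V w - V u) / (w - u)\<bar> = mdist X (\<beta> w) (\<beta> u) / \<bar>w - u\<bar>) (at u)"
      by eventually_elim (use u \<beta>d in \<open>simp add: abs_divide\<close>)
    ultimately have "((\<lambda>w. mdist X (\<beta> w) (\<beta> u) / \<bar>w - u\<bar>) \<longlongrightarrow> \<bar>v u\<bar>) (at u)"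
      by (rule Lim_transform_eventually)
    then show ?thesis unfolding metric_speed_def using v0[of u] u by (subst tendsto_Lim) auto
  qed
  have cf: "cone_form f X (\<lambda>u. u) \<beta> u = - 1 + (f u * v u)\<^sup>2" if "u \<in> {s<..<t}" for u
    using ms[OF that] by (simp add: cone_form_expand power_mult_distrib)
  have cf0: "cone_form f X (\<lambda>u. u) \<beta> u \<le> 0" if u: "u \<in> {s<..<t}" for u
  proof -
    have "u \<in> {s..t}" "u \<in> I" using u Icc_subset[OF s t] by auto
    then have "0 \<le> f u * v u" "f u * v u \<le> 1" using v0[of u] fv[of u] pos[of u] by (auto simp: less_imp_le)
    then show ?thesis unfolding cf[OF u] by (simp add: power_le_one)
  qed
  have "AE u in lebesgue_on {s..t}. cone_form f X (\<lambda>u. u) \<beta> u \<le> 0"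
  proof (subst AE_lebesgue_on_iff_negligible)
    have "{u \<in> {s..t}. \<not> cone_form f X (\<lambda>u. u) \<beta> u \<le> 0} \<subseteq> {s, t}"
      using cf0 by force
    then show "negligible {u \<in> {s..t}. \<not> cone_form f X (\<lambda>u. u) \<beta> u \<le> 0}"
      by (rule negligible_subset[rotated]) simp
  qed simp
  moreover have "1-lipschitz_on {s..t} (\<lambda>u. u)" by (rule lipschitz_onI) auto
  ultimately have "future_causal I f X s t (\<lambda>u. u) \<beta>"
    unfolding future_causal_def using st Icc_subset[OF s t] Lip by (auto simp: strict_mono_on_def)
  then show ?thesis using ends cf by blast
qed

text \<open>For sufficiency the geodesic runs at the constant fraction \<open>q \<le> 1\<close> of
  the speed of light \<open>1 / f\<close>, with \<open>q\<close> chosen so that it arrives at time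
  \<open>t\<close>.\<close>

lemma cone_caus_iff:
  assumes z: "z \<in> I \<times> mspace X" and w: "w \<in> I \<times> mspace X"
  shows "caus (gen_cone I f X) z w \<longleftrightarrow>
    fst z \<le> fst w \<and> mdist X (snd z) (snd w) \<le> optical f (fst z) (fst w)"
proof
  assume "caus (gen_cone I f X) z w"
  then consider "z = w" | a b \<alpha> \<beta> where "future_causal I f X a b \<alpha> \<beta>" "joins a b \<alpha> \<beta> z w"
    by (auto simp: gen_cone_def)
  then show "fst z \<le> fst w \<and> mdist X (snd z) (snd w) \<le> optical f (fst z) (fst w)"
  proof cases
    case 1
    then show ?thesis using z by (auto simp: optical_def)
  next
    case 2
    have "\<alpha> a < \<alpha> b" using 2(1) by (auto simp: future_causal_def strict_mono_on_def)
    then show ?thesis using causal_curve_dist(1)[OF 2(1)] 2(2) by (auto simp: joins_def)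
  qed
next
  assume h: "fst z \<le> fst w \<and> mdist X (snd z) (snd w) \<le> optical f (fst z) (fst w)"
  obtain s x t y where zw: "z = (s, x)" "w = (t, y)" by (cases z, cases w)
  have st: "s \<in> I" "t \<in> I" "x \<in> mspace X" "y \<in> mspace X" using z w zw by auto
  show "caus (gen_cone I f X) z w"
  proof (cases "s = t")
    case True
    then have "mdist X x y \<le> 0" using h zw by (simp add: optical_def)
    then have "x = y" using st X.nonneg[of x y] X.zero[of x y] by simp
    then show ?thesis using True zw by (simp add: gen_cone_def)
  next
    case False
    then have lt: "s < t" using h zw by simp
    define O1 where "O1 = optical f s t"
    define q where "q = mdist X x y / O1"
    have ic: "continuous_on {s..t} (\<lambda>u. 1 / f u)" by (rule continuous_on_subset[OF cont_optical Icc_subset[OF st(1,2)]])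
    have fp: "0 < f u" if "u \<in> {s..t}" for u using Icc_subset[OF st(1,2)] that pos by blast
    have q: "0 \<le> q" "q \<le> 1" "q * O1 = mdist X x y"
    proof -
      have O0: "0 \<le> O1" unfolding O1_def optical_def
        using fp by (intro integral_nonneg integrable_continuous_real ic) (simp add: less_imp_le)
      show "0 \<le> q" using O0 by (simp add: q_def)
      show "q \<le> 1" using h zw O0 by (simp add: q_def O1_def divide_le_eq)
      show "q * O1 = mdist X x y" using h zw antisym[OF _ X.nonneg[of x y]] by (cases "O1 = 0") (auto simp: q_def O1_def)
    qed
    have "\<exists>\<beta>. future_causal I f X s t (\<lambda>u. u) \<beta> \<and> \<beta> s = x \<and> \<beta> t = y \<and>
     (\<forall>u\<in>{s<..<t}. cone_form f X (\<lambda>u. u) \<beta> u = - 1 + (f u * (q * (1 / f u)))\<^sup>2)"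
    proof (rule graph_curve[OF st(1,2) lt st(3,4), where v = "\<lambda>u. q * (1 / f u)"])
      show "continuous_on {s..t} (\<lambda>u. q * (1 / f u))" by (intro continuous_intros ic)
      show "0 \<le> q * (1 / f u)" if "u \<in> {s..t}" for u using fp[OF that] q by (simp add: less_imp_le)
      show "f u * (q * (1 / f u)) \<le> 1" if "u \<in> {s..t}" for u using fp[OF that] q by simp
      show "integral {s..t} (\<lambda>u. q * (1 / f u)) = mdist X x y"
        using q(3) unfolding O1_def optical_def by (simp add: integral_mult_right[symmetric] del: integral_mult_right)
    qed
    then obtain \<beta> where "future_causal I f X s t (\<lambda>u. u) \<beta>" "joins s t (\<lambda>u. u) \<beta> z w"
      using zw by (auto simp: joins_def)
    then show ?thesis unfolding gen_cone_def lorentz.select_convs by blast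
  qed
qed

text \<open>The same curve as for \<open>cone_caus_iff\<close>, now with \<open>q < 1\<close>, so
  that its cone form is the negative constant \<open>q\<^sup>2 - 1\<close>. The strict inequality
  also forces the time order, as \<open>optical\<close> vanishes otherwise.\<close>

lemma cone_chron_iff:
  assumes z: "z \<in> I \<times> mspace X" and w: "w \<in> I \<times> mspace X"
  shows "chron (gen_cone I f X) z w \<longleftrightarrow> mdist X (snd z) (snd w) < optical f (fst z) (fst w)"
proof
  assume "chron (gen_cone I f X) z w"
  then obtain a b \<alpha> \<beta> where 2: "future_timelike I f X a b \<alpha> \<beta>" "joins a b \<alpha> \<beta> z w"
    by (auto simp: gen_cone_def)
  then have "future_causal I f X a b \<alpha> \<beta>" by (simp add: future_timelike_def)
  from causal_curve_dist(2)[OF this 2(1)] show "mdist X (snd z) (snd w) < optical f (fst z) (fst w)"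
    using 2(2) by (auto simp: joins_def)
next
  assume h: "mdist X (snd z) (snd w) < optical f (fst z) (fst w)"
  obtain s x t y where zw: "z = (s, x)" "w = (t, y)" by (cases z, cases w)
  have st: "s \<in> I" "t \<in> I" "x \<in> mspace X" "y \<in> mspace X" using z w zw by auto
  have lt: "s < t"
  proof (rule ccontr)
    assume "\<not> ?thesis"
    then have "optical f s t = 0" by (cases "s = t") (auto simp: optical_def)
    then show False using h zw X.nonneg[of x y] by simp
  qed
  define O1 where "O1 = optical f s t"
  define q where "q = mdist X x y / O1"
  have ic: "continuous_on {s..t} (\<lambda>u. 1 / f u)" by (rule continuous_on_subset[OF cont_optical Icc_subset[OF st(1,2)]])
  have fp: "0 < f u" if "u \<in> {s..t}" for u using Icc_subset[OF st(1,2)] that pos by blast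
  have O0: "mdist X x y < O1" using h zw by (simp add: O1_def)
  then have "0 < O1" using X.nonneg[of x y] by linarith
  then have q: "0 \<le> q" "q < 1" "q * O1 = mdist X x y"
    using O0 by (auto simp: q_def divide_less_eq)
  have "\<exists>\<beta>. future_causal I f X s t (\<lambda>u. u) \<beta> \<and> \<beta> s = x \<and> \<beta> t = y \<and>
   (\<forall>u\<in>{s<..<t}. cone_form f X (\<lambda>u. u) \<beta> u = - 1 + (f u * (q * (1 / f u)))\<^sup>2)"
  proof (rule graph_curve[OF st(1,2) lt st(3,4), where v = "\<lambda>u. q * (1 / f u)"])
    show "continuous_on {s..t} (\<lambda>u. q * (1 / f u))" by (intro continuous_intros ic)
    show "0 \<le> q * (1 / f u)" if "u \<in> {s..t}" for u using fp[OF that] q by (simp add: less_imp_le)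
    show "f u * (q * (1 / f u)) \<le> 1" if "u \<in> {s..t}" for u using fp[OF that] q by simp
    show "integral {s..t} (\<lambda>u. q * (1 / f u)) = mdist X x y"
      using q(3) unfolding O1_def optical_def by (simp add: integral_mult_right[symmetric] del: integral_mult_right)
  qed
  then obtain \<beta> where \<beta>: "future_causal I f X s t (\<lambda>u. u) \<beta>" "\<beta> s = x" "\<beta> t = y"
    "\<And>u. u\<in>{s<..<t} \<Longrightarrow> cone_form f X (\<lambda>u. u) \<beta> u = - 1 + (f u * (q * (1 / f u)))\<^sup>2" by blast
  have "q\<^sup>2 < 1" using q by (simp add: power_less_one_iff abs_square_less_1)
  then have neg: "cone_form f X (\<lambda>u. u) \<beta> u < 0" if "u\<in>{s<..<t}" for u
    using \<beta>(4)[OF that] fp[of u] that by simp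
  have "AE u in lebesgue_on {s..t}. cone_form f X (\<lambda>u. u) \<beta> u < 0"
  proof (subst AE_lebesgue_on_iff_negligible)
    have "{u \<in> {s..t}. \<not> cone_form f X (\<lambda>u. u) \<beta> u < 0} \<subseteq> {s, t}"
      using neg by force
    then show "negligible {u \<in> {s..t}. \<not> cone_form f X (\<lambda>u. u) \<beta> u < 0}"
      by (rule negligible_subset[rotated]) simp
  qed simp
  then have "future_timelike I f X s t (\<lambda>u. u) \<beta>" using \<beta>(1) by (simp add: future_timelike_def)
  moreover have "joins s t (\<lambda>u. u) \<beta> z w" using zw \<beta>(2,3) by (simp add: joins_def)
  ultimately show "chron (gen_cone I f X) z w" unfolding gen_cone_def lorentz.select_convs by blast
qed

end

section \<open>Estimates for the dual values, and the dual formula\<close>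

context warped_cone
begin

lemma optical_int: "s \<in> I \<Longrightarrow> t \<in> I \<Longrightarrow> (\<lambda>u. 1 / f u) integrable_on {s..t}"
  by (intro integrable_continuous_real continuous_on_subset[OF cont_optical Icc_subset])

lemma energy_int: "s \<in> I \<Longrightarrow> t \<in> I \<Longrightarrow> (\<lambda>u. sqrt (1 + (\<mu> / f u)\<^sup>2)) integrable_on {s..t}"
  by (intro integrable_continuous_real continuous_on_subset[OF cont_energy Icc_subset])

lemma integral_scaled_optical: "integral {s..t} (\<lambda>u. c * (1 / f u)) = c * optical f s t"
  unfolding optical_def by (rule integral_mult_right)

lemma pos_Icc: "s \<in> I \<Longrightarrow> t \<in> I \<Longrightarrow> u \<in> {s..t} \<Longrightarrow> 0 < f u"
  using Icc_subset pos by blast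

lemma optical_add:
  assumes "s \<in> I" "u \<in> I" "s \<le> t" "t \<le> u"
  shows "optical f s u = optical f s t + optical f t u"
  using Henstock_Kurzweil_Integration.integral_combine[OF assms(3,4) optical_int[OF assms(1,2)]]
  by (simp add: optical_def)

lemma energy_add:
  assumes "s \<in> I" "u \<in> I" "s \<le> t" "t \<le> u"
  shows "energy f \<mu> s u = energy f \<mu> s t + energy f \<mu> t u"
  using Henstock_Kurzweil_Integration.integral_combine[OF assms(3,4) energy_int[OF assms(1,2)]]
  by (simp add: energy_def)

lemma energy_ge_optical:
  assumes "s \<in> I" "t \<in> I" "0 \<le> \<mu>"
  shows "\<mu> * optical f s t \<le> energy f \<mu> s t"
proof -
  have "integral {s..t} (\<lambda>u. \<mu> * (1 / f u)) \<le> integral {s..t} (\<lambda>u. sqrt (1 + (\<mu> / f u)\<^sup>2))"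
  proof (rule integral_le)
    show "(\<lambda>u. \<mu> * (1 / f u)) integrable_on {s..t}"
      using integrable_on_cmult_left[OF optical_int[OF assms(1,2)]] by simp
    show "\<mu> * (1 / f u) \<le> sqrt (1 + (\<mu> / f u)\<^sup>2)" for u
      by (rule real_le_rsqrt) simp
  qed (rule energy_int[OF assms(1,2)])
  then show ?thesis unfolding integral_scaled_optical energy_def .
qed

lemma energy_ge_length:
  assumes "s \<in> I" "t \<in> I"
  shows "t - s \<le> energy f \<mu> s t"
proof (cases "s \<le> t")
  case True
  have "integral {s..t} (\<lambda>u. 1) \<le> integral {s..t} (\<lambda>u. sqrt (1 + (\<mu> / f u)\<^sup>2))"
    by (rule integral_le[OF _ energy_int[OF assms]]) auto
  then show ?thesis using True by (simp add: energy_def)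
next
  case False
  then show ?thesis by (simp add: energy_def)
qed

text \<open>From \<open>sqrt (1 + x\<^sup>2) \<le> x + 1 / (2 * x)\<close> at
  \<open>x = L / f u\<close>: for large multipliers the energy approaches its asymptote
  \<open>L * optical f s t\<close> at rate \<open>1 / L\<close>.\<close>

lemma energy_le_optical:
  assumes st: "s \<in> I" "t \<in> I" "s \<le> t" and L: "0 < L" and M: "\<And>u. u \<in> {s..t} \<Longrightarrow> f u \<le> M"
  shows "energy f L s t \<le> L * optical f s t + M * (t - s) / (2 * L)"
proof -
  have "integral {s..t} (\<lambda>u. sqrt (1 + (L / f u)\<^sup>2)) \<le> integral {s..t} (\<lambda>u. L * (1 / f u) + M / (2 * L))"
  proof (rule integral_le[OF energy_int[OF st(1,2)]])
    show "(\<lambda>u. L * (1 / f u) + M / (2 * L)) integrable_on {s..t}"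
      using integrable_on_cmult_left[OF optical_int[OF st(1,2)], of L]
      by (intro integrable_add) auto
    fix u assume u: "u \<in> {s..t}"
    have f: "0 < f u" by (rule pos_Icc[OF st(1,2) u])
    have "sqrt (1 + (L / f u)\<^sup>2) \<le> L / f u + f u / (2 * L)"
    proof (rule real_le_lsqrt)
      show "1 + (L / f u)\<^sup>2 \<le> (L / f u + f u / (2 * L))\<^sup>2"
        using f L by (simp add: power2_sum power_divide)
    qed (use f L in auto)
    also have "\<dots> \<le> L * (1 / f u) + M / (2 * L)" using M[OF u] L by (simp add: divide_right_mono)
    finally show "sqrt (1 + (L / f u)\<^sup>2) \<le> L * (1 / f u) + M / (2 * L)" .
  qed
  also have "\<dots> = L * optical f s t + M / (2 * L) * (t - s)"
    using integrable_on_cmult_left[OF optical_int[OF st(1,2)], of L] st(3) integral_scaled_optical[of s t L]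
    by (subst integral_add) auto
  finally show ?thesis by (simp add: energy_def)
qed

text \<open>Multipliers beyond \<open>L\<close> lower the dual bound by at most \<open>M (t - s) / (2 L)\<close>; this makes the
  infimum in \<open>cone_tsep\<close> below uniformly computable on a compact range.\<close>

lemma truncated_multiplier:
  assumes st: "s \<in> I" "t \<in> I" and L: "0 < L" and M: "\<And>u. u \<in> {s..t} \<Longrightarrow> f u \<le> M"
    and e: "0 \<le> e" "M * (t - s) / (2 * L) \<le> e" and \<mu>: "0 \<le> \<mu>" and r: "0 \<le> r"
  shows "\<exists>\<nu>\<in>{0..L}. energy f \<nu> s t - \<nu> * r \<le> max 0 (energy f \<mu> s t - \<mu> * r) + e"
proof (cases "s \<le> t \<and> L < \<mu>")
  case False
  then consider "t < s" | "\<mu> \<le> L" by linarith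
  then show ?thesis
  proof cases
    case 1
    then show ?thesis using L e by (intro bexI[of _ 0]) (auto simp: energy_def)
  next
    case 2
    then show ?thesis using \<mu> e by (intro bexI[of _ \<mu>]) auto
  qed
next
  case True
  \<comment> \<open>Beyond \<open>L\<close> the multiplier \<open>L\<close> itself serves: its dual
    value is, up to \<open>e\<close>, the linear term \<open>L * (optical f s t - r)\<close>, and
    this is either nonpositive or bounded by the dual value at \<open>\<mu>\<close>.\<close>
  have "energy f L s t - L * r \<le> L * (optical f s t - r) + e"
    using energy_le_optical[OF st _ L M] True e by (auto simp: algebra_simps)
  moreover have "L * (optical f s t - r) \<le> max 0 (energy f \<mu> s t - \<mu> * r)"
  proof (cases "r \<le> optical f s t")
    case True
    have "L * (optical f s t - r) \<le> \<mu> * (optical f s t - r)"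
      using True \<open>s \<le> t \<and> L < \<mu>\<close> by (intro mult_right_mono) auto
    also have "\<dots> \<le> energy f \<mu> s t - \<mu> * r"
      using energy_ge_optical[OF st \<mu>] by (simp add: algebra_simps)
    finally show ?thesis by simp
  next
    case False
    then have "L * (optical f s t - r) \<le> 0" using L by (simp add: mult_le_0_iff)
    then show ?thesis by simp
  qed
  ultimately show ?thesis using L by (intro bexI[of _ L]) auto
qed

lemma bounded_above_Icc:
  assumes "s \<in> I" "t \<in> I"
  obtains M where "M > 0" "\<And>u. u \<in> {s..t} \<Longrightarrow> f u \<le> M"
proof -
  have "bounded (f ` {s..t})" by (intro compact_imp_bounded compact_continuous_image cont_Icc assms) simp
  then obtain B where "B > 0" "\<And>u. u \<in> {s..t} \<Longrightarrow> \<bar>f u\<bar> \<le> B" by (auto simp: bounded_pos)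
  then show ?thesis by (intro that[of B]) (auto simp: abs_le_iff)
qed

text \<open>The maximizer is the geodesic run at the speed for which equality holds in the
  Cauchy--Schwarz bound; the multiplier is chosen so that the geodesic ends on time.\<close>

lemma optimal_multiplier:
  assumes st: "s \<in> I" "t \<in> I" "s < t" and d: "0 \<le> d" "d < optical f s t"
  obtains \<mu> where "0 \<le> \<mu>" "integral {s..t} (\<lambda>u. \<mu> / (f u * sqrt ((f u)\<^sup>2 + \<mu>\<^sup>2))) = d"
proof -
  \<comment> \<open>\<open>R \<mu>\<close> is the fibre distance covered at the speed of equality
    for \<open>\<mu>\<close>. It is 0 at \<open>\<mu> = 0\<close>, so the intermediate value theorem
    only needs one \<open>L\<close> with \<open>d \<le> R L\<close>.\<close>
  define R where "R = (\<lambda>\<mu>. integral {s..t} (\<lambda>u. \<mu> / (f u * sqrt ((f u)\<^sup>2 + \<mu>\<^sup>2))))"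
  note fp = pos_Icc[OF st(1,2)]
  obtain M where M: "M > 0" "\<And>u. u \<in> {s..t} \<Longrightarrow> f u \<le> M" using bounded_above_Icc[OF st(1,2)] by blast
  define q where "q = d / optical f s t"
  have q: "0 \<le> q" "q < 1" "q * optical f s t = d" using d by (auto simp: q_def divide_less_eq)
  have q2: "0 < 1 - q\<^sup>2" using q by (simp add: power_less_one_iff abs_square_less_1)
  \<comment> \<open>Solves \<open>L / sqrt (M\<^sup>2 + L\<^sup>2) = q\<close>. Then the speed for
    the multiplier \<open>L\<close> is at least the fraction \<open>q\<close> of the speed of light
    even where \<open>f\<close> is as large as \<open>M\<close>, and this fraction already covers
    the distance \<open>d\<close>.\<close>
  define L where "L = M * q / sqrt (1 - q\<^sup>2)"
  have L0: "0 \<le> L" using M q q2 by (simp add: L_def)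
  have nz: "0 < y\<^sup>2 + \<mu>\<^sup>2" if "0 < y" for y \<mu> :: real using that by (simp add: add_pos_nonneg)
  have cR: "continuous_on {0..L} R"
  proof -
    have fs: "continuous_on ({0..L} \<times> {s..t}) (\<lambda>p. f (snd p))"
      by (rule continuous_on_compose2[OF cont_Icc[OF st(1,2)] continuous_on_snd]) (auto intro: continuous_on_id)
    have "continuous_on ({0..L} \<times> {s..t}) (\<lambda>p. fst p / (f (snd p) * sqrt ((f (snd p))\<^sup>2 + (fst p)\<^sup>2)))"
    proof (intro continuous_intros fs ballI)
      fix p assume "p \<in> {0..L} \<times> {s..t}"
      then have "0 < f (snd p)" using fp by auto
      then show "f (snd p) * sqrt ((f (snd p))\<^sup>2 + (fst p)\<^sup>2) \<noteq> 0" using nz[of "f (snd p)" "fst p"] by simp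
    qed
    then have "continuous_on ({0..L} \<times> cbox s t) (\<lambda>(\<mu>, u). \<mu> / (f u * sqrt ((f u)\<^sup>2 + \<mu>\<^sup>2)))"
      by (simp add: case_prod_unfold cbox_interval)
    from integral_continuous_on_param[OF this] show ?thesis by (simp add: R_def cbox_interval)
  qed
  have "R 0 \<le> d" using d by (simp add: R_def)
  moreover have "d \<le> R L"
  proof -
    have "integral {s..t} (\<lambda>u. q * (1 / f u)) \<le> R L" unfolding R_def
    proof (rule integral_le)
      show "(\<lambda>u. q * (1 / f u)) integrable_on {s..t}"
        using integrable_on_cmult_left[OF optical_int[OF st(1,2)]] by simp
      show "(\<lambda>u. L / (f u * sqrt ((f u)\<^sup>2 + L\<^sup>2))) integrable_on {s..t}"
        using fp nz by (intro integrable_continuous_real continuous_intros cont_Icc[OF st(1,2)]) force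
      fix u assume u: "u \<in> {s..t}"
      have "q * sqrt ((f u)\<^sup>2 + L\<^sup>2) \<le> L"
      proof -
        have L2: "L\<^sup>2 = M\<^sup>2 * q\<^sup>2 / (1 - q\<^sup>2)" using q2 by (simp add: L_def power_divide power_mult_distrib)
        have "(f u)\<^sup>2 \<le> M\<^sup>2" using M(2)[OF u] fp[OF u] by (intro power_mono) auto
        then have "q\<^sup>2 * ((f u)\<^sup>2 + L\<^sup>2) \<le> q\<^sup>2 * (M\<^sup>2 + L\<^sup>2)" by (intro mult_left_mono) auto
        also have "\<dots> = L\<^sup>2" unfolding L2 using q2 by (simp add: field_simps)
        finally have "(q * sqrt ((f u)\<^sup>2 + L\<^sup>2))\<^sup>2 \<le> L\<^sup>2" by (simp add: power_mult_distrib)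
        then show ?thesis by (rule power2_le_imp_le[OF _ L0])
      qed
      moreover have "0 < sqrt ((f u)\<^sup>2 + L\<^sup>2)" using nz[OF fp[OF u]] by simp
      ultimately have "q \<le> L / sqrt ((f u)\<^sup>2 + L\<^sup>2)" by (simp add: le_divide_eq)
      from divide_right_mono[OF this, of "f u"]
      show "q * (1 / f u) \<le> L / (f u * sqrt ((f u)\<^sup>2 + L\<^sup>2))"
        using fp[OF u] by (simp add: field_simps)
    qed
    moreover have "integral {s..t} (\<lambda>u. q * (1 / f u)) = d"
      unfolding integral_scaled_optical by (rule q(3))
    ultimately show ?thesis by simp
  qed
  ultimately obtain \<mu> where "0 \<le> \<mu>" "\<mu> \<le> L" "R \<mu> = d" using IVT'[of R 0 d L, OF _ _ L0 cR] by blast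
  then show ?thesis using that by (simp add: R_def)
qed

text \<open>One inequality is weak duality. For the other, if the fibre distance is at least
  \<open>optical f s t\<close>, multipliers tending to infinity bring the infimum down to 0;
  otherwise the curve of the optimal multiplier has length equal to its dual value. The clipping at
  0 is done by \<open>ennreal\<close>.\<close>

theorem cone_tsep:
  assumes z: "z \<in> I \<times> mspace X" and w: "w \<in> I \<times> mspace X"
  shows "tsep (gen_cone I f X) z w =
    (INF \<mu>\<in>{0..}. ennreal (energy f \<mu> (fst z) (fst w) - \<mu> * mdist X (snd z) (snd w)))"
    (is "?T = ?D")
proof (rule antisym)
  show "?T \<le> ?D"
  proof (rule INF_greatest)
    fix \<mu> :: real assume "\<mu> \<in> {0..}"
    then have \<mu>: "0 \<le> \<mu>" by simp
    show "?T \<le> ennreal (energy f \<mu> (fst z) (fst w) - \<mu> * mdist X (snd z) (snd w))"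
      unfolding gen_cone_def lorentz.select_convs
    proof (rule Sup_least, clarify)
      fix a b \<alpha> \<beta> assume "future_causal I f X a b \<alpha> \<beta>" "joins a b \<alpha> \<beta> z w"
      then show "(\<integral>\<^sup>+ t. ennreal (sqrt (- cone_form f X \<alpha> \<beta> t)) \<partial>lebesgue_on {a..b})
        \<le> ennreal (energy f \<mu> (fst z) (fst w) - \<mu> * mdist X (snd z) (snd w))"
        using causal_curve_length_le[of a b \<alpha> \<beta> \<mu>] \<mu> by (auto simp: joins_def)
    qed
  qed
next
  obtain s x t y where zw: "z = (s, x)" "w = (t, y)" by (cases z, cases w)
  have st: "s \<in> I" "t \<in> I" "x \<in> mspace X" "y \<in> mspace X" using z w zw by auto
  have d0: "0 \<le> mdist X x y" by simp
  consider "t \<le> s" | "s < t" "optical f s t \<le> mdist X x y" | "s < t" "mdist X x y < optical f s t" by linarith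
  then show "?D \<le> ?T"
  proof cases
    case 1
    have "?D \<le> ennreal (energy f 0 s t - 0 * mdist X x y)"
      by (rule INF_lower2[of 0]) (auto simp: zw)
    also have "\<dots> = 0" using 1 by (simp add: energy_def)
    finally show ?thesis by simp
  next
    case 2
    obtain M where M: "M > 0" "\<And>u. u \<in> {s..t} \<Longrightarrow> f u \<le> M" using bounded_above_Icc[OF st(1,2)] by blast
    have "?D \<le> 0"
    proof (rule ennreal_le_epsilon)
      fix e :: real assume e: "0 < e"
      \<comment> \<open>Makes the error term \<open>M * (t - s) / (2 * L)\<close> of
        \<open>energy_le_optical\<close> equal to \<open>e\<close>.\<close>
      define L where "L = M * (t - s) / (2 * e)"
      have L: "0 < L" using M e 2 by (simp add: L_def)
      have "?D \<le> ennreal (energy f L s t - L * mdist X x y)"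
        by (rule INF_lower2[of L]) (use L in \<open>auto simp: zw\<close>)
      also have "\<dots> \<le> ennreal e"
      proof (rule ennreal_leI)
        have "energy f L s t \<le> L * optical f s t + M * (t - s) / (2 * L)"
          by (rule energy_le_optical[OF st(1,2) _ L M(2)]) (use 2 in auto)
        moreover have "L * optical f s t \<le> L * mdist X x y" using 2 L by simp
        moreover have "M * (t - s) / (2 * L) = e" using M(1) e 2(1) by (simp add: L_def)
        ultimately show "energy f L s t - L * mdist X x y \<le> e" by linarith
      qed
      finally show "?D \<le> 0 + ennreal e" by simp
    qed
    then show ?thesis by simp
  next
    case 3
    note fp = pos_Icc[OF st(1,2)]
    obtain \<mu> where \<mu>: "0 \<le> \<mu>" "integral {s..t} (\<lambda>u. \<mu> / (f u * sqrt ((f u)\<^sup>2 + \<mu>\<^sup>2))) = mdist X x y"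
      using optimal_multiplier[OF st(1,2) 3(1) d0 3(2)] by blast
    define v where "v = (\<lambda>u. \<mu> / (f u * sqrt ((f u)\<^sup>2 + \<mu>\<^sup>2)))"
    have nz: "0 < (f u)\<^sup>2 + \<mu>\<^sup>2" if "u \<in> {s..t}" for u using fp[OF that] by (simp add: add_pos_nonneg)
    have vc: "continuous_on {s..t} v" unfolding v_def
      using fp nz by (intro continuous_intros cont_Icc[OF st(1,2)]) force
    have fv: "f u * v u = \<mu> / sqrt ((f u)\<^sup>2 + \<mu>\<^sup>2)" if "u \<in> {s..t}" for u using fp[OF that] by (simp add: v_def)
    have "\<exists>\<beta>. future_causal I f X s t (\<lambda>u. u) \<beta> \<and> \<beta> s = x \<and> \<beta> t = y \<and>
     (\<forall>u\<in>{s<..<t}. cone_form f X (\<lambda>u. u) \<beta> u = - 1 + (f u * v u)\<^sup>2)"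
    proof (rule graph_curve[OF st(1,2) 3(1) st(3,4) vc])
      show "0 \<le> v u" if "u \<in> {s..t}" for u using fp[OF that] \<mu> by (simp add: v_def less_imp_le)
      show "f u * v u \<le> 1" if "u \<in> {s..t}" for u
        unfolding fv[OF that] using nz[OF that] by (simp add: real_le_rsqrt)
      show "integral {s..t} v = mdist X x y" using \<mu>(2) by (simp add: v_def)
    qed
    then obtain \<beta> where \<beta>: "future_causal I f X s t (\<lambda>u. u) \<beta>" "\<beta> s = x" "\<beta> t = y"
      "\<And>u. u\<in>{s<..<t} \<Longrightarrow> cone_form f X (\<lambda>u. u) \<beta> u = - 1 + (f u * v u)\<^sup>2" by blast
    \<comment> \<open>The length integrand of the optimal curve. The identity \<open>gv\<close>
      below is the case of equality in Cauchy-Schwarz.\<close>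
    define g where "g = (\<lambda>u. f u / sqrt ((f u)\<^sup>2 + \<mu>\<^sup>2))"
    have gc: "continuous_on {s..t} g" unfolding g_def
      using nz by (intro continuous_intros cont_Icc[OF st(1,2)]) force
    have gi: "g integrable_on {s..t}" "v integrable_on {s..t}" using gc vc by (auto intro: integrable_continuous_real)
    have gv: "g u + \<mu> * v u = sqrt (1 + (\<mu> / f u)\<^sup>2)" if u: "u \<in> {s..t}" for u
    proof -
      define S where "S = sqrt ((f u)\<^sup>2 + \<mu>\<^sup>2)"
      have S: "S > 0" "S * S = (f u)\<^sup>2 + \<mu>\<^sup>2" using nz[OF u] by (auto simp: S_def)
      have "g u + \<mu> * v u = ((f u)\<^sup>2 + \<mu>\<^sup>2) / (f u * S)"
        unfolding g_def v_def S_def[symmetric] unfolding power2_eq_square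
        using fp[OF u] S(1) by (simp add: divide_simps)
      also have "\<dots> = S / f u" unfolding S(2)[symmetric] using S(1) fp[OF u] by simp
      also have "\<dots> = sqrt (((f u)\<^sup>2 + \<mu>\<^sup>2) / (f u)\<^sup>2)" using fp[OF u] by (simp add: S_def real_sqrt_divide)
      also have "((f u)\<^sup>2 + \<mu>\<^sup>2) / (f u)\<^sup>2 = 1 + (\<mu> / f u)\<^sup>2" using fp[OF u] by (simp add: power_divide add_divide_distrib)
      finally show ?thesis .
    qed
    have "integral {s..t} (\<lambda>u. g u + \<mu> * v u) = integral {s..t} g + \<mu> * mdist X x y"
      using gi \<mu>(2) integrable_on_cmult_left[OF gi(2), of \<mu>] by (subst integral_add) (auto simp: v_def[symmetric])
    moreover have "integral {s..t} (\<lambda>u. g u + \<mu> * v u) = energy f \<mu> s t"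
      unfolding energy_def by (rule Henstock_Kurzweil_Integration.integral_cong) (rule gv)
    ultimately have gE: "integral {s..t} g = energy f \<mu> s t - \<mu> * mdist X x y" by simp
    have sq: "sqrt (- cone_form f X (\<lambda>u. u) \<beta> u) = g u" if u: "u \<in> {s<..<t}" for u
    proof -
      have u': "u \<in> {s..t}" using u by simp
      have "- cone_form f X (\<lambda>u. u) \<beta> u = 1 - \<mu>\<^sup>2 / ((f u)\<^sup>2 + \<mu>\<^sup>2)"
        unfolding \<beta>(4)[OF u] fv[OF u'] using nz[OF u'] by (simp add: power_divide)
      also have "\<dots> = (f u)\<^sup>2 / ((f u)\<^sup>2 + \<mu>\<^sup>2)" using nz[OF u'] fp[OF u'] by (simp add: divide_simps)
      finally show ?thesis using fp[OF u'] by (simp add: g_def real_sqrt_divide)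
    qed
    have "ennreal (integral {s..t} g) = (\<integral>\<^sup>+ u. ennreal (g u) * indicator {s..t} u \<partial>lborel)"
    proof (rule nn_integral_has_integral_lebesgue'[symmetric])
      show "0 \<le> g u" if "u \<in> {s..t}" for u using fp[OF that] by (simp add: g_def less_imp_le)
    qed (use gi in blast)
    also have "\<dots> = (\<integral>\<^sup>+ u. ennreal (g u) \<partial>lebesgue_on {s..t})"
      by (simp add: nn_integral_restrict_space nn_integral_completion)
    also have "\<dots> = (\<integral>\<^sup>+ u. ennreal (sqrt (- cone_form f X (\<lambda>u. u) \<beta> u)) \<partial>lebesgue_on {s..t})"
    proof (rule nn_integral_cong_AE)
      show "AE u in lebesgue_on {s..t}. ennreal (g u) = ennreal (sqrt (- cone_form f X (\<lambda>u. u) \<beta> u))"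
      proof (subst AE_lebesgue_on_iff_negligible)
        have "{u \<in> {s..t}. \<not> ennreal (g u) = ennreal (sqrt (- cone_form f X (\<lambda>u. u) \<beta> u))} \<subseteq> {s, t}"
          using sq by (auto, metis greaterThanLessThan_iff less_eq_real_def)
        then show "negligible {u \<in> {s..t}. \<not> ennreal (g u) = ennreal (sqrt (- cone_form f X (\<lambda>u. u) \<beta> u))}"
          by (rule negligible_subset[rotated]) simp
      qed simp
    qed
    also have "\<dots> \<le> ?T"
    proof -
      have "joins s t (\<lambda>u. u) \<beta> z w" using \<beta>(2,3) zw by (simp add: joins_def)
      then show ?thesis using \<beta>(1) unfolding gen_cone_def lorentz.select_convs by (intro Sup_upper) blast
    qed
    finally have "ennreal (energy f \<mu> s t - \<mu> * mdist X x y) \<le> ?T" by (simp add: gE)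
    then show ?thesis using \<mu>(1) by (intro INF_lower2[of \<mu>]) (auto simp: zw)
  qed
qed

end

text \<open>Endpoints in the wrong order are allowed. In all cases the integral is
  \<open>max 0 (P t - P s)\<close> for the primitive \<open>P\<close>, and clipping at 0 does not
  increase distances.\<close>

lemma integral_endpoints_lipschitz:
  fixes g :: "real \<Rightarrow> real"
  assumes g: "continuous_on {lo..hi} g" and B: "\<And>u. u \<in> {lo..hi} \<Longrightarrow> 0 \<le> g u \<and> g u \<le> B"
    and "s \<in> {lo..hi}" "t \<in> {lo..hi}" "s' \<in> {lo..hi}" "t' \<in> {lo..hi}"
  shows "\<bar>integral {s..t} g - integral {s'..t'} g\<bar> \<le> B * (\<bar>s - s'\<bar> + \<bar>t - t'\<bar>)"
proof -
  define P where "P = (\<lambda>u. integral {lo..u} g)"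
  have gi: "g integrable_on {a..b}" if "a \<in> {lo..hi}" "b \<in> {lo..hi}" for a b
    using that by (intro integrable_continuous_real continuous_on_subset[OF g]) auto
  have Pd: "integral {a..b} g = P b - P a" if "lo \<le> a" "a \<le> b" "b \<le> hi" for a b
    using Henstock_Kurzweil_Integration.integral_combine[of lo a b g] gi[of lo b] that by (simp add: P_def)
  have nn: "0 \<le> integral {a..b} g" if "a \<in> {lo..hi}" "b \<in> {lo..hi}" for a b
    using that B by (intro integral_nonneg gi) auto
  have max: "integral {a..b} g = max 0 (P b - P a)" if ab: "a \<in> {lo..hi}" "b \<in> {lo..hi}" for a b
  proof (cases "a \<le> b")
    case True
    then show ?thesis using Pd[of a b] nn[OF ab] ab by auto
  next
    case False
    then show ?thesis using Pd[of b a] nn[OF ab(2,1)] ab by auto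
  qed
  have le: "\<bar>P b - P a\<bar> \<le> B * \<bar>b - a\<bar>" if ab: "a \<in> {lo..hi}" "b \<in> {lo..hi}" "a \<le> b" for a b
  proof -
    have "norm (integral {a..b} g) \<le> B * (b - a)"
    proof (rule integral_bound)
      show "norm (g t) \<le> B" if "t \<in> {a..b}" for t using B[of t] that ab by auto
    qed (use ab in \<open>auto intro: continuous_on_subset[OF g]\<close>)
    then show ?thesis using Pd[of a b] ab by auto
  qed
  have "\<bar>P s - P s'\<bar> \<le> B * \<bar>s - s'\<bar>" using le[of s s'] le[of s' s] assms(3,5) by (cases "s \<le> s'") (auto simp: abs_minus_commute)
  moreover have "\<bar>P t - P t'\<bar> \<le> B * \<bar>t - t'\<bar>" using le[of t t'] le[of t' t] assms(4,6) by (cases "t \<le> t'") (auto simp: abs_minus_commute)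
  moreover have "\<bar>integral {s..t} g - integral {s'..t'} g\<bar> \<le> \<bar>P s - P s'\<bar> + \<bar>P t - P t'\<bar>"
    unfolding max[OF assms(3,4)] max[OF assms(5,6)] by (auto simp: max_def abs_if)
  ultimately show ?thesis by (simp add: algebra_simps)
qed

text \<open>Dual values need to be compared only for multipliers up to \<open>L\<close>. An
  arbitrary multiplier of the second cone is replaced, at cost \<open>e2\<close>, by some
  \<open>\<nu> \<le> L\<close>, and at \<open>\<nu>\<close> the two cones are compared at cost
  \<open>e1\<close>.\<close>

lemma cone_tsep_compare:
  assumes "warped_cone I1 f1 X1" "warped_cone I2 f2 X2"
    and z1: "z1 \<in> I1 \<times> mspace X1" "w1 \<in> I1 \<times> mspace X1" and z2: "z2 \<in> I2 \<times> mspace X2" "w2 \<in> I2 \<times> mspace X2"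
    and M: "\<And>u. u \<in> {fst z2..fst w2} \<Longrightarrow> f2 u \<le> M" and L: "0 < L"
    and e: "0 \<le> e1" "0 \<le> e2" "M * (fst w2 - fst z2) / (2 * L) \<le> e2"
    and le: "\<And>\<nu>. \<nu> \<in> {0..L} \<Longrightarrow> energy f1 \<nu> (fst z1) (fst w1) - \<nu> * mdist X1 (snd z1) (snd w1)
       \<le> energy f2 \<nu> (fst z2) (fst w2) - \<nu> * mdist X2 (snd z2) (snd w2) + e1"
  shows "tsep (gen_cone I1 f1 X1) z1 w1 \<le> tsep (gen_cone I2 f2 X2) z2 w2 + ennreal (e1 + e2)"
proof -
  interpret C1: warped_cone I1 f1 X1 by fact
  interpret C2: warped_cone I2 f2 X2 by fact
  have "tsep (gen_cone I1 f1 X1) z1 w1 - ennreal (e1 + e2) \<le> tsep (gen_cone I2 f2 X2) z2 w2"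
    unfolding C2.cone_tsep[OF z2]
  proof (rule INF_greatest)
    fix \<mu> :: real assume \<mu>: "\<mu> \<in> {0..}"
    define E where "E = energy f2 \<mu> (fst z2) (fst w2) - \<mu> * mdist X2 (snd z2) (snd w2)"
    have "\<exists>\<nu>\<in>{0..L}. energy f2 \<nu> (fst z2) (fst w2) - \<nu> * mdist X2 (snd z2) (snd w2) \<le> max 0 E + e2"
      unfolding E_def using z2 \<mu> e by (intro C2.truncated_multiplier[OF _ _ L M]) auto
    then obtain \<nu> where \<nu>: "\<nu> \<in> {0..L}" "energy f2 \<nu> (fst z2) (fst w2) - \<nu> * mdist X2 (snd z2) (snd w2) \<le> max 0 E + e2"
      by blast
    have "tsep (gen_cone I1 f1 X1) z1 w1 \<le> ennreal (energy f1 \<nu> (fst z1) (fst w1) - \<nu> * mdist X1 (snd z1) (snd w1))"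
      unfolding C1.cone_tsep[OF z1] by (rule INF_lower) (use \<nu> in auto)
    also have "\<dots> \<le> ennreal (max 0 E + (e1 + e2))"
      using le[OF \<nu>(1)] \<nu>(2) by (intro ennreal_leI) linarith
    also have "\<dots> = ennreal (max 0 E) + ennreal (e1 + e2)" using e by (intro ennreal_plus) auto
    also have "ennreal (max 0 E) = ennreal E" by (cases "0 \<le> E") (auto simp: max_def ennreal_neg)
    finally show "tsep (gen_cone I1 f1 X1) z1 w1 - ennreal (e1 + e2) \<le>
      ennreal (energy f2 \<mu> (fst z2) (fst w2) - \<mu> * mdist X2 (snd z2) (snd w2))"
      by (simp add: ennreal_minus_le_iff E_def add.commute)
  qed
  then show ?thesis by (simp add: ennreal_minus_le_iff add.commute)
qed

section \<open>Time separation of a single cone: positivity, reverse triangle inequality,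
  semicontinuity\<close>

context warped_cone
begin

lemma met_cone: "met (gen_cone I f X) = prod_metric (submetric euclidean_metric I) X"
  by (simp add: gen_cone_def)

lemma mspace_cone: "mspace (met (gen_cone I f X)) = I \<times> mspace X"
  by (simp add: met_cone)

lemma mdist_cone: "mdist (met (gen_cone I f X)) z w = sqrt ((fst z - fst w)\<^sup>2 + (mdist X (snd z) (snd w))\<^sup>2)"
  by (cases z, cases w) (simp add: met_cone prod_dist_def dist_real_def)

lemma mdist_cone_ge:
  "\<bar>fst z - fst w\<bar> \<le> mdist (met (gen_cone I f X)) z w"
  "mdist X (snd z) (snd w) \<le> mdist (met (gen_cone I f X)) z w"
  unfolding mdist_cone by (auto intro: real_le_rsqrt)

lemma mdist_cone_le:
  "mdist (met (gen_cone I f X)) z w \<le> \<bar>fst z - fst w\<bar> + mdist X (snd z) (snd w)"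
  unfolding mdist_cone using sqrt_sum_squares_le_sum_abs[of "fst z - fst w" "mdist X (snd z) (snd w)"] by simp

lemma tsep_le_time:
  assumes z: "z \<in> I \<times> mspace X" and w: "w \<in> I \<times> mspace X"
  shows "tsep (gen_cone I f X) z w \<le> ennreal (fst w - fst z)"
proof -
  have "tsep (gen_cone I f X) z w \<le> ennreal (energy f 0 (fst z) (fst w) - 0 * mdist X (snd z) (snd w))"
    unfolding cone_tsep[OF z w] by (rule INF_lower) simp
  also have "\<dots> = ennreal (fst w - fst z)"
    by (cases "fst z \<le> fst w") (auto simp: energy_def ennreal_neg)
  finally show ?thesis .
qed

text \<open>If \<open>r < optical f s t\<close>, the dual values stay away from 0: small multipliers
  retain half of the time difference, large ones give at least a positive multiple of
  \<open>optical f s t - r\<close>. If \<open>r \<ge> optical f s t\<close>, multipliers tending to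
  infinity bring the infimum to 0.\<close>

lemma tsep_pos_iff:
  assumes z: "z \<in> I \<times> mspace X" and w: "w \<in> I \<times> mspace X"
  shows "0 < tsep (gen_cone I f X) z w \<longleftrightarrow> mdist X (snd z) (snd w) < optical f (fst z) (fst w)"
proof -
  obtain s x t y where zw: "z = (s, x)" "w = (t, y)" by (cases z, cases w)
  have st: "s \<in> I" "t \<in> I" "x \<in> mspace X" "y \<in> mspace X" using z w zw by auto
  define r where "r = mdist X x y"
  have r0: "0 \<le> r" by (simp add: r_def)
  have T: "tsep (gen_cone I f X) z w = (INF \<mu>\<in>{0..}. ennreal (energy f \<mu> s t - \<mu> * r))"
    using cone_tsep[OF z w] by (simp add: zw r_def)
  have "0 < tsep (gen_cone I f X) z w" if lt: "r < optical f s t"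
  proof -
    have stl: "s < t"
    proof (rule ccontr)
      assume "\<not> ?thesis"
      then have "optical f s t = 0" by (cases "s = t") (auto simp: optical_def)
      then show False using lt r0 by simp
    qed
    \<comment> \<open>Chosen so that \<open>\<mu>0 * (r + 1)\<close> is half of the time difference;
      the summand 1 admits \<open>r = 0\<close>.\<close>
    define \<mu>0 where "\<mu>0 = (t - s) / (2 * (r + 1))"
    have \<mu>0: "0 < \<mu>0" using stl r0 by (simp add: \<mu>0_def)
    define c where "c = min (\<mu>0 * (optical f s t - r)) ((t - s) / 2)"
    have c: "0 < c" using \<mu>0 lt stl by (simp add: c_def)
    have "ennreal c \<le> tsep (gen_cone I f X) z w" unfolding T
    proof (rule INF_greatest)
      fix \<mu> :: real assume \<mu>: "\<mu> \<in> {0..}"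
      show "ennreal c \<le> ennreal (energy f \<mu> s t - \<mu> * r)"
      proof (rule ennreal_leI, cases "\<mu>0 \<le> \<mu>")
        case True
        have "c \<le> \<mu>0 * (optical f s t - r)" by (simp add: c_def)
        also have "\<dots> \<le> \<mu> * (optical f s t - r)" using True lt by (intro mult_right_mono) auto
        also have "\<dots> \<le> energy f \<mu> s t - \<mu> * r" using energy_ge_optical[OF st(1,2), of \<mu>] \<mu> by (simp add: algebra_simps)
        finally show "c \<le> energy f \<mu> s t - \<mu> * r" .
      next
        case False
        have "\<mu> * r \<le> \<mu>0 * (r + 1)" using False \<mu> r0 by (intro mult_mono) auto
        also have "\<dots> = (t - s) / 2" using r0 by (auto simp: \<mu>0_def divide_simps algebra_simps)
        finally show "c \<le> energy f \<mu> s t - \<mu> * r"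
          using energy_ge_length[OF st(1,2), of \<mu>] by (simp add: c_def min_le_iff_disj) 
      qed
    qed
    then show ?thesis using c by (meson ennreal_less_zero_iff less_le_trans)
  qed
  moreover have "r < optical f s t" if gt: "0 < tsep (gen_cone I f X) z w"
  proof (rule ccontr)
    assume nr: "\<not> ?thesis"
    have "tsep (gen_cone I f X) z w \<le> 0"
    proof (cases "s < t")
      case False
      then show ?thesis using tsep_le_time[OF z w] zw by (simp add: ennreal_neg)
    next
      case True
      obtain M where M: "M > 0" "\<And>u. u \<in> {s..t} \<Longrightarrow> f u \<le> M" using bounded_above_Icc[OF st(1,2)] by blast
      show ?thesis
      proof (rule ennreal_le_epsilon)
        fix e :: real assume e: "0 < e"
        define L where "L = M * (t - s) / (2 * e)"
        have L: "0 < L" using M e True by (simp add: L_def)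
        have "tsep (gen_cone I f X) z w \<le> ennreal (energy f L s t - L * r)"
          unfolding T by (rule INF_lower) (use L in simp)
        also have "\<dots> \<le> ennreal e"
        proof (rule ennreal_leI)
          have "energy f L s t \<le> L * optical f s t + M * (t - s) / (2 * L)"
            by (rule energy_le_optical[OF st(1,2) _ L M(2)]) (use True in auto)
          moreover have "L * optical f s t \<le> L * r" using nr L by simp
          moreover have "M * (t - s) / (2 * L) = e" using M(1) e True by (simp add: L_def)
          ultimately show "energy f L s t - L * r \<le> e" by linarith
        qed
        finally show "tsep (gen_cone I f X) z w \<le> 0 + ennreal e" by simp
      qed
    qed
    then show False using gt by simp
  qed
  ultimately show ?thesis by (auto simp: zw r_def)
qed

text \<open>For each fixed multiplier the energies add and the fibre distances obey the triangle
  inequality, so the dual values are superadditive. Causality makes both summands nonnegative, so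
  clipping at 0 does not spoil the sum.\<close>

lemma reverse_triangle:
  assumes z: "z \<in> I \<times> mspace X" and w: "w \<in> I \<times> mspace X" and v: "v \<in> I \<times> mspace X"
    and c1: "caus (gen_cone I f X) z w" and c2: "caus (gen_cone I f X) w v"
  shows "tsep (gen_cone I f X) z w + tsep (gen_cone I f X) w v \<le> tsep (gen_cone I f X) z v"
  unfolding cone_tsep[OF z v]
proof (rule INF_greatest)
  fix \<mu> :: real assume "\<mu> \<in> {0..}"
  then have \<mu>: "0 \<le> \<mu>" by simp
  let ?E = "\<lambda>z w. energy f \<mu> (fst z) (fst w) - \<mu> * mdist X (snd z) (snd w)"
  have I: "fst z \<in> I" "fst w \<in> I" "fst v \<in> I" and Xs: "snd z \<in> mspace X" "snd w \<in> mspace X" "snd v \<in> mspace X"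
    using z w v by auto
  have c: "fst z \<le> fst w" "mdist X (snd z) (snd w) \<le> optical f (fst z) (fst w)"
     "fst w \<le> fst v" "mdist X (snd w) (snd v) \<le> optical f (fst w) (fst v)"
    using c1 c2 cone_caus_iff[OF z w] cone_caus_iff[OF w v] by auto
  have n1: "0 \<le> ?E z w" using energy_ge_optical[OF I(1,2) \<mu>] mult_left_mono[OF c(2) \<mu>] by simp
  have n2: "0 \<le> ?E w v" using energy_ge_optical[OF I(2,3) \<mu>] mult_left_mono[OF c(4) \<mu>] by simp
  have "tsep (gen_cone I f X) z w + tsep (gen_cone I f X) w v \<le> ennreal (?E z w) + ennreal (?E w v)"
    unfolding cone_tsep[OF z w] cone_tsep[OF w v] using \<mu> by (intro add_mono INF_lower) auto
  also have "\<dots> = ennreal (?E z w + ?E w v)" using n1 n2 by simp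
  also have "\<dots> \<le> ennreal (?E z v)"
  proof (rule ennreal_leI)
    have "\<mu> * mdist X (snd z) (snd v) \<le> \<mu> * (mdist X (snd z) (snd w) + mdist X (snd w) (snd v))"
      using X.triangle[OF Xs] \<mu> by (intro mult_left_mono)
    then show "?E z w + ?E w v \<le> ?E z v"
      using energy_add[OF I(1,3) c(1,3), of \<mu>] by (simp add: algebra_simps)
  qed
  finally show "tsep (gen_cone I f X) z w + tsep (gen_cone I f X) w v \<le> ennreal (?E z v)" .
qed

lemma warped_cone_self: "warped_cone I f X"
  by unfold_locales

text \<open>The cone is compared with itself at perturbed endpoints through
  \<open>cone_tsep_compare\<close>. The estimate loses \<open>e\<close>, so \<open>e\<close> is
  first chosen with \<open>c + e\<close> still below the value at the centre.\<close>

lemma tsep_lower_semicontinuous: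
  assumes z0: "z0 \<in> I \<times> mspace X" and w0: "w0 \<in> I \<times> mspace X" and c: "c < tsep (gen_cone I f X) z0 w0"
  shows "\<exists>r>0. \<forall>z\<in>I \<times> mspace X. \<forall>w\<in>I \<times> mspace X. mdist (met (gen_cone I f X)) z0 z < r \<longrightarrow>
     mdist (met (gen_cone I f X)) w0 w < r \<longrightarrow> c < tsep (gen_cone I f X) z w"
proof -
  obtain c' where c': "c < c'" "c' < tsep (gen_cone I f X) z0 w0" using dense[OF c] by blast
  obtain d where d: "c' = ennreal d" "0 \<le> d" using c'(2) by (cases c') auto
  obtain c0 where c0: "c = ennreal c0" "0 \<le> c0" using c'(1) by (cases c) (auto simp: d)
  define e where "e = d - c0"
  have e: "0 < e" using c'(1) d c0 by (simp add: e_def ennreal_less_iff)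
  have ce: "c + ennreal e < tsep (gen_cone I f X) z0 w0"
    using c'(2) c0 d e by (simp add: e_def ennreal_plus[symmetric] del: ennreal_plus)
  have I0: "fst z0 \<in> I" "fst w0 \<in> I" using z0 w0 by auto
  obtain r1 where r1: "r1 > 0" "cball (fst z0) r1 \<subseteq> I" using open_I I0 open_contains_cball by blast
  obtain r2 where r2: "r2 > 0" "cball (fst w0) r2 \<subseteq> I" using open_I I0 open_contains_cball by blast
  define r0 where "r0 = min r1 r2"
  have r0: "r0 > 0" using r1 r2 by (simp add: r0_def)
  define lo where "lo = min (fst z0) (fst w0) - r0"
  define hi where "hi = max (fst z0) (fst w0) + r0"
  have "fst z0 - r0 \<in> cball (fst z0) r1" "fst w0 - r0 \<in> cball (fst w0) r2"
    "fst z0 + r0 \<in> cball (fst z0) r1" "fst w0 + r0 \<in> cball (fst w0) r2"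
    using r1(1) r2(1) by (auto simp: dist_real_def r0_def)
  then have lh: "lo \<in> I" "hi \<in> I" using r1(2) r2(2) by (auto simp: lo_def hi_def min_def max_def)
  have ne: "{lo..hi} \<noteq> {}" using r0 by (auto simp: lo_def hi_def)
  obtain M where M: "M > 0" "\<And>u. u \<in> {lo..hi} \<Longrightarrow> f u \<le> M" using bounded_above_Icc[OF lh] by blast
  obtain um where um: "um \<in> {lo..hi}" "\<And>u. u \<in> {lo..hi} \<Longrightarrow> f um \<le> f u"
    using continuous_attains_inf[OF compact_Icc ne cont_Icc[OF lh]] by blast
  have fm: "0 < f um" using pos_Icc[OF lh um(1)] .
  define D where "D = hi - lo"
  have D: "0 < D" using r0 by (simp add: D_def lo_def hi_def)
  \<comment> \<open>Time differences inside \<open>{lo..hi}\<close> are at most \<open>D\<close>, so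
    the truncation error \<open>M * D / (2 * L)\<close> becomes \<open>e / 2\<close>.\<close>
  define L where "L = M * D / e"
  have L: "0 < L" using M D e by (simp add: L_def)
  define B where "B = sqrt (1 + (L / f um)\<^sup>2)"
  have B: "0 < B" by (simp add: B_def add_pos_nonneg)
  \<comment> \<open>Moving both endpoints by less than \<open>r\<close> changes the energy by at
    most \<open>2 * B * r\<close> and the distance term by at most \<open>2 * L * r\<close>,
    together at most \<open>e / 2\<close>. The bound \<open>r0\<close> keeps the perturbed times
    inside \<open>{lo..hi}\<close>.\<close>
  define r where "r = min r0 (e / (4 * (B + L)))"
  have r: "0 < r" "r \<le> r0" using r0 e B L by (auto simp: r_def)
  have "r \<le> e / (4 * (B + L))" by (simp add: r_def)
  then have rBL: "B * r + L * r \<le> e / 4" using B L by (simp add: field_simps)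
  show ?thesis
  proof (intro exI[of _ r] conjI ballI impI r(1))
    fix z w assume z: "z \<in> I \<times> mspace X" and w: "w \<in> I \<times> mspace X"
      and zr: "mdist (met (gen_cone I f X)) z0 z < r" and wr: "mdist (met (gen_cone I f X)) w0 w < r"
    have tz: "\<bar>fst z0 - fst z\<bar> < r" "\<bar>fst w0 - fst w\<bar> < r" "mdist X (snd z0) (snd z) < r" "mdist X (snd w0) (snd w) < r"
      using mdist_cone_ge[of z0 z] mdist_cone_ge[of w0 w] zr wr by linarith+
    have inlh: "fst z0 \<in> {lo..hi}" "fst w0 \<in> {lo..hi}" "fst z \<in> {lo..hi}" "fst w \<in> {lo..hi}"
      using tz r r0 by (auto simp: lo_def hi_def)
    have "tsep (gen_cone I f X) z0 w0 \<le> tsep (gen_cone I f X) z w + ennreal (e / 2 + e / 2)"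
    proof (rule cone_tsep_compare[OF warped_cone_self warped_cone_self z0 w0 z w _ L])
      show "f u \<le> M" if "u \<in> {fst z..fst w}" for u using M(2)[of u] that inlh by auto
      show "M * (fst w - fst z) / (2 * L) \<le> e / 2"
      proof -
        have "M * (fst w - fst z) \<le> M * D" using M inlh by (intro mult_left_mono) (auto simp: D_def)
        then have "M * (fst w - fst z) / (2 * L) \<le> M * D / (2 * L)" using L by (intro divide_right_mono) auto
        also have "\<dots> = e / 2" using M D e by (simp add: L_def)
        finally show ?thesis .
      qed
      fix \<nu> assume \<nu>: "\<nu> \<in> {0..L}"
      have "\<bar>energy f \<nu> (fst z0) (fst w0) - energy f \<nu> (fst z) (fst w)\<bar> \<le> B * (\<bar>fst z0 - fst z\<bar> + \<bar>fst w0 - fst w\<bar>)"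
        unfolding energy_def
      proof (rule integral_endpoints_lipschitz[OF continuous_on_subset[OF cont_energy Icc_subset[OF lh]] _ inlh])
        fix u assume u: "u \<in> {lo..hi}"
        have "\<nu> / f u \<le> L / f um" using \<nu> um(2)[OF u] fm by (intro frac_le) auto
        moreover have "0 \<le> \<nu> / f u" using \<nu> pos_Icc[OF lh u] by simp
        ultimately have "(\<nu> / f u)\<^sup>2 \<le> (L / f um)\<^sup>2" by (intro power_mono)
        then show "0 \<le> sqrt (1 + (\<nu> / f u)\<^sup>2) \<and> sqrt (1 + (\<nu> / f u)\<^sup>2) \<le> B" by (simp add: B_def)
      qed
      also have "\<dots> \<le> B * (r + r)" using B tz by (intro mult_left_mono) auto
      finally have E: "energy f \<nu> (fst z0) (fst w0) - energy f \<nu> (fst z) (fst w) \<le> 2 * (B * r)"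
        by (simp add: abs_le_iff algebra_simps)
      have Xs: "snd z \<in> mspace X" "snd w \<in> mspace X" "snd z0 \<in> mspace X" "snd w0 \<in> mspace X" using z w z0 w0 by auto
      have "mdist X (snd z) (snd w) \<le> mdist X (snd z) (snd z0) + mdist X (snd z0) (snd w0) + mdist X (snd w0) (snd w)"
        using X.triangle[OF Xs(1,3,2)] X.triangle[OF Xs(3,4,2)] by linarith
      then have "mdist X (snd z) (snd w) - mdist X (snd z0) (snd w0) \<le> 2 * r"
        using tz X.commute[of "snd z" "snd z0"] by linarith
      then have "\<nu> * (mdist X (snd z) (snd w) - mdist X (snd z0) (snd w0)) \<le> L * (2 * r)"
        using \<nu> r L by (smt (verit, best) atLeastAtMost_iff mult_left_mono mult_right_mono)
      then have "\<nu> * mdist X (snd z) (snd w) - \<nu> * mdist X (snd z0) (snd w0) \<le> 2 * (L * r)" by (simp add: algebra_simps)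
      then show "energy f \<nu> (fst z0) (fst w0) - \<nu> * mdist X (snd z0) (snd w0)
        \<le> energy f \<nu> (fst z) (fst w) - \<nu> * mdist X (snd z) (snd w) + e / 2"
        using E rBL by linarith
    qed (use e in auto)
    then have "tsep (gen_cone I f X) z0 w0 \<le> tsep (gen_cone I f X) z w + ennreal e" by simp
    from less_le_trans[OF ce this] show "c < tsep (gen_cone I f X) z w"
      by (metis add_right_mono not_le)
  qed
qed

end

section \<open>Properly covered cones\<close>

lemma open_bounded_interval_real:
  fixes J :: "real set"
  assumes "is_interval J" "open J" "J \<noteq> {}" "bounded J"
  obtains a b where "a < b" "J = {a<..<b}"
proof -
  have bd: "bdd_above J" "bdd_below J" using assms(4) by (auto intro: bounded_imp_bdd_above bounded_imp_bdd_below)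
  define a where "a = Inf J"
  define b where "b = Sup J"
  have sub: "J \<subseteq> {a<..<b}"
  proof
    fix x assume x: "x \<in> J"
    then obtain e where e: "e > 0" "cball x e \<subseteq> J" using assms(2) open_contains_cball by blast
    then have "x - e \<in> J" "x + e \<in> J" by (auto simp: subset_iff dist_real_def)
    then have "a \<le> x - e" "x + e \<le> b" unfolding a_def b_def using bd by (auto intro: cInf_lower cSup_upper)
    then show "x \<in> {a<..<b}" using e by auto
  qed
  have "{a<..<b} \<subseteq> J"
  proof
    fix x assume x: "x \<in> {a<..<b}"
    obtain y where y: "y \<in> J" "y < x" using cInf_lessD[OF assms(3), of x] x by (auto simp: a_def)
    obtain z where z: "z \<in> J" "x < z" using less_cSupD[OF assms(3), of x] x by (auto simp: b_def)
    show "x \<in> J" using assms(1) y z unfolding is_interval_1 by (meson less_imp_le)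
  qed
  with sub have "J = {a<..<b}" by blast
  moreover then have "a < b" using assms(3) by auto
  ultimately show ?thesis using that by blast
qed

text \<open>A function of the parameter whose increments dominate the distances makes every
  polygonal sum telescope.\<close>

lemma curve_length_le_monotone:
  assumes h: "\<And>s t. s \<in> J \<Longrightarrow> t \<in> J \<Longrightarrow> s \<le> t \<Longrightarrow> mdist m (\<gamma> s) (\<gamma> t) \<le> h t - h s"
    and bd: "\<And>s t. s \<in> J \<Longrightarrow> t \<in> J \<Longrightarrow> h t - h s \<le> C" and C: "0 \<le> C"
  shows "curve_length m J \<gamma> \<le> ennreal C"
  unfolding curve_length_def
proof (rule SUP_least, clarify)
  fix ts :: "real list" assume ts: "sorted ts" "set ts \<subseteq> J"
  show "(\<Sum>j<length ts - 1. ennreal (mdist m (\<gamma> (ts ! j)) (\<gamma> (ts ! Suc j)))) \<le> ennreal C"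
  proof (cases "ts = []")
    case False
    then have len: "length ts > 0" by simp
    have inJ: "ts ! j \<in> J" if "j < length ts" for j using ts that by auto
    have "(\<Sum>j<length ts - 1. ennreal (mdist m (\<gamma> (ts ! j)) (\<gamma> (ts ! Suc j))))
       = ennreal (\<Sum>j<length ts - 1. mdist m (\<gamma> (ts ! j)) (\<gamma> (ts ! Suc j)))"
      by (intro sum_ennreal) simp
    also have "\<dots> \<le> ennreal (\<Sum>j<length ts - 1. h (ts ! Suc j) - h (ts ! j))"
      by (intro ennreal_leI sum_mono h inJ sorted_nth_mono ts) auto
    also have "(\<Sum>j<length ts - 1. h (ts ! Suc j) - h (ts ! j)) = h (ts ! (length ts - 1)) - h (ts ! 0)"
      by (rule sum_lessThan_telescope)
    also have "ennreal \<dots> \<le> ennreal C" using len by (intro ennreal_leI bd inJ) auto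
    finally show ?thesis .
  qed simp
qed

section \<open>Closed covers, the axioms for a cone, and lengths of causal curves\<close>

locale covered_cone =
  fixes I :: "real set" and f :: "real \<Rightarrow> real" and X :: "'x metric" and p :: 'x and J :: "nat \<Rightarrow> real set"
  assumes covered: "properly_covered_cone I f X p J"
begin

sublocale warped_cone I f X
  using covered by unfold_locales (auto simp: properly_covered_cone_def)

lemma p_in: "p \<in> mspace X" using covered by (simp add: properly_covered_cone_def)

lemma J_props:
  assumes "k \<ge> 1"
  shows "is_interval (J k)" "open (J k)" "J k \<noteq> {}" "compact (closure (J k))" "closure (J k) \<subseteq> I"
    "J k \<subseteq> J (Suc k)" "diameter (J k) \<le> real k"
  using covered assms by (auto simp: properly_covered_cone_def)

lemma J_interval:
  assumes k: "k \<ge> 1"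
  obtains a b where "a < b" "J k = {a<..<b}" "closure (J k) = {a..b}" "{a..b} \<subseteq> I" "b - a \<le> real k"
proof -
  have "bounded (J k)" using J_props(4)[OF k] compact_imp_bounded bounded_subset closure_subset by blast
  then obtain a b where ab: "a < b" "J k = {a<..<b}"
    using open_bounded_interval_real[OF J_props(1,2,3)[OF k]] by blast
  then have "diameter (J k) = b - a" by simp
  then show ?thesis using that[of a b] ab J_props[OF k] by simp
qed

lemma mcball_compact: "compactin (mtopology_of X) (mcball_of X x r)"
proof (cases "x \<in> mspace X")
  case True
  have c: "compactin X.mtopology (X.mtopology closure_of (X.mball x (r + 1)))"
    using covered True by (simp add: properly_covered_cone_def mtopology_of_def mball_of_def)
  have "X.mcball x r \<subseteq> X.mball x (r + 1)" by auto
  also have "\<dots> \<subseteq> X.mtopology closure_of (X.mball x (r + 1))" by (intro closure_of_subset) auto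
  finally have "compactin X.mtopology (X.mcball x r)" by (rule closed_compactin[OF c]) (rule X.closedin_mcball)
  then show ?thesis by (simp add: mtopology_of_def mcball_of_def)
next
  case False
  then have "mcball_of X x r = {}" by auto
  then show ?thesis by simp
qed

text \<open>The geodesic from \<open>c\<close> to \<open>x\<close>, stopped at parameter
  \<open>1 - u\<close>. It serves to push points into balls: to determine the closure of a ball, and
  to correct approximations that overshoot one.\<close>

lemma toward_center:
  assumes x: "x \<in> mspace X" and c: "c \<in> mspace X" and u: "0 \<le> u" "u \<le> 1"
  shows "\<exists>y\<in>mspace X. mdist X c y = (1 - u) * mdist X c x \<and> mdist X x y = u * mdist X c x"
proof -
  obtain \<gamma> where \<gamma>: "\<gamma> \<in> {0..1::real} \<rightarrow> mspace X" "\<gamma> 0 = c" "\<gamma> 1 = x"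
    "\<And>a b. a\<in>{0..1} \<Longrightarrow> b\<in>{0..1} \<Longrightarrow> mdist X (\<gamma> a) (\<gamma> b) = \<bar>a - b\<bar> * mdist X c x"
    using geodesic x c unfolding geodesic_space_def by metis
  have "\<gamma> (1 - u) \<in> mspace X" using \<gamma>(1) u by auto
  moreover have "mdist X c (\<gamma> (1 - u)) = (1 - u) * mdist X c x" using \<gamma>(4)[of 0 "1 - u"] \<gamma>(2) u by simp
  moreover have "mdist X x (\<gamma> (1 - u)) = u * mdist X c x" using \<gamma>(4)[of 1 "1 - u"] \<gamma>(3) u by simp
  ultimately show ?thesis by blast
qed

text \<open>False in general metric spaces. Here a point of the closed ball is the limit of points
  on a geodesic to the center, which lie strictly inside.\<close>

lemma closure_mball:
  assumes R: "0 < R"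
  shows "mtopology_of X closure_of mball_of X p R = mcball_of X p R"
proof
  have "X.mtopology closure_of X.mball p R \<subseteq> X.mcball p R"
    by (intro closure_of_minimal X.closedin_mcball) auto
  then show "mtopology_of X closure_of mball_of X p R \<subseteq> mcball_of X p R"
    by (simp add: mtopology_of_def mball_of_def mcball_of_def)
  have "x \<in> X.mtopology closure_of X.mball p R" if x: "x \<in> X.mcball p R" for x
    unfolding X.metric_closure_of
  proof (intro CollectI conjI allI impI)
    show "x \<in> mspace X" using x by simp
    fix r :: real assume r: "r > 0"
    \<comment> \<open>Positive, so that the center gets strictly closer, and small enough that the
      displacement is at most \<open>r / 2\<close>.\<close>
    define u where "u = min 1 (r / (2 * R))"
    have u: "0 < u" "u \<le> 1" using r R by (auto simp: u_def)
    obtain y where y: "y \<in> mspace X" "mdist X p y = (1 - u) * mdist X p x" "mdist X x y = u * mdist X p x"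
      using toward_center[of x p u] x u p_in by auto
    have "mdist X p y < R"
    proof (cases "mdist X p x = 0")
      case True then show ?thesis using y R by simp
    next
      case False
      then have "0 < mdist X p x" using X.nonneg[of p x] by linarith
      then have "0 < u * mdist X p x" using u by simp
      then have "mdist X p y < mdist X p x" using y(2) by (simp add: algebra_simps)
      then show ?thesis using x by simp
    qed
    moreover have "mdist X x y < r"
    proof -
      have "mdist X x y \<le> r / (2 * R) * R" unfolding y(3) using x r R by (intro mult_mono) (auto simp: u_def)
      also have "\<dots> < r" using r R by simp
      finally show ?thesis .
    qed
    ultimately show "\<exists>y\<in>X.mball p R. y \<in> X.mball x r" using y(1) x p_in by (intro bexI[of _ y]) auto
  qed
  then show "mcball_of X p R \<subseteq> mtopology_of X closure_of mball_of X p R"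
    by (auto simp: mtopology_of_def mball_of_def mcball_of_def)
qed

lemma closure_cover:
  assumes k: "k \<ge> 1"
  shows "mtopology_of (met (gen_cone I f X)) closure_of cone_cover X p J k = closure (J k) \<times> mcball_of X p (2 ^ k)"
proof -
  have "mtopology_of (submetric euclidean_metric I) closure_of J k = closure (J k)"
    using J_props(5)[OF k] closure_subset[of "J k"]
    by (simp add: mtopology_of_submetric closure_of_subtopology Int_absorb1 order_trans[of "J k" "closure (J k)" I])
  then show ?thesis unfolding met_cone cone_cover_def
    by (simp add: closure_of_Times closure_mball)
qed

lemma cl_metric_cover:
  assumes k: "k \<ge> 1"
  shows "mspace (cl_metric (gen_cone I f X) (cone_cover X p J k)) = closure (J k) \<times> mcball_of X p (2 ^ k)"
    and "mdist (cl_metric (gen_cone I f X) (cone_cover X p J k)) = mdist (met (gen_cone I f X))"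
proof -
  have "closure (J k) \<times> mcball_of X p (2 ^ k) \<subseteq> I \<times> mspace X" using J_props(5)[OF k] by auto
  then show "mspace (cl_metric (gen_cone I f X) (cone_cover X p J k)) = closure (J k) \<times> mcball_of X p (2 ^ k)"
    unfolding cl_metric_def closure_cover[OF k] mspace_submetric mspace_cone by blast
qed (simp add: cl_metric_def)

lemma compact_cover:
  assumes k: "k \<ge> 1"
  shows "compactin (mtopology_of (met (gen_cone I f X))) (closure (J k) \<times> mcball_of X p (2 ^ k))"
proof -
  have "compactin (mtopology_of (submetric euclidean_metric I)) (closure (J k))"
    using J_props(4,5)[OF k] by (simp add: mtopology_of_submetric compactin_subtopology)
  then show ?thesis unfolding met_cone by (simp add: compactin_Times mcball_compact)
qed

lemma countable_dense:
  obtains Q where "countable Q" "Q \<subseteq> mspace X" "\<And>x r. x \<in> mspace X \<Longrightarrow> 0 < r \<Longrightarrow> \<exists>q\<in>Q. mdist X q x < r"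
proof -
  have "\<exists>K. finite K \<and> K \<subseteq> mspace X \<and> (\<forall>x\<in>mcball_of X p (real n). \<exists>q\<in>K. mdist X q x < 1 / real (Suc m))" for n m
  proof -
    have "X.mtotally_bounded (X.mcball p (real n))"
      using mcball_compact[of p "real n"] by (intro X.compactin_imp_mtotally_bounded) (simp add: mtopology_of_def mcball_of_def)
    then obtain K where "finite K" "K \<subseteq> X.mcball p (real n)" "X.mcball p (real n) \<subseteq> (\<Union>x\<in>K. X.mball x (1 / real (Suc m)))"
      unfolding X.mtotally_bounded_def by (meson of_nat_0_less_iff zero_less_Suc zero_less_divide_1_iff)
    then show ?thesis by (intro exI[of _ K]) (auto simp: mcball_of_def subset_iff)
  qed
  then obtain K where K: "\<And>n m. finite (K n m)" "\<And>n m. K n m \<subseteq> mspace X"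
    "\<And>n m x. x\<in>mcball_of X p (real n) \<Longrightarrow> \<exists>q\<in>K n m. mdist X q x < 1 / real (Suc m)"
    by metis
  show thesis
  proof (rule that[of "\<Union>n m. K n m"])
    show "countable (\<Union>n m. K n m)" using K(1) by (intro countable_UN) (auto intro: countable_finite)
    show "(\<Union>n m. K n m) \<subseteq> mspace X" using K(2) by blast
    fix x r assume x: "x \<in> mspace X" and r: "(0::real) < r"
    obtain n where n: "mdist X p x \<le> real n" using real_arch_simple by blast
    obtain m where m: "1 / real (Suc m) < r" using nat_approx_posE[OF r] by blast
    have "x \<in> mcball_of X p (real n)" using n x p_in by simp
    then obtain q where "q \<in> K n m" "mdist X q x < 1 / real (Suc m)" using K(3) by blast
    then show "\<exists>q\<in>\<Union>n m. K n m. mdist X q x < r" using m by (intro bexI[of _ q]) auto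
  qed
qed

lemma separable_cone: "separable_metric (met (gen_cone I f X))"
proof -
  obtain Q where Q: "countable Q" "Q \<subseteq> mspace X" "\<And>x r. x \<in> mspace X \<Longrightarrow> 0 < r \<Longrightarrow> \<exists>q\<in>Q. mdist X q x < r"
    using countable_dense by blast
  interpret Y: Metric_space "mspace (met (gen_cone I f X))" "mdist (met (gen_cone I f X))" by simp
  define C where "C = (\<rat> \<inter> I) \<times> Q"
  have "countable C" unfolding C_def using Q(1) countable_rat by (intro countable_SIGMA) (auto intro: countable_subset)
  moreover have CM: "C \<subseteq> mspace (met (gen_cone I f X))" using Q(2) by (auto simp: C_def mspace_cone)
  moreover have "Y.mtopology closure_of C = mspace (met (gen_cone I f X))"
    unfolding Y.metric_closure_of
  proof (intro subset_antisym subsetI CollectI conjI allI impI)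
    fix z and r :: real assume z: "z \<in> mspace (met (gen_cone I f X))" and r: "r > 0"
    then have zz: "fst z \<in> I" "snd z \<in> mspace X" by (auto simp: mspace_cone)
    obtain e where e: "e > 0" "ball (fst z) e \<subseteq> I" using open_I zz open_contains_ball by blast
    obtain t where t: "t \<in> \<rat>" "fst z < t" "t < fst z + min e (r / 2)"
      using Rats_dense_in_real[of "fst z" "fst z + min e (r / 2)"] e r by auto
    have tI: "t \<in> I" using e(2) t by (auto simp: subset_iff dist_real_def)
    obtain q where q: "q \<in> Q" "mdist X q (snd z) < r / 2" using Q(3)[OF zz(2), of "r / 2"] r by auto
    have "mdist (met (gen_cone I f X)) z (t, q) \<le> \<bar>fst z - t\<bar> + mdist X (snd z) q" using mdist_cone_le[of z "(t, q)"] by simp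
    also have "\<dots> < r" using t q X.commute[of q "snd z"] by auto
    finally show "\<exists>y\<in>C. y \<in> Y.mball z r" using z t q tI CM by (intro bexI[of _ "(t, q)"]) (auto simp: C_def)
  qed auto
  ultimately show ?thesis unfolding separable_metric_def mtopology_of_def by blast
qed

text \<open>Through the formulas for the two relations, transitivity is the triangle inequality of
  the fibre plus additivity of \<open>optical\<close>.\<close>

lemma lorentzian: "Lorentzian_pre_length_space (gen_cone I f X)"
proof -
  let ?Y = "gen_cone I f X"
  interpret Y: Metric_space "mspace (met ?Y)" "mdist (met ?Y)" by simp
  note M = mspace_cone
  have 1: "reflp_on (I \<times> mspace X) (caus ?Y)" by (auto simp: reflp_on_def gen_cone_def)
  have 2: "transp_on (I \<times> mspace X) (caus ?Y)"
  proof (rule transp_onI)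
    fix z w v assume z: "z \<in> I \<times> mspace X" and w: "w \<in> I \<times> mspace X" and v: "v \<in> I \<times> mspace X"
      and c: "caus ?Y z w" "caus ?Y w v"
    have "mdist X (snd z) (snd v) \<le> mdist X (snd z) (snd w) + mdist X (snd w) (snd v)"
      using z w v by (intro X.triangle) auto
    then show "caus ?Y z v"
      using c optical_add[of "fst z" "fst v" "fst w"] z w v
      unfolding cone_caus_iff[OF z w] cone_caus_iff[OF w v] cone_caus_iff[OF z v] by force
  qed
  have lt: "fst z < fst w" if z: "z \<in> I \<times> mspace X" and w: "w \<in> I \<times> mspace X" and c: "chron ?Y z w" for z w
  proof (rule ccontr)
    assume "\<not> ?thesis"
    then have "optical f (fst z) (fst w) = 0" by (cases "fst z = fst w") (auto simp: optical_def)
    then show False using c X.nonneg[of "snd z" "snd w"] unfolding cone_chron_iff[OF z w] by simp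
  qed
  have 3: "transp_on (I \<times> mspace X) (chron ?Y)"
  proof (rule transp_onI)
    fix z w v assume z: "z \<in> I \<times> mspace X" and w: "w \<in> I \<times> mspace X" and v: "v \<in> I \<times> mspace X"
      and c: "chron ?Y z w" "chron ?Y w v"
    have "mdist X (snd z) (snd v) \<le> mdist X (snd z) (snd w) + mdist X (snd w) (snd v)"
      using z w v by (intro X.triangle) auto
    then show "chron ?Y z v"
      using c lt[OF z w c(1)] lt[OF w v c(2)] optical_add[of "fst z" "fst v" "fst w"] z w v
      unfolding cone_chron_iff[OF z w] cone_chron_iff[OF w v] cone_chron_iff[OF z v] by force
  qed
  have 4: "caus ?Y z w" if z: "z \<in> I \<times> mspace X" and w: "w \<in> I \<times> mspace X" and c: "chron ?Y z w" for z w
    using c lt[OF z w c] unfolding cone_chron_iff[OF z w] cone_caus_iff[OF z w] by simp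
  have 5: "openin (prod_topology (mtopology_of (met ?Y)) (mtopology_of (met ?Y)))
     {z \<in> (I \<times> mspace X) \<times> (I \<times> mspace X). c < tsep ?Y (fst z) (snd z)}" for c
    unfolding openin_prod_topology_alt
  proof (intro allI impI)
    fix z0 w0 assume "(z0, w0) \<in> {z \<in> (I \<times> mspace X) \<times> (I \<times> mspace X). c < tsep ?Y (fst z) (snd z)}"
    then have zw: "z0 \<in> I \<times> mspace X" "w0 \<in> I \<times> mspace X" "c < tsep ?Y z0 w0" by auto
    obtain r where r: "r > 0" "\<And>z w. z\<in>I \<times> mspace X \<Longrightarrow> w\<in>I \<times> mspace X \<Longrightarrow> mdist (met ?Y) z0 z < r \<Longrightarrow>
      mdist (met ?Y) w0 w < r \<Longrightarrow> c < tsep ?Y z w"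
      using tsep_lower_semicontinuous[OF zw] by blast
    show "\<exists>U V. openin (mtopology_of (met ?Y)) U \<and> openin (mtopology_of (met ?Y)) V \<and> z0 \<in> U \<and> w0 \<in> V \<and>
      U \<times> V \<subseteq> {z \<in> (I \<times> mspace X) \<times> (I \<times> mspace X). c < tsep ?Y (fst z) (snd z)}"
    proof (intro exI conjI)
      show "openin (mtopology_of (met ?Y)) (Y.mball z0 r)" "openin (mtopology_of (met ?Y)) (Y.mball w0 r)"
        by (simp_all add: mtopology_of_def Y.openin_mball)
      show "z0 \<in> Y.mball z0 r" "w0 \<in> Y.mball w0 r" unfolding Y.centre_in_mball_iff unfolding M using zw r(1) by auto
      show "Y.mball z0 r \<times> Y.mball w0 r \<subseteq> {z \<in> (I \<times> mspace X) \<times> (I \<times> mspace X). c < tsep ?Y (fst z) (snd z)}"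
      proof
        fix q assume "q \<in> Y.mball z0 r \<times> Y.mball w0 r"
        then have "fst q \<in> Y.mball z0 r" "snd q \<in> Y.mball w0 r" by auto
        then have q: "fst q \<in> I \<times> mspace X" "snd q \<in> I \<times> mspace X"
          "mdist (met ?Y) z0 (fst q) < r" "mdist (met ?Y) w0 (snd q) < r" unfolding Y.in_mball unfolding M by auto
        have "c < tsep ?Y (fst q) (snd q)" by (rule r(2)[OF q])
        then show "q \<in> {z \<in> (I \<times> mspace X) \<times> (I \<times> mspace X). c < tsep ?Y (fst z) (snd z)}"
          using q(1,2) by (simp add: mem_Times_iff)
      qed
    qed
  qed
  have 7: "0 < tsep ?Y z w \<longleftrightarrow> chron ?Y z w" if z: "z \<in> I \<times> mspace X" and w: "w \<in> I \<times> mspace X" for z w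
    using tsep_pos_iff[OF z w] cone_chron_iff[OF z w] by simp
  have 6: "tsep ?Y z w = 0" if z: "z \<in> I \<times> mspace X" and w: "w \<in> I \<times> mspace X" and "\<not> caus ?Y z w" for z w
    using 7[OF z w] 4[OF z w] that(3) by (meson not_gr_zero)
  have 8: "tsep ?Y z w + tsep ?Y w v \<le> tsep ?Y z v" if "z \<in> I \<times> mspace X" "w \<in> I \<times> mspace X" "v \<in> I \<times> mspace X"
    "caus ?Y z w \<and> caus ?Y w v" for z w v
    using reverse_triangle that by blast
  show ?thesis unfolding Lorentzian_pre_length_space_def Let_def M
    using 1 2 3 4 5 6 7 8 separable_cone by (intro conjI ballI allI impI) auto
qed

lemma tsep_cover_le:
  assumes k: "k \<ge> 1" and z: "z \<in> cone_cover X p J k" and w: "w \<in> cone_cover X p J k"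
  shows "tsep (gen_cone I f X) z w \<le> ennreal (real k)"
proof -
  obtain a b where ab: "a < b" "J k = {a<..<b}" "closure (J k) = {a..b}" "{a..b} \<subseteq> I" "b - a \<le> real k"
    using J_interval[OF k] by blast
  have zI: "z \<in> I \<times> mspace X" "w \<in> I \<times> mspace X" using z w ab by (auto simp: cone_cover_def)
  have "fst w - fst z \<le> real k" using z w ab by (auto simp: cone_cover_def)
  then show ?thesis using tsep_le_time[OF zI] by (meson ennreal_leI order_trans)
qed

lemma proper_cover: "proper_cover (gen_cone I f X) (cone_cover X p J)"
  unfolding proper_cover_def
proof (intro conjI allI impI)
  fix k :: nat assume k: "k \<ge> 1"
  show "cone_cover X p J k \<subseteq> mspace (met (gen_cone I f X))"
    using J_props(5)[OF k] closure_subset[of "J k"] by (auto simp: mspace_cone cone_cover_def)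
  show "compactin (mtopology_of (met (gen_cone I f X))) (mtopology_of (met (gen_cone I f X)) closure_of cone_cover X p J k)"
    unfolding closure_cover[OF k] by (rule compact_cover[OF k])
  show "cone_cover X p J k \<subseteq> cone_cover X p J (Suc k)"
  proof -
    have le: "(2::real) ^ k \<le> 2 ^ Suc k" by simp
    have "mball_of X p (2 ^ k) \<subseteq> mball_of X p (2 ^ Suc k)"
      using less_le_trans[OF _ le] by (auto simp del: power_Suc)
    then show ?thesis using J_props(6)[OF k] unfolding cone_cover_def by blast
  qed
  have "(SUP z \<in> cone_cover X p J k \<times> cone_cover X p J k. tsep (gen_cone I f X) (fst z) (snd z)) \<le> ennreal (real k)"
    by (rule SUP_least) (auto intro: tsep_cover_le[OF k])
  then show "(SUP z \<in> cone_cover X p J k \<times> cone_cover X p J k. tsep (gen_cone I f X) (fst z) (snd z)) < \<infinity>"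
    unfolding infinity_ennreal_def by (rule le_less_trans[OF _ ennreal_less_top])
next
  have U: "(\<Union>k\<in>{1..}. J k) = I" using covered by (simp add: properly_covered_cone_def)
  show "(\<Union>k\<in>{1..}. cone_cover X p J k) = mspace (met (gen_cone I f X))"
  proof (intro subset_antisym subsetI)
    fix z assume "z \<in> (\<Union>k\<in>{1..}. cone_cover X p J k)"
    then show "z \<in> mspace (met (gen_cone I f X))" using U by (auto simp: mspace_cone cone_cover_def)
  next
    fix z assume z: "z \<in> mspace (met (gen_cone I f X))"
    have zI: "fst z \<in> I" "snd z \<in> mspace X" using z unfolding mspace_cone by auto
    have "fst z \<in> (\<Union>k\<in>{1..}. J k)" unfolding U by (rule zI(1))
    then obtain k where k: "k \<ge> 1" "fst z \<in> J k" by auto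
    have mono: "J k \<subseteq> J n" if "k \<le> n" for n using that
    proof (induction n rule: dec_induct)
      case (step n) then show ?case using J_props(6)[of n] k(1) by auto
    qed simp
    obtain m where m: "mdist X p (snd z) < 2 ^ m" using real_arch_pow[of 2] by auto
    define n where "n = max k m"
    have "(2::real) ^ m \<le> 2 ^ n" by (intro power_increasing) (auto simp: n_def)
    then have "mdist X p (snd z) < 2 ^ n" using m by linarith
    moreover have "fst z \<in> J n" using k(2) mono[of n] by (auto simp: n_def)
    ultimately have "z \<in> cone_cover X p J n" using zI(2) p_in by (simp add: cone_cover_def mem_Times_iff)
    then show "z \<in> (\<Union>k\<in>{1..}. cone_cover X p J k)" using k(1) by (intro UN_I[of n]) (auto simp: n_def)
  qed
qed

text \<open>Where \<open>f \<ge> c\<close>, causally related points are at fibre distance at most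
  \<open>1 / c\<close> times their time difference. So time, multiplied by \<open>1 + 1 / c\<close>,
  dominates the length, and for time-reversed curves its negative does.\<close>

lemma causal_length_le:
  assumes k: "k \<ge> 1" and c: "0 < c" "\<And>t. t \<in> J k \<Longrightarrow> c \<le> f t"
    and \<gamma>: "causal_curve (gen_cone I f X) K \<gamma>" "\<gamma> ` K \<subseteq> cone_cover X p J k"
  shows "curve_length (met (gen_cone I f X)) K \<gamma> \<le> ennreal ((1 + 1 / c) * real k)"
proof -
  obtain a b where ab: "a < b" "J k = {a<..<b}" "closure (J k) = {a..b}" "{a..b} \<subseteq> I" "b - a \<le> real k"
    using J_interval[OF k] by blast
  define C where "C = 1 + 1 / c"
  have C: "0 < C" using c by (simp add: C_def add_pos_pos)
  have JI: "J k \<subseteq> I" using J_props(5)[OF k] closure_subset by blast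
  have inU: "\<gamma> s \<in> I \<times> mspace X" "fst (\<gamma> s) \<in> J k" if "s \<in> K" for s
  proof -
    have "\<gamma> s \<in> J k \<times> mball_of X p (2 ^ k)" using \<gamma>(2) that unfolding cone_cover_def by blast
    then show "\<gamma> s \<in> I \<times> mspace X" "fst (\<gamma> s) \<in> J k" using JI by (auto simp: mem_Times_iff)
  qed
  have step: "mdist (met (gen_cone I f X)) z w \<le> C * (fst w - fst z)"
    if z: "z \<in> I \<times> mspace X" "fst z \<in> J k" and w: "w \<in> I \<times> mspace X" "fst w \<in> J k" and ca: "caus (gen_cone I f X) z w" for z w
  proof -
    have le: "fst z \<le> fst w" "mdist X (snd z) (snd w) \<le> optical f (fst z) (fst w)"
      using ca unfolding cone_caus_iff[OF z(1) w(1)] by auto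
    have zw: "fst z \<in> I" "fst w \<in> I" using z(1) w(1) by auto
    have "optical f (fst z) (fst w) \<le> integral {fst z..fst w} (\<lambda>u. 1 / c)"
      unfolding optical_def
    proof (rule integral_le[OF optical_int[OF zw]])
      fix u assume "u \<in> {fst z..fst w}"
      then have "u \<in> J k" using z(2) w(2) ab(2) by auto
      then show "1 / f u \<le> 1 / c" using c by (intro frac_le) auto
    qed auto
    also have "\<dots> = (fst w - fst z) / c" using le by simp
    finally have "mdist X (snd z) (snd w) \<le> (fst w - fst z) / c" using le by linarith
    moreover have "C * (fst w - fst z) = (fst w - fst z) + (fst w - fst z) / c" by (simp add: C_def distrib_right)
    ultimately show ?thesis using mdist_cone_le[of z w] le(1) by simp
  qed
  have bd: "C * x - C * y \<le> C * real k" if "x \<in> J k" "y \<in> J k" for x y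
  proof -
    have "x - y \<le> real k" using that ab by auto
    then show ?thesis using C by (simp add: right_diff_distrib[symmetric])
  qed
  have alt: "(\<forall>s\<in>K. \<forall>t\<in>K. s \<le> t \<longrightarrow> caus (gen_cone I f X) (\<gamma> s) (\<gamma> t)) \<or>
      (\<forall>s\<in>K. \<forall>t\<in>K. s \<le> t \<longrightarrow> caus (gen_cone I f X) (\<gamma> t) (\<gamma> s))"
    using \<gamma>(1) by (simp add: causal_curve_def)
  have "curve_length (met (gen_cone I f X)) K \<gamma> \<le> ennreal (C * real k)"
    using alt
  proof
    assume ca: "\<forall>s\<in>K. \<forall>t\<in>K. s \<le> t \<longrightarrow> caus (gen_cone I f X) (\<gamma> s) (\<gamma> t)"
    show "curve_length (met (gen_cone I f X)) K \<gamma> \<le> ennreal (C * real k)"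
    proof (rule curve_length_le_monotone[where h = "\<lambda>s. C * fst (\<gamma> s)"])
      show "mdist (met (gen_cone I f X)) (\<gamma> s) (\<gamma> t) \<le> C * fst (\<gamma> t) - C * fst (\<gamma> s)" if "s \<in> K" "t \<in> K" "s \<le> t" for s t
        using step[OF inU[OF that(1)] inU[OF that(2)]] ca that by (simp add: right_diff_distrib)
    qed (use bd inU C in auto)
  next
    assume ca: "\<forall>s\<in>K. \<forall>t\<in>K. s \<le> t \<longrightarrow> caus (gen_cone I f X) (\<gamma> t) (\<gamma> s)"
    interpret Y: Metric_space "mspace (met (gen_cone I f X))" "mdist (met (gen_cone I f X))" by simp
    show "curve_length (met (gen_cone I f X)) K \<gamma> \<le> ennreal (C * real k)"
    proof (rule curve_length_le_monotone[where h = "\<lambda>s. - (C * fst (\<gamma> s))"])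
      show "mdist (met (gen_cone I f X)) (\<gamma> s) (\<gamma> t) \<le> - (C * fst (\<gamma> t)) - - (C * fst (\<gamma> s))" if "s \<in> K" "t \<in> K" "s \<le> t" for s t
        using step[OF inU[OF that(2)] inU[OF that(1)]] ca that Y.commute[of "\<gamma> s" "\<gamma> t"] by (simp add: right_diff_distrib)
    next
      show "- (C * fst (\<gamma> t)) - - (C * fst (\<gamma> s)) \<le> C * real k" if "s \<in> K" "t \<in> K" for s t
        using bd[OF inU(2)[OF that(1)] inU(2)[OF that(2)]] by simp
    qed (use C in auto)
  qed
  then show ?thesis by (simp add: C_def)
qed

end

section \<open>Almost isometries of intervals and fibres\<close>

text \<open>Each \<open>\<Phi> i\<close> is taken at the finest available scale among the first
  \<open>i + 1\<close> scales; this restriction keeps the set of candidates finite. It turns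
  approximations depending on \<delta> into one family, as the comparison condition of
  \<open>l_converges\<close> demands.\<close>

lemma diagonal_choice:
  fixes P :: "real \<Rightarrow> nat \<Rightarrow> 'a \<Rightarrow> bool"
  assumes ev: "\<And>\<delta>. 0 < \<delta> \<Longrightarrow> \<forall>\<^sub>F i in sequentially. \<exists>\<phi>. P \<delta> i \<phi>"
    and mono: "\<And>\<delta> \<delta>' i \<phi>. P \<delta> i \<phi> \<Longrightarrow> 0 < \<delta> \<Longrightarrow> \<delta> \<le> \<delta>' \<Longrightarrow> P \<delta>' i \<phi>"
  shows "\<exists>\<Phi>. \<forall>\<delta>>0. \<forall>\<^sub>F i in sequentially. P \<delta> i (\<Phi> i)"
proof -
  define e where "e = (\<lambda>n. 1 / real (Suc n))"
  have e: "0 < e n" for n by (simp add: e_def)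
  define S where "S = (\<lambda>i. {n. n \<le> i \<and> (\<exists>\<phi>. P (e n) i \<phi>)})"
  have fin: "finite (S i)" for i by (rule finite_subset[of _ "{..i}"]) (auto simp: S_def)
  have mem: "\<exists>\<phi>. P (e n) i \<phi>" if "n \<in> S i" for n i using that by (simp add: S_def)
  define \<Phi> where "\<Phi> = (\<lambda>i. SOME \<phi>. P (e (Max (S i))) i \<phi>)"
  have "\<forall>\<^sub>F i in sequentially. P \<delta> i (\<Phi> i)" if \<delta>: "0 < \<delta>" for \<delta>
  proof -
    obtain n where n: "e n < \<delta>" using nat_approx_posE[OF \<delta>] unfolding e_def by blast
    show ?thesis using ev[OF e[of n]] eventually_ge_at_top[of n]
    proof eventually_elim
      case (elim i)
      then have nS: "n \<in> S i" by (simp add: S_def)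
      then have MS: "Max (S i) \<in> S i" using fin by (intro Max_in) auto
      have "P (e (Max (S i))) i (\<Phi> i)" unfolding \<Phi>_def by (rule someI_ex[OF mem[OF MS]])
      moreover have "e (Max (S i)) \<le> \<delta>"
      proof -
        have "n \<le> Max (S i)" using nS fin by simp
        then have "e (Max (S i)) \<le> e n" unfolding e_def by (intro frac_le) auto
        then show ?thesis using n by simp
      qed
      ultimately show ?case using mono e by blast
    qed
  qed
  then show ?thesis by blast
qed

lemma GH_isometry_mono: "GH_isometry \<delta> A B \<phi> \<Longrightarrow> \<delta> \<le> \<delta>' \<Longrightarrow> GH_isometry \<delta>' A B \<phi>"
  unfolding GH_isometry_def nbhd_def
proof (elim conjE, intro conjI)
  assume "\<delta> \<le> \<delta>'" "(\<Union>x\<in>\<phi> ` mspace A. mball_of B x \<delta>) = mspace B"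
  moreover have "mball_of B x \<delta> \<subseteq> mball_of B x \<delta>'" for x using \<open>\<delta> \<le> \<delta>'\<close> by auto
  ultimately have "mspace B \<subseteq> (\<Union>x\<in>\<phi> ` mspace A. mball_of B x \<delta>')" by blast
  then show "(\<Union>x\<in>\<phi> ` mspace A. mball_of B x \<delta>') = mspace B" by auto
qed force+

text \<open>The pointed approximation is retracted onto the closed ball along geodesics to the center.\<close>

lemma (in covered_cone) ball_GH_isometry:
  fixes A :: "'a metric"
  assumes \<phi>: "\<phi> \<in> mball_of A q (R + 1) \<rightarrow> mspace X" "\<phi> q = p" and q: "q \<in> mspace A"
    and dist: "\<And>x y. x \<in> mball_of A q (R + 1) \<Longrightarrow> y \<in> mball_of A q (R + 1) \<Longrightarrow>
           \<bar>mdist X (\<phi> x) (\<phi> y) - mdist A x y\<bar> < \<epsilon>"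
    and onto: "mball_of X p (R + 1 - \<epsilon>) \<subseteq> nbhd X \<epsilon> (\<phi> ` mball_of A q (R + 1))"
    and \<epsilon>: "0 < \<epsilon>" "\<epsilon> < 1" "2 * \<epsilon> \<le> R"
  shows "\<exists>\<Phi>. GH_isometry (4 * \<epsilon>) (submetric A (mcball_of A q R)) (submetric X (mcball_of X p R)) \<Phi>"
proof -
  interpret A: Metric_space "mspace A" "mdist A" by simp
  let ?K = "mcball_of A q R"
  have Kball: "x \<in> mball_of A q (R + 1)" if "x \<in> ?K" for x using that by auto
  have qball: "q \<in> mball_of A q (R + 1)" using q \<epsilon> by auto
  have \<phi>X: "\<phi> x \<in> mspace X" if "x \<in> ?K" for x using \<phi>(1) Kball[OF that] by blast
  have "\<exists>y\<in>mcball_of X p R. mdist X (\<phi> x) y \<le> \<epsilon>" if x: "x \<in> ?K" for x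
  proof (cases "mdist X p (\<phi> x) \<le> R")
    case True
    then show ?thesis using \<phi>X[OF x] p_in \<epsilon> by (intro bexI[of _ "\<phi> x"]) auto
  next
    case False
    define D where "D = mdist X p (\<phi> x)"
    have D: "R < D" "0 < D" using False \<epsilon> by (auto simp: D_def)
    have "\<bar>D - mdist A q x\<bar> < \<epsilon>" using dist[OF qball Kball[OF x]] \<phi>(2) by (simp add: D_def)
    then have DR: "D < R + \<epsilon>" using x by auto
    \<comment> \<open>The fraction of the way to the center that lands exactly at distance
      \<open>R\<close>. The displacement is the overshoot \<open>D - R\<close>, which is below
      \<epsilon>.\<close>
    define u where "u = (D - R) / D"
    have u: "0 \<le> u" "u \<le> 1" "u * D = D - R" "(1 - u) * D = R"
      using D \<epsilon> by (auto simp: u_def field_simps)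
    obtain y where y: "y\<in>mspace X" "mdist X p y = (1 - u) * D" "mdist X (\<phi> x) y = u * D"
      using toward_center[OF \<phi>X[OF x] p_in u(1,2)] unfolding D_def by blast
    then show ?thesis using u DR p_in by (intro bexI[of _ y]) auto
  qed
  then obtain \<Phi> where \<Phi>: "\<And>x. x \<in> ?K \<Longrightarrow> \<Phi> x \<in> mcball_of X p R" "\<And>x. x \<in> ?K \<Longrightarrow> mdist X (\<phi> x) (\<Phi> x) \<le> \<epsilon>"
    by metis
  have \<Phi>X: "\<Phi> x \<in> mspace X" if "x \<in> ?K" for x using \<Phi>(1)[OF that] by auto
  have d: "\<bar>mdist X (\<Phi> x) (\<Phi> y) - mdist A x y\<bar> < 4 * \<epsilon>" if x: "x \<in> ?K" and y: "y \<in> ?K" for x y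
  proof -
    have "mdist X (\<Phi> x) (\<Phi> y) \<le> mdist X (\<Phi> x) (\<phi> x) + mdist X (\<phi> x) (\<phi> y) + mdist X (\<phi> y) (\<Phi> y)"
      using X.triangle[OF \<Phi>X[OF x] \<phi>X[OF x] \<Phi>X[OF y]] X.triangle[OF \<phi>X[OF x] \<phi>X[OF y] \<Phi>X[OF y]] by linarith
    moreover have "mdist X (\<phi> x) (\<phi> y) \<le> mdist X (\<phi> x) (\<Phi> x) + mdist X (\<Phi> x) (\<Phi> y) + mdist X (\<Phi> y) (\<phi> y)"
      using X.triangle[OF \<phi>X[OF x] \<Phi>X[OF x] \<phi>X[OF y]] X.triangle[OF \<Phi>X[OF x] \<Phi>X[OF y] \<phi>X[OF y]] by linarith
    ultimately show ?thesis using dist[OF Kball[OF x] Kball[OF y]] \<Phi>(2)[OF x] \<Phi>(2)[OF y]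
      X.commute[of "\<Phi> x" "\<phi> x"] X.commute[of "\<Phi> y" "\<phi> y"] \<epsilon> by linarith
  qed
  have on: "\<exists>x\<in>?K. mdist X (\<Phi> x) y < 4 * \<epsilon>" if y: "y \<in> mcball_of X p R" for y
  proof -
    have yX: "y \<in> mspace X" "mdist X p y \<le> R" using y by auto
    \<comment> \<open>A preimage must lie in the closed ball of radius \<open>R\<close>. Moving the
      target inward by \<open>2 * \<epsilon>\<close> leaves room for the \<epsilon> of approximation
      and the \<epsilon> of distortion. Together with the retraction the total is the
      \<open>4 * \<epsilon>\<close> of the conclusion.\<close>
    have "\<exists>y'\<in>mspace X. mdist X p y' \<le> R - 2 * \<epsilon> \<and> mdist X y y' \<le> 2 * \<epsilon>"
    proof (cases "mdist X p y \<le> 2 * \<epsilon>")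
      case True
      then show ?thesis using p_in \<epsilon> X.commute[of y p] by (intro bexI[of _ p]) (auto simp: X.mdist_zero p_in)
    next
      case False
      define D where "D = mdist X p y"
      define u where "u = 2 * \<epsilon> / D"
      have D: "2 * \<epsilon> < D" "0 < D" using False \<epsilon> by (auto simp: D_def)
      then have u: "0 \<le> u" "u \<le> 1" "u * D = 2 * \<epsilon>" "(1 - u) * D = D - 2 * \<epsilon>"
        using \<epsilon> by (auto simp: u_def field_simps)
      obtain y' where "y'\<in>mspace X" "mdist X p y' = (1 - u) * D" "mdist X y y' = u * D"
        using toward_center[OF yX(1) p_in u(1,2)] unfolding D_def by blast
      then show ?thesis using u yX(2) by (intro bexI[of _ y']) (auto simp: D_def)
    qed
    then obtain y' where y': "y'\<in>mspace X" "mdist X p y' \<le> R - 2 * \<epsilon>" "mdist X y y' \<le> 2 * \<epsilon>" by blast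
    have "y' \<in> mball_of X p (R + 1 - \<epsilon>)" using y' p_in \<epsilon> by auto
    from subsetD[OF onto this] obtain x where x: "x \<in> mball_of A q (R + 1)" "y' \<in> mball_of X (\<phi> x) \<epsilon>"
      unfolding nbhd_def by blast
    then have x: "x \<in> mball_of A q (R + 1)" "mdist X (\<phi> x) y' < \<epsilon>" "\<phi> x \<in> mspace X" by auto
    have "mdist X p (\<phi> x) \<le> mdist X p y' + mdist X y' (\<phi> x)" using y'(1) x(3) p_in by (intro X.triangle)
    moreover have "\<bar>mdist X p (\<phi> x) - mdist A q x\<bar> < \<epsilon>" using dist[OF qball x(1)] \<phi>(2) by simp
    ultimately have xR: "mdist A q x \<le> R" using x(2) y'(2) X.commute[of y' "\<phi> x"] by linarith
    then have xK: "x \<in> ?K" using x(1) by auto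
    have "mdist X (\<Phi> x) y \<le> mdist X (\<Phi> x) (\<phi> x) + mdist X (\<phi> x) y' + mdist X y' y"
      using X.triangle[OF \<Phi>X[OF xK] x(3) yX(1)] X.triangle[OF x(3) y'(1) yX(1)] by linarith
    then have "mdist X (\<Phi> x) y < 4 * \<epsilon>"
      using \<Phi>(2)[OF xK] x(2) y'(3) X.commute[of "\<Phi> x" "\<phi> x"] X.commute[of y' y] by linarith
    then show ?thesis using xK by blast
  qed
  have K: "mspace (submetric A ?K) = ?K" "mspace (submetric X (mcball_of X p R)) = mcball_of X p R" by auto
  have "nbhd (submetric X (mcball_of X p R)) (4 * \<epsilon>) (\<Phi> ` ?K) = mcball_of X p R"
  proof
    show "nbhd (submetric X (mcball_of X p R)) (4 * \<epsilon>) (\<Phi> ` ?K) \<subseteq> mcball_of X p R"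
      unfolding nbhd_def by auto
    show "mcball_of X p R \<subseteq> nbhd (submetric X (mcball_of X p R)) (4 * \<epsilon>) (\<Phi> ` ?K)"
    proof
      fix y assume y: "y \<in> mcball_of X p R"
      obtain x where "x \<in> ?K" "mdist X (\<Phi> x) y < 4 * \<epsilon>" using on[OF y] by blast
      then show "y \<in> nbhd (submetric X (mcball_of X p R)) (4 * \<epsilon>) (\<Phi> ` ?K)"
        using y \<Phi>(1)[of x] unfolding nbhd_def by auto
    qed
  qed
  then show ?thesis unfolding GH_isometry_def K mdist_submetric
    using \<Phi>(1) d by (intro exI[of _ \<Phi>]) auto
qed

section \<open>Affine comparison of intervals\<close>

definition aff :: "real \<Rightarrow> real \<Rightarrow> real \<Rightarrow> real \<Rightarrow> real \<Rightarrow> real" where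
  "aff a b a' b' t = a' + (t - a) * ((b' - a') / (b - a))"

lemma aff_bounds:
  assumes "a < b" "a' < b'" "t \<in> {a..b}"
  shows "aff a b a' b' t \<in> {a'..b'}"
proof -
  define q where "q = (t - a) / (b - a)"
  have "0 \<le> q" "q \<le> 1" using assms by (auto simp: q_def)
  define m where "m = q * (b' - a')"
  have "0 \<le> m" "m \<le> b' - a'"
    using assms(2) \<open>0 \<le> q\<close> mult_right_mono[OF \<open>q \<le> 1\<close>, of "b' - a'"] by (simp_all add: m_def)
  moreover have "aff a b a' b' t = a' + m" by (simp add: aff_def q_def m_def)
  ultimately have "a' \<le> aff a b a' b' t" "aff a b a' b' t \<le> b'" by linarith+
  then show ?thesis by simp
qed

lemma aff_inverse:
  assumes "a < b" "a' < b'"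
  shows "aff a b a' b' (aff a' b' a b t) = t"
  using assms by (simp add: aff_def)

lemma aff_mono:
  assumes "a < b" "a' < b'" "s \<le> t"
  shows "aff a b a' b' s \<le> aff a b a' b' t"
  using assms by (simp add: aff_def divide_right_mono mult_right_mono)

lemma aff_diff:
  assumes "a < b" "s \<in> {a..b}" "t \<in> {a..b}"
  shows "\<bar>(aff a b a' b' s - aff a b a' b' t) - (s - t)\<bar> \<le> \<bar>(b' - a') - (b - a)\<bar>"
proof -
  have e: "(aff a b a' b' s - aff a b a' b' t) - (s - t) = ((s - t) / (b - a)) * ((b' - a') - (b - a))"
  proof -
    have "aff a b a' b' s - aff a b a' b' t = (s - t) / (b - a) * (b' - a')"
    proof -
      define m where "m = (b' - a') / (b - a)"
      have "aff a b a' b' s - aff a b a' b' t = (s - t) * m" by (simp add: aff_def m_def[symmetric] algebra_simps)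
      then show ?thesis by (simp add: m_def)
    qed
    moreover have "s - t = (s - t) / (b - a) * (b - a)" using assms(1) by simp
    ultimately show ?thesis by (simp only: right_diff_distrib)
  qed
  have "\<bar>(s - t) / (b - a)\<bar> \<le> 1" using assms by (auto simp: abs_le_iff divide_le_eq minus_divide_left)
  from mult_right_mono[OF this, of "\<bar>(b' - a') - (b - a)\<bar>"] show ?thesis
    unfolding e abs_mult by simp
qed

lemma aff_cont: "continuous_on S (aff a b a' b')"
  unfolding aff_def divide_inverse by (intro continuous_intros)

text \<open>After the substitution the integrands differ by \<open>e\<close> and by the deviation of
  the slope \<kappa> from 1. Times \<open>b - a\<close>, this deviation is exactly the difference of
  the two lengths. Reversed endpoints give integrals over empty sets on both sides.\<close>

lemma integral_aff:
  fixes h1 h2 :: "real \<Rightarrow> real"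
  assumes ab: "a < b" "a' < b'" and h1: "continuous_on {a..b} h1" and h2: "continuous_on {a'..b'} h2"
    and close: "\<And>u. u \<in> {a..b} \<Longrightarrow> \<bar>h1 u - h2 (aff a b a' b' u)\<bar> \<le> e"
    and B: "\<And>v. v \<in> {a'..b'} \<Longrightarrow> \<bar>h2 v\<bar> \<le> B" and e: "0 \<le> e"
    and s: "s \<in> {a..b}" and t: "t \<in> {a..b}"
  shows "\<bar>integral {s..t} h1 - integral {aff a b a' b' s..aff a b a' b' t} h2\<bar>
     \<le> (b - a) * e + B * \<bar>(b' - a') - (b - a)\<bar>"
proof (cases "s \<le> t")
  case False
  then have "s > t" by simp
  moreover have "aff a b a' b' s > aff a b a' b' t"
    using \<open>s > t\<close> ab by (simp add: aff_def divide_strict_right_mono)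
  moreover have "0 \<le> B" using B[of a'] ab by force
  ultimately show ?thesis using ab e by simp
next
  case True
  let ?\<psi> = "aff a b a' b'"
  define \<kappa> where "\<kappa> = (b' - a') / (b - a)"
  have B0: "0 \<le> B" using B[of a'] ab by force
  have sub: "{s..t} \<subseteq> {a..b}" using s t by auto
  have \<psi>im: "?\<psi> u \<in> {a'..b'}" if "u \<in> {s..t}" for u using aff_bounds[OF ab] sub that by blast
  have sb: "((\<lambda>u. \<kappa> *\<^sub>R h2 (?\<psi> u)) has_integral (integral {?\<psi> s..?\<psi> t} h2)) {s..t}"
  proof (rule has_integral_substitution[OF True aff_mono[OF ab True] _ h2])
    show "?\<psi> ` {s..t} \<subseteq> {a'..b'}" using \<psi>im by blast
    show "(?\<psi> has_real_derivative \<kappa>) (at x within {s..t})" for x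
      unfolding aff_def \<kappa>_def[symmetric] by (auto intro!: derivative_eq_intros)
  qed
  have "norm (integral {s..t} (\<lambda>u. h1 u - \<kappa> * h2 (?\<psi> u))) \<le> (e + \<bar>1 - \<kappa>\<bar> * B) * (t - s)"
  proof (rule integral_bound[OF True])
    have "continuous_on {s..t} (\<lambda>u. h2 (?\<psi> u))"
      by (rule continuous_on_compose2[OF h2 aff_cont]) (use \<psi>im in blast)
    then show "continuous_on {s..t} (\<lambda>u. h1 u - \<kappa> * h2 (?\<psi> u))"
      by (intro continuous_intros continuous_on_subset[OF h1 sub])
    fix u assume u: "u \<in> {s..t}"
    have "h1 u - \<kappa> * h2 (?\<psi> u) = (h1 u - h2 (?\<psi> u)) + (1 - \<kappa>) * h2 (?\<psi> u)" by (simp add: algebra_simps)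
    also have "\<bar>\<dots>\<bar> \<le> e + \<bar>1 - \<kappa>\<bar> * B"
    proof (rule order_trans[OF abs_triangle_ineq add_mono])
      show "\<bar>h1 u - h2 (?\<psi> u)\<bar> \<le> e" using close u sub by blast
      show "\<bar>(1 - \<kappa>) * h2 (?\<psi> u)\<bar> \<le> \<bar>1 - \<kappa>\<bar> * B" unfolding abs_mult by (intro mult_left_mono B \<psi>im u) simp
    qed
    finally show "norm (h1 u - \<kappa> * h2 (?\<psi> u)) \<le> e + \<bar>1 - \<kappa>\<bar> * B" by simp
  qed
  moreover have "integral {s..t} (\<lambda>u. h1 u - \<kappa> * h2 (?\<psi> u)) = integral {s..t} h1 - integral {?\<psi> s..?\<psi> t} h2"
  proof -
    have "(h1 has_integral integral {s..t} h1) {s..t}"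
      by (intro integrable_integral integrable_continuous_real continuous_on_subset[OF h1 sub])
    from has_integral_diff[OF this sb] show ?thesis by (simp add: integral_unique)
  qed
  moreover have "(e + \<bar>1 - \<kappa>\<bar> * B) * (t - s) \<le> (e + \<bar>1 - \<kappa>\<bar> * B) * (b - a)"
    using s t e B0 by (intro mult_left_mono) auto
  moreover have "(e + \<bar>1 - \<kappa>\<bar> * B) * (b - a) = (b - a) * e + B * \<bar>(b' - a') - (b - a)\<bar>"
  proof -
    have "\<bar>1 - \<kappa>\<bar> * (b - a) = \<bar>(1 - \<kappa>) * (b - a)\<bar>" using ab by (simp add: abs_mult)
    also have "(1 - \<kappa>) * (b - a) = (b - a) - (b' - a')" using ab by (simp add: \<kappa>_def field_simps)
    finally have "\<bar>1 - \<kappa>\<bar> * (b - a) = \<bar>(b' - a') - (b - a)\<bar>" by (simp add: abs_minus_commute)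
    then have "B * (\<bar>1 - \<kappa>\<bar> * (b - a)) = B * \<bar>(b' - a') - (b - a)\<bar>" by simp
    then show ?thesis by (simp add: algebra_simps)
  qed
  ultimately show ?thesis by simp
qed

lemma open_interval_length_le:
  fixes a b c :: real
  assumes ab: "a < b" and le: "\<And>s t. a < s \<Longrightarrow> s < t \<Longrightarrow> t < b \<Longrightarrow> t - s \<le> c"
  shows "b - a \<le> c"
proof (rule field_le_epsilon)
  fix e :: real assume e: "0 < e"
  define d where "d = min (e / 2) ((b - a) / 3)"
  have "0 < d" using e ab by (simp add: d_def)
  moreover have "d \<le> e / 2" unfolding d_def by (rule min.cobounded1)
  moreover have "d \<le> (b - a) / 3" unfolding d_def by (rule min.cobounded2)
  ultimately have d: "0 < d" "d \<le> e / 2" "d \<le> (b - a) / 3" .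
  have "(b - d) - (a + d) \<le> c" using d ab by (intro le) auto
  then show "b - a \<le> c + e" using d by linarith
qed

text \<open>Both maps are within \<open>e\<close> of the translation from \<open>a\<close> to
  \<open>a'\<close>: the affine one because the lengths differ by at most \<open>e\<close>, the
  given one by comparing \<open>s\<close> with points near the left end. That end belongs to neither
  open interval, hence the limiting arguments.\<close>

lemma almost_isometry_aff:
  fixes a b a' b' :: real
  assumes ab: "a < b" "a' < b'" and \<phi>: "strict_mono_on {a<..<b} \<phi>" "bij_betw \<phi> {a<..<b} {a'<..<b'}"
    and d: "\<And>s t. s \<in> {a<..<b} \<Longrightarrow> t \<in> {a<..<b} \<Longrightarrow> \<bar>(\<phi> s - \<phi> t) - (s - t)\<bar> \<le> e"
  shows "\<bar>(b' - a') - (b - a)\<bar> \<le> e" and "\<And>s. s \<in> {a<..<b} \<Longrightarrow> \<bar>\<phi> s - aff a b a' b' s\<bar> \<le> 2 * e"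
proof -
  have im: "\<phi> s \<in> {a'<..<b'}" if "s \<in> {a<..<b}" for s using \<phi>(2) that by (auto simp: bij_betw_def)
  have sur: "\<exists>s\<in>{a<..<b}. \<phi> s = y" if "y \<in> {a'<..<b'}" for y
  proof -
    have "y \<in> \<phi> ` {a<..<b}" using \<phi>(2) that by (simp only: bij_betw_def)
    then show ?thesis by auto
  qed
  have less: "s < t \<longleftrightarrow> \<phi> s < \<phi> t" if "s \<in> {a<..<b}" "t \<in> {a<..<b}" for s t
    using strict_mono_onD[OF \<phi>(1)] that by (metis linorder_neqE_linordered_idom order_less_asym)
  have "b - a \<le> (b' - a') + e"
  proof (rule open_interval_length_le[OF ab(1)])
    fix s t assume st: "a < s" "s < t" "t < b"
    then show "t - s \<le> b' - a' + e" using d[of t s] im[of s] im[of t] by auto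
  qed
  moreover have "b' - a' \<le> (b - a) + e"
  proof (rule open_interval_length_le[OF ab(2)])
    fix s' t' assume st: "a' < s'" "s' < t'" "t' < b'"
    obtain s where s: "s \<in> {a<..<b}" "\<phi> s = s'" using sur[of s'] st by auto
    obtain t where t: "t \<in> {a<..<b}" "\<phi> t = t'" using sur[of t'] st by auto
    show "t' - s' \<le> b - a + e" using d[OF t(1) s(1)] s t by auto
  qed
  ultimately show len: "\<bar>(b' - a') - (b - a)\<bar> \<le> e" by linarith
  fix s assume s: "s \<in> {a<..<b}"
  have "\<phi> s - a' \<le> (s - a) + e"
  proof (rule field_le_epsilon)
    fix d' :: real assume d': "0 < d'"
    define y where "y = a' + min ((\<phi> s - a') / 2) d'"
    have y: "y \<in> {a'<..<b'}" "y < \<phi> s" "y \<le> a' + d'" using im[OF s] d' by (auto simp: y_def min_def field_simps)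
    obtain t where t: "t \<in> {a<..<b}" "\<phi> t = y" using sur[OF y(1)] by blast
    show "\<phi> s - a' \<le> (s - a) + e + d'" using d[OF s t(1)] t y(3) by auto
  qed
  moreover have "(s - a) - e \<le> \<phi> s - a'"
  proof (rule field_le_epsilon)
    fix d' :: real assume d': "0 < d'"
    define t where "t = a + min ((s - a) / 2) d'"
    have t: "t \<in> {a<..<b}" "t \<le> a + d'" using s d' by (auto simp: t_def min_def field_simps)
    show "(s - a) - e \<le> \<phi> s - a' + d'" using d[OF s t(1)] im[OF t(1)] t(2) by auto
  qed
  moreover have "\<bar>(aff a b a' b' s - aff a b a' b' a) - (s - a)\<bar> \<le> e"
    using aff_diff[of a b s a a' b'] ab s len by force
  moreover have "aff a b a' b' a = a'" by (simp add: aff_def)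
  ultimately show "\<bar>\<phi> s - aff a b a' b' s\<bar> \<le> 2 * e" by linarith
qed

text \<open>Uniform continuity of \<open>f'\<close> on the compact interval permits exchanging the
  given bijection for the nearby affine map. Continuity then extends the estimate from the open
  interval to its closure.\<close>

lemma warping_converges_aff:
  fixes a b :: "nat \<Rightarrow> real"
  assumes w: "warping_converges (\<lambda>i. {a i<..<b i}) f {a'<..<b'} f'"
    and ab: "\<And>i. a i < b i" "a' < b'"
    and f: "\<And>i. continuous_on {a i..b i} (f i)" and f': "continuous_on {a'..b'} f'" and e: "0 < e"
  shows "\<forall>\<^sub>F i in sequentially. \<bar>(b' - a') - (b i - a i)\<bar> \<le> e \<and>
     (\<forall>s\<in>{a i..b i}. \<bar>f i s - f' (aff (a i) (b i) a' b' s)\<bar> \<le> e)"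
proof -
  obtain \<phi> where w1: "\<forall>i. strict_mono_on {a i<..<b i} (\<phi> i) \<and> bij_betw (\<phi> i) {a i<..<b i} {a'<..<b'}"
    and w2: "\<forall>e>0. \<forall>\<^sub>F i in sequentially. \<forall>s\<in>{a i<..<b i}. \<forall>t\<in>{a i<..<b i}. \<bar>(\<phi> i s - \<phi> i t) - (s - t)\<bar> \<le> e"
    and w3: "\<forall>e>0. \<forall>\<^sub>F i in sequentially. \<forall>s\<in>{a i<..<b i}. \<bar>f i s - f' (\<phi> i s)\<bar> \<le> e"
    using w unfolding warping_converges_def by - (elim exE conjE, rule that)
  have \<phi>: "strict_mono_on {a i<..<b i} (\<phi> i)" "bij_betw (\<phi> i) {a i<..<b i} {a'<..<b'}" for i
    using w1[rule_format, of i] by simp_all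
  have "uniformly_continuous_on {a'..b'} f'" by (intro compact_uniformly_continuous f') simp
  moreover have e2: "0 < e / 2" using e by simp
  ultimately obtain d where d: "0 < d" and d': "\<forall>x\<in>{a'..b'}. \<forall>y\<in>{a'..b'}. dist y x < d \<longrightarrow> dist (f' y) (f' x) < e / 2"
    unfolding uniformly_continuous_on_def by blast
  have d2: "\<bar>f' y - f' x\<bar> < e / 2" if "x \<in> {a'..b'}" "y \<in> {a'..b'}" "\<bar>y - x\<bar> < d" for x y
    using d'[rule_format, OF that(1,2)] that(3) by (simp add: dist_real_def)
  \<comment> \<open>The affine map is within \<open>2 * e1\<close> of the bijection, and this must
    stay below the modulus \<open>d\<close> of uniform continuity.\<close>
  define e1 where "e1 = min e (d / 3)"
  have e1: "0 < e1" "e1 \<le> e" "2 * e1 < d" using e d by (auto simp: e1_def)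
  show ?thesis using w2[rule_format, OF e1(1)] w3[rule_format, OF e2]
  proof eventually_elim
    case (elim i)
    note al = almost_isometry_aff[OF ab(1)[of i] ab(2) \<phi>(1,2)[of i], of e1]
    let ?\<psi> = "aff (a i) (b i) a' b'"
    have len: "\<bar>(b' - a') - (b i - a i)\<bar> \<le> e" using al(1) elim e1 by force
    have op: "\<bar>f i s - f' (?\<psi> s)\<bar> \<le> e" if s: "s \<in> {a i<..<b i}" for s
    proof -
      have "\<bar>\<phi> i s - ?\<psi> s\<bar> < d" using al(2)[OF _ s] elim(1) e1 by force
      moreover have "?\<psi> s \<in> {a'..b'}" using s by (intro aff_bounds ab) auto
      moreover have "\<phi> i s \<in> {a'..b'}" using bij_betwE[OF \<phi>(2)[of i]] s by force
      ultimately have "\<bar>f' (\<phi> i s) - f' (?\<psi> s)\<bar> < e / 2" by (intro d2)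
      moreover have "\<bar>f i s - f' (\<phi> i s)\<bar> \<le> e / 2" using elim(2) s by blast
      ultimately show ?thesis by linarith
    qed
    have cl: "closure {a i<..<b i} = {a i..b i}" using ab(1) by simp
    have cont: "continuous_on {a i..b i} (\<lambda>s. \<bar>f i s - f' (?\<psi> s)\<bar>)"
    proof (intro continuous_intros f)
      show "continuous_on {a i..b i} (\<lambda>s. f' (?\<psi> s))"
        by (rule continuous_on_compose2[OF f' aff_cont]) (use aff_bounds[OF ab(1,2)] in blast)
    qed
    have "\<bar>f i s - f' (?\<psi> s)\<bar> \<le> e" if "s \<in> {a i..b i}" for s
      using continuous_le_on_closure[of "{a i<..<b i}" "\<lambda>s. \<bar>f i s - f' (?\<psi> s)\<bar>" s e] cont op that
      unfolding cl by blast
    then show ?case using len by blast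
  qed
qed

section \<open>Convergence at a fixed level of the covers\<close>

text \<open>The triangle inequality in the plane for \<open>(1, y)\<close> and
  \<open>(0, x - y)\<close>.\<close>

lemma sqrt_one_plus_square_lipschitz: "\<bar>sqrt (1 + x\<^sup>2) - sqrt (1 + y\<^sup>2)\<bar> \<le> \<bar>x - y\<bar>" for x y :: real
proof -
  have "sqrt (1 + x\<^sup>2) \<le> sqrt (1 + y\<^sup>2) + \<bar>x - y\<bar>" for x y :: real
    using real_sqrt_sum_squares_triangle_ineq[of 1 0 y "x - y"] by simp
  from this[of x y] this[of y x] show ?thesis by linarith
qed

text \<open>The bound \<open>c / 2\<close> is what the approximating warping functions inherit from
  the bound \<open>c\<close> on the limit.\<close>

lemma reciprocal_lipschitz:
  fixes x y c :: real
  assumes "0 < c" "c / 2 \<le> x" "c / 2 \<le> y"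
  shows "\<bar>1 / x - 1 / y\<bar> \<le> 4 / c\<^sup>2 * \<bar>x - y\<bar>"
proof -
  have xy: "0 < x" "0 < y" using assms by auto
  have "\<bar>1 / x - 1 / y\<bar> = \<bar>x - y\<bar> * (1 / (x * y))"
    using xy by (simp add: abs_divide[symmetric] abs_mult[symmetric] diff_frac_eq abs_minus_commute)
  also have "\<dots> \<le> \<bar>x - y\<bar> * (1 / (c / 2 * (c / 2)))"
    using assms by (intro mult_left_mono frac_le mult_mono) auto
  also have "\<dots> = 4 / c\<^sup>2 * \<bar>x - y\<bar>" by (simp add: power2_eq_square)
  finally show ?thesis .
qed

text \<open>All data at one level \<open>k\<close> of the covers. The approximations
  \<open>\<Phi>\<close> form one family serving every \<delta>, so that the charts built from them
  do not depend on the accuracy.\<close>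

locale cone_level = L: covered_cone I' f' X' p' J'
  for I' :: "real set" and f' :: "real \<Rightarrow> real" and X' :: "'y metric" and p' :: 'y and J' :: "nat \<Rightarrow> real set" +
  fixes I :: "nat \<Rightarrow> real set" and f :: "nat \<Rightarrow> real \<Rightarrow> real" and X :: "nat \<Rightarrow> 'x metric" and p :: "nat \<Rightarrow> 'x"
    and J :: "nat \<Rightarrow> nat \<Rightarrow> real set" and k :: nat and a b :: "nat \<Rightarrow> real" and a' b' :: real and \<Phi> :: "nat \<Rightarrow> 'x \<Rightarrow> 'y"
  assumes C: "\<And>i. covered_cone (I i) (f i) (X i) (p i) (J i)" and k: "1 \<le> k"
    and J: "\<And>i. J i k = {a i<..<b i}" "J' k = {a'<..<b'}" and ab: "\<And>i. a i < b i" "a' < b'"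
    and warp: "warping_converges (\<lambda>i. J i k) f (J' k) f'"
    and \<Phi>: "\<And>\<delta>. 0 < \<delta> \<Longrightarrow> \<forall>\<^sub>F i in sequentially.
       GH_isometry \<delta> (submetric (X i) (mcball_of (X i) (p i) (2 ^ k))) (submetric X' (mcball_of X' p' (2 ^ k))) (\<Phi> i)"
begin

abbreviation \<psi> :: "nat \<Rightarrow> real \<Rightarrow> real" where "\<psi> i \<equiv> aff (a i) (b i) a' b'"

abbreviation ball where "ball i \<equiv> mcball_of (X i) (p i) (2 ^ k)"
abbreviation ball' where "ball' \<equiv> mcball_of X' p' (2 ^ k)"
abbreviation Y where "Y i \<equiv> gen_cone (I i) (f i) (X i)"
abbreviation Y' where "Y' \<equiv> gen_cone I' f' X'"

definition chart :: "nat \<Rightarrow> real \<times> 'x \<Rightarrow> real \<times> 'y" where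
  "chart i z = (\<psi> i (fst z), \<Phi> i (snd z))"

lemma level_warped: "warped_cone (I i) (f i) (X i)" and limit_warped: "warped_cone I' f' X'"
proof -
  interpret covered_cone "I i" "f i" "X i" "p i" "J i" by (rule C)
  show "warped_cone (I i) (f i) (X i)" by unfold_locales
  show "warped_cone I' f' X'" by unfold_locales
qed

lemma closure_J: "closure (J i k) = {a i..b i}" "closure (J' k) = {a'..b'}"
  using J ab by simp_all

lemma Icc_in_domain: "{a i..b i} \<subseteq> I i" "{a'..b'} \<subseteq> I'"
proof -
  interpret Ci: covered_cone "I i" "f i" "X i" "p i" "J i" by (rule C)
  show "{a i..b i} \<subseteq> I i" using Ci.J_props(5)[OF k] closure_J by simp
  show "{a'..b'} \<subseteq> I'" using L.J_props(5)[OF k] closure_J by simp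
qed

lemma interval_length_le: "b i - a i \<le> real k" "b' - a' \<le> real k"
proof -
  interpret Ci: covered_cone "I i" "f i" "X i" "p i" "J i" by (rule C)
  show "b i - a i \<le> real k" using Ci.J_props(7)[OF k] J(1)[of i] ab(1)[of i] by simp
  show "b' - a' \<le> real k" using L.J_props(7)[OF k] J(2) ab(2) by simp
qed

lemma f_cont: "continuous_on {a i..b i} (f i)" "continuous_on {a'..b'} f'"
  using warped_cone.cont[OF level_warped[of i]] warped_cone.cont[OF limit_warped] continuous_on_subset Icc_in_domain by blast+

lemma warp_eventually:
  assumes "0 < e"
  shows "\<forall>\<^sub>F i in sequentially. \<bar>(b' - a') - (b i - a i)\<bar> \<le> e \<and> (\<forall>s\<in>{a i..b i}. \<bar>f i s - f' (\<psi> i s)\<bar> \<le> e)"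
  by (rule warping_converges_aff[OF _ ab f_cont assms]) (use warp J in simp)

lemma f'_bounds:
  obtains c M where "0 < c" "0 < M" "\<And>t. t \<in> {a'..b'} \<Longrightarrow> c \<le> f' t" "\<And>t. t \<in> {a'..b'} \<Longrightarrow> f' t \<le> M"
proof -
  have ne: "{a'..b'} \<noteq> {}" using ab(2) by simp
  obtain u where u: "u \<in> {a'..b'}" "\<And>t. t \<in> {a'..b'} \<Longrightarrow> f' u \<le> f' t"
    using continuous_attains_inf[OF compact_Icc ne f_cont(2)] by blast
  obtain v where v: "v \<in> {a'..b'}" "\<And>t. t \<in> {a'..b'} \<Longrightarrow> f' t \<le> f' v"
    using continuous_attains_sup[OF compact_Icc ne f_cont(2)] by blast
  have "0 < f' u" "0 < f' v" using u(1) v(1) Icc_in_domain(2) L.pos by blast+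
  then show ?thesis using that u v by blast
qed

text \<open>Common core of the convergence of \<open>optical\<close> and \<open>energy\<close>.
  Uniformity over a whole family \<open>Q\<close> is essential: for the energies it covers all
  multipliers in a bounded range at once.\<close>

lemma profile_convergence:
  assumes c: "0 < c" "\<And>t. t \<in> {a'..b'} \<Longrightarrow> c \<le> f' t" and K: "0 \<le> K" and B: "0 \<le> B" and e: "0 < e"
    and Q: "\<And>q y y'. q \<in> Q \<Longrightarrow> c / 2 \<le> y \<Longrightarrow> c / 2 \<le> y' \<Longrightarrow> \<bar>q y - q y'\<bar> \<le> K * \<bar>y - y'\<bar>"
    and QB: "\<And>q y. q \<in> Q \<Longrightarrow> c \<le> y \<Longrightarrow> \<bar>q y\<bar> \<le> B"
  shows "\<forall>\<^sub>F i in sequentially. \<forall>q\<in>Q. \<forall>s\<in>{a i..b i}. \<forall>t\<in>{a i..b i}.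
    \<bar>integral {s..t} (\<lambda>u. q (f i u)) - integral {\<psi> i s..\<psi> i t} (\<lambda>u. q (f' u))\<bar> \<le> e"
proof -
  \<comment> \<open>The first bound keeps \<open>f i\<close> above \<open>c / 2\<close>, where the
    profiles are Lipschitz. The second makes the total error \<open>(real k * K + B) * e1\<close> at
    most \<open>e\<close>; the summand 1 avoids a zero denominator.\<close>
  define e1 where "e1 = min (c / 2) (e / (real k * K + B + 1))"
  have dpos: "0 < real k * K + B + 1" using K B by (simp add: add_nonneg_pos)
  have "0 < e1" using c(1) e dpos by (simp add: e1_def)
  moreover have "e1 \<le> c / 2" unfolding e1_def by (rule min.cobounded1)
  moreover have "e1 \<le> e / (real k * K + B + 1)" unfolding e1_def by (rule min.cobounded2)
  ultimately have e1: "0 < e1" "e1 \<le> c / 2" "e1 * (real k * K + B + 1) \<le> e" using dpos by (simp_all add: le_divide_eq)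
  show ?thesis using warp_eventually[OF e1(1)]
  proof eventually_elim
    case (elim i)
    show ?case
    proof (intro ballI)
      fix q s t assume q: "q \<in> Q" and s: "s \<in> {a i..b i}" and t: "t \<in> {a i..b i}"
      have fc: "c / 2 \<le> f i u" "c / 2 \<le> f' (\<psi> i u)" if u: "u \<in> {a i..b i}" for u
      proof -
        have "\<psi> i u \<in> {a'..b'}" by (rule aff_bounds[OF ab u])
        then have "c \<le> f' (\<psi> i u)" by (rule c(2))
        moreover have "\<bar>f i u - f' (\<psi> i u)\<bar> \<le> e1" using elim u by blast
        ultimately show "c / 2 \<le> f i u" "c / 2 \<le> f' (\<psi> i u)" using e1(2) c(1) by linarith+
      qed
      have "K-lipschitz_on {c / 2..} q"
        by (rule lipschitz_onI) (use Q[OF q] K in \<open>auto simp: dist_real_def\<close>)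
      then have qc: "continuous_on {c / 2..} q" by (rule lipschitz_on_continuous_on)
      have "\<bar>integral {s..t} (\<lambda>u. q (f i u)) - integral {\<psi> i s..\<psi> i t} (\<lambda>u. q (f' u))\<bar>
        \<le> (b i - a i) * (K * e1) + B * \<bar>(b' - a') - (b i - a i)\<bar>"
      proof (rule integral_aff[OF ab _ _ _ _ _ s t])
        show "continuous_on {a i..b i} (\<lambda>u. q (f i u))"
          by (rule continuous_on_compose2[OF qc f_cont(1)]) (use fc in auto)
        show "continuous_on {a'..b'} (\<lambda>u. q (f' u))"
          by (rule continuous_on_compose2[OF qc f_cont(2)]) (use c in force)
        show "\<bar>q (f i u) - q (f' (\<psi> i u))\<bar> \<le> K * e1" if u: "u \<in> {a i..b i}" for u
        proof -
          have "\<bar>q (f i u) - q (f' (\<psi> i u))\<bar> \<le> K * \<bar>f i u - f' (\<psi> i u)\<bar>" by (rule Q[OF q fc[OF u]])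
          also have "\<dots> \<le> K * e1" using elim u K by (intro mult_left_mono) auto
          finally show ?thesis .
        qed
        show "\<bar>q (f' v)\<bar> \<le> B" if "v \<in> {a'..b'}" for v by (rule QB[OF q c(2)[OF that]])
      qed (use K e1 in simp)
      also have "\<dots> \<le> real k * (K * e1) + B * e1"
        using elim interval_length_le(1)[of i] K B e1 by (intro add_mono mult_mono mult_left_mono mult_nonneg_nonneg) auto
      also have "\<dots> \<le> e1 * (real k * K + B + 1)" using e1(1) by (simp add: algebra_simps)
      also have "\<dots> \<le> e" by (rule e1(3))
      finally show "\<bar>integral {s..t} (\<lambda>u. q (f i u)) - integral {\<psi> i s..\<psi> i t} (\<lambda>u. q (f' u))\<bar> \<le> e" .
    qed
  qed
qed

lemma optical_convergence:
  assumes e: "0 < e"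
  shows "\<forall>\<^sub>F i in sequentially. \<forall>s\<in>{a i..b i}. \<forall>t\<in>{a i..b i}. \<bar>optical (f i) s t - optical f' (\<psi> i s) (\<psi> i t)\<bar> \<le> e"
proof -
  obtain c M where c: "0 < c" "0 < M" "\<And>t. t \<in> {a'..b'} \<Longrightarrow> c \<le> f' t" "\<And>t. t \<in> {a'..b'} \<Longrightarrow> f' t \<le> M"
    using f'_bounds by blast
  have "\<forall>\<^sub>F i in sequentially. \<forall>q\<in>{\<lambda>y. 1 / y}. \<forall>s\<in>{a i..b i}. \<forall>t\<in>{a i..b i}.
    \<bar>integral {s..t} (\<lambda>u. q (f i u)) - integral {\<psi> i s..\<psi> i t} (\<lambda>u. q (f' u))\<bar> \<le> e"
  proof (rule profile_convergence[OF c(1,3) _ _ e])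
    fix q :: "real \<Rightarrow> real" and y y' assume q: "q \<in> {\<lambda>y. 1 / y}"
    show "c / 2 \<le> y \<Longrightarrow> c / 2 \<le> y' \<Longrightarrow> \<bar>q y - q y'\<bar> \<le> 4 / c\<^sup>2 * \<bar>y - y'\<bar>"
      using reciprocal_lipschitz[OF c(1), of y y'] q by simp
    show "c \<le> y \<Longrightarrow> \<bar>q y\<bar> \<le> 1 / c" using q c(1) frac_le[of 1 1 c y] by simp
  qed (use c(1) in auto)
  then show ?thesis by (simp add: optical_def)
qed

lemma energy_convergence:
  assumes e: "0 < e" and L: "0 \<le> L"
  shows "\<forall>\<^sub>F i in sequentially. \<forall>\<nu>\<in>{0..L}. \<forall>s\<in>{a i..b i}. \<forall>t\<in>{a i..b i}.
    \<bar>energy (f i) \<nu> s t - energy f' \<nu> (\<psi> i s) (\<psi> i t)\<bar> \<le> e"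
proof -
  obtain c M where c: "0 < c" "0 < M" "\<And>t. t \<in> {a'..b'} \<Longrightarrow> c \<le> f' t" "\<And>t. t \<in> {a'..b'} \<Longrightarrow> f' t \<le> M"
    using f'_bounds by blast
  have "\<forall>\<^sub>F i in sequentially. \<forall>q\<in>(\<lambda>\<nu> y. sqrt (1 + (\<nu> / y)\<^sup>2)) ` {0..L}. \<forall>s\<in>{a i..b i}. \<forall>t\<in>{a i..b i}.
    \<bar>integral {s..t} (\<lambda>u. q (f i u)) - integral {\<psi> i s..\<psi> i t} (\<lambda>u. q (f' u))\<bar> \<le> e"
  proof (rule profile_convergence[OF c(1,3) _ _ e])
    fix q :: "real \<Rightarrow> real" and y y' assume "q \<in> (\<lambda>\<nu> y. sqrt (1 + (\<nu> / y)\<^sup>2)) ` {0..L}"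
    then obtain \<nu> where \<nu>: "0 \<le> \<nu>" "\<nu> \<le> L" "q = (\<lambda>y. sqrt (1 + (\<nu> / y)\<^sup>2))" by auto
    show "\<bar>q y - q y'\<bar> \<le> (L * (4 / c\<^sup>2)) * \<bar>y - y'\<bar>" if "c / 2 \<le> y" "c / 2 \<le> y'"
    proof -
      have "\<bar>q y - q y'\<bar> \<le> \<bar>\<nu> / y - \<nu> / y'\<bar>" unfolding \<nu>(3) by (rule sqrt_one_plus_square_lipschitz)
      also have "\<dots> = \<nu> * \<bar>1 / y - 1 / y'\<bar>"
      proof -
        have "\<nu> / y - \<nu> / y' = \<nu> * (1 / y - 1 / y')" by (simp add: algebra_simps)
        then show ?thesis using \<nu>(1) by (simp add: abs_mult)
      qed
      also have "\<dots> \<le> L * (4 / c\<^sup>2 * \<bar>y - y'\<bar>)"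
        using \<nu> reciprocal_lipschitz[OF c(1) that] L by (intro mult_mono) auto
      finally show ?thesis by (simp only: mult.assoc)
    qed
    show "\<bar>q y\<bar> \<le> sqrt (1 + (L / c)\<^sup>2)" if "c \<le> y"
    proof -
      have "\<nu> / y \<le> L / c" "0 \<le> \<nu> / y" using \<nu> that c(1) by (auto intro!: frac_le)
      then have "(\<nu> / y)\<^sup>2 \<le> (L / c)\<^sup>2" by (intro power_mono)
      then show ?thesis by (simp add: \<nu>(3))
    qed
  qed (use c(1) L in auto)
  then show ?thesis by (simp add: energy_def)
qed

lemma chart_in:
  assumes "GH_isometry \<delta> (submetric (X i) (ball i)) (submetric X' ball') (\<Phi> i)" "z \<in> {a i..b i} \<times> ball i"
  shows "chart i z \<in> {a'..b'} \<times> ball'"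
proof -
  have "ball i \<subseteq> mspace (X i)" "ball' \<subseteq> mspace X'" by auto
  then have "\<Phi> i (snd z) \<in> ball'" using assms unfolding GH_isometry_def by auto
  moreover have "\<psi> i (fst z) \<in> {a'..b'}" using assms(2) by (intro aff_bounds ab) auto
  ultimately show ?thesis by (simp add: chart_def)
qed

lemma chart_dist:
  assumes "GH_isometry \<delta> (submetric (X i) (ball i)) (submetric X' ball') (\<Phi> i)" "x \<in> ball i" "y \<in> ball i"
  shows "\<bar>mdist X' (\<Phi> i x) (\<Phi> i y) - mdist (X i) x y\<bar> < \<delta>"
proof -
  have "x \<in> mspace (submetric (X i) (ball i))" "y \<in> mspace (submetric (X i) (ball i))" using assms by auto
  then show ?thesis using assms(1) unfolding GH_isometry_def by simp
qed

lemma chart_GH_isometry: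
  assumes \<delta>: "0 < \<delta>"
  shows "\<forall>\<^sub>F i in sequentially. GH_isometry \<delta> (cl_metric (Y i) (cone_cover (X i) (p i) (J i) k))
     (cl_metric Y' (cone_cover X' p' J' k)) (chart i)"
proof -
  have d2: "0 < \<delta> / 2" "0 < \<delta> / 4" using \<delta> by auto
  show ?thesis using \<Phi>[OF d2(1)] warp_eventually[OF d2(2)]
  proof eventually_elim
    case (elim i)
    interpret Ci: covered_cone "I i" "f i" "X i" "p i" "J i" by (rule C)
    note A = Ci.cl_metric_cover[OF k, unfolded closure_J] and B = L.cl_metric_cover[OF k, unfolded closure_J]
    show ?case unfolding GH_isometry_def A B
    proof (intro conjI ballI)
      show "chart i \<in> {a i..b i} \<times> ball i \<rightarrow> {a'..b'} \<times> ball'" using chart_in[OF elim(1)] by blast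
      fix z w assume z: "z \<in> {a i..b i} \<times> ball i" and w: "w \<in> {a i..b i} \<times> ball i"
      define u1 u2 v1 v2 where "u1 = \<psi> i (fst z) - \<psi> i (fst w)" and "u2 = mdist X' (\<Phi> i (snd z)) (\<Phi> i (snd w))"
        and "v1 = fst z - fst w" and "v2 = mdist (X i) (snd z) (snd w)"
      have "\<bar>u1 - v1\<bar> \<le> \<bar>(b' - a') - (b i - a i)\<bar>" unfolding u1_def v1_def
        using z w by (intro aff_diff ab) auto
      then have 1: "\<bar>u1 - v1\<bar> \<le> \<delta> / 4" using elim(2) by linarith
      have 2: "\<bar>u2 - v2\<bar> < \<delta> / 2" unfolding u2_def v2_def using z w by (intro chart_dist[OF elim(1)]) auto
      have tri: "sqrt (x1\<^sup>2 + x2\<^sup>2) \<le> sqrt (y1\<^sup>2 + y2\<^sup>2) + (\<bar>x1 - y1\<bar> + \<bar>x2 - y2\<bar>)" for x1 x2 y1 y2 :: real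
        using real_sqrt_sum_squares_triangle_ineq[of y1 "x1 - y1" y2 "x2 - y2"]
          sqrt_sum_squares_le_sum_abs[of "x1 - y1" "x2 - y2"] by simp
      have "\<bar>sqrt (u1\<^sup>2 + u2\<^sup>2) - sqrt (v1\<^sup>2 + v2\<^sup>2)\<bar> < \<delta>"
        using tri[of u1 u2 v1 v2] tri[of v1 v2 u1 u2] 1 2 \<delta> by linarith
      then show "\<bar>mdist (met Y') (chart i z) (chart i w) - mdist (met (Y i)) z w\<bar> < \<delta>"
        unfolding L.mdist_cone Ci.mdist_cone chart_def fst_conv snd_conv u1_def u2_def v1_def v2_def .
    next
      show "nbhd (cl_metric Y' (cone_cover X' p' J' k)) \<delta> (chart i ` ({a i..b i} \<times> ball i)) = {a'..b'} \<times> ball'"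
      proof (intro subset_antisym subsetI)
        fix w assume "w \<in> nbhd (cl_metric Y' (cone_cover X' p' J' k)) \<delta> (chart i ` ({a i..b i} \<times> ball i))"
        then show "w \<in> {a'..b'} \<times> ball'" unfolding nbhd_def using B(1) by (metis UN_iff in_mball_of)
      next
        fix w assume w: "w \<in> {a'..b'} \<times> ball'"
        have "snd w \<in> mspace (submetric X' ball')" using w by auto
        then have "snd w \<in> nbhd (submetric X' ball') (\<delta> / 2) (\<Phi> i ` mspace (submetric (X i) (ball i)))"
          using elim(1) unfolding GH_isometry_def by blast
        then obtain x where x: "x \<in> ball i" "mdist X' (\<Phi> i x) (snd w) < \<delta> / 2" unfolding nbhd_def by auto
        \<comment> \<open>The affine map is invertible, so the time coordinate is hit exactly and
          the whole error sits in the fibre.\<close>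
        define z where "z = (aff a' b' (a i) (b i) (fst w), x)"
        have z: "z \<in> {a i..b i} \<times> ball i" unfolding z_def using w x(1) aff_bounds[OF ab(2) ab(1)] by auto
        have cz: "chart i z = (fst w, \<Phi> i x)" unfolding chart_def z_def using aff_inverse[OF ab] by simp
        have "mdist (met Y') (chart i z) w \<le> mdist X' (\<Phi> i x) (snd w)"
          using L.mdist_cone_le[of "chart i z" w] unfolding cz by simp
        then have "mdist (met Y') (chart i z) w < \<delta>" using x(2) d2 by linarith
        then have "w \<in> mball_of (cl_metric Y' (cone_cover X' p' J' k)) (chart i z) \<delta>"
          unfolding in_mball_of B using w chart_in[OF elim(1) z] by blast
        then show "w \<in> nbhd (cl_metric Y' (cone_cover X' p' J' k)) \<delta> (chart i ` ({a i..b i} \<times> ball i))"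
          unfolding nbhd_def using z by blast
      qed
    qed
  qed
qed

end

section \<open>Time separation and causality along the charts\<close>

context cone_level
begin

abbreviation K where "K i \<equiv> {a i..b i} \<times> ball i"
abbreviation K' where "K' \<equiv> {a'..b'} \<times> ball'"

lemma K_sub: "K i \<subseteq> I i \<times> mspace (X i)" "K' \<subseteq> I' \<times> mspace X'"
  using Icc_in_domain by auto

lemma energy_endpoints:
  assumes c: "0 < c" "\<And>t. t \<in> {a'..b'} \<Longrightarrow> c \<le> f' t" and \<nu>: "\<nu> \<in> {0..\<Lambda>}"
    and s: "s \<in> {a'..b'}" "s' \<in> {a'..b'}" and t: "t \<in> {a'..b'}" "t' \<in> {a'..b'}"
  shows "\<bar>energy f' \<nu> s t - energy f' \<nu> s' t'\<bar> \<le> sqrt (1 + (\<Lambda> / c)\<^sup>2) * (\<bar>s - s'\<bar> + \<bar>t - t'\<bar>)"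
  unfolding energy_def
proof (rule integral_endpoints_lipschitz[OF continuous_on_subset[OF L.cont_energy Icc_in_domain(2)] _ s(1) t(1) s(2) t(2)])
  fix u assume u: "u \<in> {a'..b'}"
  have "\<nu> / f' u \<le> \<Lambda> / c" "0 \<le> \<nu> / f' u" using \<nu> c(1) c(2)[OF u] by (auto intro!: frac_le)
  then have "(\<nu> / f' u)\<^sup>2 \<le> (\<Lambda> / c)\<^sup>2" by (intro power_mono)
  then show "0 \<le> sqrt (1 + (\<nu> / f' u)\<^sup>2) \<and> sqrt (1 + (\<nu> / f' u)\<^sup>2) \<le> sqrt (1 + (\<Lambda> / c)\<^sup>2)" by simp
qed

text \<open>For multipliers up to \<Lambda> the dual values of the two cones differ by at most
  \<open>\<epsilon> / 2\<close>. Truncation costs another \<open>\<epsilon> / 2\<close>, and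
  \<open>cone_tsep_compare\<close> is applied in both directions. The radius does not depend on
  \<open>i\<close>.\<close>

lemma tsep_convergence:
  assumes \<epsilon>: "0 < \<epsilon>"
  shows "\<exists>\<delta>\<^sub>0>0. \<forall>\<^sub>F i in sequentially. \<forall>xi\<in>K i. \<forall>yi\<in>K i. \<forall>x\<in>K'. \<forall>y\<in>K'.
     mdist (met Y') (chart i xi) x + mdist (met Y') (chart i yi) y \<le> \<delta>\<^sub>0 \<longrightarrow>
     tsep (Y i) xi yi \<le> tsep Y' x y + ennreal \<epsilon> \<and> tsep Y' x y \<le> tsep (Y i) xi yi + ennreal \<epsilon>"
proof -
  obtain c M where c: "0 < c" "0 < M" "\<And>t. t \<in> {a'..b'} \<Longrightarrow> c \<le> f' t" "\<And>t. t \<in> {a'..b'} \<Longrightarrow> f' t \<le> M"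
    using f'_bounds by blast
  \<comment> \<open>\<open>M + 1\<close> eventually bounds both warping functions and
    \<open>k\<close> both interval lengths, so the truncation error
    \<open>(M + 1) * k / (2 * \<Lambda>)\<close> is \<open>\<epsilon> / 2\<close>.\<close>
  define \<Lambda> where "\<Lambda> = (M + 1) * real k / \<epsilon>"
  have \<Lambda>: "0 < \<Lambda>" using c(2) k \<epsilon> by (simp add: \<Lambda>_def)
  define B where "B = sqrt (1 + (\<Lambda> / c)\<^sup>2)"
  have B: "0 < B" by (simp add: B_def add_pos_nonneg)
  \<comment> \<open>Of the allowed \<open>\<epsilon> / 2\<close>, moving times and fibre points uses
    \<open>(B + \<Lambda>) * \<delta>0 = \<epsilon> / 8\<close>. The distortion of
    \<open>\<Phi>\<close> uses \<open>\<Lambda> * \<eta> = \<epsilon> / 8\<close>, and the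
    convergence of the energies another \<open>\<epsilon> / 8\<close>.\<close>
  define \<delta>0 where "\<delta>0 = \<epsilon> / 8 / (B + \<Lambda>)"
  have "B + \<Lambda> \<noteq> 0" using B \<Lambda> by simp
  moreover have "S * (\<epsilon> / 8 / S) = \<epsilon> / 8" if "S \<noteq> 0" for S using that by simp
  ultimately have \<delta>0: "0 < \<delta>0" "(B + \<Lambda>) * \<delta>0 = \<epsilon> / 8" using B \<Lambda> \<epsilon> unfolding \<delta>0_def by (simp, blast)
  define \<eta> where "\<eta> = \<epsilon> / (8 * \<Lambda>)"
  have \<eta>: "0 < \<eta>" "\<Lambda> * \<eta> = \<epsilon> / 8" using \<Lambda> \<epsilon> by (simp_all add: \<eta>_def)
  have \<epsilon>8: "0 < \<epsilon> / 8" "0 \<le> \<Lambda>" using \<epsilon> \<Lambda> by simp_all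
  have trunc: "(M + 1) * d / (2 * \<Lambda>) \<le> \<epsilon> / 2" if "d \<le> real k" for d
  proof -
    have "(M + 1) * d / (2 * \<Lambda>) \<le> (M + 1) * real k / (2 * \<Lambda>)"
      using that c(2) \<Lambda> by (intro divide_right_mono mult_left_mono) auto
    also have "\<dots> = \<epsilon> / 2" using c(2) k \<epsilon> by (simp add: \<Lambda>_def)
    finally show ?thesis .
  qed
  show ?thesis
  proof (intro exI[of _ \<delta>0] conjI \<delta>0(1))
    show "\<forall>\<^sub>F i in sequentially. \<forall>xi\<in>K i. \<forall>yi\<in>K i. \<forall>x\<in>K'. \<forall>y\<in>K'.
      mdist (met Y') (chart i xi) x + mdist (met Y') (chart i yi) y \<le> \<delta>0 \<longrightarrow>
      tsep (Y i) xi yi \<le> tsep Y' x y + ennreal \<epsilon> \<and> tsep Y' x y \<le> tsep (Y i) xi yi + ennreal \<epsilon>"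
      using \<Phi>[OF \<eta>(1)] energy_convergence[OF \<epsilon>8] warp_eventually[OF zero_less_one]
    proof eventually_elim
      case (elim i)
      show ?case
      proof (intro ballI impI)
        fix xi yi x y assume xi: "xi \<in> K i" and yi: "yi \<in> K i" and x: "x \<in> K'" and y: "y \<in> K'"
          and d: "mdist (met Y') (chart i xi) x + mdist (met Y') (chart i yi) y \<le> \<delta>0"
        have xyi: "xi \<in> I i \<times> mspace (X i)" "yi \<in> I i \<times> mspace (X i)" and xy: "x \<in> I' \<times> mspace X'" "y \<in> I' \<times> mspace X'"
          using K_sub xi yi x y by blast+
        have f1: "fst xi \<in> {a i..b i}" "fst yi \<in> {a i..b i}" "fst x \<in> {a'..b'}" "fst y \<in> {a'..b'}"
          "snd xi \<in> ball i" "snd yi \<in> ball i" "snd x \<in> ball'" "snd y \<in> ball'"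
          using xi yi x y by (auto simp: mem_Times_iff)
        have \<psi>in: "\<psi> i (fst xi) \<in> {a'..b'}" "\<psi> i (fst yi) \<in> {a'..b'}" using f1 by (intro aff_bounds ab; simp)+
        have \<Phi>in: "\<Phi> i (snd xi) \<in> mspace X'" "\<Phi> i (snd yi) \<in> mspace X'"
          using chart_in[OF elim(1) xi] chart_in[OF elim(1) yi] by (auto simp: chart_def)
        have sX: "snd x \<in> mspace X'" "snd y \<in> mspace X'" using f1 by auto
        have g: "\<bar>\<psi> i (fst xi) - fst x\<bar> \<le> mdist (met Y') (chart i xi) x" "mdist X' (\<Phi> i (snd xi)) (snd x) \<le> mdist (met Y') (chart i xi) x"
          "\<bar>\<psi> i (fst yi) - fst y\<bar> \<le> mdist (met Y') (chart i yi) y" "mdist X' (\<Phi> i (snd yi)) (snd y) \<le> mdist (met Y') (chart i yi) y"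
          using L.mdist_cone_ge[of "chart i xi" x] L.mdist_cone_ge[of "chart i yi" y] by (simp_all add: chart_def)
        have time: "\<bar>\<psi> i (fst xi) - fst x\<bar> + \<bar>\<psi> i (fst yi) - fst y\<bar> \<le> \<delta>0" using g d by linarith
        define ri where "ri = mdist (X i) (snd xi) (snd yi)"
        define r where "r = mdist X' (snd x) (snd y)"
        have rr: "\<bar>ri - r\<bar> \<le> \<delta>0 + \<eta>"
        proof -
          have "\<bar>mdist X' (\<Phi> i (snd xi)) (\<Phi> i (snd yi)) - ri\<bar> < \<eta>"
            unfolding ri_def by (rule chart_dist[OF elim(1) f1(5,6)])
          moreover have "mdist X' (\<Phi> i (snd xi)) (\<Phi> i (snd yi)) \<le> mdist X' (\<Phi> i (snd xi)) (snd x) + r + mdist X' (snd y) (\<Phi> i (snd yi))"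
            unfolding r_def using L.X.triangle[OF \<Phi>in(1) sX(1) \<Phi>in(2)] L.X.triangle[OF sX(1) sX(2) \<Phi>in(2)] by linarith
          moreover have "r \<le> mdist X' (snd x) (\<Phi> i (snd xi)) + mdist X' (\<Phi> i (snd xi)) (\<Phi> i (snd yi)) + mdist X' (\<Phi> i (snd yi)) (snd y)"
            unfolding r_def using L.X.triangle[OF sX(1) \<Phi>in(1) sX(2)] L.X.triangle[OF \<Phi>in(1) \<Phi>in(2) sX(2)] by linarith
          ultimately show ?thesis using g(2,4) d L.X.commute[of "snd x" "\<Phi> i (snd xi)"] L.X.commute[of "snd y" "\<Phi> i (snd yi)"]
            by linarith
        qed
        have en: "\<bar>(energy (f i) \<nu> (fst xi) (fst yi) - \<nu> * ri) - (energy f' \<nu> (fst x) (fst y) - \<nu> * r)\<bar> \<le> \<epsilon> / 2"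
          if \<nu>: "\<nu> \<in> {0..\<Lambda>}" for \<nu>
        proof -
          have 1: "\<bar>energy (f i) \<nu> (fst xi) (fst yi) - energy f' \<nu> (\<psi> i (fst xi)) (\<psi> i (fst yi))\<bar> \<le> \<epsilon> / 8"
            using elim(2) \<nu> f1 by blast
          have "\<bar>energy f' \<nu> (\<psi> i (fst xi)) (\<psi> i (fst yi)) - energy f' \<nu> (fst x) (fst y)\<bar>
            \<le> B * (\<bar>\<psi> i (fst xi) - fst x\<bar> + \<bar>\<psi> i (fst yi) - fst y\<bar>)"
            unfolding B_def by (rule energy_endpoints[OF c(1,3) \<nu> \<psi>in(1) f1(3) \<psi>in(2) f1(4)])
          also have "\<dots> \<le> B * \<delta>0" using time B by (intro mult_left_mono) auto
          finally have 2: "\<bar>energy f' \<nu> (\<psi> i (fst xi)) (\<psi> i (fst yi)) - energy f' \<nu> (fst x) (fst y)\<bar> \<le> B * \<delta>0" .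
          have "\<bar>\<nu> * ri - \<nu> * r\<bar> = \<nu> * \<bar>ri - r\<bar>" using \<nu> by (simp add: right_diff_distrib[symmetric] abs_mult)
          also have "\<dots> \<le> \<Lambda> * (\<delta>0 + \<eta>)" using \<nu> rr \<Lambda> by (intro mult_mono) auto
          finally have 3: "\<bar>\<nu> * ri - \<nu> * r\<bar> \<le> \<Lambda> * \<delta>0 + \<Lambda> * \<eta>" by (simp add: distrib_left)
          have "B * \<delta>0 + \<Lambda> * \<delta>0 = \<epsilon> / 8" using \<delta>0(2) by (simp add: distrib_right)
          then show ?thesis using 1 2 3 \<eta>(2) \<epsilon> by linarith
        qed
        have M1: "f i u \<le> M + 1" if u: "u \<in> {fst xi..fst yi}" for u
        proof -
          have u': "u \<in> {a i..b i}" using u f1(1,2) by auto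
          have "f' (\<psi> i u) \<le> M" by (rule c(4)[OF aff_bounds[OF ab u']])
          moreover have "\<bar>f i u - f' (\<psi> i u)\<bar> \<le> 1" using elim(3) u' by blast
          ultimately show ?thesis by linarith
        qed
        have M2: "f' u \<le> M + 1" if u: "u \<in> {fst x..fst y}" for u
          using c(4)[of u] u f1(3,4) by force
        have l1: "fst yi - fst xi \<le> real k" "fst y - fst x \<le> real k" using interval_length_le(1)[of i] interval_length_le(2) f1(1-4) by auto
        have half: "0 \<le> \<epsilon> / 2" using \<epsilon> by simp
        have "tsep (Y i) xi yi \<le> tsep Y' x y + ennreal (\<epsilon> / 2 + \<epsilon> / 2)"
        proof (rule cone_tsep_compare[OF level_warped limit_warped xyi xy M2 \<Lambda> half half trunc[OF l1(2)]])
          fix \<nu> assume "\<nu> \<in> {0..\<Lambda>}"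
          from en[OF this] show "energy (f i) \<nu> (fst xi) (fst yi) - \<nu> * mdist (X i) (snd xi) (snd yi)
            \<le> energy f' \<nu> (fst x) (fst y) - \<nu> * mdist X' (snd x) (snd y) + \<epsilon> / 2"
            unfolding ri_def r_def by linarith
        qed
        moreover have "tsep Y' x y \<le> tsep (Y i) xi yi + ennreal (\<epsilon> / 2 + \<epsilon> / 2)"
        proof (rule cone_tsep_compare[OF limit_warped level_warped xy xyi M1 \<Lambda> half half trunc[OF l1(1)]])
          fix \<nu> assume "\<nu> \<in> {0..\<Lambda>}"
          from en[OF this] show "energy f' \<nu> (fst x) (fst y) - \<nu> * mdist X' (snd x) (snd y)
            \<le> energy (f i) \<nu> (fst xi) (fst yi) - \<nu> * mdist (X i) (snd xi) (snd yi) + \<epsilon> / 2"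
            unfolding ri_def r_def by linarith
        qed
        ultimately show "tsep (Y i) xi yi \<le> tsep Y' x y + ennreal \<epsilon> \<and> tsep Y' x y \<le> tsep (Y i) xi yi + ennreal \<epsilon>"
          by simp
      qed
    qed
  qed
qed

text \<open>There need not be room in \<open>K'\<close> to repair a
  given pair explicitly, hence the compactness argument.\<close>

lemma nearly_causal:
  assumes \<delta>: "0 < \<delta>"
  shows "\<exists>\<eta>>0. \<forall>z\<in>K'. \<forall>w\<in>K'. fst z \<le> fst w \<and> mdist X' (snd z) (snd w) \<le> optical f' (fst z) (fst w) + \<eta> \<longrightarrow>
     (\<exists>z'\<in>K'. \<exists>w'\<in>K'. mdist (met Y') z z' + mdist (met Y') w w' \<le> \<delta> \<and> caus Y' z' w')"
proof (rule ccontr)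
  interpret Y: Metric_space "mspace (met Y')" "mdist (met Y')" by simp
  \<comment> \<open>Counterexamples with tolerance \<open>1 / (n + 1)\<close>.\<close>
  define G where "G = (\<lambda>n z w. z \<in> K' \<and> w \<in> K' \<and> fst z \<le> fst w \<and>
      mdist X' (snd z) (snd w) \<le> optical f' (fst z) (fst w) + 1 / real (Suc n) \<and>
      \<not> (\<exists>z'\<in>K'. \<exists>w'\<in>K'. mdist (met Y') z z' + mdist (met Y') w w' \<le> \<delta> \<and> caus Y' z' w'))"
  assume neg: "\<not> ?thesis"
  have "\<forall>n::nat. \<exists>zw. G n (fst zw) (snd zw)"
  proof
    fix n :: nat
    have "0 < 1 / real (Suc n)" by simp
    then obtain z w where "G n z w" using neg unfolding G_def by blast
    then show "\<exists>zw. G n (fst zw) (snd zw)" by (intro exI[of _ "(z, w)"]) simp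
  qed
  from choice[OF this] obtain ZV where ZV': "\<And>n. G n (fst (ZV n)) (snd (ZV n))" by blast
  define Z V where "Z = (\<lambda>n. fst (ZV n))" and "V = (\<lambda>n. snd (ZV n))"
  have GZV: "G n (Z n) (V n)" for n using ZV' by (simp add: Z_def V_def)
  have Z: "Z n \<in> K'" and V: "V n \<in> K'" for n using GZV[of n] unfolding G_def by blast+
  have ZV: "fst (Z n) \<le> fst (V n)"
    "mdist X' (snd (Z n)) (snd (V n)) \<le> optical f' (fst (Z n)) (fst (V n)) + 1 / real (Suc n)" for n
    using GZV[of n] unfolding G_def by blast+
  have bad: "\<delta> < mdist (met Y') (Z n) z' + mdist (met Y') (V n) w'" if "z' \<in> K'" "w' \<in> K'" "caus Y' z' w'" for n z' w'
    using GZV[of n] that unfolding G_def by (meson not_le)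
  have cK: "compactin Y.mtopology K'"
    using L.compact_cover[OF k] unfolding closure_J by (simp add: mtopology_of_def)
  have seq: "\<exists>l r. l \<in> K' \<and> strict_mono r \<and> (\<lambda>n. mdist (met Y') (\<sigma> (r n)) l) \<longlonglongrightarrow> 0"
    if \<sigma>: "\<And>n. \<sigma> n \<in> K'" for \<sigma> :: "nat \<Rightarrow> real \<times> 'y"
  proof -
    have "range \<sigma> \<subseteq> K'" using \<sigma> by blast
    then obtain l and r :: "nat \<Rightarrow> nat" where lr: "l \<in> K'" "strict_mono r" "limitin Y.mtopology (\<sigma> \<circ> r) l sequentially"
      using cK unfolding Y.compactin_sequentially by blast
    then have "((\<lambda>n. mdist (met Y') ((\<sigma> \<circ> r) n) l) \<longlongrightarrow> 0) sequentially"
      by (simp add: Y.limitin_metric_dist_null)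
    then have "(\<lambda>n. mdist (met Y') (\<sigma> (r n)) l) \<longlonglongrightarrow> 0" by (simp add: comp_def)
    then show ?thesis using lr by blast
  qed
  obtain z r where z: "z \<in> K'" and r: "strict_mono r" and zlim: "(\<lambda>n. mdist (met Y') (Z (r n)) z) \<longlonglongrightarrow> 0"
    using seq[of Z] Z by blast
  obtain w q where w: "w \<in> K'" and q: "strict_mono q" and wlim: "(\<lambda>n. mdist (met Y') (V (r (q n))) w) \<longlonglongrightarrow> 0"
    using seq[of "\<lambda>n. V (r n)"] V by blast
  define m where "m = (\<lambda>n. r (q n))"
  \<comment> \<open>One subsequence along which both coordinates converge. The time order and the
    optical inequality are closed conditions, so they pass to the limit pair.\<close>
  have m: "strict_mono m" using r q by (simp add: m_def strict_mono_def)
  have zl: "(\<lambda>n. mdist (met Y') (Z (m n)) z) \<longlonglongrightarrow> 0"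
    using LIMSEQ_subseq_LIMSEQ[OF zlim q] by (simp add: m_def comp_def)
  have wl: "(\<lambda>n. mdist (met Y') (V (m n)) w) \<longlonglongrightarrow> 0" using wlim by (simp add: m_def)
  have dl: "(\<lambda>n. mdist (met Y') (Z (m n)) z + mdist (met Y') (V (m n)) w) \<longlonglongrightarrow> 0"
    using tendsto_add[OF zl wl] by simp
  define D where "D = (\<lambda>n. mdist (met Y') (Z (m n)) z + mdist (met Y') (V (m n)) w)"
  have Dl: "D \<longlonglongrightarrow> 0" using dl by (simp add: D_def)
  have D1: "\<bar>fst (Z (m n)) - fst z\<bar> + \<bar>fst (V (m n)) - fst w\<bar> \<le> D n"
    "mdist X' (snd (Z (m n))) (snd z) + mdist X' (snd (V (m n))) (snd w) \<le> D n" for n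
    unfolding D_def using L.mdist_cone_ge[of "Z (m n)" z] L.mdist_cone_ge[of "V (m n)" w] by linarith+
  have fs: "fst v \<in> {a'..b'}" "snd v \<in> mspace X'" if "v \<in> K'" for v using that by auto
  have time: "fst z \<le> fst w"
  proof (rule LIMSEQ_le[of "\<lambda>_. fst z" _ "\<lambda>n. fst w + D n"])
    show "(\<lambda>n. fst w + D n) \<longlonglongrightarrow> fst w" using tendsto_add[OF tendsto_const Dl] by simp
    have "fst z \<le> fst w + D n" for n using D1(1)[of n] ZV(1)[of "m n"] by linarith
    then show "\<exists>N. \<forall>n\<ge>N. fst z \<le> fst w + D n" by blast
  qed simp
  obtain c M where c: "0 < c" "0 < M" "\<And>t. t \<in> {a'..b'} \<Longrightarrow> c \<le> f' t" "\<And>t. t \<in> {a'..b'} \<Longrightarrow> f' t \<le> M"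
    using f'_bounds by blast
  have opt: "\<bar>optical f' (fst (Z (m n))) (fst (V (m n))) - optical f' (fst z) (fst w)\<bar> \<le> 1 / c * D n" for n
  proof -
    have "\<bar>optical f' (fst (Z (m n))) (fst (V (m n))) - optical f' (fst z) (fst w)\<bar>
       \<le> 1 / c * (\<bar>fst (Z (m n)) - fst z\<bar> + \<bar>fst (V (m n)) - fst w\<bar>)"
      unfolding optical_def
    proof (rule integral_endpoints_lipschitz[OF continuous_on_subset[OF L.cont_optical Icc_in_domain(2)]])
      show "0 \<le> 1 / f' u \<and> 1 / f' u \<le> 1 / c" if "u \<in> {a'..b'}" for u
        using c(1) c(3)[OF that] frac_le[of 1 1 c "f' u"] by simp
    qed (use fs(1) Z V z w in auto)
    also have "\<dots> \<le> 1 / c * D n" using D1(1)[of n] c(1) by (intro mult_left_mono) auto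
    finally show ?thesis .
  qed
  have "mdist X' (snd z) (snd w) \<le> optical f' (fst z) (fst w)"
  proof (rule LIMSEQ_le[of "\<lambda>_. mdist X' (snd z) (snd w)" _ "\<lambda>n. optical f' (fst z) (fst w) + (1 / c * D n + (1 / real (Suc (m n)) + D n))"])
    have "(\<lambda>n. 1 / real (Suc n)) \<longlonglongrightarrow> 0" by (rule LIMSEQ_Suc[OF lim_1_over_n])
    from LIMSEQ_subseq_LIMSEQ[OF this m] have "(\<lambda>n. 1 / real (Suc (m n))) \<longlonglongrightarrow> 0" by (simp add: comp_def)
    then have "(\<lambda>n. optical f' (fst z) (fst w) + (1 / c * D n + (1 / real (Suc (m n)) + D n)))
      \<longlonglongrightarrow> optical f' (fst z) (fst w) + (1 / c * 0 + (0 + 0))"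
      by (intro tendsto_add tendsto_mult tendsto_const Dl)
    then show "(\<lambda>n. optical f' (fst z) (fst w) + (1 / c * D n + (1 / real (Suc (m n)) + D n))) \<longlonglongrightarrow> optical f' (fst z) (fst w)"
      by simp
    have "mdist X' (snd z) (snd w) \<le> optical f' (fst z) (fst w) + (1 / c * D n + (1 / real (Suc (m n)) + D n))" for n
    proof -
      have Xs: "snd z \<in> mspace X'" "snd w \<in> mspace X'" "snd (Z (m n)) \<in> mspace X'" "snd (V (m n)) \<in> mspace X'"
        using fs(2) z w Z V by blast+
      have "mdist X' (snd z) (snd w) \<le> mdist X' (snd z) (snd (Z (m n))) + mdist X' (snd (Z (m n))) (snd (V (m n))) + mdist X' (snd (V (m n))) (snd w)"
        using L.X.triangle[OF Xs(1,3,2)] L.X.triangle[OF Xs(3,4,2)] by linarith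
      then show ?thesis using ZV(2)[of "m n"] opt[of n] D1(2)[of n] L.X.commute[of "snd z" "snd (Z (m n))"] by linarith
    qed
    then show "\<exists>N. \<forall>n\<ge>N. mdist X' (snd z) (snd w) \<le> optical f' (fst z) (fst w) + (1 / c * D n + (1 / real (Suc (m n)) + D n))"
      by blast
  qed simp
  then have "caus Y' z w" using time z w K_sub(2) L.cone_caus_iff[of z w] by blast
  \<comment> \<open>The limit pair is causal and lies in \<open>K'\<close>, so it would repair its
    own approximants as soon as \<open>D n\<close> drops below \<delta>.\<close>
  then have "\<delta> < D n" for n unfolding D_def by (rule bad[OF z w])
  moreover
  have "\<forall>\<^sub>F n in sequentially. D n < \<delta>" by (rule order_tendstoD(2)[OF Dl \<delta>])
  then obtain n where "D n < \<delta>" by (auto simp: eventually_sequentially)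
  ultimately show False by (metis less_asym)
qed

text \<open>Increasing affine maps preserve the time order exactly, so the image of a causal pair
  can violate causality only in the fibre distance. The violation is at most half of \<eta> from
  \<open>\<Phi>\<close> plus half from \<open>optical\<close>, and \<open>nearly_causal\<close>
  repairs it.\<close>

lemma causal_pairs_converge:
  assumes \<delta>: "0 < \<delta>"
  shows "\<forall>\<^sub>F i in sequentially. \<forall>xi\<in>K i. \<forall>yi\<in>K i. caus (Y i) xi yi \<longrightarrow>
    (\<exists>x'\<in>K'. \<exists>y'\<in>K'. mdist (met Y') (chart i xi) x' + mdist (met Y') (chart i yi) y' \<le> \<delta> \<and> caus Y' x' y')"
proof -
  obtain \<eta> where \<eta>: "\<eta> > 0" "\<And>z w. z\<in>K' \<Longrightarrow> w\<in>K' \<Longrightarrow> fst z \<le> fst w \<Longrightarrow>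
     mdist X' (snd z) (snd w) \<le> optical f' (fst z) (fst w) + \<eta> \<Longrightarrow>
     \<exists>z'\<in>K'. \<exists>w'\<in>K'. mdist (met Y') z z' + mdist (met Y') w w' \<le> \<delta> \<and> caus Y' z' w'"
    using nearly_causal[OF \<delta>] by blast
  have h: "0 < \<eta> / 2" using \<eta>(1) by simp
  show ?thesis using \<Phi>[OF h] optical_convergence[OF h]
  proof eventually_elim
    case (elim i)
    show ?case
    proof (intro ballI impI)
      fix xi yi assume xi: "xi \<in> K i" and yi: "yi \<in> K i" and ca: "caus (Y i) xi yi"
      have xyi: "xi \<in> I i \<times> mspace (X i)" "yi \<in> I i \<times> mspace (X i)" using K_sub xi yi by blast+
      have ci: "fst xi \<le> fst yi" "mdist (X i) (snd xi) (snd yi) \<le> optical (f i) (fst xi) (fst yi)"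
        using ca warped_cone.cone_caus_iff[OF level_warped xyi] by auto
      have f1: "fst xi \<in> {a i..b i}" "fst yi \<in> {a i..b i}" "snd xi \<in> ball i" "snd yi \<in> ball i"
        using xi yi by (auto simp: mem_Times_iff)
      show "\<exists>x'\<in>K'. \<exists>y'\<in>K'. mdist (met Y') (chart i xi) x' + mdist (met Y') (chart i yi) y' \<le> \<delta> \<and> caus Y' x' y'"
      proof (rule \<eta>(2))
        show "chart i xi \<in> K'" "chart i yi \<in> K'" using chart_in[OF elim(1)] xi yi by blast+
        show "fst (chart i xi) \<le> fst (chart i yi)" unfolding chart_def using aff_mono[OF ab ci(1)] by simp
        have "\<bar>mdist X' (\<Phi> i (snd xi)) (\<Phi> i (snd yi)) - mdist (X i) (snd xi) (snd yi)\<bar> < \<eta> / 2"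
          by (rule chart_dist[OF elim(1) f1(3,4)])
        moreover have "\<bar>optical (f i) (fst xi) (fst yi) - optical f' (\<psi> i (fst xi)) (\<psi> i (fst yi))\<bar> \<le> \<eta> / 2"
          using elim(2) f1 by blast
        ultimately show "mdist X' (snd (chart i xi)) (snd (chart i yi)) \<le> optical f' (fst (chart i xi)) (fst (chart i yi)) + \<eta>"
          unfolding chart_def fst_conv snd_conv using ci(2) by linarith
      qed
    qed
  qed
qed

text \<open>Passage from \<open>tsep\<close> to \<open>ell\<close>. The two agree on causally
  related pairs, so beyond \<open>tsep_convergence\<close> it has to be shown that the relevant
  pairs are causally related.\<close>

lemma ell_convergence:
  assumes \<epsilon>: "0 < \<epsilon>"
  shows "\<exists>\<delta>\<^sub>0>0. \<forall>\<delta>. 0 < \<delta> \<and> \<delta> < \<delta>\<^sub>0 \<longrightarrow> (\<forall>\<^sub>F i in sequentially.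
    ell_upper (Y i) (cl_metric (Y i) (cone_cover (X i) (p i) (J i) k)) Y' (cl_metric Y' (cone_cover X' p' J' k)) (chart i) \<epsilon> \<delta> \<and>
    (\<forall>l\<ge>1. \<epsilon> < 1 / (2 * real l) \<longrightarrow>
    ell_lower (Y i) (cl_metric (Y i) (cone_cover (X i) (p i) (J i) k)) Y' (cl_metric Y' (cone_cover X' p' J' k)) (chart i) l \<epsilon> \<delta>))"
proof -
  obtain \<delta>0 where \<delta>0: "0 < \<delta>0" and ev: "\<forall>\<^sub>F i in sequentially. \<forall>xi\<in>K i. \<forall>yi\<in>K i. \<forall>x\<in>K'. \<forall>y\<in>K'.
     mdist (met Y') (chart i xi) x + mdist (met Y') (chart i yi) y \<le> \<delta>0 \<longrightarrow>
     tsep (Y i) xi yi \<le> tsep Y' x y + ennreal \<epsilon> \<and> tsep Y' x y \<le> tsep (Y i) xi yi + ennreal \<epsilon>"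
    using tsep_convergence[OF \<epsilon>] by blast
  show ?thesis
  proof (intro exI[of _ \<delta>0] conjI \<delta>0 allI impI)
    fix \<delta> assume \<delta>: "0 < \<delta> \<and> \<delta> < \<delta>0"
    then have \<delta>p: "0 < \<delta>" by simp
    show "\<forall>\<^sub>F i in sequentially.
    ell_upper (Y i) (cl_metric (Y i) (cone_cover (X i) (p i) (J i) k)) Y' (cl_metric Y' (cone_cover X' p' J' k)) (chart i) \<epsilon> \<delta> \<and>
    (\<forall>l\<ge>1. \<epsilon> < 1 / (2 * real l) \<longrightarrow>
    ell_lower (Y i) (cl_metric (Y i) (cone_cover (X i) (p i) (J i) k)) Y' (cl_metric Y' (cone_cover X' p' J' k)) (chart i) l \<epsilon> \<delta>)"
      using ev causal_pairs_converge[OF \<delta>p]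
    proof eventually_elim
      case (elim i)
      interpret Ci: covered_cone "I i" "f i" "X i" "p i" "J i" by (rule C)
      note A = Ci.cl_metric_cover[OF k, unfolded closure_J] and B = L.cl_metric_cover[OF k, unfolded closure_J]
      have T: "tsep (Y i) xi yi \<le> tsep Y' x y + ennreal \<epsilon>" "tsep Y' x y \<le> tsep (Y i) xi yi + ennreal \<epsilon>"
        if "xi \<in> K i" "yi \<in> K i" "x \<in> K'" "y \<in> K'" "mdist (met Y') (chart i xi) x + mdist (met Y') (chart i yi) y \<le> \<delta>" for xi yi x y
        using elim(1) that \<delta> by force+
      show ?case
      proof (intro conjI allI impI)
        show "ell_upper (Y i) (cl_metric (Y i) (cone_cover (X i) (p i) (J i) k)) Y' (cl_metric Y' (cone_cover X' p' J' k)) (chart i) \<epsilon> \<delta>"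
          unfolding ell_upper_def A B
        proof (intro ballI impI conjI)
          fix xi yi assume xi: "xi \<in> K i" and yi: "yi \<in> K i" and "0 \<le> ell (Y i) xi yi"
          then have ca: "caus (Y i) xi yi" by (auto simp: ell_def split: if_splits)
          show "ell (Y i) xi yi \<le> enn2ereal (tsep Y' x y) + ereal \<epsilon>"
            if "x \<in> K'" "y \<in> K'" "mdist (met Y') (chart i xi) x + mdist (met Y') (chart i yi) y \<le> \<delta>" for x y
          proof -
            have "enn2ereal (tsep (Y i) xi yi) \<le> enn2ereal (tsep Y' x y + ennreal \<epsilon>)"
              using T(1)[OF xi yi that] by (simp add: less_eq_ennreal.rep_eq)
            also have "\<dots> = enn2ereal (tsep Y' x y) + ereal \<epsilon>" using \<epsilon> by (simp add: plus_ennreal.rep_eq enn2ereal_ennreal)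
            finally show ?thesis using ca by (simp add: ell_def)
          qed
          obtain x' y' where "x'\<in>K'" "y'\<in>K'" "mdist (met Y') (chart i xi) x' + mdist (met Y') (chart i yi) y' \<le> \<delta>" "caus Y' x' y'"
            using elim(2) xi yi ca by blast
          moreover from this(4) have "0 \<le> ell Y' x' y'" by (simp add: ell_def)
          ultimately show "\<exists>x'\<in>K'. \<exists>y'\<in>K'. mdist (met Y') (chart i xi) x' + mdist (met Y') (chart i yi) y' \<le> \<delta> \<and> 0 \<le> ell Y' x' y'"
            by blast
        qed
        fix l :: nat assume l: "1 \<le> l" and \<epsilon>l: "\<epsilon> < 1 / (2 * real l)"
        show "ell_lower (Y i) (cl_metric (Y i) (cone_cover (X i) (p i) (J i) k)) Y' (cl_metric Y' (cone_cover X' p' J' k)) (chart i) l \<epsilon> \<delta>"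
          unfolding ell_lower_def A B
        proof (intro ballI impI)
          fix x y xi yi assume x: "x \<in> K'" and y: "y \<in> K'" and ge: "ereal (1 / real l) \<le> ell Y' x y"
            and xi: "xi \<in> K i" and yi: "yi \<in> K i" and d: "mdist (met Y') (chart i xi) x + mdist (met Y') (chart i yi) y \<le> \<delta>"
          have xyi: "xi \<in> I i \<times> mspace (X i)" "yi \<in> I i \<times> mspace (X i)" using K_sub xi yi by blast+
          have ca: "ell Y' x y = enn2ereal (tsep Y' x y)" using ge by (auto simp: ell_def split: if_splits)
          have le: "tsep Y' x y \<le> tsep (Y i) xi yi + ennreal \<epsilon>" by (rule T(2)[OF xi yi x y d])
          have "\<epsilon> < 1 / real l"
          proof -
            have "1 / (2 * real l) \<le> 1 / real l" using l by (simp add: frac_le)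
            then show ?thesis using \<epsilon>l by linarith
          qed
          then have "ereal \<epsilon> < enn2ereal (tsep Y' x y)" using ge unfolding ca by (meson ereal_less_eq(3) less_ereal.simps(1) less_le_trans)
          then have "ennreal \<epsilon> < tsep Y' x y" using \<epsilon> by (simp add: less_ennreal.rep_eq enn2ereal_ennreal)
          then have "0 < tsep (Y i) xi yi" using le by (metis add.left_neutral not_gr_zero not_le)
          then have "mdist (X i) (snd xi) (snd yi) < optical (f i) (fst xi) (fst yi)" using Ci.tsep_pos_iff[OF xyi] by simp
          moreover have "fst xi \<le> fst yi"
          proof (rule ccontr)
            assume "\<not> ?thesis"
            then have "tsep (Y i) xi yi \<le> 0" using Ci.tsep_le_time[OF xyi] by (simp add: ennreal_neg)
            then show False using \<open>0 < tsep (Y i) xi yi\<close> by simp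
          qed
          ultimately have "caus (Y i) xi yi" using Ci.cone_caus_iff[OF xyi] by simp
          then have e: "ell (Y i) xi yi = enn2ereal (tsep (Y i) xi yi)" by (simp add: ell_def)
          have "enn2ereal (tsep Y' x y) \<le> enn2ereal (tsep (Y i) xi yi + ennreal \<epsilon>)" using le by (simp add: less_eq_ennreal.rep_eq)
          also have "\<dots> = enn2ereal (tsep (Y i) xi yi) + ereal \<epsilon>" using \<epsilon> by (simp add: plus_ennreal.rep_eq enn2ereal_ennreal)
          finally show "ell Y' x y - ereal \<epsilon> \<le> ell (Y i) xi yi" unfolding ca e by (simp add: ereal_minus_le_iff add.commute)
        qed
      qed
    qed
  qed
qed

end

section \<open>Gluing compact spaces\<close>

lemma nbhd_mono: "r \<le> r' \<Longrightarrow> nbhd m r S \<subseteq> nbhd m r' S"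
  unfolding nbhd_def by force

lemma Hausdorff_dist_le:
  assumes "0 < r" "S \<subseteq> nbhd Z r T" "T \<subseteq> nbhd Z r S"
  shows "Hausdorff_dist Z S T \<le> r" and "0 \<le> Hausdorff_dist Z S T"
proof -
  have mem: "r \<in> {r. 0 < r \<and> S \<subseteq> nbhd Z r T \<and> T \<subseteq> nbhd Z r S}" using assms by simp
  show "Hausdorff_dist Z S T \<le> r" unfolding Hausdorff_dist_def
    by (rule cInf_lower[OF mem]) (auto intro: bdd_belowI[of _ 0])
  show "0 \<le> Hausdorff_dist Z S T" unfolding Hausdorff_dist_def
    using mem by (intro cInf_greatest) auto
qed

text \<open>The infimum of an empty set of reals carries no information, so some admissible radius
  \<open>r0\<close> has to be supplied before a small value of \<open>Hausdorff_dist\<close> says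
  anything.\<close>

lemma Hausdorff_dist_less:
  assumes "0 < r0" "S \<subseteq> nbhd Z r0 T" "T \<subseteq> nbhd Z r0 S" and "Hausdorff_dist Z S T < r"
  shows "S \<subseteq> nbhd Z r T \<and> T \<subseteq> nbhd Z r S"
proof -
  have "{r. 0 < r \<and> S \<subseteq> nbhd Z r T \<and> T \<subseteq> nbhd Z r S} \<noteq> {}" using assms by blast
  from cInf_lessD[OF this assms(4)[unfolded Hausdorff_dist_def]]
  obtain r' where "S \<subseteq> nbhd Z r' T" "T \<subseteq> nbhd Z r' S" "r' < r" by blast
  then show ?thesis using nbhd_mono[of r' r Z] by (meson less_imp_le subset_trans)
qed

text \<open>Transport of a metric along an injection, used to place auxiliary spaces on carriers in
  \<open>nat \<Rightarrow> real\<close>.\<close>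

lemma metric_encode:
  fixes e :: "'a \<Rightarrow> 'b"
  assumes M: "Metric_space M d" and e: "inj_on e M"
  obtains Z where "mspace Z = e ` M" "\<And>x y. x \<in> M \<Longrightarrow> y \<in> M \<Longrightarrow> mdist Z (e x) (e y) = d x y"
proof -
  interpret M: Metric_space M d by fact
  define d' where "d' = (\<lambda>u v. d (inv_into M e u) (inv_into M e v))"
  have inv: "inv_into M e (e x) = x" if "x \<in> M" for x using e that by simp
  have "Metric_space (e ` M) d'"
  proof
    show "0 \<le> d' u v" for u v by (simp add: d'_def)
    show "d' u v = d' v u" for u v by (simp add: d'_def M.commute)
    show "(d' u v = 0) = (u = v)" if uv: "u \<in> e ` M" "v \<in> e ` M" for u v
    proof -
      obtain x y where xy: "x \<in> M" "y \<in> M" "u = e x" "v = e y" using uv by blast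
      then have "d' u v = d x y" by (simp add: d'_def inv)
      then show ?thesis using xy e by (auto simp: inj_on_eq_iff)
    qed
    show "d' u w \<le> d' u v + d' v w" if uv: "u \<in> e ` M" "v \<in> e ` M" "w \<in> e ` M" for u v w
    proof -
      have "inv_into M e u \<in> M" "inv_into M e v \<in> M" "inv_into M e w \<in> M" using uv by (auto intro: inv_into_into)
      then show ?thesis unfolding d'_def by (rule M.triangle)
    qed
  qed
  then interpret Z: Metric_space "e ` M" d' .
  have "mspace (metric (e ` M, d')) = e ` M" "mdist (metric (e ` M, d')) = d'" by simp_all
  then show thesis using inv by (intro that[of "metric (e ` M, d')"]) (simp_all add: d'_def)
qed

text \<open>The metric on the disjoint union in which \<open>x\<close> and \<open>\<phi> x\<close> are at distance \<open>\<delta> / 2\<close>: the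
  distortion bound is what the triangle inequality needs.\<close>

definition glue_cross :: "'a metric \<Rightarrow> 'b metric \<Rightarrow> real \<Rightarrow> ('a \<Rightarrow> 'b) \<Rightarrow> 'a \<Rightarrow> 'b \<Rightarrow> real" where
  "glue_cross A B \<delta> \<phi> x y = (INF x'\<in>mspace A. mdist A x x' + mdist B (\<phi> x') y) + \<delta> / 2"

fun glue_dist :: "'a metric \<Rightarrow> 'b metric \<Rightarrow> real \<Rightarrow> ('a \<Rightarrow> 'b) \<Rightarrow> 'a + 'b \<Rightarrow> 'a + 'b \<Rightarrow> real" where
  "glue_dist A B \<delta> \<phi> (Inl x) (Inl y) = mdist A x y"
| "glue_dist A B \<delta> \<phi> (Inr x) (Inr y) = mdist B x y"
| "glue_dist A B \<delta> \<phi> (Inl x) (Inr y) = glue_cross A B \<delta> \<phi> x y"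
| "glue_dist A B \<delta> \<phi> (Inr y) (Inl x) = glue_cross A B \<delta> \<phi> x y"

lemma glue_metric:
  assumes \<phi>: "GH_isometry \<delta> A B \<phi>" and \<delta>: "0 < \<delta>" and ne: "mspace A \<noteq> {}"
  shows "Metric_space (Inl ` mspace A \<union> Inr ` mspace B) (glue_dist A B \<delta> \<phi>)"
    and "\<And>x. x \<in> mspace A \<Longrightarrow> y \<in> mspace B \<Longrightarrow> glue_cross A B \<delta> \<phi> x y \<le> mdist B (\<phi> x) y + \<delta> / 2"
proof -
  interpret A: Metric_space "mspace A" "mdist A" by simp
  interpret B: Metric_space "mspace B" "mdist B" by simp
  have \<phi>B: "\<phi> x \<in> mspace B" if "x \<in> mspace A" for x using \<phi> that by (auto simp: GH_isometry_def)
  have dist: "\<bar>mdist B (\<phi> x) (\<phi> y) - mdist A x y\<bar> < \<delta>" if "x \<in> mspace A" "y \<in> mspace A" for x y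
    using \<phi> that by (auto simp: GH_isometry_def)
  let ?c = "glue_cross A B \<delta> \<phi>"
  have bdd: "bdd_below ((\<lambda>x'. mdist A x x' + mdist B (\<phi> x') y) ` mspace A)" for x y
    by (rule bdd_belowI[of _ 0]) auto
  have c_le: "?c x y \<le> mdist A x x' + mdist B (\<phi> x') y + \<delta> / 2" if "x' \<in> mspace A" for x y x'
    unfolding glue_cross_def using cINF_lower[OF bdd that, of x y] by linarith
  have c_pos: "\<delta> / 2 \<le> ?c x y" for x y
    unfolding glue_cross_def using cINF_greatest[OF ne, of 0 "\<lambda>x'. mdist A x x' + mdist B (\<phi> x') y"] by simp
  have c_ge: "t \<le> ?c x y" if "\<And>x'. x' \<in> mspace A \<Longrightarrow> t \<le> mdist A x x' + mdist B (\<phi> x') y + \<delta> / 2" for t x y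
  proof -
    have "t - \<delta> / 2 \<le> (INF x'\<in>mspace A. mdist A x x' + mdist B (\<phi> x') y)"
      using that by (intro cINF_greatest[OF ne]) force
    then show ?thesis by (simp add: glue_cross_def)
  qed
  show "glue_cross A B \<delta> \<phi> x y \<le> mdist B (\<phi> x) y + \<delta> / 2" if "x \<in> mspace A" "y \<in> mspace B" for x
    using c_le[OF that(1), of x y] that by simp
  have t1: "?c x y \<le> mdist A x z + ?c z y" if "x \<in> mspace A" "z \<in> mspace A" "y \<in> mspace B" for x y z
  proof -
    have "?c x y - mdist A x z \<le> ?c z y"
    proof (rule c_ge)
      fix x' assume x': "x' \<in> mspace A"
      show "?c x y - mdist A x z \<le> mdist A z x' + mdist B (\<phi> x') y + \<delta> / 2"
        using c_le[OF x', of x y] A.triangle[OF that(1,2) x'] by linarith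
    qed
    then show ?thesis by linarith
  qed
  have t2: "?c x y \<le> ?c x w + mdist B w y" if "x \<in> mspace A" "w \<in> mspace B" "y \<in> mspace B" for x y w
  proof -
    have "?c x y - mdist B w y \<le> ?c x w"
    proof (rule c_ge)
      fix x' assume x': "x' \<in> mspace A"
      show "?c x y - mdist B w y \<le> mdist A x x' + mdist B (\<phi> x') w + \<delta> / 2"
        using c_le[OF x', of x y] B.triangle[OF \<phi>B[OF x'] that(2,3)] by linarith
    qed
    then show ?thesis by linarith
  qed
  \<comment> \<open>Crossing to the other space and back costs twice \<open>\<delta> / 2\<close>,
    which pays for the distortion between the two crossing points. The same balance gives
    \<open>t4\<close>.\<close>
  have t3: "mdist A x z \<le> ?c x y + ?c z y" if xz: "x \<in> mspace A" "z \<in> mspace A" and y: "y \<in> mspace B" for x y z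
  proof -
    have "mdist A x z - ?c x y \<le> ?c z y"
    proof (rule c_ge)
      fix z' assume z': "z' \<in> mspace A"
      have "mdist A x z - (mdist A z z' + mdist B (\<phi> z') y + \<delta> / 2) \<le> ?c x y"
      proof (rule c_ge)
        fix x' assume x': "x' \<in> mspace A"
        have "mdist A x z \<le> mdist A x x' + mdist A x' z' + mdist A z' z"
          using A.triangle[OF xz(1) x' xz(2)] A.triangle[OF x' z' xz(2)] by linarith
        moreover have "mdist B (\<phi> x') (\<phi> z') \<le> mdist B (\<phi> x') y + mdist B y (\<phi> z')"
          by (rule B.triangle[OF \<phi>B[OF x'] y \<phi>B[OF z']])
        ultimately show "mdist A x z - (mdist A z z' + mdist B (\<phi> z') y + \<delta> / 2) \<le> mdist A x x' + mdist B (\<phi> x') y + \<delta> / 2"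
          using dist[OF x' z'] A.commute[of z' z] B.commute[of y "\<phi> z'"] by linarith
      qed
      then show "mdist A x z - ?c x y \<le> mdist A z z' + mdist B (\<phi> z') y + \<delta> / 2" by linarith
    qed
    then show ?thesis by linarith
  qed
  have t4: "mdist B y w \<le> ?c x y + ?c x w" if x: "x \<in> mspace A" and yw: "y \<in> mspace B" "w \<in> mspace B" for x y w
  proof -
    have "mdist B y w - ?c x y \<le> ?c x w"
    proof (rule c_ge)
      fix z' assume z': "z' \<in> mspace A"
      have "mdist B y w - (mdist A x z' + mdist B (\<phi> z') w + \<delta> / 2) \<le> ?c x y"
      proof (rule c_ge)
        fix x' assume x': "x' \<in> mspace A"
        have "mdist B y w \<le> mdist B y (\<phi> x') + mdist B (\<phi> x') (\<phi> z') + mdist B (\<phi> z') w"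
          using B.triangle[OF yw(1) \<phi>B[OF x'] yw(2)] B.triangle[OF \<phi>B[OF x'] \<phi>B[OF z'] yw(2)] by linarith
        moreover have "mdist A x' z' \<le> mdist A x' x + mdist A x z'" by (rule A.triangle[OF x' x z'])
        ultimately show "mdist B y w - (mdist A x z' + mdist B (\<phi> z') w + \<delta> / 2) \<le> mdist A x x' + mdist B (\<phi> x') y + \<delta> / 2"
          using dist[OF x' z'] A.commute[of x' x] B.commute[of y "\<phi> x'"] by linarith
      qed
      then show "mdist B y w - ?c x y \<le> mdist A x z' + mdist B (\<phi> z') w + \<delta> / 2" by linarith
    qed
    then show ?thesis by linarith
  qed
  have cp: "0 < ?c x y" for x y using c_pos[of x y] \<delta> by linarith
  show "Metric_space (Inl ` mspace A \<union> Inr ` mspace B) (glue_dist A B \<delta> \<phi>)"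
  proof
    show "0 \<le> glue_dist A B \<delta> \<phi> u v" for u v
      by (cases u; cases v) (use cp in \<open>auto simp: less_imp_le\<close>)
    show "glue_dist A B \<delta> \<phi> u v = glue_dist A B \<delta> \<phi> v u" for u v
      by (cases u; cases v) (auto simp: A.commute B.commute)
    show "(glue_dist A B \<delta> \<phi> u v = 0) = (u = v)" if "u \<in> Inl ` mspace A \<union> Inr ` mspace B" "v \<in> Inl ` mspace A \<union> Inr ` mspace B" for u v
      using that cp by (cases u; cases v) (auto simp: less_imp_neq[symmetric])
    fix u v w assume m: "u \<in> Inl ` mspace A \<union> Inr ` mspace B" "v \<in> Inl ` mspace A \<union> Inr ` mspace B" "w \<in> Inl ` mspace A \<union> Inr ` mspace B"
    show "glue_dist A B \<delta> \<phi> u w \<le> glue_dist A B \<delta> \<phi> u v + glue_dist A B \<delta> \<phi> v w"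
    proof (cases u; cases v; cases w)
      fix x y z assume h: "u = Inl x" "v = Inl y" "w = Inl z"
      then show ?thesis using m A.triangle[of x y z] by auto
    next
      fix x y z assume h: "u = Inl x" "v = Inl y" "w = Inr z"
      then show ?thesis using m t1[of x y z] by auto
    next
      fix x y z assume h: "u = Inl x" "v = Inr y" "w = Inl z"
      then show ?thesis using m t3[of x z y] by auto
    next
      fix x y z assume h: "u = Inl x" "v = Inr y" "w = Inr z"
      then show ?thesis using m t2[of x y z] by auto
    next
      fix x y z assume h: "u = Inr x" "v = Inl y" "w = Inl z"
      then show ?thesis using m t1[of z y x] A.commute[of y z] by auto
    next
      fix x y z assume h: "u = Inr x" "v = Inl y" "w = Inr z"
      then show ?thesis using m t4[of y x z] by auto
    next
      fix x y z assume h: "u = Inr x" "v = Inr y" "w = Inl z"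
      then show ?thesis using m t2[of z y x] B.commute[of x y] by auto
    next
      fix x y z assume h: "u = Inr x" "v = Inr y" "w = Inr z"
      then show ?thesis using m B.triangle[of x y z] by auto
    qed
  qed
qed

text \<open>In the glued space a point of \<open>A\<close> lies at distance at most
  \<open>\<delta> / 2\<close> from its image. A point of \<open>B\<close> is within \<delta> of some
  image, hence within \<open>3 * \<delta> / 2\<close> of \<open>A\<close>; the bound
  \<open>2 * \<delta>\<close> leaves room for strict inequalities.\<close>

lemma GH_dist_le:
  fixes eA :: "'a \<Rightarrow> nat \<Rightarrow> real" and eB :: "'b \<Rightarrow> nat \<Rightarrow> real"
  assumes \<phi>: "GH_isometry \<delta> A B \<phi>" and \<delta>: "0 < \<delta>" and ne: "mspace A \<noteq> {}"
    and e: "inj_on eA (mspace A)" "inj_on eB (mspace B)"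
  shows "GH_dist A B \<le> 2 * \<delta>"
proof -
  \<comment> \<open>The entry at index 0 separates the two pieces of the disjoint union; the
    remaining entries carry the given encodings.\<close>
  define e where "e = (\<lambda>u. case u of Inl x \<Rightarrow> case_nat 0 (eA x) | Inr y \<Rightarrow> case_nat (1::real) (eB y))"
  have cn: "case_nat r s = case_nat r' s' \<longleftrightarrow> r = r' \<and> s = s'" for r r' :: real and s s'
    by (metis nat.case(1) nat.case(2) ext)
  have inj: "inj_on e (Inl ` mspace A \<union> Inr ` mspace B)"
  proof (rule inj_onI)
    fix u v assume "u \<in> Inl ` mspace A \<union> Inr ` mspace B" "v \<in> Inl ` mspace A \<union> Inr ` mspace B" "e u = e v"
    then show "u = v" using assms(4,5) by (cases u; cases v) (auto simp: e_def cn dest: inj_onD)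
  qed
  obtain Z where Z: "mspace Z = e ` (Inl ` mspace A \<union> Inr ` mspace B)"
    "\<And>x y. x \<in> Inl ` mspace A \<union> Inr ` mspace B \<Longrightarrow> y \<in> Inl ` mspace A \<union> Inr ` mspace B \<Longrightarrow> mdist Z (e x) (e y) = glue_dist A B \<delta> \<phi> x y"
    using metric_encode[OF glue_metric(1)[OF \<phi> \<delta> ne] inj] by blast
  let ?\<iota> = "\<lambda>x. e (Inl x)" and ?\<kappa> = "\<lambda>y. e (Inr y)"
  have emb: "isometric_embedding A Z ?\<iota>" "isometric_embedding B Z ?\<kappa>"
    unfolding isometric_embedding_def using Z by auto
  interpret Zm: Metric_space "mspace Z" "mdist Z" by simp
  have \<phi>B: "\<phi> x \<in> mspace B" if "x \<in> mspace A" for x using \<phi> that by (auto simp: GH_isometry_def)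
  interpret B: Metric_space "mspace B" "mdist B" by simp
  have dZ: "mdist Z (?\<iota> x) (?\<kappa> y) \<le> mdist B (\<phi> x) y + \<delta> / 2" if "x \<in> mspace A" "y \<in> mspace B" for x y
    using glue_metric(2)[OF \<phi> \<delta> ne that] Z(2)[of "Inl x" "Inr y"] that by simp
  have near: "mdist Z (?\<iota> x) (?\<kappa> (\<phi> x)) < 2 * \<delta>" if "x \<in> mspace A" for x
    using dZ[OF that \<phi>B[OF that]] B.mdist_zero[OF \<phi>B[OF that]] \<delta> by simp
  have H: "Hausdorff_dist Z (?\<iota> ` mspace A) (?\<kappa> ` mspace B) \<le> 2 * \<delta>"
  proof (rule Hausdorff_dist_le(1))
    show "0 < 2 * \<delta>" using \<delta> by simp
    show "?\<iota> ` mspace A \<subseteq> nbhd Z (2 * \<delta>) (?\<kappa> ` mspace B)"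
    proof
      fix u assume "u \<in> ?\<iota> ` mspace A"
      then obtain x where x: "x \<in> mspace A" "u = ?\<iota> x" by blast
      have "u \<in> mball_of Z (?\<kappa> (\<phi> x)) (2 * \<delta>)"
        using near[OF x(1)] Zm.commute[of u "?\<kappa> (\<phi> x)"] x \<phi>B[OF x(1)] Z(1) by simp
      then show "u \<in> nbhd Z (2 * \<delta>) (?\<kappa> ` mspace B)" unfolding nbhd_def using \<phi>B[OF x(1)] by blast
    qed
    show "?\<kappa> ` mspace B \<subseteq> nbhd Z (2 * \<delta>) (?\<iota> ` mspace A)"
    proof
      fix v assume "v \<in> ?\<kappa> ` mspace B"
      then obtain y where y: "y \<in> mspace B" "v = ?\<kappa> y" by blast
      then have "y \<in> nbhd B \<delta> (\<phi> ` mspace A)" using \<phi> by (simp add: GH_isometry_def)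
      then obtain x where x: "x \<in> mspace A" "mdist B (\<phi> x) y < \<delta>" unfolding nbhd_def by auto
      have "mdist Z (?\<iota> x) v < 2 * \<delta>" using dZ[OF x(1) y(1)] x(2) y(2) \<delta> by simp
      then have "v \<in> mball_of Z (?\<iota> x) (2 * \<delta>)" using x y Z(1) by simp
      then show "v \<in> nbhd Z (2 * \<delta>) (?\<iota> ` mspace A)" unfolding nbhd_def using x(1) by blast
    qed
  qed
  have lower: "min 0 (Inf {}) \<le> Hausdorff_dist Z' S T" for Z' :: "(nat \<Rightarrow> real) metric" and S T
  proof (cases "{r. 0 < r \<and> S \<subseteq> nbhd Z' r T \<and> T \<subseteq> nbhd Z' r S} = {}")
    case True
    show ?thesis unfolding Hausdorff_dist_def True by simp
  next
    case False
    then have "0 \<le> Hausdorff_dist Z' S T" unfolding Hausdorff_dist_def by (intro cInf_greatest) auto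
    then show ?thesis by simp
  qed
  have "GH_dist A B \<le> Hausdorff_dist Z (?\<iota> ` mspace A) (?\<kappa> ` mspace B)"
    unfolding GH_dist_def
  proof (rule cInf_lower)
    show "bdd_below {Hausdorff_dist Z (\<iota> ` mspace A) (\<kappa> ` mspace B) |
     (Z :: (nat \<Rightarrow> real) metric) \<iota> \<kappa>. isometric_embedding A Z \<iota> \<and> isometric_embedding B Z \<kappa>}"
      using lower by (intro bdd_belowI[of _ "min 0 (Inf {})"]) blast
  qed (use emb in blast)
  then show ?thesis using H by linarith
qed

section \<open>Encoding cones by real sequences\<close>

context covered_cone
begin

text \<open>A point is determined by its distances to a countable dense set.\<close>

lemma fibre_encoding:
  obtains e :: "'x \<Rightarrow> nat \<Rightarrow> real" where "inj_on e (mspace X)"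
proof -
  obtain Q where Q: "countable Q" "Q \<subseteq> mspace X" "\<And>x r. x \<in> mspace X \<Longrightarrow> 0 < r \<Longrightarrow> \<exists>q\<in>Q. mdist X q x < r"
    using countable_dense by blast
  have ne: "Q \<noteq> {}" using Q(3)[OF p_in zero_less_one] by blast
  define e where "e = (\<lambda>x n. mdist X (from_nat_into Q n) x)"
  have "inj_on e (mspace X)"
  proof (rule inj_onI, rule ccontr)
    fix x y assume x: "x \<in> mspace X" and y: "y \<in> mspace X" and eq: "e x = e y" and neq: "x \<noteq> y"
    have d: "0 < mdist X x y" using x y neq X.mdist_pos_less by blast
    obtain q where q: "q \<in> Q" "mdist X q x < mdist X x y / 2" using Q(3)[OF x, of "mdist X x y / 2"] d by auto
    obtain n where n: "from_nat_into Q n = q" using q(1) Q(1) ne range_from_nat_into[of Q] by (metis rangeE)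
    have "mdist X q x = mdist X q y" using fun_cong[OF eq, of n] n by (simp add: e_def)
    moreover have "mdist X x y \<le> mdist X x q + mdist X q y" using x y q(1) Q(2) by (intro X.triangle) auto
    ultimately show False using q(2) X.commute[of x q] by linarith
  qed
  then show ?thesis using that by blast
qed

lemma cone_encoding:
  obtains e :: "real \<times> 'x \<Rightarrow> nat \<Rightarrow> real" where "inj_on e (UNIV \<times> mspace X)"
proof -
  obtain e :: "'x \<Rightarrow> nat \<Rightarrow> real" where e: "inj_on e (mspace X)" using fibre_encoding by blast
  have "inj_on (\<lambda>z. case_nat (fst z) (e (snd z))) (UNIV \<times> mspace X)"
  proof (rule inj_onI)
    fix z w assume z: "z \<in> UNIV \<times> mspace X" and w: "w \<in> UNIV \<times> mspace X"
      and eq: "case_nat (fst z) (e (snd z)) = case_nat (fst w) (e (snd w))"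
    have "fst z = fst w" using fun_cong[OF eq, of 0] by simp
    moreover have "e (snd z) = e (snd w)"
    proof
      fix n show "e (snd z) n = e (snd w) n" using fun_cong[OF eq, of "Suc n"] by simp
    qed
    then have "snd z = snd w" using e z w by (auto dest: inj_onD)
    ultimately show "z = w" by (simp add: prod_eq_iff)
  qed
  then show ?thesis using that by blast
qed

end

lemma (in cone_level) GH_dist_convergence:
  assumes \<delta>: "0 < \<delta>"
  shows "\<forall>\<^sub>F i in sequentially. GH_dist (cl_metric (Y i) (cone_cover (X i) (p i) (J i) k))
     (cl_metric Y' (cone_cover X' p' J' k)) \<le> \<delta>"
proof -
  have h: "0 < \<delta> / 2" using \<delta> by simp
  show ?thesis using chart_GH_isometry[OF h]
  proof eventually_elim
    case (elim i)
    interpret Ci: covered_cone "I i" "f i" "X i" "p i" "J i" by (rule C)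
    obtain e :: "real \<times> 'x \<Rightarrow> nat \<Rightarrow> real" where e: "inj_on e (UNIV \<times> mspace (X i))" using Ci.cone_encoding by blast
    obtain e' :: "real \<times> 'y \<Rightarrow> nat \<Rightarrow> real" where e': "inj_on e' (UNIV \<times> mspace X')" using L.cone_encoding by blast
    have "GH_dist (cl_metric (Y i) (cone_cover (X i) (p i) (J i) k)) (cl_metric Y' (cone_cover X' p' J' k)) \<le> 2 * (\<delta> / 2)"
    proof (rule GH_dist_le[OF elim h])
      show "mspace (cl_metric (Y i) (cone_cover (X i) (p i) (J i) k)) \<noteq> {}"
      proof -
        have "p i \<in> ball i" using Ci.p_in by simp
        moreover have "a i \<in> {a i..b i}" using ab(1)[of i] by simp
        ultimately show ?thesis unfolding Ci.cl_metric_cover[OF k] closure_J by blast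
      qed
      show "inj_on e (mspace (cl_metric (Y i) (cone_cover (X i) (p i) (J i) k)))"
        by (rule inj_on_subset[OF e]) (auto simp: Ci.cl_metric_cover[OF k])
      show "inj_on e' (mspace (cl_metric Y' (cone_cover X' p' J' k)))"
        by (rule inj_on_subset[OF e']) (auto simp: L.cl_metric_cover[OF k])
    qed
    then show ?case by simp
  qed
qed

section \<open>Weak convergence of the measures\<close>

lemma isometric_continuous_map:
  assumes "isometric_embedding A Z \<iota>"
  shows "continuous_map (mtopology_of A) (mtopology_of Z) \<iota>"
proof -
  have "Lipschitz_continuous_map A Z \<iota>"
    using assms unfolding isometric_embedding_def Lipschitz_continuous_map_def by (auto intro!: exI[of _ 1])
  then show ?thesis by (intro uniformly_continuous_imp_continuous_map Lipschitz_imp_uniformly_continuous_map)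
qed

text \<open>Rounding \<open>t\<close> down to multiples of \<open>1 / (n + 1)\<close> leaves
  countably many values and hence a jointly measurable function. Continuity in \<open>t\<close>
  gives pointwise convergence to \<open>F\<close>.\<close>

lemma caratheodory_measurable:
  fixes F :: "real \<Rightarrow> 'x \<Rightarrow> real"
  assumes x: "\<And>t. F t \<in> borel_measurable m" and t: "\<And>x. x \<in> space m \<Longrightarrow> continuous_on UNIV (\<lambda>t. F t x)"
  shows "(\<lambda>z. F (fst z) (snd z)) \<in> borel_measurable (borel \<Otimes>\<^sub>M m)"
proof (rule borel_measurable_LIMSEQ_real[where u = "\<lambda>n z. F (real_of_int \<lfloor>fst z * real (Suc n)\<rfloor> / real (Suc n)) (snd z)"])
  let ?q = "\<lambda>n t. real_of_int \<lfloor>t * real (Suc n)\<rfloor> / real (Suc n)"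
  fix z :: "real \<times> 'x" assume z: "z \<in> space (borel \<Otimes>\<^sub>M m)"
  have "(\<lambda>n. ?q n (fst z)) \<longlonglongrightarrow> fst z"
  proof (rule real_tendsto_sandwich)
    have b: "fst z - 1 / real (Suc n) \<le> ?q n (fst z) \<and> ?q n (fst z) \<le> fst z" for n
    proof -
      have "fst z * real (Suc n) - 1 \<le> real_of_int \<lfloor>fst z * real (Suc n)\<rfloor>" by linarith
      moreover have "real_of_int \<lfloor>fst z * real (Suc n)\<rfloor> \<le> fst z * real (Suc n)" by linarith
      ultimately have "(fst z * real (Suc n) - 1) / real (Suc n) \<le> ?q n (fst z)"
        "?q n (fst z) \<le> fst z * real (Suc n) / real (Suc n)" by (intro divide_right_mono; simp)+
      moreover have "(fst z * real (Suc n) - 1) / real (Suc n) = fst z - 1 / real (Suc n)"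
        by (simp add: diff_divide_distrib del: of_nat_Suc)
      ultimately show ?thesis by (simp del: of_nat_Suc)
    qed
    then show "\<forall>\<^sub>F n in sequentially. fst z - 1 / real (Suc n) \<le> ?q n (fst z)"
      "\<forall>\<^sub>F n in sequentially. ?q n (fst z) \<le> fst z" by simp_all
    have "(\<lambda>n. fst z - 1 / real (Suc n)) \<longlonglongrightarrow> fst z - 0"
      by (intro tendsto_diff tendsto_const LIMSEQ_Suc[OF lim_1_over_n])
    then show "(\<lambda>n. fst z - 1 / real (Suc n)) \<longlonglongrightarrow> fst z" by simp
  qed simp
  moreover have "snd z \<in> space m" using z by (auto simp: space_pair_measure)
  ultimately show "(\<lambda>n. F (?q n (fst z)) (snd z)) \<longlonglongrightarrow> F (fst z) (snd z)"
    using t by (intro continuous_on_tendsto_compose[of UNIV "\<lambda>t. F t (snd z)"]) auto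
next
  fix n :: nat
  let ?P = "borel \<Otimes>\<^sub>M m :: (real \<times> 'x) measure"
  have "(\<lambda>z. F (real_of_int i / real (Suc n)) (snd z)) \<in> borel_measurable ?P" for i :: int
    by (rule measurable_compose[OF measurable_snd x])
  moreover have "(\<lambda>z. \<lfloor>fst z * real (Suc n)\<rfloor>) \<in> ?P \<rightarrow>\<^sub>M count_space UNIV" by measurable
  ultimately show "(\<lambda>z. F (real_of_int \<lfloor>fst z * real (Suc n)\<rfloor> / real (Suc n)) (snd z)) \<in> borel_measurable ?P"
    by (rule measurable_compose_countable)
qed

section \<open>Integration over a cone\<close>

context covered_cone
begin

text \<open>Closed balls are compact, so finitely many open sets of finite measure cover
  them.\<close>

lemma radon_mcball:
  assumes m: "radon_measure_on X m"
  shows "mcball_of X p r \<in> sets m" and "emeasure m (mcball_of X p r) < \<infinity>"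
proof -
  have sp: "space m = mspace X" and st: "sets m = sigma_sets (mspace X) {U. openin (mtopology_of X) U}"
    and lf: "\<And>x. x \<in> mspace X \<Longrightarrow> \<exists>U. openin (mtopology_of X) U \<and> x \<in> U \<and> emeasure m U < \<infinity>"
    using m by (auto simp: radon_measure_on_def)
  have op: "U \<in> sets m" if "openin (mtopology_of X) U" for U using that unfolding st by (intro sigma_sets.Basic) simp
  have "closedin (mtopology_of X) (mcball_of X p r)" by (simp add: mtopology_of_def mcball_of_def)
  then have "openin (mtopology_of X) (mspace X - mcball_of X p r)" by (auto simp: closedin_def mtopology_of_def)
  then have "space m - (mspace X - mcball_of X p r) \<in> sets m" using op by (intro sets.compl_sets) simp
  moreover have "space m - (mspace X - mcball_of X p r) = mcball_of X p r" unfolding sp by auto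
  ultimately show "mcball_of X p r \<in> sets m" by simp
  have "\<exists>\<F>. finite \<F> \<and> \<F> \<subseteq> {U. openin (mtopology_of X) U \<and> emeasure m U < \<infinity>} \<and> mcball_of X p r \<subseteq> \<Union>\<F>"
  proof -
    have "mcball_of X p r \<subseteq> \<Union>{U. openin (mtopology_of X) U \<and> emeasure m U < \<infinity>}"
    proof
      fix x assume "x \<in> mcball_of X p r"
      then have "x \<in> mspace X" by simp
      from lf[OF this] show "x \<in> \<Union>{U. openin (mtopology_of X) U \<and> emeasure m U < \<infinity>}" by blast
    qed
    then show ?thesis using mcball_compact[of p r] unfolding compactin_def by simp
  qed
  then obtain \<F> where F: "finite \<F>" "\<F> \<subseteq> {U. openin (mtopology_of X) U \<and> emeasure m U < \<infinity>}" "mcball_of X p r \<subseteq> \<Union>\<F>" by blast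
  have Fs: "\<F> \<subseteq> sets m" using F(2) op by blast
  have "emeasure m (mcball_of X p r) \<le> emeasure m (\<Union>U\<in>\<F>. U)"
    using F(3) Fs F(1) by (intro emeasure_mono) auto
  also have "\<dots> \<le> (\<Sum>U\<in>\<F>. emeasure m U)" using Fs F(1) by (intro emeasure_subadditive_finite) auto
  also have "\<dots> < \<infinity>" using F by auto
  finally show "emeasure m (mcball_of X p r) < \<infinity>" .
qed

lemma radon_sigma_finite:
  assumes m: "radon_measure_on X m" shows "sigma_finite_measure m"
proof
  have sp: "space m = mspace X" using m by (simp add: radon_measure_on_def)
  show "\<exists>A. countable A \<and> A \<subseteq> sets m \<and> \<Union>A = space m \<and> (\<forall>a\<in>A. emeasure m a \<noteq> \<infinity>)"
  proof (intro exI conjI ballI)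
    let ?A = "range (\<lambda>n. mcball_of X p (real n))"
    show "countable ?A" by simp
    show "?A \<subseteq> sets m" using radon_mcball(1)[OF m] by blast
    show "\<Union>?A = space m"
    proof (intro subset_antisym subsetI)
      fix x assume x: "x \<in> space m"
      obtain n where "mdist X p x \<le> real n" using real_arch_simple by blast
      then have "x \<in> mcball_of X p (real n)" using x p_in by (simp add: sp)
      then show "x \<in> \<Union>?A" by blast
    qed (auto simp: sp)
    show "emeasure m a \<noteq> \<infinity>" if "a \<in> ?A" for a using radon_mcball(2)[OF m] that by (auto simp: less_top)
  qed
qed

text \<open>The function is continuous only on the closed ball; its extension by 0 is still Borel,
  as relatively open subsets of the ball are traces of open sets.\<close>

lemma radon_measurable:
  fixes G :: "'x \<Rightarrow> real"
  assumes m: "radon_measure_on X m" and G: "continuous_map (mtopology_of (submetric X (mcball_of X p r))) euclideanreal G"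
  shows "(\<lambda>x. indicator (mcball_of X p r) x * G x) \<in> borel_measurable m"
proof (rule borel_measurableI)
  let ?B = "mcball_of X p r"
  fix S :: "real set" assume S: "open S"
  have sp: "space m = mspace X" and st: "sets m = sigma_sets (mspace X) {U. openin (mtopology_of X) U}"
    using m by (auto simp: radon_measure_on_def)
  have B: "?B \<in> sets m" by (rule radon_mcball(1)[OF m])
  have ts: "topspace (mtopology_of (submetric X ?B)) = ?B" by auto
  have "openin (mtopology_of (submetric X ?B)) {x \<in> topspace (mtopology_of (submetric X ?B)). G x \<in> S}"
    by (rule openin_continuous_map_preimage[OF G]) (use S in simp)
  then have "\<exists>U. openin (mtopology_of X) U \<and> {x \<in> ?B. G x \<in> S} = U \<inter> ?B"
    unfolding ts unfolding mtopology_of_submetric openin_subtopology .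
  then obtain U where U: "openin (mtopology_of X) U" "{x \<in> ?B. G x \<in> S} = U \<inter> ?B" by (elim exE conjE)
  have "U \<in> sets m" using U(1) unfolding st by (intro sigma_sets.Basic) simp
  then have 1: "{x \<in> ?B. G x \<in> S} \<in> sets m" unfolding U(2) using B by (rule sets.Int)
  have "(\<lambda>x. indicator ?B x * G x) -` S \<inter> space m = {x \<in> ?B. G x \<in> S} \<union> (if 0 \<in> S then space m - ?B else {})"
  proof -
    have "(\<lambda>x. indicator C x * G x) -` S \<inter> M = {x \<in> C. G x \<in> S} \<union> (if 0 \<in> S then M - C else {})" if "C \<subseteq> M" for C M
    proof (rule set_eqI)
      fix x show "x \<in> (\<lambda>x. indicator C x * G x) -` S \<inter> M \<longleftrightarrow> x \<in> {x \<in> C. G x \<in> S} \<union> (if 0 \<in> S then M - C else {})"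
        using that by (cases "x \<in> C") auto
    qed
    from this[OF sets.sets_into_space[OF B]] show ?thesis .
  qed
  then show "(\<lambda>x. indicator ?B x * G x) -` S \<inter> space m \<in> sets m" using 1 B by auto
qed

text \<open>Fubini for the cone measure. \<open>F\<close> depends on all real times, so the fibre
  integrals are functions on the whole line and can be compared for intervals that vary with
  \<open>i\<close>.\<close>

lemma cone_set_integral:
  fixes F :: "real \<Rightarrow> 'x \<Rightarrow> real"
  assumes m: "radon_measure_on X m" and ab: "a \<le> b" "{a..b} \<subseteq> I"
    and F: "\<And>t. continuous_map (mtopology_of (submetric X (mcball_of X p r))) euclideanreal (F t)"
    and Ft: "\<And>x. x \<in> mcball_of X p r \<Longrightarrow> continuous_on UNIV (\<lambda>t. F t x)"
    and D: "\<And>t x. x \<in> mcball_of X p r \<Longrightarrow> \<bar>F t x\<bar> \<le> D"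
  shows "(LINT z:{a..b} \<times> mcball_of X p r|cone_measure I f N m. F (fst z) (snd z)) =
      (LINT t|lborel. indicator {a..b} t * f t powr N * (LINT x:mcball_of X p r|m. F t x))"
    and "(\<lambda>t. LINT x:mcball_of X p r|m. F t x) \<in> borel_measurable borel"
    and "\<And>t. \<bar>LINT x:mcball_of X p r|m. F t x\<bar> \<le> D * measure m (mcball_of X p r)"
proof -
  let ?B = "mcball_of X p r"
  interpret m: sigma_finite_measure m by (rule radon_sigma_finite[OF m])
  note B = radon_mcball[OF m, of r]
  have sp: "space m = mspace X" using m by (simp add: radon_measure_on_def)
  define H where "H = (\<lambda>t x. indicator ?B x * F t x)"
  have Hx: "H t \<in> borel_measurable m" for t unfolding H_def by (rule radon_measurable[OF m F])
  have Ht: "continuous_on UNIV (\<lambda>t. H t x)" for x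
    using Ft[of x] by (cases "x \<in> ?B") (auto simp: H_def)
  have H: "(\<lambda>z. H (fst z) (snd z)) \<in> borel_measurable (borel \<Otimes>\<^sub>M m)"
    by (rule caratheodory_measurable[OF Hx Ht])
  have int: "(LINT x:?B|m. F t x) = (LINT x|m. H t x)" for t
    by (simp add: set_lebesgue_integral_def H_def)
  show meas: "(\<lambda>t. LINT x:?B|m. F t x) \<in> borel_measurable borel"
    unfolding int by (rule m.borel_measurable_lebesgue_integral) (use H in \<open>simp add: case_prod_unfold\<close>)
  have D0: "0 \<le> D" if "x \<in> ?B" for x using D[OF that, of 0] by linarith
  have Hi: "integrable m (H t)" for t
    by (rule integrableI_bounded_set[OF B(1) Hx B(2), of _ D]) (use D in \<open>auto simp: H_def\<close>)
  have bnd: "\<bar>LINT x:?B|m. F t x\<bar> \<le> D * measure m ?B" for t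
  proof -
    have "\<bar>LINT x|m. H t x\<bar> \<le> (LINT x|m. \<bar>H t x\<bar>)" using integral_norm_bound[of m "H t"] by simp
    also have "\<dots> \<le> (LINT x|m. D * indicator ?B x)"
    proof (rule integral_mono)
      show "integrable m (\<lambda>x. \<bar>H t x\<bar>)" using Hi by simp
      show "integrable m (\<lambda>x. D * indicator ?B x)" using B by (simp add: less_top)
      show "\<bar>H t x\<bar> \<le> D * indicator ?B x" for x using D[of x t] by (auto simp: H_def indicator_def)
    qed
    also have "\<dots> = D * measure m ?B" using B(1) sets.sets_into_space[OF B(1)] by (simp add: Int_absorb2)
    finally show ?thesis by (simp add: int)
  qed
  then show "\<And>t. \<bar>LINT x:?B|m. F t x\<bar> \<le> D * measure m ?B" .
  define R where "R = restrict_space lborel I"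
  define T where "T = density R (\<lambda>t. ennreal (f t powr N))"
  have Ib: "I \<in> sets borel" using open_I by simp
  have sR: "sets R = sets (restrict_space borel I)" unfolding R_def by (intro sets_restrict_space_cong) simp
  have fR: "f \<in> borel_measurable R"
    unfolding measurable_cong_sets[OF sR refl] by (rule borel_measurable_continuous_on_restrict[OF cont])
  have pR[measurable]: "(\<lambda>t. f t powr N) \<in> borel_measurable R" using fR by measurable
  have idR: "(\<lambda>x. x) \<in> R \<rightarrow>\<^sub>M borel"
    unfolding measurable_cong_sets[OF sR refl] by (rule measurable_restrict_space1) simp
  have sT: "sets T = sets R" by (simp add: T_def)
  have idT: "(\<lambda>x. x) \<in> T \<rightarrow>\<^sub>M borel" unfolding measurable_cong_sets[OF sT refl] by (rule idR)
  interpret R: sigma_finite_measure R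
    unfolding R_def by (rule sigma_finite_measure_restrict_space[OF sigma_finite_lborel]) (use Ib in simp)
  have "sigma_finite_measure T"
    unfolding T_def by (subst R.sigma_finite_iff_density_finite) auto
  from pair_sigma_finite.intro[OF this m.sigma_finite_measure_axioms] interpret P: pair_sigma_finite T m .
  have abR: "{a..b} \<in> sets R" unfolding R_def using Ib ab(2) by (simp add: sets_restrict_space_iff)
  have abT: "{a..b} \<in> sets T" using abR by (simp add: sT)
  \<comment> \<open>On the compact interval the density is bounded. Hence \<open>{a..b}\<close>
    times the ball has finite measure and the bounded integrand is integrable.\<close>
  have cpow: "continuous_on {a..b} (\<lambda>t. f t powr N)"
  proof (rule continuous_on_powr[OF continuous_on_subset[OF cont ab(2)] continuous_on_const])
    show "\<forall>t\<in>{a..b}. f t \<noteq> 0" using ab(2) pos by force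
  qed
  then have "bounded ((\<lambda>t. f t powr N) ` {a..b})" by (intro compact_imp_bounded compact_continuous_image) simp_all
  then obtain c where c0: "\<forall>y\<in>(\<lambda>t. f t powr N) ` {a..b}. norm y \<le> c" unfolding bounded_iff by blast
  have c: "f t powr N \<le> c" if "t \<in> {a..b}" for t using bspec[OF c0 imageI[OF that]] by simp
  have "emeasure T {a..b} = (\<integral>\<^sup>+t. ennreal (f t powr N) * indicator {a..b} t \<partial>R)"
    unfolding T_def by (rule emeasure_density) (use abR in auto)
  also have "\<dots> \<le> (\<integral>\<^sup>+t. ennreal c * indicator {a..b} t \<partial>R)"
    using c by (intro nn_integral_mono) (auto simp: indicator_def intro: ennreal_leI)
  also have "\<dots> = ennreal c * emeasure R {a..b}" by (rule nn_integral_cmult_indicator[OF abR])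
  also have "emeasure R {a..b} = emeasure lborel {a..b}" unfolding R_def using Ib ab(2) by (intro emeasure_restrict_space) auto
  also have "ennreal c * emeasure lborel {a..b} < \<infinity>" using ab(1) by (simp add: ennreal_mult_less_top)
  finally have fin: "emeasure T {a..b} < \<infinity>" .
  have cm: "cone_measure I f N m = T \<Otimes>\<^sub>M m" by (simp add: cone_measure_def T_def R_def)
  define Q where "Q = (\<lambda>z. indicator {a..b} (fst z) * H (fst z) (snd z))"
  have "(\<lambda>z. (fst z, snd z)) \<in> T \<Otimes>\<^sub>M m \<rightarrow>\<^sub>M borel \<Otimes>\<^sub>M m"
    by (intro measurable_Pair measurable_compose[OF measurable_fst idT] measurable_snd)
  from measurable_compose[OF this H] have HT: "(\<lambda>z. H (fst z) (snd z)) \<in> borel_measurable (T \<Otimes>\<^sub>M m)" by simp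
  have Qm: "Q \<in> borel_measurable (T \<Otimes>\<^sub>M m)"
    unfolding Q_def by (intro borel_measurable_times HT measurable_compose[OF measurable_fst borel_measurable_indicator[OF abT]])
  have Qi: "integrable (T \<Otimes>\<^sub>M m) Q"
  proof (rule integrableI_bounded_set[OF _ Qm, of "{a..b} \<times> ?B" D])
    show "{a..b} \<times> ?B \<in> sets (T \<Otimes>\<^sub>M m)" using abT B(1) by simp
    show "emeasure (T \<Otimes>\<^sub>M m) ({a..b} \<times> ?B) < \<infinity>"
      using fin B(2) by (simp add: m.emeasure_pair_measure_Times[OF abT B(1)] ennreal_mult_less_top)
    show "AE z in T \<Otimes>\<^sub>M m. z \<in> {a..b} \<times> ?B \<longrightarrow> norm (Q z) \<le> D" using D by (auto simp: Q_def H_def)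
    show "AE z in T \<Otimes>\<^sub>M m. z \<notin> {a..b} \<times> ?B \<longrightarrow> Q z = 0"
      by (rule AE_I2) (auto simp: Q_def H_def indicator_def mem_Times_iff)
  qed
  have "(LINT z:{a..b} \<times> ?B|cone_measure I f N m. F (fst z) (snd z)) = integral\<^sup>L (T \<Otimes>\<^sub>M m) Q"
    unfolding set_lebesgue_integral_def cm
    by (rule arg_cong[where f = "integral\<^sup>L (T \<Otimes>\<^sub>M m)"]) (auto simp: Q_def H_def fun_eq_iff indicator_def)
  also have "\<dots> = (LINT t|T. LINT x|m. Q (t, x))" by (rule P.integral_fst'[OF Qi, symmetric])
  also have "\<dots> = (LINT t|T. indicator {a..b} t * (LINT x:?B|m. F t x))"
    by (simp add: Q_def int)
  also have "\<dots> = (LINT t|R. f t powr N *\<^sub>R (indicator {a..b} t * (LINT x:?B|m. F t x)))"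
    unfolding T_def
  proof (rule integral_density)
    show "(\<lambda>t. indicator {a..b} t * (LINT x:?B|m. F t x)) \<in> borel_measurable R"
      by (intro borel_measurable_times borel_measurable_indicator[OF abR] measurable_compose[OF idR meas])
  qed auto
  also have "\<dots> = (LINT t|lborel. indicator I t *\<^sub>R (f t powr N *\<^sub>R (indicator {a..b} t * (LINT x:?B|m. F t x))))"
    unfolding R_def by (rule integral_restrict_space) (use Ib in simp)
  also have "\<dots> = (LINT t|lborel. indicator {a..b} t * f t powr N * (LINT x:?B|m. F t x))"
    using ab(2) by (intro Bochner_Integration.integral_cong) (auto simp: indicator_def)
  finally show "(LINT z:{a..b} \<times> ?B|cone_measure I f N m. F (fst z) (snd z)) =
      (LINT t|lborel. indicator {a..b} t * f t powr N * (LINT x:?B|m. F t x))" .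
qed

end

text \<open>The ambient spaces of \<open>measured_GH_converges\<close> have their points in \<open>nat \<Rightarrow> real\<close>.\<close>

definition enc :: "real \<times> (nat \<Rightarrow> real) \<Rightarrow> nat \<Rightarrow> real" where
  "enc z = case_nat (fst z) (snd z)"

lemma inj_enc: "inj_on enc S"
proof (rule inj_onI)
  fix z w assume eq: "enc z = enc w"
  have "fst z = fst w" using fun_cong[OF eq, of 0] by (simp add: enc_def)
  moreover have "snd z = snd w"
  proof
    fix n show "snd z n = snd w n" using fun_cong[OF eq, of "Suc n"] by (simp add: enc_def)
  qed
  ultimately show "z = w" by (simp add: prod_eq_iff)
qed

text \<open>Ambient space for the cones: the common space of the fibre balls times the real line, on
  which the time intervals can be slid.\<close>

lemma line_product:
  fixes Z0 :: "(nat \<Rightarrow> real) metric"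
  obtains Z :: "(nat \<Rightarrow> real) metric" where "mspace Z = enc ` (UNIV \<times> mspace Z0)"
    "\<And>z w. z \<in> UNIV \<times> mspace Z0 \<Longrightarrow> w \<in> UNIV \<times> mspace Z0 \<Longrightarrow>
      mdist Z (enc z) (enc w) = sqrt ((fst z - fst w)\<^sup>2 + (mdist Z0 (snd z) (snd w))\<^sup>2)"
proof -
  let ?P = "prod_metric (euclidean_metric :: real metric) Z0"
  have P: "Metric_space (mspace ?P) (mdist ?P)" by (rule Metric_space_mspace_mdist)
  obtain Z where Z: "mspace Z = enc ` mspace ?P" "\<And>x y. x \<in> mspace ?P \<Longrightarrow> y \<in> mspace ?P \<Longrightarrow> mdist Z (enc x) (enc y) = mdist ?P x y"
    using metric_encode[OF P inj_enc] by blast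
  show thesis
  proof (rule that[of Z])
    show "mspace Z = enc ` (UNIV \<times> mspace Z0)" using Z(1) by simp
    fix z w :: "real \<times> (nat \<Rightarrow> real)" assume "z \<in> UNIV \<times> mspace Z0" "w \<in> UNIV \<times> mspace Z0"
    then show "mdist Z (enc z) (enc w) = sqrt ((fst z - fst w)\<^sup>2 + (mdist Z0 (snd z) (snd w))\<^sup>2)"
      using Z(2)[of z w] by (cases z; cases w) (simp add: prod_dist_def dist_real_def)
  qed
qed

section \<open>Time densities and weak convergence of the cone measures\<close>

context cone_level
begin

text \<open>Translation aligning the left ends of the intervals. The affine map \<psi> would not
  give an isometric embedding.\<close>

definition shift :: "nat \<Rightarrow> real" where "shift i = a' - a i"

definition weight :: "real \<Rightarrow> nat \<Rightarrow> real \<Rightarrow> real" where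
  "weight N i t = indicator {a i..b i} (t - shift i) * f i (t - shift i) powr N"

definition weight' :: "real \<Rightarrow> real \<Rightarrow> real" where
  "weight' N t = indicator {a'..b'} t * f' t powr N"

lemma weight_measurable: "weight N i \<in> borel_measurable borel" "weight' N \<in> borel_measurable borel"
proof -
  have "continuous_on {a i..b i} (\<lambda>t. f i t powr N)"
    using Icc_in_domain(1)[of i] warped_cone.pos[OF level_warped[of i]] by (intro continuous_on_powr f_cont continuous_on_const) force
  then have "(\<lambda>t. indicator {a i..b i} t *\<^sub>R (f i t powr N)) \<in> borel_measurable borel"
    by (intro borel_measurable_continuous_on_indicator) auto
  then have m: "(\<lambda>t. indicator {a i..b i} t * f i t powr N) \<in> borel_measurable borel" by simp
  have "(\<lambda>t. t - shift i) \<in> borel \<rightarrow>\<^sub>M borel" by measurable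
  from measurable_compose[OF this m] show "weight N i \<in> borel_measurable borel" by (simp add: weight_def[abs_def])
  have "continuous_on {a'..b'} (\<lambda>t. f' t powr N)"
    using Icc_in_domain(2) L.pos by (intro continuous_on_powr f_cont continuous_on_const) force
  then have "(\<lambda>t. indicator {a'..b'} t *\<^sub>R (f' t powr N)) \<in> borel_measurable borel"
    by (intro borel_measurable_continuous_on_indicator) auto
  then show "weight' N \<in> borel_measurable borel" by (simp add: weight'_def[abs_def])
qed

lemma length_tendsto: "(\<lambda>i. b i - a i) \<longlonglongrightarrow> b' - a'"
proof (rule LIMSEQ_I)
  fix r :: real assume "0 < r"
  then have "0 < r / 2" by simp
  from warp_eventually[OF this] have "\<forall>\<^sub>F i in sequentially. norm ((b i - a i) - (b' - a')) < r"
  proof eventually_elim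
    case (elim i)
    then show ?case using \<open>0 < r\<close> unfolding real_norm_def by linarith
  qed
  then show "\<exists>no. \<forall>n\<ge>no. norm ((b n - a n) - (b' - a')) < r" by (simp add: eventually_sequentially)
qed

text \<open>At the endpoints of the limit interval the indicators may jump; away from them they are
  eventually constant.\<close>

lemma weight_tendsto:
  assumes t: "t \<noteq> a'" "t \<noteq> b'"
  shows "(\<lambda>i. weight N i t) \<longlonglongrightarrow> weight' N t"
proof -
  consider "t < a'" | "b' < t" | "a' < t" "t < b'" using t by linarith
  then show ?thesis
  proof cases
    case 1
    then have "weight N i t = 0" "weight' N t = 0" for i by (auto simp: weight_def weight'_def shift_def)
    then show ?thesis by simp
  next
    case 2
    then have "\<forall>\<^sub>F i in sequentially. b i - a i < t - a'" by (intro order_tendstoD(2)[OF length_tendsto]) simp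
    then have "\<forall>\<^sub>F i in sequentially. weight N i t = weight' N t"
      by eventually_elim (use 2 in \<open>auto simp: weight_def weight'_def shift_def\<close>)
    then show ?thesis by (rule tendsto_eventually)
  next
    case 3
    define u where "u = (\<lambda>i. t - shift i)"
    have ev: "\<forall>\<^sub>F i in sequentially. t - a' < b i - a i" using 3 by (intro order_tendstoD(1)[OF length_tendsto]) simp
    then have uin: "\<forall>\<^sub>F i in sequentially. u i \<in> {a i..b i}"
      by eventually_elim (use 3 in \<open>auto simp: u_def shift_def\<close>)
    \<comment> \<open>Translated and affine time agree in the limit because the lengths converge.
      This brings in the estimate of \<open>warp_eventually\<close>, which is stated along
      \<psi>.\<close>
    have \<psi>u: "(\<lambda>i. \<psi> i (u i)) \<longlonglongrightarrow> t"
    proof -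
      have "(\<lambda>i. a' + (t - a') * ((b' - a') / (b i - a i))) \<longlonglongrightarrow> a' + (t - a') * ((b' - a') / (b' - a'))"
        using ab(2) by (intro tendsto_intros length_tendsto) simp
      then show ?thesis using ab(2) by (simp add: aff_def u_def shift_def)
    qed
    have f't: "(\<lambda>i. f' (\<psi> i (u i))) \<longlonglongrightarrow> f' t"
    proof (rule continuous_on_tendsto_compose[OF f_cont(2) \<psi>u])
      show "t \<in> {a'..b'}" using 3 by simp
      show "\<forall>\<^sub>F i in sequentially. \<psi> i (u i) \<in> {a'..b'}" using uin by eventually_elim (rule aff_bounds[OF ab])
    qed
    have diff: "(\<lambda>i. f i (u i) - f' (\<psi> i (u i))) \<longlonglongrightarrow> 0"
    proof (rule LIMSEQ_I)
      fix r :: real assume "0 < r"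
      then have "0 < r / 2" by simp
      from warp_eventually[OF this] uin have "\<forall>\<^sub>F i in sequentially. norm (f i (u i) - f' (\<psi> i (u i)) - 0) < r"
      proof eventually_elim
        case (elim i)
        then have "\<bar>f i (u i) - f' (\<psi> i (u i))\<bar> \<le> r / 2" by blast
        then show ?case using \<open>0 < r\<close> by simp
      qed
      then show "\<exists>no. \<forall>n\<ge>no. norm (f n (u n) - f' (\<psi> n (u n)) - 0) < r" by (simp add: eventually_sequentially)
    qed
    have "(\<lambda>i. f i (u i)) \<longlonglongrightarrow> f' t" using tendsto_add[OF diff f't] by simp
    moreover have "f' t \<noteq> 0"
    proof -
      have "t \<in> I'" using Icc_in_domain(2) 3 by auto
      from L.pos[OF this] show ?thesis by simp
    qed
    ultimately have "(\<lambda>i. f i (u i) powr N) \<longlonglongrightarrow> f' t powr N" by (intro tendsto_powr tendsto_const)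
    moreover have "\<forall>\<^sub>F i in sequentially. f i (u i) powr N = weight N i t"
      using uin by eventually_elim (simp add: weight_def u_def)
    ultimately have "(\<lambda>i. weight N i t) \<longlonglongrightarrow> f' t powr N" by (rule Lim_transform_eventually)
    then show ?thesis using 3 by (simp add: weight'_def)
  qed
qed

text \<open>Dominated convergence. The aligned intervals eventually lie in
  \<open>{a'..b' + 1}\<close>, and \<open>f i \<le> M + 1\<close> there gives a constant bound
  because \<open>0 \<le> N\<close> makes \<open>powr N\<close> monotone.\<close>

lemma weighted_integral_tendsto:
  assumes N: "0 \<le> N" and h: "\<And>i. h i \<in> borel_measurable borel" "h' \<in> borel_measurable borel"
    and lim: "\<And>t. (\<lambda>i. h i t) \<longlonglongrightarrow> h' t" and D: "\<And>i t. \<bar>h i t\<bar> \<le> D"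
  shows "(\<lambda>i. LINT t|lborel. weight N i t * h i t) \<longlonglongrightarrow> (LINT t|lborel. weight' N t * h' t)"
proof -
  obtain c M where c: "0 < c" "0 < M" "\<And>t. t \<in> {a'..b'} \<Longrightarrow> c \<le> f' t" "\<And>t. t \<in> {a'..b'} \<Longrightarrow> f' t \<le> M"
    using f'_bounds by blast
  have D0: "0 \<le> D" using D[of 0 0] by linarith
  have "\<forall>\<^sub>F i in sequentially. \<forall>t. \<bar>weight N i t * h i t\<bar> \<le> (M + 1) powr N * D * indicator {a'..b' + 1} t"
    using warp_eventually[OF zero_less_one]
  proof eventually_elim
    case (elim i)
    show ?case
    proof
      fix t
      show "\<bar>weight N i t * h i t\<bar> \<le> (M + 1) powr N * D * indicator {a'..b' + 1} t"
      proof (cases "t - shift i \<in> {a i..b i}")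
        case False
        then show ?thesis using D0 by (simp add: weight_def)
      next
        case True
        have "\<psi> i (t - shift i) \<in> {a'..b'}" by (rule aff_bounds[OF ab True])
        then have "f' (\<psi> i (t - shift i)) \<le> M" by (rule c(4))
        moreover have "\<bar>f i (t - shift i) - f' (\<psi> i (t - shift i))\<bar> \<le> 1" using elim True by blast
        ultimately have fM: "f i (t - shift i) \<le> M + 1" by linarith
        have "0 < f i (t - shift i)" using warped_cone.pos[OF level_warped[of i]] Icc_in_domain(1)[of i] True by blast
        then have "f i (t - shift i) powr N \<le> (M + 1) powr N" using N fM by (intro powr_mono2) auto
        then have "\<bar>weight N i t * h i t\<bar> \<le> (M + 1) powr N * D"
          unfolding abs_mult using True D[of i t] by (intro mult_mono) (auto simp: weight_def)
        moreover have "t \<in> {a'..b' + 1}" using True elim by (auto simp: shift_def)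
        ultimately show ?thesis by simp
      qed
    qed
  qed
  then obtain i0 where i0: "\<And>i t. i0 \<le> i \<Longrightarrow> \<bar>weight N i t * h i t\<bar> \<le> (M + 1) powr N * D * indicator {a'..b' + 1} t"
    unfolding eventually_sequentially by blast
  \<comment> \<open>The domination holds only from \<open>i0\<close> on, so the sequence is
    shifted.\<close>
  have "(\<lambda>i. LINT t|lborel. weight N (i + i0) t * h (i + i0) t) \<longlonglongrightarrow> (LINT t|lborel. weight' N t * h' t)"
  proof (rule integral_dominated_convergence[where w = "\<lambda>t. (M + 1) powr N * D * indicator {a'..b' + 1} t"])
    show "(\<lambda>t. weight' N t * h' t) \<in> borel_measurable lborel" using weight_measurable(2) h(2) by simp
    show "(\<lambda>t. weight N (i + i0) t * h (i + i0) t) \<in> borel_measurable lborel" for i using weight_measurable(1) h(1) by simp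
    show "integrable lborel (\<lambda>t. (M + 1) powr N * D * indicator {a'..b' + 1} t)"
      by (intro integrable_mult_right integrable_real_indicator) (auto simp: emeasure_lborel_Icc_eq)
    have "AE t in lborel. t \<noteq> a'" "AE t in lborel. t \<noteq> b'" by (rule AE_lborel_singleton)+
    then show "AE t in lborel. (\<lambda>i. weight N (i + i0) t * h (i + i0) t) \<longlonglongrightarrow> weight' N t * h' t"
    proof eventually_elim
      case (elim t)
      then show ?case by (intro LIMSEQ_ignore_initial_segment tendsto_mult weight_tendsto lim)
    qed
    show "AE t in lborel. norm (weight N (i + i0) t * h (i + i0) t) \<le> (M + 1) powr N * D * indicator {a'..b' + 1} t" for i
      using i0[of "i + i0"] by simp
  qed
  then show ?thesis by (rule LIMSEQ_offset)
qed

text \<open>Permits division by the limit of the total time weights.\<close>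

lemma weight_integral_pos: "0 < (LINT t|lborel. weight' N t)"
proof -
  have cont: "continuous_on {a'..b'} (\<lambda>t. f' t powr N)"
    using Icc_in_domain(2) L.pos by (intro continuous_on_powr f_cont continuous_on_const) force
  have si: "set_integrable lborel {a'..b'} (\<lambda>t. f' t powr N)" by (rule borel_integrable_atLeastAtMost') (rule cont)
  have "(LINT t|lborel. weight' N t) = (LINT t:{a'..b'}|lborel. f' t powr N)"
    by (simp add: set_lebesgue_integral_def weight'_def)
  also have "\<dots> = integral {a'..b'} (\<lambda>t. f' t powr N)" by (rule set_borel_integral_eq_integral(2)[OF si])
  finally have e: "(LINT t|lborel. weight' N t) = integral {a'..b'} (\<lambda>t. f' t powr N)" .
  have nn: "0 \<le> integral {a'..b'} (\<lambda>t. f' t powr N)" by (intro integral_nonneg integrable_continuous_real cont) simp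
  have "integral {a'..b'} (\<lambda>t. f' t powr N) \<noteq> 0"
  proof
    assume "integral {a'..b'} (\<lambda>t. f' t powr N) = 0"
    then have "f' a' powr N = 0" using integral_eq_0_iff[OF cont ab(2)] ab(2) by simp
    moreover have "0 < f' a'" using L.pos Icc_in_domain(2) ab(2) by force
    ultimately show False by simp
  qed
  then show ?thesis using nn e by linarith
qed

text \<open>If the fibre ball is a null set, both sides vanish, as \<open>x / 0 = 0\<close>.\<close>

lemma (in covered_cone) normalized_cone_integral:
  fixes F :: "real \<Rightarrow> 'x \<Rightarrow> real"
  assumes m: "radon_measure_on X m" and ab: "a \<le> b" "{a..b} \<subseteq> I"
    and F: "\<And>t. continuous_map (mtopology_of (submetric X (mcball_of X p r))) euclideanreal (F t)"
    and Ft: "\<And>x. x \<in> mcball_of X p r \<Longrightarrow> continuous_on UNIV (\<lambda>t. F t x)"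
    and D: "\<And>t x. x \<in> mcball_of X p r \<Longrightarrow> \<bar>F t x\<bar> \<le> D"
  defines "h \<equiv> (\<lambda>t. (LINT x:mcball_of X p r|m. F t x) / measure m (mcball_of X p r))"
  shows "(LINT z:{a..b} \<times> mcball_of X p r|cone_measure I f N m. F (fst z) (snd z)) /
      measure (cone_measure I f N m) ({a..b} \<times> mcball_of X p r) =
      (LINT t|lborel. indicator {a..b} t * f t powr N * h t) / (LINT t|lborel. indicator {a..b} t * f t powr N)"
    and "h \<in> borel_measurable borel" and "0 \<le> D \<Longrightarrow> \<bar>h t\<bar> \<le> D"
proof -
  let ?B = "mcball_of X p r"
  note A = cone_set_integral[OF m ab F Ft D]
  note B = radon_mcball[OF m, of r]
  have Bsub: "?B \<inter> space m = ?B" using sets.sets_into_space[OF B(1)] by blast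
  show "h \<in> borel_measurable borel" unfolding h_def using A(2) by measurable
  show "\<bar>h t\<bar> \<le> D" if "0 \<le> D"
  proof (cases "measure m ?B = 0")
    case False
    then have "0 < measure m ?B" by (simp add: zero_less_measure_iff)
    then show ?thesis using A(3)[of t] by (simp add: h_def abs_divide divide_le_eq)
  qed (simp add: h_def that)
  \<comment> \<open>This holds for null balls too: the bound on the fibre integral then forces it to
    vanish.\<close>
  have mh: "(LINT x:?B|m. F t x) = measure m ?B * h t" for t
    using A(3)[of t] by (cases "measure m ?B = 0") (auto simp: h_def)
  have one: "(LINT z:{a..b} \<times> ?B|cone_measure I f N m. (1::real)) = (LINT t|lborel. indicator {a..b} t * f t powr N * (LINT x:?B|m. (1::real)))"
    using cone_set_integral(1)[OF m ab, of r "\<lambda>_ _. 1" 1 N] by simp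
  have "(LINT x:?B|m. (1::real)) = measure m ?B" by (simp add: set_lebesgue_integral_def Bsub)
  moreover have "(LINT z:{a..b} \<times> ?B|cone_measure I f N m. (1::real)) = measure (cone_measure I f N m) ({a..b} \<times> ?B)"
  proof -
    have "{a..b} \<times> ?B \<subseteq> space (cone_measure I f N m)"
      using ab(2) Bsub by (auto simp: cone_measure_def space_pair_measure space_restrict_space)
    then show ?thesis by (simp add: set_lebesgue_integral_def Int_absorb2)
  qed
  ultimately have meas: "measure (cone_measure I f N m) ({a..b} \<times> ?B) = measure m ?B * (LINT t|lborel. indicator {a..b} t * f t powr N)"
    using one by (simp add: mult.commute)
  have int: "(LINT z:{a..b} \<times> ?B|cone_measure I f N m. F (fst z) (snd z)) = measure m ?B * (LINT t|lborel. indicator {a..b} t * f t powr N * h t)"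
  proof -
    have "(LINT t|lborel. indicator {a..b} t * f t powr N * (measure m ?B * h t)) =
       (LINT t|lborel. measure m ?B * (indicator {a..b} t * f t powr N * h t))"
      by (rule Bochner_Integration.integral_cong) (auto simp: algebra_simps)
    moreover have "(LINT z:{a..b} \<times> ?B|cone_measure I f N m. F (fst z) (snd z)) =
      (LINT t|lborel. indicator {a..b} t * f t powr N * (measure m ?B * h t))"
      using A(1)[of N] unfolding mh .
    ultimately show ?thesis by simp
  qed
  show "(LINT z:{a..b} \<times> ?B|cone_measure I f N m. F (fst z) (snd z)) /
      measure (cone_measure I f N m) ({a..b} \<times> ?B) =
      (LINT t|lborel. indicator {a..b} t * f t powr N * h t) / (LINT t|lborel. indicator {a..b} t * f t powr N)"
  proof (cases "measure m ?B = 0")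
    case True
    then have "h t = 0" for t by (simp add: h_def)
    then show ?thesis unfolding int meas using True by simp
  next
    case False
    then show ?thesis unfolding int meas by simp
  qed
qed

text \<open>A test function on the product, frozen at time \<open>t\<close>, is a test function on
  the common space of the fibres. So the fibre averages \<open>h i t\<close> converge for every
  \<open>t\<close>. The normalised cone integrals are their averages with respect to the time
  weights.\<close>

lemma measured_convergence:
  fixes m :: "nat \<Rightarrow> 'x measure" and m' :: "'y measure"
  assumes N: "0 \<le> N" and m: "\<And>i. radon_measure_on (X i) (m i)" and m': "radon_measure_on X' m'"
    and conv: "measured_GH_converges (\<lambda>i. submetric (X i) (ball i)) m (submetric X' ball') m'"
  shows "measured_GH_converges (\<lambda>i. cl_metric (Y i) (cone_cover (X i) (p i) (J i) k))
     (\<lambda>i. cone_measure (I i) (f i) N (m i)) (cl_metric Y' (cone_cover X' p' J' k)) (cone_measure I' f' N m')"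
proof -
  have ms: "mspace (submetric (X i) (ball i)) = ball i" "mspace (submetric X' ball') = ball'" for i by auto
  obtain Z0 :: "(nat \<Rightarrow> real) metric" and \<iota> \<kappa> where
    \<iota>: "\<And>i. isometric_embedding (submetric (X i) (ball i)) Z0 (\<iota> i)" and \<kappa>: "isometric_embedding (submetric X' ball') Z0 \<kappa>"
    and H: "(\<lambda>i. Hausdorff_dist Z0 (\<iota> i ` ball i) (\<kappa> ` ball')) \<longlonglongrightarrow> 0"
    and weak: "\<And>g. continuous_map (mtopology_of Z0) euclideanreal g \<Longrightarrow> bounded (g ` mspace Z0) \<Longrightarrow>
           (\<lambda>i. (LINT x:ball i|m i. g (\<iota> i x)) / measure (m i) (ball i))
             \<longlonglongrightarrow> (LINT x:ball'|m'. g (\<kappa> x)) / measure m' ball'"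
    using conv unfolding measured_GH_converges_def ms by blast
  obtain Z :: "(nat \<Rightarrow> real) metric" where Z: "mspace Z = enc ` (UNIV \<times> mspace Z0)"
    and dZ: "\<And>z w. z \<in> UNIV \<times> mspace Z0 \<Longrightarrow> w \<in> UNIV \<times> mspace Z0 \<Longrightarrow>
      mdist Z (enc z) (enc w) = sqrt ((fst z - fst w)\<^sup>2 + (mdist Z0 (snd z) (snd w))\<^sup>2)"
    using line_product[of Z0] by blast
  interpret Z0: Metric_space "mspace Z0" "mdist Z0" by simp
  have \<iota>in: "\<iota> i x \<in> mspace Z0" if "x \<in> ball i" for i x
    using \<iota>[of i] that unfolding isometric_embedding_def ms by blast
  have \<kappa>in: "\<kappa> x \<in> mspace Z0" if "x \<in> ball'" for x
    using \<kappa> that unfolding isometric_embedding_def ms by blast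
  have \<iota>d: "mdist Z0 (\<iota> i x) (\<iota> i y) = mdist (X i) x y" if "x \<in> ball i" "y \<in> ball i" for i x y
    using \<iota>[of i] that unfolding isometric_embedding_def ms by simp
  have \<kappa>d: "mdist Z0 (\<kappa> x) (\<kappa> y) = mdist X' x y" if "x \<in> ball'" "y \<in> ball'" for x y
    using \<kappa> that unfolding isometric_embedding_def ms by simp
  define \<iota>' where "\<iota>' = (\<lambda>i z. enc (fst z + shift i, \<iota> i (snd z)))"
  define \<kappa>' where "\<kappa>' = (\<lambda>z. enc (fst z, \<kappa> (snd z)))"
  have A: "mspace (cl_metric (Y i) (cone_cover (X i) (p i) (J i) k)) = K i"
      "mdist (cl_metric (Y i) (cone_cover (X i) (p i) (J i) k)) z w = sqrt ((fst z - fst w)\<^sup>2 + (mdist (X i) (snd z) (snd w))\<^sup>2)" for i z w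
  proof -
    interpret Ci: covered_cone "I i" "f i" "X i" "p i" "J i" by (rule C)
    show "mspace (cl_metric (Y i) (cone_cover (X i) (p i) (J i) k)) = K i" unfolding Ci.cl_metric_cover[OF k] closure_J ..
    show "mdist (cl_metric (Y i) (cone_cover (X i) (p i) (J i) k)) z w = sqrt ((fst z - fst w)\<^sup>2 + (mdist (X i) (snd z) (snd w))\<^sup>2)"
      unfolding Ci.cl_metric_cover[OF k] Ci.mdist_cone ..
  qed
  have A': "mspace (cl_metric Y' (cone_cover X' p' J' k)) = K'"
      "mdist (cl_metric Y' (cone_cover X' p' J' k)) z w = sqrt ((fst z - fst w)\<^sup>2 + (mdist X' (snd z) (snd w))\<^sup>2)" for z w
    unfolding L.cl_metric_cover[OF k] L.mdist_cone closure_J by (rule refl)+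
  have emb: "isometric_embedding (cl_metric (Y i) (cone_cover (X i) (p i) (J i) k)) Z (\<iota>' i)" for i
    unfolding isometric_embedding_def A
  proof (intro conjI ballI funcsetI)
    show "\<iota>' i z \<in> mspace Z" if "z \<in> K i" for z 
    proof -
      have "(fst z + shift i, \<iota> i (snd z)) \<in> UNIV \<times> mspace Z0" using \<iota>in[of "snd z" i] that by (simp add: mem_Times_iff)
      then show ?thesis unfolding \<iota>'_def Z by (rule imageI)
    qed
    show "mdist Z (\<iota>' i z) (\<iota>' i w) = sqrt ((fst z - fst w)\<^sup>2 + (mdist (X i) (snd z) (snd w))\<^sup>2)" if "z \<in> K i" "w \<in> K i" for z w
    proof -
      have zw: "snd z \<in> ball i" "snd w \<in> ball i" using that by (auto simp: mem_Times_iff)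
      show ?thesis unfolding \<iota>'_def using \<iota>in[OF zw(1)] \<iota>in[OF zw(2)] \<iota>d[OF zw]
        dZ[of "(fst z + shift i, \<iota> i (snd z))" "(fst w + shift i, \<iota> i (snd w))"] by simp
    qed
  qed
  have emb': "isometric_embedding (cl_metric Y' (cone_cover X' p' J' k)) Z \<kappa>'"
    unfolding isometric_embedding_def A'
  proof (intro conjI ballI funcsetI)
    show "\<kappa>' z \<in> mspace Z" if "z \<in> K'" for z 
    proof -
      have "(fst z, \<kappa> (snd z)) \<in> UNIV \<times> mspace Z0" using \<kappa>in[of "snd z"] that by (simp add: mem_Times_iff)
      then show ?thesis unfolding \<kappa>'_def Z by (rule imageI)
    qed
    show "mdist Z (\<kappa>' z) (\<kappa>' w) = sqrt ((fst z - fst w)\<^sup>2 + (mdist X' (snd z) (snd w))\<^sup>2)" if "z \<in> K'" "w \<in> K'" for z w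
    proof -
      have zw: "snd z \<in> ball'" "snd w \<in> ball'" using that by (auto simp: mem_Times_iff)
      show ?thesis unfolding \<kappa>'_def using \<kappa>in[OF zw(1)] \<kappa>in[OF zw(2)] \<kappa>d[OF zw]
        dZ[of "(fst z, \<kappa> (snd z))" "(fst w, \<kappa> (snd w))"] by simp
    qed
  qed
  have pin: "p i \<in> ball i" "p' \<in> ball'" for i
  proof -
    interpret Ci: covered_cone "I i" "f i" "X i" "p i" "J i" by (rule C)
    show "p i \<in> ball i" using Ci.p_in by simp
    show "p' \<in> ball'" using L.p_in by simp
  qed
  \<comment> \<open>Balls about the base points provide the admissible radius that
    \<open>Hausdorff_dist_less\<close> asks for.\<close>
  have coarse: "\<exists>r0>0. \<iota> i ` ball i \<subseteq> nbhd Z0 r0 (\<kappa> ` ball') \<and> \<kappa> ` ball' \<subseteq> nbhd Z0 r0 (\<iota> i ` ball i)" for i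
  proof -
    define r0 where "r0 = mdist Z0 (\<kappa> p') (\<iota> i (p i)) + 2 ^ k + 1"
    have r0: "0 < r0" unfolding r0_def by (intro add_nonneg_pos add_nonneg_nonneg) auto
    have 1: "\<iota> i x \<in> mball_of Z0 (\<kappa> p') r0" if x: "x \<in> ball i" for x
    proof -
      have "mdist Z0 (\<kappa> p') (\<iota> i x) \<le> mdist Z0 (\<kappa> p') (\<iota> i (p i)) + mdist Z0 (\<iota> i (p i)) (\<iota> i x)"
        by (rule Z0.triangle[OF \<kappa>in[OF pin(2)] \<iota>in[OF pin(1)] \<iota>in[OF x]])
      moreover have "mdist Z0 (\<iota> i (p i)) (\<iota> i x) \<le> 2 ^ k" unfolding \<iota>d[OF pin(1) x] using x by simp
      ultimately show ?thesis using \<kappa>in[OF pin(2)] \<iota>in[OF x] by (simp add: r0_def)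
    qed
    have 2: "\<kappa> y \<in> mball_of Z0 (\<iota> i (p i)) r0" if y: "y \<in> ball'" for y
    proof -
      have "mdist Z0 (\<iota> i (p i)) (\<kappa> y) \<le> mdist Z0 (\<iota> i (p i)) (\<kappa> p') + mdist Z0 (\<kappa> p') (\<kappa> y)"
        by (rule Z0.triangle[OF \<iota>in[OF pin(1)] \<kappa>in[OF pin(2)] \<kappa>in[OF y]])
      moreover have "mdist Z0 (\<kappa> p') (\<kappa> y) \<le> 2 ^ k" unfolding \<kappa>d[OF pin(2) y] using y by simp
      ultimately show ?thesis using \<iota>in[OF pin(1)] \<kappa>in[OF y] Z0.commute[of "\<iota> i (p i)" "\<kappa> p'"] by (simp add: r0_def)
    qed
    show ?thesis unfolding nbhd_def using r0 1 2 pin by blast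
  qed
  have haus: "(\<lambda>i. Hausdorff_dist Z (\<iota>' i ` K i) (\<kappa>' ` K')) \<longlonglongrightarrow> 0"
  proof (rule LIMSEQ_I)
    fix r :: real assume r: "0 < r"
    then have r3: "0 < r / 3" by simp
    have "\<forall>\<^sub>F i in sequentially. Hausdorff_dist Z0 (\<iota> i ` ball i) (\<kappa> ` ball') < r / 3"
      by (rule order_tendstoD(2)[OF H r3])
    then have "\<forall>\<^sub>F i in sequentially. norm (Hausdorff_dist Z (\<iota>' i ` K i) (\<kappa>' ` K') - 0) < r"
      using warp_eventually[OF r3]
    proof eventually_elim
      case (elim i)
      obtain r0 where "0 < r0" "\<iota> i ` ball i \<subseteq> nbhd Z0 r0 (\<kappa> ` ball')" "\<kappa> ` ball' \<subseteq> nbhd Z0 r0 (\<iota> i ` ball i)" using coarse by blast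
      from Hausdorff_dist_less[OF this elim(1)]
      have near: "\<iota> i ` ball i \<subseteq> nbhd Z0 (r / 3) (\<kappa> ` ball')" "\<kappa> ` ball' \<subseteq> nbhd Z0 (r / 3) (\<iota> i ` ball i)" by auto
      \<comment> \<open>Any number strictly between \<open>2 * r / 3\<close>, the sum of the time
        and fibre errors, and \<open>r\<close>.\<close>
      define s where "s = 5 * r / 6"
      have s: "0 < s" "s < r" using r by (auto simp: s_def)
      have dist: "mdist Z (\<iota>' i z) (\<kappa>' w) < s" if z: "z \<in> K i" and w: "w \<in> K'"
          and t: "\<bar>fst z + shift i - fst w\<bar> \<le> r / 3" and d: "mdist Z0 (\<iota> i (snd z)) (\<kappa> (snd w)) < r / 3" for z w
      proof -
        have zw: "\<iota> i (snd z) \<in> mspace Z0" "\<kappa> (snd w) \<in> mspace Z0" using z w \<iota>in \<kappa>in by (auto simp: mem_Times_iff)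
        have "mdist Z (\<iota>' i z) (\<kappa>' w) = sqrt ((fst z + shift i - fst w)\<^sup>2 + (mdist Z0 (\<iota> i (snd z)) (\<kappa> (snd w)))\<^sup>2)"
          unfolding \<iota>'_def \<kappa>'_def using zw dZ[of "(fst z + shift i, \<iota> i (snd z))" "(fst w, \<kappa> (snd w))"] by simp
        also have "\<dots> \<le> \<bar>fst z + shift i - fst w\<bar> + \<bar>mdist Z0 (\<iota> i (snd z)) (\<kappa> (snd w))\<bar>" by (rule sqrt_sum_squares_le_sum_abs)
        also have "\<dots> < s" using t d r by (simp add: s_def)
        finally show ?thesis .
      qed
      interpret Zm: Metric_space "mspace Z" "mdist Z" by simp
      have inZ: "\<iota>' i z \<in> mspace Z" if "z \<in> K i" for z by (rule funcset_mem[OF conjunct1[OF emb[unfolded isometric_embedding_def A]] that])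
      have inZ': "\<kappa>' z \<in> mspace Z" if "z \<in> K'" for z by (rule funcset_mem[OF conjunct1[OF emb'[unfolded isometric_embedding_def A']] that])
      have S1: "\<iota>' i ` K i \<subseteq> nbhd Z s (\<kappa>' ` K')"
      proof
        fix u assume "u \<in> \<iota>' i ` K i"
        then obtain z where z: "z \<in> K i" "u = \<iota>' i z" by blast
        have sz: "snd z \<in> ball i" "fst z \<in> {a i..b i}" using z(1) by (auto simp: mem_Times_iff)
        have "\<iota> i (snd z) \<in> nbhd Z0 (r / 3) (\<kappa> ` ball')" using near(1) sz(1) by blast
        then obtain y where y: "y \<in> ball'" "mdist Z0 (\<kappa> y) (\<iota> i (snd z)) < r / 3" unfolding nbhd_def by auto
        \<comment> \<open>The shifted interval may reach beyond \<open>b'\<close>, by at most the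
          difference of the lengths; the time is clipped there.\<close>
        define w where "w = (min (fst z + shift i) b', y)"
        have w: "w \<in> K'" using sz(2) y(1) ab(2) by (auto simp: w_def shift_def)
        have "\<bar>fst z + shift i - fst w\<bar> \<le> r / 3" using sz(2) elim(2) r by (auto simp: w_def shift_def min_def)
        then have "mdist Z u (\<kappa>' w) < s" unfolding z(2) by (rule dist[OF z(1) w]) (use y(2) Z0.commute in \<open>simp add: w_def\<close>)
        then have "u \<in> mball_of Z (\<kappa>' w) s" using inZ[OF z(1)] inZ'[OF w] z(2) Zm.commute[of u "\<kappa>' w"] by simp
        then show "u \<in> nbhd Z s (\<kappa>' ` K')" unfolding nbhd_def using w by blast
      qed
      have S2: "\<kappa>' ` K' \<subseteq> nbhd Z s (\<iota>' i ` K i)"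
      proof
        fix u assume "u \<in> \<kappa>' ` K'"
        then obtain w where w: "w \<in> K'" "u = \<kappa>' w" by blast
        have sw: "snd w \<in> ball'" "fst w \<in> {a'..b'}" using w(1) by (auto simp: mem_Times_iff)
        have "\<kappa> (snd w) \<in> nbhd Z0 (r / 3) (\<iota> i ` ball i)" using near(2) sw(1) by blast
        then obtain x where x: "x \<in> ball i" "mdist Z0 (\<iota> i x) (\<kappa> (snd w)) < r / 3" unfolding nbhd_def by auto
        define z where "z = (min (fst w - shift i) (b i), x)"
        have z: "z \<in> K i" using sw(2) x(1) ab(1)[of i] by (auto simp: z_def shift_def)
        have "\<bar>fst z + shift i - fst w\<bar> \<le> r / 3" using sw(2) elim(2) r by (auto simp: z_def shift_def min_def)
        then have "mdist Z (\<iota>' i z) u < s" unfolding w(2) by (rule dist[OF z w(1)]) (use x(2) in \<open>simp add: z_def\<close>)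
        then have "u \<in> mball_of Z (\<iota>' i z) s" using inZ[OF z] inZ'[OF w(1)] w(2) by simp
        then show "u \<in> nbhd Z s (\<iota>' i ` K i)" unfolding nbhd_def using z by blast
      qed
      show ?case using Hausdorff_dist_le[OF s(1) S1 S2] s(2) by simp
    qed
    then show "\<exists>no. \<forall>n\<ge>no. norm (Hausdorff_dist Z (\<iota>' n ` K n) (\<kappa>' ` K') - 0) < r" by (simp add: eventually_sequentially)
  qed
  have weak_cone: "(\<lambda>i. (LINT z:K i|cone_measure (I i) (f i) N (m i). g (\<iota>' i z)) / measure (cone_measure (I i) (f i) N (m i)) (K i))
      \<longlonglongrightarrow> (LINT z:K'|cone_measure I' f' N m'. g (\<kappa>' z)) / measure (cone_measure I' f' N m') K'"
    if g: "continuous_map (mtopology_of Z) euclideanreal g" and gb: "bounded (g ` mspace Z)" for g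
  proof -
    obtain D where D: "0 < D" "\<And>\<omega>. \<omega> \<in> mspace Z \<Longrightarrow> \<bar>g \<omega>\<bar> \<le> D" using gb by (auto simp: bounded_pos)
    have gx: "continuous_map (mtopology_of Z0) euclideanreal (\<lambda>\<zeta>. g (enc (t, \<zeta>)))" for t
    proof -
      have "isometric_embedding Z0 Z (\<lambda>\<zeta>. enc (t, \<zeta>))" unfolding isometric_embedding_def using Z dZ by auto
      from continuous_map_compose[OF isometric_continuous_map[OF this] g] show ?thesis by (simp add: comp_def)
    qed
    have gt: "continuous_on UNIV (\<lambda>t. g (enc (t, \<zeta>)))" if "\<zeta> \<in> mspace Z0" for \<zeta>
    proof -
      have "isometric_embedding (euclidean_metric :: real metric) Z (\<lambda>t. enc (t, \<zeta>))"
        unfolding isometric_embedding_def using Z dZ that by (auto simp: dist_real_def)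
      from continuous_map_compose[OF isometric_continuous_map[OF this] g] show ?thesis by (simp add: comp_def)
    qed
    have gD: "\<bar>g (enc (t, \<zeta>))\<bar> \<le> D" if "\<zeta> \<in> mspace Z0" for t \<zeta> using D(2) Z that by blast
    define h where "h = (\<lambda>i t. (LINT x:ball i|m i. g (enc (t, \<iota> i x))) / measure (m i) (ball i))"
    define h' where "h' = (\<lambda>t. (LINT x:ball'|m'. g (enc (t, \<kappa> x))) / measure m' ball')"
    have hlim: "(\<lambda>i. h i t) \<longlonglongrightarrow> h' t" for t
      unfolding h_def h'_def
    proof (rule weak[OF gx[of t]])
      show "bounded ((\<lambda>\<zeta>. g (enc (t, \<zeta>))) ` mspace Z0)" using gD by (auto simp: bounded_iff)
    qed
    have cone: "(LINT z:K i|cone_measure (I i) (f i) N (m i). g (\<iota>' i z)) / measure (cone_measure (I i) (f i) N (m i)) (K i)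
        = (LINT t|lborel. weight N i t * h i t) / (LINT t|lborel. weight N i t * 1)"
      and hm: "h i \<in> borel_measurable borel" and hD: "\<bar>h i t\<bar> \<le> D" for i t
    proof -
      interpret Ci: covered_cone "I i" "f i" "X i" "p i" "J i" by (rule C)
      have F1: "continuous_map (mtopology_of (submetric (X i) (ball i))) euclideanreal (\<lambda>x. g (enc (t, \<iota> i x)))" for t
        using continuous_map_compose[OF isometric_continuous_map[OF \<iota>[of i]] gx[of t]] by (simp add: comp_def)
      have F2: "continuous_on UNIV (\<lambda>t. g (enc (t + c, \<iota> i x)))" if "x \<in> ball i" for x c
        by (rule continuous_on_compose2[OF gt[OF \<iota>in[OF that]]]) (auto intro!: continuous_intros)
      have F3: "\<bar>g (enc (t, \<iota> i x))\<bar> \<le> D" if "x \<in> ball i" for x t by (rule gD[OF \<iota>in[OF that]])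
      have F20: "continuous_on UNIV (\<lambda>t. g (enc (t, \<iota> i x)))" if "x \<in> ball i" for x using F2[OF that, of 0] by simp
      note nc = Ci.normalized_cone_integral[OF m[of i] less_imp_le[OF ab(1)[of i]] Icc_in_domain(1)[of i], where r = "2 ^ k" and D = D]
      note n0 = nc[where F = "\<lambda>t x. g (enc (t, \<iota> i x))"] and n1 = nc[where F = "\<lambda>t x. g (enc (t + shift i, \<iota> i x))"]
      show "h i \<in> borel_measurable borel" unfolding h_def by (rule n0(2)) (use F1 F20 F3 in blast)+
      show "\<bar>h i t\<bar> \<le> D" unfolding h_def by (rule n0(3)) (use F1 F20 F3 D(1) in \<open>auto intro: less_imp_le\<close>)
      \<comment> \<open>Translation invariance moves the shift from the test function onto the
        weight, so that all weights refer to the same time variable.\<close>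
      have tr: "(LINT t|lborel. G (t + shift i)) = (LINT t|lborel. G t)" for G :: "real \<Rightarrow> real"
        using lborel_integral_real_affine[of 1 G "shift i"] by (simp add: add.commute)
      have "(LINT z:K i|cone_measure (I i) (f i) N (m i). g (\<iota>' i z)) / measure (cone_measure (I i) (f i) N (m i)) (K i)
        = (LINT t|lborel. indicator {a i..b i} t * f i t powr N * h i (t + shift i)) / (LINT t|lborel. indicator {a i..b i} t * f i t powr N)"
        unfolding \<iota>'_def h_def by (rule n1(1)) (use F1 F2 F3 in blast)+
      moreover have "(LINT t|lborel. indicator {a i..b i} t * f i t powr N * h i (t + shift i)) = (LINT t|lborel. weight N i t * h i t)"
        using tr[of "\<lambda>t. weight N i t * h i t"] by (simp add: weight_def)
      moreover have "(LINT t|lborel. indicator {a i..b i} t * f i t powr N) = (LINT t|lborel. weight N i t)"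
        using tr[of "\<lambda>t. weight N i t"] by (simp add: weight_def)
      ultimately show "(LINT z:K i|cone_measure (I i) (f i) N (m i). g (\<iota>' i z)) / measure (cone_measure (I i) (f i) N (m i)) (K i)
        = (LINT t|lborel. weight N i t * h i t) / (LINT t|lborel. weight N i t * 1)" by simp
    qed
    have cone': "(LINT z:K'|cone_measure I' f' N m'. g (\<kappa>' z)) / measure (cone_measure I' f' N m') K'
        = (LINT t|lborel. weight' N t * h' t) / (LINT t|lborel. weight' N t * 1)"
      and hm': "h' \<in> borel_measurable borel"
    proof -
      have F1: "continuous_map (mtopology_of (submetric X' ball')) euclideanreal (\<lambda>x. g (enc (t, \<kappa> x)))" for t
        using continuous_map_compose[OF isometric_continuous_map[OF \<kappa>] gx[of t]] by (simp add: comp_def)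
      have F2: "continuous_on UNIV (\<lambda>t. g (enc (t, \<kappa> x)))" if "x \<in> ball'" for x by (rule gt[OF \<kappa>in[OF that]])
      have F3: "\<bar>g (enc (t, \<kappa> x))\<bar> \<le> D" if "x \<in> ball'" for x t by (rule gD[OF \<kappa>in[OF that]])
      note n0 = L.normalized_cone_integral[OF m' less_imp_le[OF ab(2)] Icc_in_domain(2), where r = "2 ^ k" and D = D
        and F = "\<lambda>t x. g (enc (t, \<kappa> x))", OF F1 F2 F3]
      show "h' \<in> borel_measurable borel" unfolding h'_def by (rule n0(2))
      show "(LINT z:K'|cone_measure I' f' N m'. g (\<kappa>' z)) / measure (cone_measure I' f' N m') K'
        = (LINT t|lborel. weight' N t * h' t) / (LINT t|lborel. weight' N t * 1)"
        using n0(1)[where N = N] by (simp add: \<kappa>'_def h'_def weight'_def)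
    qed
    have "(\<lambda>i. LINT t|lborel. weight N i t * h i t) \<longlonglongrightarrow> (LINT t|lborel. weight' N t * h' t)"
      by (rule weighted_integral_tendsto[OF N hm hm' hlim hD])
    moreover have "(\<lambda>i. LINT t|lborel. weight N i t * 1) \<longlonglongrightarrow> (LINT t|lborel. weight' N t * 1)"
      by (rule weighted_integral_tendsto[OF N, where D = 1]) auto
    ultimately show ?thesis unfolding cone cone' using weight_integral_pos[of N] by (intro tendsto_divide) auto
  qed
  show ?thesis unfolding measured_GH_converges_def A A'
  proof (intro exI[of _ Z] exI[of _ \<iota>'] exI[of _ \<kappa>'] conjI allI impI emb emb' haus)
    fix g assume "continuous_map (mtopology_of Z) euclideanreal g \<and> bounded (g ` mspace Z)"
    then show "(\<lambda>i. (LINT z:K i|cone_measure (I i) (f i) N (m i). g (\<iota>' i z)) / measure (cone_measure (I i) (f i) N (m i)) (K i))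
      \<longlonglongrightarrow> (LINT z:K'|cone_measure I' f' N m'. g (\<kappa>' z)) / measure (cone_measure I' f' N m') K'"
      by (elim conjE) (rule weak_cone)
  qed
qed

end

section \<open>Convergence of cones\<close>

context cone_level
begin

text \<open>For large \<open>i\<close> the warping functions are at least \<open>c / 2\<close>. Each
  of the finitely many other cones has its own positive minimum on the compact interval.\<close>

lemma causal_length_bound:
  "\<exists>B>0. \<forall>i S \<gamma>. causal_curve (Y i) S \<gamma> \<and> \<gamma> ` S \<subseteq> cone_cover (X i) (p i) (J i) k \<longrightarrow>
     curve_length (met (Y i)) S \<gamma> \<le> ennreal B"
proof -
  have J_sub: "J i k \<subseteq> {a i..b i}" for i unfolding J by auto
  have interval_length_le: "curve_length (met (Y i)) S \<gamma> \<le> ennreal ((1 + 1 / c) * real k)"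
    if "0 < c" "\<And>t. t \<in> {a i..b i} \<Longrightarrow> c \<le> f i t" "causal_curve (Y i) S \<gamma>" "\<gamma> ` S \<subseteq> cone_cover (X i) (p i) (J i) k" for i c S \<gamma>
  proof -
    interpret Ci: covered_cone "I i" "f i" "X i" "p i" "J i" by (rule C)
    show ?thesis by (rule Ci.causal_length_le[OF k that(1) _ that(3,4)]) (use that(2) J_sub in blast)
  qed
  obtain c M where c: "0 < c" "0 < M" "\<And>t. t \<in> {a'..b'} \<Longrightarrow> c \<le> f' t" "\<And>t. t \<in> {a'..b'} \<Longrightarrow> f' t \<le> M"
    using f'_bounds by blast
  have c2: "0 < c / 2" using c(1) by simp
  have "\<forall>\<^sub>F i in sequentially. \<forall>t\<in>{a i..b i}. c / 2 \<le> f i t"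
    using warp_eventually[OF c2]
  proof eventually_elim
    case (elim i)
    show ?case
    proof
      fix t assume t: "t \<in> {a i..b i}"
      have "c \<le> f' (\<psi> i t)" by (rule c(3)[OF aff_bounds[OF ab t]])
      moreover have "\<bar>f i t - f' (\<psi> i t)\<bar> \<le> c / 2" using elim t by blast
      ultimately show "c / 2 \<le> f i t" by linarith
    qed
  qed
  then obtain i0 where i0: "\<And>i t. i0 \<le> i \<Longrightarrow> t \<in> {a i..b i} \<Longrightarrow> c / 2 \<le> f i t"
    unfolding eventually_sequentially by blast
  have "\<exists>d>0. \<forall>t\<in>{a i..b i}. d \<le> f i t" for i
  proof -
    have ne: "{a i..b i} \<noteq> {}" using ab(1)[of i] by simp
    obtain u where u: "u \<in> {a i..b i}" "\<And>t. t \<in> {a i..b i} \<Longrightarrow> f i u \<le> f i t"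
      using continuous_attains_inf[OF compact_Icc ne f_cont(1)] by blast
    have "0 < f i u" using warped_cone.pos[OF level_warped[of i]] Icc_in_domain(1)[of i] u(1) by blast
    then show ?thesis using u(2) by blast
  qed
  then obtain d where d: "\<And>i. 0 < d i" "\<And>i t. t \<in> {a i..b i} \<Longrightarrow> d i \<le> f i t" by metis
  \<comment> \<open>A sum over the exceptional indices dominates each single constant.\<close>
  define B where "B = (1 + 1 / (c / 2)) * real k + (\<Sum>i<i0. (1 + 1 / d i) * real k)"
  have nn: "0 \<le> (1 + 1 / d i) * real k" for i using d(1)[of i] by (simp add: less_imp_le)
  have k0: "0 < (1 + 1 / (c / 2)) * real k" using c(1) k by (intro mult_pos_pos add_pos_pos) auto
  have "0 < B" unfolding B_def using k0 nn by (intro add_pos_nonneg sum_nonneg)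
  moreover have "curve_length (met (Y i)) S \<gamma> \<le> ennreal B"
    if "causal_curve (Y i) S \<gamma>" "\<gamma> ` S \<subseteq> cone_cover (X i) (p i) (J i) k" for i S \<gamma>
  proof (cases "i0 \<le> i")
    case True
    have "curve_length (met (Y i)) S \<gamma> \<le> ennreal ((1 + 1 / (c / 2)) * real k)" by (rule interval_length_le[OF c2 i0[OF True] that])
    also have "\<dots> \<le> ennreal B" unfolding B_def using nn by (intro ennreal_leI) (simp add: sum_nonneg)
    finally show ?thesis .
  next
    case False
    have "curve_length (met (Y i)) S \<gamma> \<le> ennreal ((1 + 1 / d i) * real k)" by (rule interval_length_le[OF d that])
    also have "\<dots> \<le> ennreal B"
    proof (rule ennreal_leI)
      have "(1 + 1 / d i) * real k \<le> (\<Sum>i<i0. (1 + 1 / d i) * real k)"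
        using False nn by (intro member_le_sum[of i "{..<i0}" "\<lambda>i. (1 + 1 / d i) * real k"]) auto
      then show "(1 + 1 / d i) * real k \<le> B" unfolding B_def using k0 by linarith
    qed
    finally show ?thesis .
  qed
  ultimately show ?thesis by blast
qed

lemma comparison:
  assumes l: "1 \<le> l" and \<epsilon>: "0 < \<epsilon>" "\<epsilon> < 1 / (2 * real l)"
  shows "\<exists>\<delta>\<^sub>0>0. \<forall>\<delta>. 0 < \<delta> \<and> \<delta> < \<delta>\<^sub>0 \<longrightarrow> (\<exists>i\<^sub>0. \<forall>i\<ge>i\<^sub>0.
    GH_dist (cl_metric (Y i) (cone_cover (X i) (p i) (J i) k)) (cl_metric Y' (cone_cover X' p' J' k)) \<le> \<delta> \<and>
    GH_isometry \<delta> (cl_metric (Y i) (cone_cover (X i) (p i) (J i) k)) (cl_metric Y' (cone_cover X' p' J' k)) (chart i) \<and>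
    ell_upper (Y i) (cl_metric (Y i) (cone_cover (X i) (p i) (J i) k)) Y' (cl_metric Y' (cone_cover X' p' J' k)) (chart i) \<epsilon> \<delta> \<and>
    ell_lower (Y i) (cl_metric (Y i) (cone_cover (X i) (p i) (J i) k)) Y' (cl_metric Y' (cone_cover X' p' J' k)) (chart i) l \<epsilon> \<delta>)"
proof -
  obtain \<delta>0 where \<delta>0: "0 < \<delta>0" and ev: "\<And>\<delta>. 0 < \<delta> \<and> \<delta> < \<delta>0 \<Longrightarrow> \<forall>\<^sub>F i in sequentially.
    ell_upper (Y i) (cl_metric (Y i) (cone_cover (X i) (p i) (J i) k)) Y' (cl_metric Y' (cone_cover X' p' J' k)) (chart i) \<epsilon> \<delta> \<and>
    (\<forall>l\<ge>1. \<epsilon> < 1 / (2 * real l) \<longrightarrow>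
    ell_lower (Y i) (cl_metric (Y i) (cone_cover (X i) (p i) (J i) k)) Y' (cl_metric Y' (cone_cover X' p' J' k)) (chart i) l \<epsilon> \<delta>)"
    using ell_convergence[OF \<epsilon>(1)] by blast
  show ?thesis
  proof (intro exI[of _ \<delta>0] conjI \<delta>0 allI impI)
    fix \<delta> assume \<delta>: "0 < \<delta> \<and> \<delta> < \<delta>0"
    show "\<exists>i\<^sub>0. \<forall>i\<ge>i\<^sub>0.
    GH_dist (cl_metric (Y i) (cone_cover (X i) (p i) (J i) k)) (cl_metric Y' (cone_cover X' p' J' k)) \<le> \<delta> \<and>
    GH_isometry \<delta> (cl_metric (Y i) (cone_cover (X i) (p i) (J i) k)) (cl_metric Y' (cone_cover X' p' J' k)) (chart i) \<and>
    ell_upper (Y i) (cl_metric (Y i) (cone_cover (X i) (p i) (J i) k)) Y' (cl_metric Y' (cone_cover X' p' J' k)) (chart i) \<epsilon> \<delta> \<and>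
    ell_lower (Y i) (cl_metric (Y i) (cone_cover (X i) (p i) (J i) k)) Y' (cl_metric Y' (cone_cover X' p' J' k)) (chart i) l \<epsilon> \<delta>"
      unfolding eventually_sequentially[symmetric]
      using ev[OF \<delta>] GH_dist_convergence[OF conjunct1[OF \<delta>]] chart_GH_isometry[OF conjunct1[OF \<delta>]]
      by eventually_elim (use l \<epsilon>(2) in blast)
  qed
qed

end

section \<open>Assembling the levels\<close>

lemma covered_coneI: "properly_covered_cone I f X p J \<Longrightarrow> covered_cone I f X p J"
  by (rule covered_cone.intro)

text \<open>The pointed approximations are taken on the open balls of radius \<open>R + 1\<close>,
  which contain the closed balls of radius \<open>R\<close> with a collar.\<close>

lemma fibre_balls_converge:
  fixes X :: "nat \<Rightarrow> 'x metric" and X' :: "'y metric"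
  assumes C': "covered_cone I' f' X' p' J'" and p: "\<And>i. p i \<in> mspace (X i)"
    and conv: "pointed_GH_converges X p X' p'" and R: "1 \<le> R" and \<delta>: "0 < \<delta>"
  shows "\<forall>\<^sub>F i in sequentially. \<exists>\<Phi>. GH_isometry \<delta> (submetric (X i) (mcball_of (X i) (p i) R)) (submetric X' (mcball_of X' p' R)) \<Phi>"
proof -
  interpret L: covered_cone I' f' X' p' J' by (rule C')
  \<comment> \<open>The retraction onto the closed ball multiplies the error by 4. The bound
    \<open>1 / 2\<close> secures \<open>\<epsilon> < 1\<close> and, as \<open>1 \<le> R\<close>,
    also \<open>2 * \<epsilon> \<le> R\<close>.\<close>
  define \<epsilon> where "\<epsilon> = min (\<delta> / 4) (1 / 2)"
  have "0 < \<epsilon>" using \<delta> by (simp add: \<epsilon>_def)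
  moreover have "\<epsilon> \<le> \<delta> / 4" unfolding \<epsilon>_def by (rule min.cobounded1)
  moreover have "\<epsilon> \<le> 1 / 2" unfolding \<epsilon>_def by (rule min.cobounded2)
  ultimately have \<epsilon>: "0 < \<epsilon>" "\<epsilon> < 1" "2 * \<epsilon> \<le> R" "4 * \<epsilon> \<le> \<delta>" using R by linarith+
  have R1: "0 < R + 1" using R by simp
  have "\<forall>\<^sub>F i in sequentially. \<exists>\<phi>. \<phi> \<in> mball_of (X i) (p i) (R + 1) \<rightarrow> mspace X' \<and> \<phi> (p i) = p' \<and>
        (\<forall>x\<in>mball_of (X i) (p i) (R + 1). \<forall>y\<in>mball_of (X i) (p i) (R + 1).
           \<bar>mdist X' (\<phi> x) (\<phi> y) - mdist (X i) x y\<bar> < \<epsilon>) \<and>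
        mball_of X' p' (R + 1 - \<epsilon>) \<subseteq> nbhd X' \<epsilon> (\<phi> ` mball_of (X i) (p i) (R + 1))"
    using conv[unfolded pointed_GH_converges_def, rule_format, OF R1 \<epsilon>(1)] .
  then show ?thesis
  proof eventually_elim
    case (elim i)
    then obtain \<phi> where \<phi>: "\<phi> \<in> mball_of (X i) (p i) (R + 1) \<rightarrow> mspace X'" "\<phi> (p i) = p'"
        "\<And>x y. x\<in>mball_of (X i) (p i) (R + 1) \<Longrightarrow> y\<in>mball_of (X i) (p i) (R + 1) \<Longrightarrow>
           \<bar>mdist X' (\<phi> x) (\<phi> y) - mdist (X i) x y\<bar> < \<epsilon>"
        "mball_of X' p' (R + 1 - \<epsilon>) \<subseteq> nbhd X' \<epsilon> (\<phi> ` mball_of (X i) (p i) (R + 1))" by blast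
    from L.ball_GH_isometry[OF \<phi>(1,2) p \<phi>(3,4) \<epsilon>(1,2,3)] show ?case
      using GH_isometry_mono \<epsilon>(4) by blast
  qed
qed

text \<open>For each \<delta> the fibre approximations exist only eventually and may vary with
  \<delta>; the diagonal choice fixes one family per level.\<close>

lemma cone_level_exists:
  fixes I :: "enat \<Rightarrow> real set" and X :: "enat \<Rightarrow> 'x metric"
  assumes cones: "\<And>i. properly_covered_cone (I i) (f i) (X i) (p i) (J i)"
    and fibres: "pointed_GH_converges (\<lambda>i. X (enat i)) (\<lambda>i. p (enat i)) (X \<infinity>) (p \<infinity>)"
    and warp: "warping_converges (\<lambda>i. J (enat i) k) (\<lambda>i. f (enat i)) (J \<infinity> k) (f \<infinity>)"
    and k: "1 \<le> k"
  shows "\<exists>a b a' b' \<Phi>. cone_level (I \<infinity>) (f \<infinity>) (X \<infinity>) (p \<infinity>) (J \<infinity>) (\<lambda>i. I (enat i)) (\<lambda>i. f (enat i))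
     (\<lambda>i. X (enat i)) (\<lambda>i. p (enat i)) (\<lambda>i. J (enat i)) k a b a' b' \<Phi>"
proof -
  have C: "covered_cone (I i) (f i) (X i) (p i) (J i)" for i by (rule covered_coneI[OF cones])
  have "\<exists>a b. a < b \<and> J i k = {a<..<b}" for i
  proof -
    interpret covered_cone "I i" "f i" "X i" "p i" "J i" by (rule C)
    show ?thesis
    proof (rule J_interval[OF k])
      fix a b assume "a < b" "J i k = {a<..<b}"
      then show ?thesis by (intro exI conjI)
    qed
  qed
  then have "\<forall>i. \<exists>a b. a < b \<and> J i k = {a<..<b}" ..
  from choice[OF this] obtain a where "\<forall>i. \<exists>b. a i < b \<and> J i k = {a i<..<b}" ..
  from choice[OF this] obtain b where "\<forall>i. a i < b i \<and> J i k = {a i<..<b i}" ..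
  then have ab: "a i < b i" "J i k = {a i<..<b i}" for i by simp_all
  have "\<exists>\<Phi>. \<forall>\<delta>>0. \<forall>\<^sub>F i in sequentially. GH_isometry \<delta>
      (submetric (X (enat i)) (mcball_of (X (enat i)) (p (enat i)) (2 ^ k))) (submetric (X \<infinity>) (mcball_of (X \<infinity>) (p \<infinity>) (2 ^ k))) (\<Phi> i)"
  proof (rule diagonal_choice)
    fix \<delta> :: real assume \<delta>: "0 < \<delta>"
    show "\<forall>\<^sub>F i in sequentially. \<exists>\<phi>. GH_isometry \<delta>
      (submetric (X (enat i)) (mcball_of (X (enat i)) (p (enat i)) (2 ^ k))) (submetric (X \<infinity>) (mcball_of (X \<infinity>) (p \<infinity>) (2 ^ k))) \<phi>"
    proof (rule fibre_balls_converge[OF C[of \<infinity>] _ fibres _ \<delta>])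
      show "p (enat i) \<in> mspace (X (enat i))" for i using covered_cone.p_in[OF C] .
    qed simp
  qed (rule GH_isometry_mono)
  then obtain \<Phi> where \<Phi>: "\<And>\<delta>. 0 < \<delta> \<Longrightarrow> \<forall>\<^sub>F i in sequentially. GH_isometry \<delta>
      (submetric (X (enat i)) (mcball_of (X (enat i)) (p (enat i)) (2 ^ k))) (submetric (X \<infinity>) (mcball_of (X \<infinity>) (p \<infinity>) (2 ^ k))) (\<Phi> i)"
    by blast
  have "cone_level (I \<infinity>) (f \<infinity>) (X \<infinity>) (p \<infinity>) (J \<infinity>) (\<lambda>i. I (enat i)) (\<lambda>i. f (enat i))
     (\<lambda>i. X (enat i)) (\<lambda>i. p (enat i)) (\<lambda>i. J (enat i)) k (\<lambda>i. a (enat i)) (\<lambda>i. b (enat i)) (a \<infinity>) (b \<infinity>) \<Phi>"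
    by (intro cone_level.intro cone_level_axioms.intro C ab k warp \<Phi>)
  then show ?thesis by blast
qed

theorem cones_l_converge:
  fixes I :: "enat \<Rightarrow> real set" and f :: "enat \<Rightarrow> real \<Rightarrow> real"
    and X :: "enat \<Rightarrow> 'x metric" and p :: "enat \<Rightarrow> 'x"
    and J :: "enat \<Rightarrow> nat \<Rightarrow> real set"
  assumes cones: "\<And>i. properly_covered_cone (I i) (f i) (X i) (p i) (J i)"
    and fibres: "pointed_GH_converges (\<lambda>i. X (enat i)) (\<lambda>i. p (enat i)) (X \<infinity>) (p \<infinity>)"
    and warpings: "\<And>k. k \<ge> 1 \<Longrightarrow>
      warping_converges (\<lambda>i. J (enat i) k) (\<lambda>i. f (enat i)) (J \<infinity> k) (f \<infinity>)"
  shows "l_converges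
       (\<lambda>i. gen_cone (I (enat i)) (f (enat i)) (X (enat i)))
       (\<lambda>i. cone_cover (X (enat i)) (p (enat i)) (J (enat i)))
       (gen_cone (I \<infinity>) (f \<infinity>) (X \<infinity>))
       (cone_cover (X \<infinity>) (p \<infinity>) (J \<infinity>))"
proof -
  have C: "covered_cone (I i) (f i) (X i) (p i) (J i)" for i by (rule covered_coneI[OF cones])
  have LP: "Lorentzian_pre_length_space (gen_cone (I i) (f i) (X i))"
    "proper_cover (gen_cone (I i) (f i) (X i)) (cone_cover (X i) (p i) (J i))" for i
    by (rule covered_cone.lorentzian[OF C]) (rule covered_cone.proper_cover[OF C])
  have level: "\<exists>a b a' b' \<Phi>. cone_level (I \<infinity>) (f \<infinity>) (X \<infinity>) (p \<infinity>) (J \<infinity>) (\<lambda>i. I (enat i)) (\<lambda>i. f (enat i))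
     (\<lambda>i. X (enat i)) (\<lambda>i. p (enat i)) (\<lambda>i. J (enat i)) k a b a' b' \<Phi>" if "1 \<le> k" for k
    by (rule cone_level_exists[OF cones fibres warpings[OF that] that])
  show ?thesis
    unfolding l_converges_def
  proof (intro conjI allI impI LP)
    fix k :: nat assume k: "1 \<le> k"
    obtain a b a' b' \<Phi> where "cone_level (I \<infinity>) (f \<infinity>) (X \<infinity>) (p \<infinity>) (J \<infinity>) (\<lambda>i. I (enat i)) (\<lambda>i. f (enat i))
     (\<lambda>i. X (enat i)) (\<lambda>i. p (enat i)) (\<lambda>i. J (enat i)) k a b a' b' \<Phi>" using level[OF k] by blast
    then interpret cone_level "I \<infinity>" "f \<infinity>" "X \<infinity>" "p \<infinity>" "J \<infinity>" "\<lambda>i. I (enat i)" "\<lambda>i. f (enat i)"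
     "\<lambda>i. X (enat i)" "\<lambda>i. p (enat i)" "\<lambda>i. J (enat i)" k a b a' b' \<Phi> .
    show "GH_converges (\<lambda>i. cl_metric (gen_cone (I (enat i)) (f (enat i)) (X (enat i))) (cone_cover (X (enat i)) (p (enat i)) (J (enat i)) k))
       (cl_metric (gen_cone (I \<infinity>) (f \<infinity>) (X \<infinity>)) (cone_cover (X \<infinity>) (p \<infinity>) (J \<infinity>) k))"
      unfolding GH_converges_def
    proof (intro allI impI)
      fix \<delta> :: real assume "0 < \<delta>"
      from chart_GH_isometry[OF this]
      show "\<forall>\<^sub>F i in sequentially. \<exists>\<phi>. GH_isometry \<delta> (cl_metric (gen_cone (I (enat i)) (f (enat i)) (X (enat i))) (cone_cover (X (enat i)) (p (enat i)) (J (enat i)) k))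
       (cl_metric (gen_cone (I \<infinity>) (f \<infinity>) (X \<infinity>)) (cone_cover (X \<infinity>) (p \<infinity>) (J \<infinity>) k)) \<phi>"
        by eventually_elim (rule exI)
    qed
    show "\<exists>B>0. \<forall>i S \<gamma>. causal_curve (gen_cone (I (enat i)) (f (enat i)) (X (enat i))) S \<gamma> \<and>
       \<gamma> ` S \<subseteq> cone_cover (X (enat i)) (p (enat i)) (J (enat i)) k \<longrightarrow>
       curve_length (met (gen_cone (I (enat i)) (f (enat i)) (X (enat i)))) S \<gamma> \<le> ennreal B"
      by (rule causal_length_bound)
    show "\<exists>\<phi>. \<forall>l\<ge>1. \<forall>\<epsilon>. 0 < \<epsilon> \<and> \<epsilon> < 1 / (2 * real l) \<longrightarrow>
        (\<exists>\<delta>\<^sub>0>0. \<forall>\<delta>. 0 < \<delta> \<and> \<delta> < \<delta>\<^sub>0 \<longrightarrow>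
          (\<exists>i\<^sub>0. \<forall>i\<ge>i\<^sub>0.
             GH_dist (cl_metric (gen_cone (I (enat i)) (f (enat i)) (X (enat i))) (cone_cover (X (enat i)) (p (enat i)) (J (enat i)) k))
               (cl_metric (gen_cone (I \<infinity>) (f \<infinity>) (X \<infinity>)) (cone_cover (X \<infinity>) (p \<infinity>) (J \<infinity>) k)) \<le> \<delta> \<and>
             GH_isometry \<delta> (cl_metric (gen_cone (I (enat i)) (f (enat i)) (X (enat i))) (cone_cover (X (enat i)) (p (enat i)) (J (enat i)) k))
               (cl_metric (gen_cone (I \<infinity>) (f \<infinity>) (X \<infinity>)) (cone_cover (X \<infinity>) (p \<infinity>) (J \<infinity>) k)) (\<phi> i) \<and>
             ell_upper (gen_cone (I (enat i)) (f (enat i)) (X (enat i)))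
               (cl_metric (gen_cone (I (enat i)) (f (enat i)) (X (enat i))) (cone_cover (X (enat i)) (p (enat i)) (J (enat i)) k))
               (gen_cone (I \<infinity>) (f \<infinity>) (X \<infinity>))
               (cl_metric (gen_cone (I \<infinity>) (f \<infinity>) (X \<infinity>)) (cone_cover (X \<infinity>) (p \<infinity>) (J \<infinity>) k)) (\<phi> i) \<epsilon> \<delta> \<and>
             ell_lower (gen_cone (I (enat i)) (f (enat i)) (X (enat i)))
               (cl_metric (gen_cone (I (enat i)) (f (enat i)) (X (enat i))) (cone_cover (X (enat i)) (p (enat i)) (J (enat i)) k))
               (gen_cone (I \<infinity>) (f \<infinity>) (X \<infinity>))
               (cl_metric (gen_cone (I \<infinity>) (f \<infinity>) (X \<infinity>)) (cone_cover (X \<infinity>) (p \<infinity>) (J \<infinity>) k)) (\<phi> i) l \<epsilon> \<delta>))"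
      by (intro exI[of _ chart] allI impI) (erule conjE, rule comparison)
  qed
qed

theorem theorem6p4:
  fixes I :: "enat \<Rightarrow> real set" and f :: "enat \<Rightarrow> real \<Rightarrow> real"
    and X :: "enat \<Rightarrow> 'x metric" and p :: "enat \<Rightarrow> 'x"
    and J :: "enat \<Rightarrow> nat \<Rightarrow> real set"
  assumes cones: "\<And>i. properly_covered_cone (I i) (f i) (X i) (p i) (J i)"
    and fibres: "pointed_GH_converges (\<lambda>i. X (enat i)) (\<lambda>i. p (enat i)) (X \<infinity>) (p \<infinity>)"
    and intervals: "\<And>k. k \<ge> 1 \<Longrightarrow>
      GH_converges (\<lambda>i. submetric euclidean_metric (J (enat i) k))
        (submetric euclidean_metric (J \<infinity> k))"
    and warpings: "\<And>k. k \<ge> 1 \<Longrightarrow>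
      warping_converges (\<lambda>i. J (enat i) k) (\<lambda>i. f (enat i)) (J \<infinity> k) (f \<infinity>)"
  shows
    "l_converges
       (\<lambda>i. gen_cone (I (enat i)) (f (enat i)) (X (enat i)))
       (\<lambda>i. cone_cover (X (enat i)) (p (enat i)) (J (enat i)))
       (gen_cone (I \<infinity>) (f \<infinity>) (X \<infinity>))
       (cone_cover (X \<infinity>) (p \<infinity>) (J \<infinity>)) \<and>
     (\<forall>(m :: enat \<Rightarrow> 'x measure) N. 0 \<le> N \<and> (\<forall>i. radon_measure_on (X i) (m i)) \<and>
        (\<forall>k\<ge>1. measured_GH_converges
           (\<lambda>i. submetric (X (enat i)) (mcball_of (X (enat i)) (p (enat i)) (2 ^ k)))
           (\<lambda>i. m (enat i))
           (submetric (X \<infinity>) (mcball_of (X \<infinity>) (p \<infinity>) (2 ^ k))) (m \<infinity>)) \<longrightarrow>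
        measured_l_converges
          (\<lambda>i. gen_cone (I (enat i)) (f (enat i)) (X (enat i)))
          (\<lambda>i. cone_cover (X (enat i)) (p (enat i)) (J (enat i)))
          (\<lambda>i. cone_measure (I (enat i)) (f (enat i)) N (m (enat i)))
          (gen_cone (I \<infinity>) (f \<infinity>) (X \<infinity>))
          (cone_cover (X \<infinity>) (p \<infinity>) (J \<infinity>))
          (cone_measure (I \<infinity>) (f \<infinity>) N (m \<infinity>)))"
proof (intro conjI allI impI)
  note l = cones_l_converge[OF cones fibres warpings]
  show "l_converges
       (\<lambda>i. gen_cone (I (enat i)) (f (enat i)) (X (enat i)))
       (\<lambda>i. cone_cover (X (enat i)) (p (enat i)) (J (enat i)))
       (gen_cone (I \<infinity>) (f \<infinity>) (X \<infinity>))
       (cone_cover (X \<infinity>) (p \<infinity>) (J \<infinity>))"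
    by (rule l)
  fix m :: "enat \<Rightarrow> 'x measure" and N :: real
  assume h: "0 \<le> N \<and> (\<forall>i. radon_measure_on (X i) (m i)) \<and>
        (\<forall>k\<ge>1. measured_GH_converges
           (\<lambda>i. submetric (X (enat i)) (mcball_of (X (enat i)) (p (enat i)) (2 ^ k)))
           (\<lambda>i. m (enat i))
           (submetric (X \<infinity>) (mcball_of (X \<infinity>) (p \<infinity>) (2 ^ k))) (m \<infinity>))"
  show "measured_l_converges
          (\<lambda>i. gen_cone (I (enat i)) (f (enat i)) (X (enat i)))
          (\<lambda>i. cone_cover (X (enat i)) (p (enat i)) (J (enat i)))
          (\<lambda>i. cone_measure (I (enat i)) (f (enat i)) N (m (enat i)))
          (gen_cone (I \<infinity>) (f \<infinity>) (X \<infinity>))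
          (cone_cover (X \<infinity>) (p \<infinity>) (J \<infinity>))
          (cone_measure (I \<infinity>) (f \<infinity>) N (m \<infinity>))"
    unfolding measured_l_converges_def
  proof (intro conjI allI impI)
    show "l_converges
       (\<lambda>i. gen_cone (I (enat i)) (f (enat i)) (X (enat i)))
       (\<lambda>i. cone_cover (X (enat i)) (p (enat i)) (J (enat i)))
       (gen_cone (I \<infinity>) (f \<infinity>) (X \<infinity>))
       (cone_cover (X \<infinity>) (p \<infinity>) (J \<infinity>))"
      by (rule l)
    fix k :: nat assume k: "1 \<le> k"
    have "\<exists>a b a' b' \<Phi>. cone_level (I \<infinity>) (f \<infinity>) (X \<infinity>) (p \<infinity>) (J \<infinity>) (\<lambda>i. I (enat i)) (\<lambda>i. f (enat i))
     (\<lambda>i. X (enat i)) (\<lambda>i. p (enat i)) (\<lambda>i. J (enat i)) k a b a' b' \<Phi>"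
      by (rule cone_level_exists[OF cones fibres warpings[OF k] k])
    then obtain a b a' b' \<Phi> where "cone_level (I \<infinity>) (f \<infinity>) (X \<infinity>) (p \<infinity>) (J \<infinity>) (\<lambda>i. I (enat i)) (\<lambda>i. f (enat i))
     (\<lambda>i. X (enat i)) (\<lambda>i. p (enat i)) (\<lambda>i. J (enat i)) k a b a' b' \<Phi>" by blast
    then interpret cone_level "I \<infinity>" "f \<infinity>" "X \<infinity>" "p \<infinity>" "J \<infinity>" "\<lambda>i. I (enat i)" "\<lambda>i. f (enat i)"
     "\<lambda>i. X (enat i)" "\<lambda>i. p (enat i)" "\<lambda>i. J (enat i)" k a b a' b' \<Phi> .
    show "measured_GH_converges
        (\<lambda>i. cl_metric (gen_cone (I (enat i)) (f (enat i)) (X (enat i))) (cone_cover (X (enat i)) (p (enat i)) (J (enat i)) k))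
        (\<lambda>i. cone_measure (I (enat i)) (f (enat i)) N (m (enat i)))
        (cl_metric (gen_cone (I \<infinity>) (f \<infinity>) (X \<infinity>)) (cone_cover (X \<infinity>) (p \<infinity>) (J \<infinity>) k))
        (cone_measure (I \<infinity>) (f \<infinity>) N (m \<infinity>))"
      by (rule measured_convergence) (use h k in blast)+
  qed
qed



end
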